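(* Under the standing assumptions in the context, let $|\xi|$ be the limit on $\mathbb{R}^n\times[0,\infty)$, along a subsequence, of the discrepancy measures $|\xi_{\varepsilon_i}|$ given by $$d|\xi_{\varepsilon_i}|:=\left|\frac{\varepsilon_i|\nabla u_{\varepsilon_i}|^2}{2}-\frac{W(u_{\varepsilon_i})}{\varepsilon_i}\right|\,d\mathcal{L}^n\lfloor_\Omega\,dt.$$ Then $|\xi|=0$ on $\mathbb{R}^n\times(0,\infty)$.
   Context: Setting. $n$ is a positive integer, $\Omega\subset\mathbb{R}^n$ is a bounded domain with smooth boundary (not assumed convex), $\nu$ is the outer unit normal to $\partial\Omega$. $W\in C^3(\mathbb{R})$ satisfies: (W1) $W(\pm1)=0$ and $W(s)>0$ for all $s\ne\pm1$; (W2) for some $-1<\gamma<1$, $W'<0$ on $(\gamma,1)$ and $W'>0$ on $(-1,\gamma)$; (W3) for some $0<\alpha<1$ and $\beta>0$, $W''(s)\ge\beta$ for all $\alpha\le|s|\le1$. Initial data. $\{\varepsilon_i\}_{i\ge1}$ are positive numbers with $\varepsilon_i\to0$, and $u_{\varepsilon_i,0}\in C^1(\overline\Omega)$ satisfy, with constants $D_0,c_1,c_2$ and $\lambda\in[3/5,1)$ independent of $i$: (i) $\|u_{\varepsilon_i,0}\|_{L^\infty(\Omega)}\le1$; (ii) $\sup_i\sup_{x\in\Omega,\,r>0}\omega_{n-1}^{-1}r^{1-n}\int_{B_r(x)\cap\Omega}\frac{\varepsilon_i|\nabla u_{\varepsilon_i,0}|^2}{2}+\frac{W(u_{\varepsilon_i,0})}{\varepsilon_i}\,dy\le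 D_0$; (iii) $\sup_i\max_{\overline\Omega}\varepsilon_i|\nabla u_{\varepsilon_i,0}|\le c_1$; (iv) $\max_{\overline\Omega}\left(\frac{\varepsilon_i|\nabla u_{\varepsilon_i,0}|^2}{2}-\frac{W(u_{\varepsilon_i,0})}{\varepsilon_i}\right)\le c_2\varepsilon_i^{-\lambda}$ for all $i$; (v) $\langle\nabla u_{\varepsilon_i,0},\nu\rangle=0$ on $\partial\Omega$ for all $i$. Here $\omega_{n-1}$ is the volume of the unit ball of $\mathbb{R}^{n-1}$ and $B_r(x)$ is the open ball. Equation. $u_{\varepsilon_i}$ is the unique solution, with regularity $C([0,\infty);C^1(\overline\Omega))\cap C^\infty(\overline\Omega\times(0,\infty))$ as recorded in the paper, of $\partial_tu_{\varepsilon_i}=\Delta u_{\varepsilon_i}-W'(u_{\varepsilon_i})/\varepsilon_i^2$ in $\Omega\times(0,\infty)$, $\langle\nabla u_{\varepsilon_i},\nu\rangle=0$ on $\partial\Omega\times(0,\infty)$, $u_{\varepsilon_i}(\cdot,0)=u_{\varepsilon_i,0}$ in $\Omega$. Measures. $\mu^t_{\varepsilon_i}:=\left(\frac{\varepsilon_i|\nabla u_{\varepsilon_i}(\cdot,t)|^2}{2}+\frac{W(u_{\varepsilon_i}(\cdot,t))}{\varepsilon_i}\right)\mathcal{L}^n\lfloor_\Omega$, regarded as a Radon measure on $\mathbb{R}^n$. A subsequence (same index) is fixed along which $\mu^t_{\varepsilon_i}$ converges, as Radon measures on $\mathbb{R}^n$, to a Radon measure $\mu^t$ for all $t\ge0$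 (such a subsequence is known to exist). By the uniform energy bound, after passing to a further subsequence the Radon measures $|\xi_{\varepsilon_i}|$ on $\mathbb{R}^n\times[0,\infty)$ converge to a Radon measure $|\xi|$. *)

theory Defs
  imports "HOL-Analysis.Analysis"
begin

text \<open>
  Derivatives are taken within \<open>S\<close>. For open \<open>S\<close> this is the usual class C^k(S). The definition is
  also used for \<open>S = closure \<Omega>\<close> and \<open>S = closure \<Omega> \<times> {0<..}\<close> with \<open>\<Omega>\<close> a bounded domain with smooth
  boundary. There derivatives within \<open>S\<close> are unique, also at boundary points, where they are the
  continuous extensions of the interior derivatives; so the class consists of the functions all
  of whose partial derivatives of order at most k in the interior extend continuously to \<open>S\<close>. On
  sets where derivatives within \<open>S\<close> are not unique the definition is not meaningful.
\<close>

primrec Ck_on :: "nat \<Rightarrow> ('a::euclidean_space \<Rightarrow> real) \<Rightarrow> 'a set \<Rightarrow> bool" where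
  "Ck_on 0 f S \<longleftrightarrow> continuous_on S f"
| "Ck_on (Suc k) f S \<longleftrightarrow>
     f differentiable_on S \<and>
     (\<forall>b\<in>Basis. Ck_on k (\<lambda>x. frechet_derivative f (at x within S) b) S)"

definition smooth_on :: "('a::euclidean_space \<Rightarrow> real) \<Rightarrow> 'a set \<Rightarrow> bool" where
  "smooth_on f S \<longleftrightarrow> (\<forall>k. Ck_on k f S)"

definition gradient_on :: "'a set \<Rightarrow> ('a::euclidean_space \<Rightarrow> real) \<Rightarrow> 'a \<Rightarrow> 'a" where
  "gradient_on S f x = (\<Sum>b\<in>Basis. frechet_derivative f (at x within S) b *\<^sub>R b)"

definition laplacian :: "('a::euclidean_space \<Rightarrow> real) \<Rightarrow> 'a \<Rightarrow> real" where
  "laplacian f x =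
     (\<Sum>b\<in>Basis. frechet_derivative (\<lambda>y. frechet_derivative f (at y) b) (at x) b)"

text \<open>
  Since the gradient of \<open>\<phi>\<close> does not vanish on \<open>U\<close>, the last condition entails
  \<open>frontier \<Omega> \<inter> U = {x \<in> U. \<phi> x = 0}\<close>, and the gradient of \<open>\<phi>\<close> points out of \<open>\<Omega>\<close> there.
\<close>

definition local_defining_function ::
  "'a::euclidean_space set \<Rightarrow> 'a \<Rightarrow> 'a set \<Rightarrow> ('a \<Rightarrow> real) \<Rightarrow> bool" where
  "local_defining_function \<Omega> p U \<phi> \<longleftrightarrow>
     open U \<and> p \<in> U \<and> smooth_on \<phi> U \<and> (\<forall>x\<in>U. gradient_on U \<phi> x \<noteq> 0) \<and>
     \<Omega> \<inter> U = {x \<in> U. \<phi> x < 0}"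

definition smooth_bounded_domain :: "'a::euclidean_space set \<Rightarrow> bool" where
  "smooth_bounded_domain \<Omega> \<longleftrightarrow>
     open \<Omega> \<and> connected \<Omega> \<and> \<Omega> \<noteq> {} \<and> bounded \<Omega> \<and>
     (\<forall>p\<in>frontier \<Omega>. \<exists>U \<phi>. local_defining_function \<Omega> p U \<phi>)"

definition outer_unit_normal :: "'a::euclidean_space set \<Rightarrow> 'a \<Rightarrow> 'a \<Rightarrow> bool" where
  "outer_unit_normal \<Omega> p \<nu> \<longleftrightarrow>
     p \<in> frontier \<Omega> \<and>
     (\<exists>U \<phi>. local_defining_function \<Omega> p U \<phi> \<and>
            \<nu> = gradient_on U \<phi> p /\<^sub>R norm (gradient_on U \<phi> p))"

definition neumann_condition :: "'a::euclidean_space set \<Rightarrow> ('a \<Rightarrow> real) \<Rightarrow> bool" where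
  "neumann_condition \<Omega> f \<longleftrightarrow>
     (\<forall>p \<nu>. outer_unit_normal \<Omega> p \<nu> \<longrightarrow> gradient_on (closure \<Omega>) f p \<bullet> \<nu> = 0)"

text \<open>
  \<open>X\<close> is a closed subset of a Euclidean space. There Borel measures that are finite on compact
  sets are automatically regular.
\<close>

definition radon_measure_on :: "'a::euclidean_space set \<Rightarrow> 'a measure \<Rightarrow> bool" where
  "radon_measure_on X M \<longleftrightarrow>
     sets M = sets (restrict_space borel X) \<and>
     (\<forall>K. compact K \<and> K \<subseteq> X \<longrightarrow> emeasure M K < \<infinity>)"

definition radon_converges_on ::
  "'a::euclidean_space set \<Rightarrow> (nat \<Rightarrow> 'a measure) \<Rightarrow> 'a measure \<Rightarrow> bool" where
  "radon_converges_on X Ms M \<longleftrightarrow>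
     (\<forall>\<phi> :: 'a \<Rightarrow> real.
        continuous_on X \<phi> \<and> (\<exists>K. compact K \<and> K \<subseteq> X \<and> (\<forall>x\<in>X - K. \<phi> x = 0)) \<longrightarrow>
        (\<lambda>i. integral\<^sup>L (Ms i) \<phi>) \<longlonglongrightarrow> integral\<^sup>L M \<phi>)"

definition double_well :: "(real \<Rightarrow> real) \<Rightarrow> bool" where
  "double_well W \<longleftrightarrow>
     Ck_on 3 W UNIV \<and>
     W 1 = 0 \<and> W (-1) = 0 \<and> (\<forall>s. s \<noteq> 1 \<and> s \<noteq> -1 \<longrightarrow> W s > 0) \<and>
     (\<exists>\<gamma>. -1 < \<gamma> \<and> \<gamma> < 1 \<and>
        (\<forall>s\<in>{\<gamma><..<1}. deriv W s < 0) \<and> (\<forall>s\<in>{-1<..<\<gamma>}. deriv W s > 0)) \<and>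
     (\<exists>\<alpha> \<beta>. 0 < \<alpha> \<and> \<alpha> < 1 \<and> 0 < \<beta> \<and>
        (\<forall>s. \<alpha> \<le> \<bar>s\<bar> \<and> \<bar>s\<bar> \<le> 1 \<longrightarrow> deriv (deriv W) s \<ge> \<beta>))"

definition energy_density ::
  "(real \<Rightarrow> real) \<Rightarrow> 'a::euclidean_space set \<Rightarrow> real \<Rightarrow> ('a \<Rightarrow> real) \<Rightarrow> 'a \<Rightarrow> real" where
  "energy_density W \<Omega> \<epsilon> f x =
     \<epsilon> * (norm (gradient_on (closure \<Omega>) f x))\<^sup>2 / 2 + W (f x) / \<epsilon>"

definition discrepancy ::
  "(real \<Rightarrow> real) \<Rightarrow> 'a::euclidean_space set \<Rightarrow> real \<Rightarrow> ('a \<Rightarrow> real) \<Rightarrow> 'a \<Rightarrow> real" where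
  "discrepancy W \<Omega> \<epsilon> f x =
     \<epsilon> * (norm (gradient_on (closure \<Omega>) f x))\<^sup>2 / 2 - W (f x) / \<epsilon>"

definition energy_measure ::
  "(real \<Rightarrow> real) \<Rightarrow> 'a::euclidean_space set \<Rightarrow> real \<Rightarrow> ('a \<Rightarrow> real) \<Rightarrow> 'a measure" where
  "energy_measure W \<Omega> \<epsilon> f =
     density lborel (\<lambda>x. ennreal (energy_density W \<Omega> \<epsilon> f x) * indicator \<Omega> x)"

text \<open>The measure |\<open>\<xi>\<close>| lives on \<open>UNIV \<times> {0..}\<close>; the function \<open>u t\<close> is the solution at time \<open>t\<close>.\<close>

definition discrepancy_measure ::
  "(real \<Rightarrow> real) \<Rightarrow> 'a::euclidean_space set \<Rightarrow> real \<Rightarrow> (real \<Rightarrow> 'a \<Rightarrow> real) \<Rightarrow> ('a \<times> real) measure"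
where
  "discrepancy_measure W \<Omega> \<epsilon> u =
     density (restrict_space lborel (UNIV \<times> {0..}))
       (\<lambda>(x, t). ennreal \<bar>discrepancy W \<Omega> \<epsilon> (u t) x\<bar> * indicator \<Omega> x)"

text \<open>
  The first three conditions say that \<open>u\<close> belongs to C([0,\<open>\<infinity>\<close>); C^1(closure \<open>\<Omega>\<close>)), where C^1(closure \<open>\<Omega>\<close>)
  carries the norm of uniform convergence of functions and gradients.
\<close>

definition allen_cahn_solution ::
  "(real \<Rightarrow> real) \<Rightarrow> 'a::euclidean_space set \<Rightarrow> real \<Rightarrow> ('a \<Rightarrow> real) \<Rightarrow> (real \<Rightarrow> 'a \<Rightarrow> real) \<Rightarrow> bool"
where
  "allen_cahn_solution W \<Omega> \<epsilon> u\<^sub>0 u \<longleftrightarrow>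
     (\<forall>t\<ge>0. Ck_on 1 (u t) (closure \<Omega>)) \<and>
     (\<forall>t\<ge>0. uniform_limit (closure \<Omega>) u (u t) (at t within {0..})) \<and>
     (\<forall>t\<ge>0. uniform_limit (closure \<Omega>) (\<lambda>s. gradient_on (closure \<Omega>) (u s))
               (gradient_on (closure \<Omega>) (u t)) (at t within {0..})) \<and>
     smooth_on (\<lambda>(x, t). u t x) (closure \<Omega> \<times> {0<..}) \<and>
     (\<forall>t>0. \<forall>x\<in>\<Omega>.
        ((\<lambda>s. u s x) has_real_derivative laplacian (u t) x - deriv W (u t x) / \<epsilon>\<^sup>2) (at t)) \<and>
     (\<forall>t>0. neumann_condition \<Omega> (u t)) \<and>
     (\<forall>x\<in>\<Omega>. u 0 x = u\<^sub>0 x)"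

end

theory Submission
  imports Defs "HOL-Analysis.Analysis" "HOL-Real_Asymp.Real_Asymp"
begin

text \<open>
  The proof controls the discrepancy at each fixed time and then integrates over time. Fix a time, let \<open>e\<close> and \<open>xi\<close> be the energy
  density and the discrepancy of \<open>u\<close>, and let \<open>f\<close> be the right-hand side of the equation, that is, the time derivative of \<open>u\<close>.

  Two facts come from the parabolic equation. The energy decreases (\<open>energy_deriv\<close>): the integral of \<open>eps * f\<^sup>2\<close> over space and
  time is at most the initial energy \<open>E\<close>, which is bounded uniformly by the density assumption for one large ball. So at most
  times the spatial integral of \<open>eps * f\<^sup>2\<close> is below a given large number. And the discrepancy is at most
  \<open>C * eps powr a / eps\<close> for some positive \<open>a\<close> (\<open>discrepancy_upper_bound\<close>). This is a maximum principle for \<open>xi\<close> with small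
  corrections; one of them is a boundary layer that compensates the curvature of the boundary, which may have any sign.

  The core is \<open>slice_equipartition\<close>: under these two bounds the integral of \<open>\<bar>xi\<bar>\<close> at a fixed time is arbitrarily small when
  \<open>eps\<close> is small. The first variation of the energy along radial vector fields, corrected near the boundary to be tangential,
  shows that the derivative of the density ratio \<open>r ^ (1 - n) * (\<integral>x\<in>ball p r. e x)\<close> is at least \<open>r ^ (- n)\<close> times the integral
  of the negative part of \<open>xi\<close>, up to errors given by the positive part and by \<open>f\<close> (\<open>monotonicity\<close>). At most points the errors
  are harmless at all scales between \<open>eps\<close> and 1. If the negative part were a definite fraction of the energy at all these scales,
  the density ratio would increase by a multiple of \<open>ln (1 / eps)\<close>, although it is bounded. Hence the negative part is a small
  fraction of the energy at some scale, and Vitali coverings by such balls give the global statement (\<open>vanishing_defect\<close>). This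
  needs a lower density bound at scale \<open>eps\<close>, which holds where \<open>u\<close> stays away from the wells; near the wells the energy itself is
  small, by testing the equation with a function of \<open>u\<close> (\<open>near_well_energy\<close>). The same estimate turns the pointwise upper bound of
  \<open>xi\<close> into smallness of the integral of its positive part.

  At the exceptional times of large dissipation \<open>\<bar>xi\<bar>\<close> is at most the energy density, and these times have small total length
  (\<open>discrepancy_time_integral\<close>). So the discrepancy measures of every slab between two positive times tend to 0, and the weak limit vanishes
  for positive times.
\<close>

section \<open>Almost monotone density ratios\<close>

lemma measure_ball_mono:
 fixes N :: "'a::euclidean_space measure"
 assumes "finite_measure N" "sets N = sets borel" "ball x r \<subseteq> ball y s"
 shows "measure N (ball x r) <= measure N (ball y s)"
 using assms by (intro finite_measure.finite_measure_mono) auto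

text \<open>A pointwise comparison of the \<open>P\<close>-measure of a ball, enlarged five times, with the \<open>N\<close>-measure of the ball itself
  survives summation over a disjoint Vitali subfamily whose enlargements still cover \<open>K\<close>.\<close>

lemma Vitali_ball_measure_le:
 fixes N :: "'a::euclidean_space measure"
 assumes N: "finite_measure N" "sets N = sets borel" and P: "finite_measure P" "sets P = sets borel"
  and r: "\<And>x. x \<in> K ==> 0 < r x \<and> r x <= B" and k: "0 <= k"
  and le: "\<And>x. x \<in> K ==> measure P (ball x (5 * r x)) <= k * measure N (ball x (r x))"
 obtains U where "open U" "K \<subseteq> U" "measure P U <= k * measure N UNIV"
proof -
 interpret N: finite_measure N by fact
 interpret P: finite_measure P by fact
 have sub: "K \<subseteq> (\<Union>i\<in>K. ball i (r i))"
  using r by (intro subsetI UN_I) auto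
 obtain C where C: "countable C" "C \<subseteq> K" and disj: "pairwise (\<lambda>i j. disjnt (ball i (r i)) (ball j (r j))) C"
  and cov: "K \<subseteq> (\<Union>i\<in>C. ball i (5 * r i))"
  by (rule Vitali_covering_lemma_balls [where a="\<lambda>x. x", OF sub r])
 define A where "A = (\<Union>i\<in>C. ball i (5 * r i))"
 have A: "open A" by (auto simp: A_def)
 have "emeasure P A = (\<integral>\<^sup>+ x. indicator A x \<partial>P)"
  using A P(2) by simp
 also have "\<dots> <= (\<integral>\<^sup>+ x. (\<integral>\<^sup>+ i. indicator (ball i (5 * r i)) x \<partial>count_space C) \<partial>P)"
 proof (rule nn_integral_mono)
  fix x
  show "indicator A x <= (\<integral>\<^sup>+ i. indicator (ball i (5 * r i)) x \<partial>count_space C)"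
  proof (cases "x \<in> A")
   case True
   then obtain i where i: "i \<in> C" "x \<in> ball i (5 * r i)" unfolding A_def by blast
   show ?thesis using nn_integral_ge_point [OF i(1), of "\<lambda>i. indicator (ball i (5 * r i)) x"] i(2) True by simp
  qed simp
 qed
 also have "\<dots> = (\<integral>\<^sup>+ i. (\<integral>\<^sup>+ x. indicator (ball i (5 * r i)) x \<partial>P) \<partial>count_space C)"
  using C P(2) by (intro nn_integral_count_space_nn_integral borel_measurable_indicator) auto
 also have "\<dots> = (\<integral>\<^sup>+ i. emeasure P (ball i (5 * r i)) \<partial>count_space C)"
  using P(2) by (intro nn_integral_cong) auto
 also have "\<dots> <= (\<integral>\<^sup>+ i. ennreal k * emeasure N (ball i (r i)) \<partial>count_space C)"
  using le k C(2) by (intro nn_integral_mono)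
   (auto simp: N.emeasure_eq_measure P.emeasure_eq_measure ennreal_mult [symmetric])
 also have "\<dots> = ennreal k * (\<integral>\<^sup>+ i. emeasure N (ball i (r i)) \<partial>count_space C)"
  by (intro nn_integral_cmult) auto
 also have "(\<integral>\<^sup>+ i. emeasure N (ball i (r i)) \<partial>count_space C) = emeasure N (\<Union>i\<in>C. ball i (r i))"
  using C N(2) disj by (intro emeasure_UN_countable [symmetric])
   (auto simp: disjoint_family_on_def pairwise_def disjnt_def)
 also have "ennreal k * emeasure N (\<Union>i\<in>C. ball i (r i)) <= ennreal k * emeasure N UNIV"
  using C N(2) by (intro mult_left_mono emeasure_mono) auto
 finally have "measure P A <= k * measure N UNIV"
  using k by (simp add: N.emeasure_eq_measure P.emeasure_eq_measure ennreal_mult [symmetric])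
 with A cov show ?thesis by (intro that [of A]) (auto simp: A_def)
qed

definition mono_const :: "nat => real" where "mono_const m = 64 * 24 ^ m"

text \<open>The measure-theoretic skeleton of the argument at a fixed time. In the application \<open>m + 1\<close> is the dimension, \<open>mu\<close>
  is the energy, \<open>xp\<close> and \<open>xm\<close> are the positive and negative parts of the discrepancy, \<open>al\<close> collects the error terms, \<open>F\<close> is the
  boundary of the domain \<open>Om\<close>, and \<open>J p r\<close> is a smoothed density ratio \<open>r ^ - m * mu (ball p r)\<close>. The ratio is almost monotone
  around boundary points and, for radii up to the distance from the boundary, around interior points. What it gains is
  the mass of \<open>xm\<close>.\<close>

locale almost_monotone =
 fixes m :: nat and mu xp xm al :: "'a::euclidean_space measure" and F Om :: "'a set"
  and J :: "'a => real => real"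
 assumes fin: "finite_measure mu" "finite_measure xp" "finite_measure xm" "finite_measure al"
  and sets: "sets mu = sets borel" "sets xp = sets borel" "sets xm = sets borel" "sets al = sets borel"
  and F: "closed F" "F \<noteq> {}" "F \<inter> Om = {}"
  and J_lower: "\<And>p r. 0 < r ==> measure mu (ball p (r/2)) / 2 <= r ^ m * J p r"
  and J_upper: "\<And>p r. 0 < r ==> r ^ m * J p r <= measure mu (ball p r)"
  and J_deriv: "\<And>p r. 0 < r ==> r <= 1 ==> p \<in> F \<or> (p \<in> Om \<and> r <= infdist p F) ==>
    \<exists>D. (J p has_real_derivative D) (at r) \<and>
     (measure xm (ball p (r/2)) / 2 - measure xp (ball p r)) / r ^ Suc m - measure al (ball p r) / r ^ m <= D"
begin

text \<open>From the scale \<open>s\<close> upwards the two bad terms in the derivative of \<open>J x\<close> have an integral bounded independently of \<open>s\<close>, up to a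
  factor \<open>h * ln (1/s)\<close>.\<close>

definition good :: "real => real => 'a => real => bool" where
 "good h M x s \<longleftrightarrow> (\<forall>r. s <= r \<and> r <= 1 -->
   measure xp (ball x r) <= h * r ^ m \<and> measure al (ball x r) <= M * r ^ m / sqrt r)"

lemma mono: "ball x r \<subseteq> ball y s ==> measure mu (ball x r) <= measure mu (ball y s)"
 "ball x r \<subseteq> ball y s ==> measure xp (ball x r) <= measure xp (ball y s)"
 "ball x r \<subseteq> ball y s ==> measure xm (ball x r) <= measure xm (ball y s)"
 "ball x r \<subseteq> ball y s ==> measure al (ball x r) <= measure al (ball y s)"
 using measure_ball_mono fin sets by blast+

lemma growth:
 assumes ab: "0 < a" "a <= b" "b <= 1" and p: "p \<in> F \<or> (p \<in> Om \<and> b <= infdist p F)"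
  and xp: "\<And>r. a <= r ==> r <= b ==> measure xp (ball p r) <= h * r ^ m"
  and al: "\<And>r. a <= r ==> r <= b ==> measure al (ball p r) <= M * r ^ m / sqrt r"
  and xm: "\<And>r. a <= r ==> r <= b ==> 2 * k * r ^ m <= measure xm (ball p (r/2))"
  and M: "0 <= M"
 shows "J p a + k * ln (b/a) <= J p b + h * ln (b/a) + 2 * M * sqrt b"
proof -
 define g where "g r = J p r - (k - h) * ln r + 2 * M * sqrt r" for r
 have "g a <= g b"
 proof (rule DERIV_nonneg_imp_nondecreasing [OF ab(2)])
  fix r assume r: "a <= r" "r <= b"
  then have r0: "0 < r" "r <= 1" using ab by auto
  obtain D where D: "(J p has_real_derivative D) (at r)"
   "(measure xm (ball p (r/2)) / 2 - measure xp (ball p r)) / r ^ Suc m - measure al (ball p r) / r ^ m <= D"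
   using J_deriv [OF r0, of p] p r by auto
  have 1: "(k - h) / r = (k * r ^ m - h * r ^ m) / r ^ Suc m"
   using r0 by (simp add: field_simps)
  have 2: "\<dots> <= (measure xm (ball p (r/2)) / 2 - measure xp (ball p r)) / r ^ Suc m"
   using xm [OF r] xp [OF r] r0 by (intro divide_right_mono) auto
  have "measure al (ball p r) / r ^ m <= (M * r ^ m / sqrt r) / r ^ m"
   using al [OF r] r0 by (intro divide_right_mono) auto
  then have 3: "measure al (ball p r) / r ^ m <= M / sqrt r"
   using r0 by simp
  have "(g has_real_derivative D - (k - h) / r + M / sqrt r) (at r)"
   unfolding g_def using r0
   by (auto intro!: derivative_eq_intros D(1) simp: field_simps)
  moreover have "0 <= D - (k - h) / r + M / sqrt r"
   using 1 2 3 D(2) by linarith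
  ultimately show "\<exists>y. (g has_real_derivative y) (at r) \<and> 0 <= y" by blast
 qed
 moreover have "0 <= M * sqrt a" using M ab by simp
 ultimately show ?thesis
  using ab by (simp add: g_def ln_div algebra_simps)
qed

lemma nearest:
 obtains y where "y \<in> F" "dist x y = infdist x F"
proof -
 obtain y where "y \<in> F" "infdist x F = dist x y" using infdist_attains_inf [OF F(1,2)] .
 then show ?thesis using that by simp
qed

lemma ball_sub: "dist x y + r <= s ==> ball x r \<subseteq> ball y s"
proof
 fix z assume "dist x y + r <= s" "z \<in> ball x r"
 then show "z \<in> ball y s" using dist_triangle [of y z x] by (simp add: dist_commute)
qed

text \<open>Once the radius exceeds the distance from the boundary, the ratio is almost monotone only around boundary points.
  Passing to the nearest one at most doubles the radius.\<close>

lemma good_nearest: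
 assumes g: "good h M x s" and r: "0 < r" "infdist x F <= r" "r <= 1/2" "s <= 2 * r"
  and y: "dist x y = infdist x F" and hM: "0 <= h" "0 <= M"
 shows "measure xp (ball y r) <= (2^m * h) * r ^ m" "measure al (ball y r) <= (2^m * M) * r ^ m / sqrt r"
proof -
 have sub: "ball y r \<subseteq> ball x (2 * r)"
  using y r by (intro ball_sub) (simp add: dist_commute)
 have "measure xp (ball y r) <= h * (2 * r) ^ m"
  using g [unfolded good_def, rule_format, of "2 * r"] r mono(2) [OF sub] by linarith
 then show "measure xp (ball y r) <= (2^m * h) * r ^ m"
  by (simp add: power_mult_distrib mult_ac)
 have "measure al (ball y r) <= M * (2 * r) ^ m / sqrt (2 * r)"
  using g [unfolded good_def, rule_format, of "2 * r"] r mono(4) [OF sub] by linarith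
 also have "\<dots> <= M * (2 * r) ^ m / sqrt r"
  using r hM by (intro divide_left_mono) auto
 finally show "measure al (ball y r) <= (2^m * M) * r ^ m / sqrt r"
  by (simp add: power_mult_distrib mult_ac)
qed

lemma density_le_J:
 assumes "0 < s" shows "measure mu (ball p s) / s ^ m <= 2 * 2 ^ m * J p (2 * s)"
proof -
 have "measure mu (ball p s) <= 2 * ((2 * s) ^ m * J p (2 * s))"
  using J_lower [of "2 * s" p] assms by simp
 then show ?thesis using assms by (simp add: pos_divide_le_eq power_mult_distrib mult_ac)
qed

lemma J_le_density:
 assumes "0 < s" shows "J p s <= measure mu (ball p s) / s ^ m"
 using J_upper [OF assms, of p] assms by (simp add: pos_le_divide_eq mult_ac)

lemma J_nonneg:
 assumes "0 < r" shows "0 <= J p r"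
proof -
 have "0 <= measure mu (ball p (r/2)) / 2" by simp
 also have "\<dots> <= r ^ m * J p r" using assms by (rule J_lower)
 finally show ?thesis using zero_less_power [OF assms, of m] by (auto simp: zero_le_mult_iff)
qed

lemma quasi_monotone_near:
 assumes x: "x \<in> Om" and s: "0 < s" "s <= S" "S <= 1/12" "infdist x F <= 2 * s"
  and g: "good h M x s" and hM: "0 <= h" "0 <= M"
 shows "measure mu (ball x s) / s ^ m <=
  2 * 6^m * (measure mu (ball x (8 * S)) / S ^ m + 2^m * h * ln (S/s) + 6 * 2^m * M * sqrt S)"
proof -
 obtain y where y: "y \<in> F" "dist x y = infdist x F" using nearest .
 have "measure mu (ball x s) <= measure mu (ball y (3 * s))"
  using s y by (intro mono ball_sub) auto
 then have "measure mu (ball x s) / s ^ m <= 3 ^ m * (measure mu (ball y (3 * s)) / (3 * s) ^ m)"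
  using s by (simp add: field_simps power_mult_distrib)
 also have "\<dots> <= 3 ^ m * (2 * 2 ^ m * J y (2 * (3 * s)))"
  using s by (intro mult_left_mono density_le_J) auto
 also have "\<dots> = 2 * 6 ^ m * J y (6 * s)"
 proof -
  have "(6::real) ^ m = 3 ^ m * 2 ^ m" using power_mult_distrib [of 3 "2::real" m] by simp
  then show ?thesis by simp
 qed
 finally have 1: "measure mu (ball x s) / s ^ m <= 2 * 6 ^ m * J y (6 * s)" .
 have "J y (6 * s) + 0 * ln ((6 * S)/(6 * s)) <=
   J y (6 * S) + (2^m * h) * ln ((6 * S)/(6 * s)) + 2 * (2^m * M) * sqrt (6 * S)"
  using s y good_nearest [OF g _ _ _ _ y(2)] hM by (intro growth) auto
 then have 2: "J y (6 * s) <= J y (6 * S) + 2^m*h * ln (S/s) + 2 * (2^m * M) * sqrt (6 * S)"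
  using s by simp
 have "sqrt 6 <= 3" by (rule real_le_lsqrt) auto
 then have "sqrt (6 * S) <= 3 * sqrt S"
  using s by (simp add: real_sqrt_mult mult_right_mono)
 then have 3: "2 * (2^m * M) * sqrt (6 * S) <= 2 * (2^m * M) * (3 * sqrt S)"
  using hM by (intro mult_left_mono) auto
 have "J y (6 * S) <= measure mu (ball y (6 * S)) / (6 * S) ^ m"
  using s by (intro J_le_density) auto
 also have "\<dots> <= measure mu (ball x (8 * S)) / (6 * S) ^ m"
  using s y by (intro divide_right_mono mono ball_sub) (auto simp: dist_commute)
 also have "\<dots> <= measure mu (ball x (8 * S)) / S ^ m"
  using s by (intro divide_left_mono power_mono) auto
 finally have 4: "J y (6 * S) <= measure mu (ball x (8 * S)) / S ^ m" .
 have "J y (6 * s) <= measure mu (ball x (8 * S)) / S ^ m + 2^m * h * ln (S/s) + 6 * 2^m * M * sqrt S"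
  using 2 3 4 by (simp add: mult_ac)
 then have "2 * 6^m * J y (6 * s) <= 2 * 6^m * (measure mu (ball x (8 * S)) / S ^ m + 2^m * h * ln (S/s) + 6 * 2^m * M * sqrt S)"
  by (intro mult_left_mono) auto
 with 1 show ?thesis by linarith
qed

abbreviation "Cm \<equiv> mono_const m"

lemma Cm_pos: "Cm > 0" by (simp add: mono_const_def)

text \<open>The ratio is followed around \<open>x\<close> up to the distance from \<open>F\<close>, and around the nearest point of \<open>F\<close> beyond. The change of
  centre costs a factor depending on \<open>m\<close> only.\<close>

lemma quasi_monotone:
 assumes x: "x \<in> Om" and s: "0 < s" "s <= S" "S <= 1/24"
  and g: "good h M x s" and hM: "0 <= h" "0 <= M"
 shows "measure mu (ball x s) / s ^ m <= Cm * (measure mu (ball x (16 * S)) / S ^ m + h * ln (S/s) + M * sqrt S)"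
proof -
 define d where "d = infdist x F"
 define A where "A = measure mu (ball x (16 * S)) / S ^ m"
 have A0: "0 <= A" using s by (simp add: A_def)
 have gd: "good h M x s'" if "s <= s'" for s'
  using g that unfolding good_def by auto
 have L0: "0 <= ln (S/s)" using s by simp
 define a b :: real where "a = 2 ^ m" and "b = 6 ^ m"
 have ab: "1 <= a" "1 <= b" by (simp_all add: a_def b_def)
 have "(24::real) = 2 * 2 * 6" by simp
 then have Cab: "Cm = 64 * (a * a * b)" unfolding mono_const_def a_def b_def
  by (metis power_mult_distrib)
 have aab: "1 <= a * a" "a <= a * a" "b <= a * a * b" "a * b <= a * a * b" "a <= a * a * b"
 proof -
  have 1: "1 * 1 <= a * a" "1 * a <= a * a" "1 * b <= a * b" "1 * 1 <= a * b" "a * 1 <= a * b"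
   by (intro mult_mono; use ab in linarith)+
  have "1 * (a * b) <= a * (a * b)" using ab by (intro mult_right_mono) auto
  then show "1 <= a * a" "a <= a * a" "b <= a * a * b" "a * b <= a * a * b" "a <= a * a * b"
   using 1 by (auto simp: mult.assoc)
 qed
 have ba: "1 <= b * a" "1 <= 2 * b * a" "b <= a * b" "1 <= a * b"
 proof -
  have "1 * 1 <= b * a" "1 * b <= a * b" by (intro mult_mono; use ab in linarith)+
  then show "1 <= b * a" "1 <= 2 * b * a" "b <= a * b" "1 <= a * b" by (auto simp: mult.commute)
 qed
 have grow: "c <= 2 * b * a * c'" if "0 <= c" "c <= c'" for c c' :: real
  using mult_mono [OF ba(2) that(2)] that(1) ba(4) by (simp add: mult_ac)
 show ?thesis
 proof (cases "d <= 2 * s")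
  case True
  have "measure mu (ball x s) / s ^ m <= 2 * b * (measure mu (ball x (8 * S)) / S ^ m + a * h * ln (S/s) + 6 * a * M * sqrt S)"
   unfolding a_def b_def using True s by (intro quasi_monotone_near [OF x _ _ _ _ g hM]) (auto simp: d_def)
  also have "\<dots> <= 2 * b * (6 * a * A + 6 * a * (h * ln (S/s)) + 6 * a * (M * sqrt S))"
  proof -
   have "measure mu (ball x (8 * S)) / S ^ m <= A"
    unfolding A_def using s by (intro divide_right_mono mono ball_sub) auto
   also have "A <= 6 * a * A" using A0 ab by (simp add: mult_le_cancel_right1)
   finally have *: "measure mu (ball x (8 * S)) / S ^ m <= 6 * a * A" .
   have "a * (h * ln (S/s)) <= 6 * a * (h * ln (S/s))"
    using hM L0 ab by (intro mult_right_mono) auto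
   with * show ?thesis using ab by (intro mult_left_mono add_mono) (auto simp: mult_ac)
  qed
  also have "\<dots> = 12 * (a * b) * (A + h * ln (S/s) + M * sqrt S)" by (simp add: algebra_simps)
  also have "\<dots> <= Cm * (A + h * ln (S/s) + M * sqrt S)"
   unfolding Cab using aab ab A0 hM L0 s by (intro mult_right_mono) auto
  finally show ?thesis unfolding A_def .
 next
  case False
  have near: "measure mu (ball x d) / d ^ m <=
    2 * b * (A + a * h * ln (2 * S/d) + 12 * a * M * sqrt S)" if dS: "d <= 2 * S"
  proof -
   have "measure mu (ball x d) / d ^ m <=
    2 * b * (measure mu (ball x (8 * (2 * S))) / (2 * S) ^ m + a * h * ln ((2 * S)/d) + 6 * a * M * sqrt (2 * S))"
    unfolding a_def b_def using False dS s by (intro quasi_monotone_near [OF x _ _ _ _ gd hM]) (auto simp: d_def)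
   also have "\<dots> <= 2 * b * (A + a * h * ln (2 * S/d) + 12 * a * M * sqrt S)"
   proof -
    have "measure mu (ball x (8 * (2 * S))) / (2 * S) ^ m <= A"
     unfolding A_def using s by (auto intro!: divide_left_mono power_mono)
    moreover have "sqrt (2 * S) <= 2 * sqrt S"
     using s sqrt2_less_2 by (simp add: real_sqrt_mult mult_right_mono)
    then have "6 * a * M * sqrt (2 * S) <= 6 * a * M * (2 * sqrt S)"
     using ab hM by (intro mult_left_mono) auto
    ultimately show ?thesis using ab by (intro mult_left_mono; linarith)
   qed
   finally show ?thesis .
  qed
  define T where "T = min d (2 * S)"
  have T: "2 * s <= T" "T <= d" "T <= 2 * S" "T > 0" using False s by (auto simp: T_def)
  have 1: "measure mu (ball x s) / s ^ m <= 2 * a * J x (2 * s)"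
   unfolding a_def using s by (intro density_le_J) auto
  have "J x (2 * s) + 0 * ln (T/(2 * s)) <= J x T + h * ln (T/(2 * s)) + 2 * M * sqrt T"
   using s T g x hM by (intro growth) (auto simp: good_def d_def)
  then have 2: "J x (2 * s) <= J x T + h * ln (T/(2 * s)) + 2 * M * sqrt T" by simp
  have "sqrt T <= sqrt (2 * S)" using T by simp
  also have "\<dots> <= 2 * sqrt S"
   using s sqrt2_less_2 by (simp add: real_sqrt_mult mult_right_mono)
  finally have 3: "2 * M * sqrt T <= 4 * M * sqrt S"
   using mult_left_mono [of "sqrt T" "2 * sqrt S" "2 * M"] hM by simp
  have JT: "J x T <= measure mu (ball x T) / T ^ m" using T by (intro J_le_density)
  have 4: "J x T + h * ln (T/(2 * s)) <= 2 * b * A + 2 * b * a * (h * ln (S/s)) + 24 * b * a * (M * sqrt S)"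
  proof (cases "d <= 2 * S")
   case True
   then have Td: "T = d" by (simp add: T_def)
   have l: "ln (S/s) = ln (2 * S/d) + ln (d/(2 * s))" "0 <= ln (d/(2 * s))"
    subgoal using s False T Td by (simp add: ln_div ln_mult)
    subgoal using s False by (intro ln_ge_zero) simp
    done
   have "h * ln (d/(2 * s)) <= 2 * b * a * (h * ln (d/(2 * s)))"
    using hM l by (intro grow) auto
   moreover have "0 <= a * h * ln (2 * S/d)" using True s T Td hM ab by (auto intro!: mult_nonneg_nonneg)
   ultimately show ?thesis
    using JT near [OF True] unfolding Td l(1) by (simp add: algebra_simps)
  next
   case False
   then have TS: "T = 2 * S" by (simp add: T_def)
   have "measure mu (ball x T) / T ^ m <= A"
    unfolding A_def TS using s by (intro frac_le mono ball_sub power_mono) auto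
   also have "A <= 2 * b * A" using A0 ab by (simp add: mult_le_cancel_right1)
   finally have "J x T <= 2 * b * A" using JT by linarith
   moreover have "h * ln (T/(2 * s)) <= 2 * b * a * (h * ln (S/s))"
    unfolding TS using hM L0 s by (intro grow) auto
   moreover have "0 <= b * a * (M * sqrt S)" using hM ab s by auto
   ultimately show ?thesis by linarith
  qed
  have "J x (2 * s) <= 2 * b * A + 2 * b * a * (h * ln (S/s)) + (24 * b * a + 4) * (M * sqrt S)"
   using 2 3 4 by (simp add: algebra_simps)
  also have "\<dots> <= 32 * (a * b) * (A + h * ln (S/s) + M * sqrt S)"
  proof -
   have "2 * b * A <= 32 * (a * b) * A" using A0 ba ab by (intro mult_right_mono) auto
   moreover have "2 * b * a * (h * ln (S/s)) <= 32 * (a * b) * (h * ln (S/s))"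
    using hM L0 ba ab by (intro mult_right_mono) auto
   moreover have "(24 * b * a + 4) * (M * sqrt S) <= 32 * (a * b) * (M * sqrt S)"
    using hM s ba ab by (intro mult_right_mono) (auto simp: mult.commute)
   ultimately show ?thesis by (simp add: algebra_simps)
  qed
  finally have "2 * a * J x (2 * s) <= 2 * a * (32 * (a * b) * (A + h * ln (S/s) + M * sqrt S))"
   using ab by (intro mult_left_mono) auto
  also have "\<dots> = Cm * (A + h * ln (S/s) + M * sqrt S)" unfolding Cab by simp
  finally show ?thesis using 1 unfolding A_def by linarith
 qed
qed

text \<open>If every ball between the radii \<open>a\<close> and \<open>b\<close> carried a fixed fraction of negative discrepancy, the ratio would grow by a
  multiple of \<open>ln (b/a)\<close>, although it is bounded above by \<open>D\<close>. Splitting at the geometric mean leaves half of the logarithm on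
  one side of the distance from \<open>F\<close>, where a single centre suffices.\<close>

lemma log_bound:
 assumes x: "x \<in> Om" and ab: "0 < a" "a <= b" "b <= 1/24"
  and g: "good h M x a" and hM: "0 <= h" "0 <= M"
  and D: "\<And>r. a <= r ==> r <= 1 ==> measure mu (ball x r) <= D * r ^ m"
  and k: "0 <= k" "\<And>r. a <= r ==> r <= b ==> k * r ^ m <= measure xm (ball x r)"
 shows "k * (ln (b/a) / 2 - ln 2) <= 4 * 8 ^ m * (D + h * ln (b/a) + 4 * M)"
proof -
 define L where "L = ln (b/a)"
 have L0: "0 <= L" using ab by (simp add: L_def)
 have D0: "0 <= D"
  using D [of 1] ab by (metis measure_nonneg mult.right_neutral order_trans power_one le_numeral_extra(4) dual_order.trans one_le_numeral half_bounded_equal divide_le_eq_1_pos zero_less_numeral landau_o.R_trans)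
 have nn: "0 <= D + h * L + 4 * M" using D0 hM L0 by simp
 have gd: "good h M x s'" if "a <= s'" for s'
  using g that unfolding good_def by auto
 define q where "q = sqrt (a * b)"
 have q: "a <= q" "q <= b" "0 < q"
  using ab real_sqrt_le_mono [of "a*a" "a*b"] real_sqrt_le_mono [of "a*b" "b*b"] by (auto simp: q_def)
 have lq: "ln q = (ln a + ln b) / 2" using ab by (simp add: q_def ln_sqrt ln_mult)
 define d where "d = infdist x F"
 have p1: "(1::real) <= 2 ^ m" "(2::real) ^ m <= 8 ^ m" "(4::real)^m <= 8^m" "0 < (8::real)^m" by (auto intro: power_mono)
 show ?thesis
 proof (cases "q <= d")
  case True
  show ?thesis
  proof (cases "2 * a <= q")
   case False
   have "ln q < ln (2 * a)" using False q ab by (subst ln_less_cancel_iff) auto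
   then have "L / 2 - ln 2 < 0" using lq ab by (simp add: L_def ln_div ln_mult)
   then have "k * (L / 2 - ln 2) <= 0" using k(1) by (simp add: mult_nonneg_nonpos)
   also have "0 <= 4 * 8 ^ m * (D + h * L + 4 * M)" using D0 hM L0 by auto
   finally show ?thesis unfolding L_def .
  next
   case True2: True
   have "J x (2*a) + (k / 2 / 2^m) * ln (q/(2*a)) <= J x q + h * ln (q/(2*a)) + 2 * M * sqrt q"
   proof (rule growth)
    fix r assume r: "2 * a <= r" "r <= q"
    have "k * (r/2) ^ m <= measure xm (ball x (r/2))" using r q ab by (intro k) auto
    then show "2 * (k / 2 / 2 ^ m) * r ^ m <= measure xm (ball x (r / 2))"
     by (simp add: power_divide)
   qed (use True True2 ab q g x hM in \<open>auto simp: good_def d_def\<close>)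
   moreover have "ln (q/(2*a)) = L / 2 - ln 2" using q ab lq by (simp add: ln_div ln_mult L_def)
   moreover have "0 <= J x (2*a)" using ab by (intro J_nonneg) auto
   moreover have "J x q <= D"
   proof -
    have "J x q <= measure mu (ball x q) / q ^ m" using q by (intro J_le_density)
    also have "\<dots> <= (D * q ^ m) / q ^ m" using q ab by (intro divide_right_mono D) auto
    finally show ?thesis using q by simp
   qed
   moreover have "h * (L / 2 - ln 2) <= h * L" using hM L0 ln_gt_zero [of "2::real"] by (intro mult_left_mono; linarith)
   moreover have "2 * M * sqrt q <= 4 * M"
   proof -
    have "sqrt q <= 1" using q ab by simp
    then have "2 * M * sqrt q <= 2 * M * 1" using hM by (intro mult_left_mono) auto
    then show ?thesis using hM by linarith
   qed
   ultimately have *: "(k / 2 / 2^m) * (L / 2 - ln 2) <= D + h * L + 4 * M" by simp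
   have "k * (L / 2 - ln 2) = 2 * 2^m * ((k / 2 / 2^m) * (L / 2 - ln 2))" by simp
   also have "\<dots> <= 2 * 2^m * (D + h * L + 4 * M)" using * by (intro mult_left_mono) auto
   also have "\<dots> <= 4 * 8^m * (D + h * L + 4 * M)"
    by (rule mult_right_mono [OF _ nn]) (use p1 in linarith)
   finally show ?thesis unfolding L_def .
  qed
 next
  case False
  obtain y where y: "y \<in> F" "dist x y = d" using nearest d_def by metis
  have yd: "dist x y = infdist x F" using y d_def by simp
  have gr: "J y (4*q) + (k / 2 / 4^m) * ln ((4*b)/(4*q)) <= J y (4*b) + (2^m * h) * ln ((4*b)/(4*q)) + 2 * (2^m * M) * sqrt (4*b)"
  proof (rule growth)
   fix r assume r: "4 * q <= r" "r <= 4 * b"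
   have "infdist x F <= r" using r False q by (simp add: d_def)
   then show "measure xp (ball y r) <= 2 ^ m * h * r ^ m" "measure al (ball y r) <= 2 ^ m * M * r ^ m / sqrt r"
    using good_nearest [OF g _ _ _ _ yd] r q ab hM by auto
   have "k * (r/4) ^ m <= measure xm (ball x (r/4))" using r q ab by (intro k) auto
   also have "\<dots> <= measure xm (ball y (r/2))"
    using y False r q by (intro mono ball_sub) auto
   finally show "2 * (k / 2 / 4 ^ m) * r ^ m <= measure xm (ball y (r / 2))"
    by (simp add: power_divide)
  qed (use ab q y hM in auto)
  have e: "ln ((4*b)/(4*q)) = L / 2"
  proof -
   have "(4*b)/(4*q) = b / q" by simp
   moreover have "ln (b / q) = ln b - ln q" using q by (simp add: ln_div)
   ultimately have 1: "ln ((4*b)/(4*q)) = ln b - ln q" by (simp only:)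
   have 2: "L = ln b - ln a" using ab by (simp add: ln_div L_def)
   show ?thesis unfolding 1 2 lq by (simp add: field_simps)
  qed
  note gr [unfolded e]
  moreover have "0 <= J y (4*q)" using q by (intro J_nonneg) auto
  moreover have "J y (4*b) <= 2^m * D"
  proof -
   have "J y (4*b) <= measure mu (ball y (4*b)) / (4*b) ^ m" using q by (intro J_le_density) auto
   also have "\<dots> <= measure mu (ball x (8*b)) / (4*b) ^ m"
    using y False q by (intro divide_right_mono mono ball_sub) (auto simp: dist_commute)
   also have "\<dots> <= (D * (8*b) ^ m) / (4*b) ^ m" using q ab by (intro divide_right_mono D) auto
   also have "(8*b) ^ m = 2 ^ m * (4*b)^m" using power_mult_distrib [of 2 "4 * b" m] by simp
   finally show ?thesis using q ab by (simp add: mult.commute)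
  qed
  moreover have "2^m*h * (L / 2) <= 2^m * h * L" using hM L0 by (intro mult_left_mono) auto
  moreover have "2 * (2^m * M) * sqrt (4*b) <= 2^m * (4 * M)"
  proof -
   have "sqrt (4 * b) <= 1" using q ab by simp
   then have "2 * (2^m * M) * sqrt (4*b) <= 2 * (2^m * M) * 1" using hM by (intro mult_left_mono) auto
   moreover have "0 <= 2^m * M" using hM by simp
   ultimately show ?thesis by linarith
  qed
  ultimately have *: "(k / 2 / 4^m) * (L / 2) <= 2^m * (D + h * L + 4 * M)" by (simp add: algebra_simps)
  have "k * (L / 2 - ln 2) <= k * (L/2)" using k by (intro mult_left_mono) auto
  also have "\<dots> = 2 * 4^m * ((k / 2 / 4^m) * (L / 2))" by simp
  also have "\<dots> <= 2 * 4^m * (2^m * (D + h * L + 4 * M))" using * by (intro mult_left_mono) auto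
  also have "\<dots> = 2 * 8^m * (D + h * L + 4 * M)" using power_mult_distrib [of 4 "2::real" m] by simp
  also have "\<dots> <= 4 * 8^m * (D + h * L + 4 * M)"
   using D0 hM L0 by (intro mult_right_mono) auto
  finally show ?thesis unfolding L_def .
 qed
qed

text \<open>Points of \<open>P\<close> that violate one of the two conditions in \<open>good\<close> at some scale are covered by balls in which \<open>xp\<close> or \<open>al\<close> is
  large, so their energy is small; \<open>U1\<close> and \<open>U2\<close> are these coverings. At the other points the lower bound for the energy at
  scale \<open>eps\<close> propagates to all larger scales up to \<open>S\<close>, so that \<open>log_bound\<close> yields a scale at which \<open>xm\<close> is a small
  fraction of \<open>mu\<close>; the corresponding covering is \<open>U3\<close>.\<close>

lemma defect_le:
 assumes eps: "0 < eps" and s0: "0 < s0" "s0 <= 1/144" and h: "0 < h" "h <= s0 ^ m" "h * ln (1/eps) <= 1"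
  and E: "measure mu UNIV <= E" and A: "measure al UNIV <= A" and xp: "measure xp UNIV <= h\<^sup>2"
  and M: "M = (A + 1) / s0 ^ m"
  and P: "P \<subseteq> Om" "P \<in> sets borel" "\<And>x. x \<in> P ==> c * eps ^ m <= measure mu (ball x eps)"
  and xm: "\<And>B. B \<in> sets borel ==> measure xm B <= measure mu B"
  and c: "0 < c" "Cm * (M * sqrt S) <= c/4" "Cm * (h * ln (1/eps)) <= c/4"
  and S: "0 < S" "S <= 1/2304" "eps <= S" and \<kappa>: "0 < \<kappa>"
  and D: "D = Cm * (24 ^ m * E + 1 + M)"
  and k: "k = \<kappa> * (c / (2 * Cm * 16 ^ m)) / 6 ^ m" "4 * 8 ^ m * (D + 1 + 4 * M) < k * (ln (S/eps) / 2 - ln 2)"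
  and K: "K = 5 ^ m * Cm * (24 ^ m * E + 2)"
 shows "measure xm P <= K * M * h + K * sqrt s0 * A + \<kappa> * E"
proof -
 have E0: "0 <= E" and A0: "0 <= A" using E A measure_nonneg [of mu UNIV] measure_nonneg [of al UNIV] by linarith+
 have s0m: "0 < s0 ^ m" "s0 ^ m <= 1" using s0 by (auto intro: power_le_one)
 have M1: "1 <= M" using s0m A0 unfolding M by (simp add: le_divide_eq)
 have eps1: "eps <= 1/2304" using S by simp
 have L: "0 <= ln (1/eps)" using eps eps1 by simp
 have UN: "measure mu B <= E" "measure al B <= A" "measure xp B <= h\<^sup>2" for B
 proof -
  have s: "space mu = UNIV" "space al = UNIV" "space xp = UNIV"
   using sets_eq_imp_space_eq [OF sets(1)] sets_eq_imp_space_eq [OF sets(2)] sets_eq_imp_space_eq [OF sets(4)] by simp_all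
  show "measure mu B <= E"
   using finite_measure.bounded_measure [OF fin(1), of B] E unfolding s by (rule order_trans)
  show "measure al B <= A"
   using finite_measure.bounded_measure [OF fin(4), of B] A unfolding s by (rule order_trans)
  show "measure xp B <= h\<^sup>2"
   using finite_measure.bounded_measure [OF fin(2), of B] xp unfolding s by (rule order_trans)
 qed
 have upper: "measure mu (ball x s) <= s ^ m * (Cm * (24 ^ m * E + 1 + M))"
  if x: "x \<in> Om" "good h M x s" and s: "eps <= s" "s <= 1/24" for x s
 proof -
  have s0: "0 < s" using s eps by simp
  have "measure mu (ball x s) / s ^ m <= Cm * (measure mu (ball x (16 * (1/24))) / (1/24) ^ m + h * ln ((1/24)/s) + M * sqrt (1/24))"
   using x s s0 M1 h by (intro quasi_monotone) auto
  also have "\<dots> <= Cm * (24 ^ m * E + 1 + M)"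
  proof (intro mult_left_mono add_mono)
   show "measure mu (ball x (16 * (1/24))) / (1/24) ^ m <= 24 ^ m * E"
    using UN(1) [of "ball x (16 * (1/24))"] by (simp add: power_divide mult.commute)
   have "ln ((1/24)/s) <= ln (1/eps)" using s s0 eps by (intro ln_mono) (auto simp: field_simps)
   then have "h * ln ((1/24)/s) <= h * ln (1/eps)" using h by (intro mult_left_mono) auto
   then show "h * ln ((1/24)/s) <= 1" using h by linarith
   have "sqrt (1/24) <= 1" by simp
   then have "M * sqrt (1/24) <= M * 1" using M1 by (intro mult_left_mono) auto
   then show "M * sqrt (1/24) <= M" by simp
  qed (use Cm_pos in auto)
  finally show ?thesis using s0 by (simp add: pos_divide_le_eq mult.commute)
 qed
 define viol where "viol x r \<longleftrightarrow> eps <= r \<and> r <= 1 \<and>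
   \<not> (measure xp (ball x r) <= h * r ^ m \<and> measure al (ball x r) <= M * r ^ m / sqrt r)" for x r
 have viol_small: "r < s0" if "viol x r" for x r
 proof (rule ccontr)
  assume "\<not> r < s0"
  then have r: "s0 <= r" "r <= 1" "0 < r" using that s0 by (auto simp: viol_def)
  have rm: "s0 ^ m <= r ^ m" using r s0 by (intro power_mono) auto
  have "measure xp (ball x r) <= h\<^sup>2" by (rule UN)
  also have "\<dots> <= h * r ^ m" unfolding power2_eq_square using h rm by (intro mult_left_mono) auto
  finally have 1: "measure xp (ball x r) <= h * r ^ m" .
  have "measure al (ball x r) <= A + 1" using UN(2) [of "ball x r"] by simp
  also have "\<dots> = M * s0 ^ m" using s0m(1) s0(1) unfolding M by simp
  also have "\<dots> <= M * r ^ m" using rm M1 by (intro mult_left_mono) auto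
  also have "\<dots> <= M * r ^ m / sqrt r"
   using r M1 by (simp add: le_divide_eq mult_left_le)
  finally show False using 1 that by (simp add: viol_def)
 qed
 define bad where "bad = {x \<in> P. \<exists>r. viol x r}"
 have "\<exists>r. viol x r \<and> good h M x (2 * r)" if x: "x \<in> bad" for x
 proof -
  define V where "V = {r. viol x r}"
  have V: "V \<noteq> {}" "bdd_above V"
   using x viol_small by (auto simp: V_def bad_def bdd_above_def intro: less_imp_le)
  obtain r0 where "r0 \<in> V" using V by auto
  then have "0 < Sup V" using cSup_upper [OF _ V(2), of r0] eps by (auto simp: V_def viol_def)
  then obtain r where r: "r \<in> V" "Sup V / 2 < r" using less_cSup_iff [OF V, of "Sup V / 2"] by auto
  have "\<not> viol x r'" if "2 * r <= r'" for r'
   using cSup_upper [OF _ V(2), of r'] r that by (auto simp: V_def)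
  moreover have "eps <= r'" if "2 * r <= r'" for r' using r(1) that eps by (auto simp: V_def viol_def)
  ultimately have "good h M x (2 * r)" by (simp add: good_def viol_def)
  then show ?thesis using r by (auto simp: V_def)
 qed
 then obtain \<rho> where \<rho>: "\<And>x. x \<in> bad ==> viol x (\<rho> x)" "\<And>x. x \<in> bad ==> good h M x (2 * \<rho> x)" by metis
 have \<rho>0: "0 < \<rho> x" "\<rho> x <= s0" "eps <= \<rho> x" if "x \<in> bad" for x
  using \<rho>(1) [OF that] viol_small [of x "\<rho> x"] eps by (auto simp: viol_def)
 have K0: "0 <= K" using K E0 Cm_pos by simp
 have five: "measure mu (ball x (5 * \<rho> x)) <= K * M * \<rho> x ^ m" if x: "x \<in> bad" for x
 proof -
  have "good h M x (5 * \<rho> x)" using \<rho>(2) [OF x] \<rho>0 [OF x] by (auto simp: good_def)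
  then have "measure mu (ball x (5 * \<rho> x)) <= (5 * \<rho> x) ^ m * (Cm * (24 ^ m * E + 1 + M))"
   using x \<rho>0 [OF x] s0 P by (intro upper) (auto simp: bad_def)
  also have "\<dots> <= (5 * \<rho> x) ^ m * (Cm * ((24 ^ m * E + 2) * M))"
  proof -
   have "24 ^ m * E * 1 <= 24 ^ m * E * M" using M1 E0 by (intro mult_left_mono) auto
   then have "24 ^ m * E + 1 + M <= (24 ^ m * E + 2) * M" using M1 by (simp add: algebra_simps)
   then show ?thesis using \<rho>0 [OF x] Cm_pos by (intro mult_left_mono) auto
  qed
  also have "\<dots> = K * M * \<rho> x ^ m" by (simp add: K power_mult_distrib mult_ac)
  finally show ?thesis .
 qed
 define bad1 where "bad1 = {x \<in> bad. h * \<rho> x ^ m < measure xp (ball x (\<rho> x))}"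
 have 1: "measure mu (ball x (5 * \<rho> x)) <= (K * M / h) * measure xp (ball x (\<rho> x))" if "x \<in> bad1" for x
 proof -
  have "measure mu (ball x (5 * \<rho> x)) <= K * M * \<rho> x ^ m" using that by (intro five) (auto simp: bad1_def)
  also have "\<dots> = (K * M / h) * (h * \<rho> x ^ m)" using h by simp
  also have "\<dots> <= (K * M / h) * measure xp (ball x (\<rho> x))"
   using that K0 M1 h by (intro mult_left_mono) (auto simp: bad1_def)
  finally show ?thesis .
 qed
 have 2: "measure mu (ball x (5 * \<rho> x)) <= (K * sqrt s0) * measure al (ball x (\<rho> x))" if "x \<in> bad - bad1" for x
 proof -
  have x: "x \<in> bad" and "M * \<rho> x ^ m / sqrt (\<rho> x) <= measure al (ball x (\<rho> x))"
   using that \<rho>(1) [of x] by (auto simp: bad1_def viol_def)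
  then have "M * \<rho> x ^ m <= sqrt (\<rho> x) * measure al (ball x (\<rho> x))"
   using \<rho>0 [OF x] by (simp add: pos_divide_le_eq mult.commute)
  also have "\<dots> <= sqrt s0 * measure al (ball x (\<rho> x))" using \<rho>0 [OF x] by (intro mult_right_mono) auto
  finally have "K * (M * \<rho> x ^ m) <= K * (sqrt s0 * measure al (ball x (\<rho> x)))" using K0 by (intro mult_left_mono)
  then show ?thesis using five [OF x] by (simp add: mult_ac)
 qed
 obtain U1 where U1: "open U1" "bad1 \<subseteq> U1" "measure mu U1 <= (K * M / h) * measure xp UNIV"
  using Vitali_ball_measure_le [OF fin(2) sets(2) fin(1) sets(1), of bad1 \<rho> s0 "K * M / h"] 1 \<rho>0 K0 M1 h
  by (auto simp: bad1_def)
 obtain U2 where U2: "open U2" "bad - bad1 \<subseteq> U2" "measure mu U2 <= (K * sqrt s0) * measure al UNIV"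
  using Vitali_ball_measure_le [OF fin(4) sets(4) fin(1) sets(1), of "bad - bad1" \<rho> s0 "K * sqrt s0"] 2 \<rho>0 K0 s0
  by auto
 have "(K * M / h) * measure xp UNIV <= (K * M / h) * h\<^sup>2"
  using xp K0 M1 h by (intro mult_left_mono) auto
 also have "\<dots> = K * M * h" using h by (simp add: power2_eq_square)
 finally have m1: "measure xm U1 <= K * M * h" using U1 xm [of U1] by auto
 have "(K * sqrt s0) * measure al UNIV <= (K * sqrt s0) * A"
  using A K0 s0 by (intro mult_left_mono) auto
 then have m2: "measure xm U2 <= K * sqrt s0 * A" using U2 xm [of U2] by auto
 define G where "G = P - (U1 \<union> U2)"
 have good: "good h M x s" if "x \<in> G" "eps <= s" for x s
  unfolding good_def
 proof (intro allI impI)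
  fix r assume r: "s <= r \<and> r <= 1"
  have "x \<notin> bad" "x \<in> P" using that U1 U2 by (auto simp: G_def)
  then have "\<not> viol x r" by (auto simp: bad_def)
  then show "measure xp (ball x r) <= h * r ^ m \<and> measure al (ball x r) <= M * r ^ m / sqrt r"
   using r that(2) by (auto simp: viol_def)
 qed
 have GO: "x \<in> Om" if "x \<in> G" for x using that P by (auto simp: G_def)
 define c' where "c' = c / (2 * Cm * 16 ^ m)"
 have c'0: "0 < c'" using c Cm_pos by (simp add: c'_def)
 have lower: "c' * s ^ m <= measure mu (ball x s)" if x: "x \<in> G" and s: "16 * eps <= s" "s <= 16 * S" for x s
 proof -
  define T where "T = s / 16"
  have T: "eps <= T" "T <= S" "0 < T" using s eps by (auto simp: T_def)
  have "c <= measure mu (ball x eps) / eps ^ m"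
   using P(3) [of x] x eps by (auto simp: G_def pos_le_divide_eq)
  also have "\<dots> <= Cm * (measure mu (ball x (16 * T)) / T ^ m + h * ln (T/eps) + M * sqrt T)"
   using T S M1 h eps by (intro quasi_monotone GO good x) auto
  also have "\<dots> = Cm * (measure mu (ball x s) / T ^ m) + Cm * (h * ln (T/eps)) + Cm * (M * sqrt T)"
   by (simp add: T_def algebra_simps)
  also have "Cm * (h * ln (T/eps)) <= c / 4"
  proof -
   have "ln (T/eps) <= ln (1/eps)" using T S eps by (intro ln_mono divide_right_mono) auto
   then have "Cm * (h * ln (T/eps)) <= Cm * (h * ln (1/eps))" using h Cm_pos by (intro mult_left_mono) auto
   then show ?thesis using c by linarith
  qed
  also have "Cm * (M * sqrt T) <= c / 4"
  proof -
   have "Cm * (M * sqrt T) <= Cm * (M * sqrt S)" using T M1 Cm_pos by (intro mult_left_mono) auto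
   then show ?thesis using c by linarith
  qed
  finally have "c / 2 <= Cm * (measure mu (ball x s) / T ^ m)" by linarith
  then have "c / 2 * T ^ m <= Cm * measure mu (ball x s)" using T by (simp add: pos_le_divide_eq)
  then have "c / (2 * Cm) * T ^ m <= measure mu (ball x s)"
   using Cm_pos by (simp add: pos_divide_le_eq mult_ac)
  then show ?thesis by (simp add: T_def c'_def power_divide)
 qed
 have "\<exists>s. 0 < s \<and> s <= 1 \<and> measure xm (ball x (5 * s)) <= \<kappa> * measure mu (ball x s)" if x: "x \<in> G" for x
 proof (rule ccontr)
  assume neg: "\<not> ?thesis"
  have k0: "0 <= k"
   unfolding k(1) using \<kappa> c Cm_pos by (intro divide_nonneg_nonneg mult_nonneg_nonneg) auto
  have eS: "96 * eps < 96 * S"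
  proof (rule ccontr)
   assume "\<not> ?thesis"
   then have "S = eps" using S by simp
   then have "k * (ln (S/eps) / 2 - ln 2) <= 0" using k0 eps by simp
   moreover have "0 <= 4 * 8 ^ m * (D + 1 + 4 * M)" using D E0 M1 Cm_pos by simp
   ultimately show False using k(2) by linarith
  qed
  have "k * (ln ((96 * S)/(96 * eps)) / 2 - ln 2) <= 4 * 8 ^ m * (D + h * ln ((96 * S)/(96 * eps)) + 4 * M)"
  proof (rule log_bound [OF GO [OF x]])
   show "good h M x (96 * eps)" using eps by (intro good x) auto
   fix r assume r: "96 * eps <= r"
   show "measure mu (ball x r) <= D * r ^ m" if "r <= 1"
   proof (cases "r <= 1/24")
    case True
    then show ?thesis using upper [OF GO [OF x] good [OF x], of r] r eps unfolding D by (simp add: mult.commute)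
   next
    case False
    have "measure mu (ball x r) <= E * 1" using UN by simp
    also have "\<dots> <= E * (24 * r) ^ m" using False E0 by (intro mult_left_mono one_le_power) auto
    also have "\<dots> = (24 ^ m * E) * r ^ m" by (simp add: power_mult_distrib)
    also have "\<dots> <= D * r ^ m"
    proof (rule mult_right_mono)
     have "1 <= Cm" using one_le_power [of "24::real" m] unfolding mono_const_def by linarith
     then have "1 * (24 ^ m * E) <= Cm * (24 ^ m * E + 1 + M)"
      using E0 M1 by (intro mult_mono) auto
     then show "24 ^ m * E <= D" unfolding D by simp
    qed (use False in simp)
    finally show ?thesis .
   qed
   show "k * r ^ m <= measure xm (ball x r)" if "r <= 96 * S"
   proof -
    have "\<kappa> * (c' * (r/6) ^ m) <= \<kappa> * measure mu (ball x (r/6))"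
     using lower [OF x, of "r/6"] r that eps \<kappa> by (intro mult_left_mono) auto
    also have "\<dots> <= measure xm (ball x (5 * (r/6)))"
    proof (rule ccontr)
     assume "\<not> \<kappa> * measure mu (ball x (r/6)) <= measure xm (ball x (5 * (r/6)))"
     then have "\<exists>s. 0 < s \<and> s <= 1 \<and> measure xm (ball x (5 * s)) <= \<kappa> * measure mu (ball x s)"
      using r that eps S by (intro exI [of _ "r/6"]) auto
     with neg show False ..
    qed
    also have "\<dots> <= measure xm (ball x r)"
     using r eps by (intro mono subset_ball) auto
    finally show ?thesis by (simp add: k(1) c'_def power_divide)
   qed
  qed (use eps S eS M1 h k0 in auto)
  moreover have "h * ln (S/eps) <= 1"
  proof -
   have "ln (S/eps) <= ln (1/eps)" using S eps by (intro ln_mono divide_right_mono) auto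
   then have "h * ln (S/eps) <= h * ln (1/eps)" using h by (intro mult_left_mono) auto
   then show ?thesis using h by linarith
  qed
  then have "4 * 8 ^ m * (D + h * ln (S/eps) + 4 * M) <= 4 * 8 ^ m * (D + 1 + 4 * M)"
   by (intro mult_left_mono) auto
  ultimately show False using k(2) by simp
 qed
 then obtain \<sigma> where \<sigma>: "\<And>x. x \<in> G ==> 0 < \<sigma> x \<and> \<sigma> x <= 1"
  "\<And>x. x \<in> G ==> measure xm (ball x (5 * \<sigma> x)) <= \<kappa> * measure mu (ball x (\<sigma> x))" by metis
 obtain U3 where U3: "open U3" "G \<subseteq> U3" "measure xm U3 <= \<kappa> * measure mu UNIV"
  using Vitali_ball_measure_le [OF fin(1) sets(1) fin(3) sets(3) \<sigma>(1) _ \<sigma>(2)] \<kappa> by auto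
 have m3: "measure xm U3 <= \<kappa> * E" using U3(3) mult_left_mono [OF E less_imp_le [OF \<kappa>]] by (rule order_trans)
 have "measure xm P <= measure xm (U1 \<union> U2 \<union> U3)"
  using U1 U2 U3 P(2) sets(3) by (intro finite_measure.finite_measure_mono [OF fin(3)]) (auto simp: G_def)
 also have "\<dots> <= measure xm (U1 \<union> U2) + measure xm U3"
  using U1 U2 U3 sets(3) by (intro measure_Un_le) auto
 also have "measure xm (U1 \<union> U2) <= measure xm U1 + measure xm U2"
  using U1 U2 U3 sets(3) by (intro measure_Un_le) auto
 finally show ?thesis using m1 m2 m3 by linarith
qed

end

lemma sqrt_min_le:
 assumes "0 < a" "0 < b" "0 <= q" "0 < C" "C * b <= a"
 shows "C * sqrt (min q (b\<^sup>2)) <= (a::real)"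
proof -
 have "sqrt (min q (b\<^sup>2)) <= sqrt (b\<^sup>2)" by (intro real_sqrt_le_mono) simp
 then have "C * sqrt (min q (b\<^sup>2)) <= C * b" using assms by (intro mult_left_mono) auto
 with assms show ?thesis by linarith
qed

text \<open>The predicate quantifies over all instances of the locale at once, so that the threshold is visibly uniform in them.\<close>

definition is_threshold :: "'a::euclidean_space itself => nat => real => real => real => real => real => bool" where
 "is_threshold _ m E A c \<tau> \<delta> \<longleftrightarrow>
  (\<forall>(mu :: 'a measure) xp xm al F Om J eps h P.
    almost_monotone m mu xp xm al F Om J --> 0 < eps --> eps < \<delta> --> 0 < h --> h < \<delta> -->
    h * ln (1/eps) <= \<delta> --> measure mu UNIV <= E --> measure al UNIV <= A --> measure xp UNIV <= h\<^sup>2 -->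
    P \<subseteq> Om --> P \<in> sets borel --> (\<forall>x\<in>P. c * eps ^ m <= measure mu (ball x eps)) -->
    (\<forall>B\<in>sets borel. measure xm B <= measure mu B) --> measure xm P <= \<tau>)"

lemma is_thresholdD:
 fixes mu :: "'a::euclidean_space measure"
 assumes "is_threshold TYPE('a) m E A c \<tau> \<delta>" "almost_monotone m mu xp xm al F Om J" "0 < eps" "eps < \<delta>" "0 < h" "h < \<delta>"
  "h * ln (1/eps) <= \<delta>" "measure mu UNIV <= E" "measure al UNIV <= A" "measure xp UNIV <= h\<^sup>2"
  "P \<subseteq> Om" "P \<in> sets borel" "\<And>x. x \<in> P ==> c * eps ^ m <= measure mu (ball x eps)"
  "\<And>B. B \<in> sets borel ==> measure xm B <= measure mu B"
 shows "measure xm P <= \<tau>"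
 using assms unfolding is_threshold_def by blast

theorem vanishing_defect:
 fixes E A c \<tau> :: real
 assumes E: "0 <= E" and A: "0 <= A" and c: "0 < c" and \<tau>: "0 < \<tau>"
 obtains \<delta> where "0 < \<delta>" "is_threshold TYPE('a::euclidean_space) m E A c \<tau> \<delta>"
proof -
 define C where "C = mono_const m"
 have C0: "0 < C" by (simp add: C_def mono_const_def)
 define K where "K = 5 ^ m * C * (24 ^ m * E + 2)"
 have "0 < 24 ^ m * E + 2" using E by (intro add_nonneg_pos) auto
 then have K0: "0 < K" using C0 by (simp add: K_def)
 define Q where "Q = K * A + 1"
 define s0 where "s0 = min (1/144) ((\<tau> / (3 * Q))\<^sup>2)"
 have Q: "0 < Q" using K0 A unfolding Q_def by (intro add_nonneg_pos) auto
 have s0: "0 < s0" "s0 <= 1/144" using \<tau> Q by (auto simp: s0_def)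
 have "Q * sqrt s0 <= \<tau> / 3"
  unfolding s0_def using \<tau> Q by (intro sqrt_min_le) auto
 moreover have "K * A * sqrt s0 <= Q * sqrt s0" using s0 by (intro mult_right_mono) (auto simp: Q_def)
 ultimately have t1: "K * sqrt s0 * A <= \<tau> / 3" by (simp add: mult_ac)
 define M where "M = (A + 1) / s0 ^ m"
 have M0: "0 < M" using A s0 by (simp add: M_def)
 define S where "S = min (1/2304) ((c / (4 * (C * M)))\<^sup>2)"
 have S: "0 < S" "S <= 1/2304" using c C0 M0 by (auto simp: S_def)
 have "(C * M) * sqrt S <= c / 4"
  unfolding S_def using c C0 M0 by (intro sqrt_min_le) auto
 then have cS: "C * (M * sqrt S) <= c / 4" by (simp add: mult_ac)
 define \<kappa> where "\<kappa> = \<tau> / (3 * (E + 1))"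
 have \<kappa>0: "0 < \<kappa>" using E \<tau> by (simp add: \<kappa>_def)
 have "\<kappa> * E <= \<kappa> * (E + 1)" using \<kappa>0 by (intro mult_left_mono) auto
 also have "\<dots> = \<tau> / 3"
 proof -
  have "\<tau> / (3 * e) * e = \<tau> / 3" if "0 < e" for e using that by simp
  from this [of "E + 1"] E show ?thesis by (simp only: \<kappa>_def)
 qed
 finally have t3: "\<kappa> * E <= \<tau> / 3" .
 define D where "D = C * (24 ^ m * E + 1 + M)"
 define k where "k = \<kappa> * (c / (2 * C * 16 ^ m)) / 6 ^ m"
 have k0: "0 < k" using \<kappa>0 c C0 by (simp add: k_def)
 define R where "R = 4 * 8 ^ m * (D + 1 + 4 * M) / k"
 define \<delta> where "\<delta> = min (S * exp (- 2 * (R + ln 2))) (min S (min (s0 ^ m) (min 1 (min (c / (4 * C)) (\<tau> / (3 * (K * M)))))))"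
 have "0 < \<delta>" using S s0 c C0 \<tau> K0 M0 by (simp add: \<delta>_def)
 moreover have "measure xm P <= \<tau>"
  if am: "almost_monotone m mu xp xm al F Om J" and eps: "0 < eps" "eps < \<delta>" and h: "0 < h" "h < \<delta>"
   "h * ln (1/eps) <= \<delta>" and m: "measure mu UNIV <= E" "measure al UNIV <= A" "measure xp UNIV <= h\<^sup>2"
   and P: "P \<subseteq> Om" "P \<in> sets borel" "\<And>x. x \<in> P ==> c * eps ^ m <= measure mu (ball x eps)"
   and xm: "\<And>B. B \<in> sets borel ==> measure xm B <= measure mu B"
  for mu :: "'a measure" and xp xm al F Om J eps h P
 proof -
  interpret almost_monotone m mu xp xm al F Om J by fact
  have "measure xm P <= K * M * h + K * sqrt s0 * A + \<kappa> * E"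
  proof (rule defect_le [OF eps(1) s0 h(1)])
   show "h <= s0 ^ m" "h * ln (1 / eps) <= 1" "eps <= S" using h eps by (auto simp: \<delta>_def)
   have "C * (h * ln (1/eps)) <= C * (c / (4 * C))"
    using h C0 by (intro mult_left_mono) (auto simp: \<delta>_def)
   then show "mono_const m * (h * ln (1/eps)) <= c/4" using C0 by (simp add: C_def)
   show "4 * 8 ^ m * (D + 1 + 4 * M) < k * (ln (S/eps) / 2 - ln 2)"
   proof -
    have "ln eps < ln (S * exp (- 2 * (R + ln 2)))"
     using eps S by (subst ln_less_cancel_iff) (auto simp: \<delta>_def)
    also have "\<dots> = ln S - 2 * (R + ln 2)" using S by (simp add: ln_mult)
    finally have "ln eps < ln S - 2 * (R + ln 2)" .
    moreover have half: "a < b - 2 * (R + l) ==> R < (b - a) / 2 - l" for a b l :: real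
     by (simp add: field_simps)
    ultimately have "R < (ln S - ln eps) / 2 - ln 2" by (intro half)
    then have "R < ln (S/eps) / 2 - ln 2" using S eps by (simp add: ln_div)
    then have "k * R < k * (ln (S/eps) / 2 - ln 2)" using k0 by simp
    then show ?thesis using k0 by (simp add: R_def)
   qed
  qed (use m P xm c cS S \<kappa>0 in \<open>auto simp: M_def D_def k_def K_def C_def\<close>)
  moreover have "K * M * h <= K * M * (\<tau> / (3 * (K * M)))"
   using h K0 M0 by (intro mult_left_mono) (auto simp: \<delta>_def)
  then have "K * M * h <= \<tau> / 3" using K0 M0 by simp
  ultimately show ?thesis using t1 t3 by linarith
 qed
 then have "is_threshold TYPE('a) m E A c \<tau> \<delta>" unfolding is_threshold_def by blast
 ultimately show ?thesis using that by blast
qed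

section \<open>The divergence theorem on a domain with a defining function\<close>

definition leb :: "'a::euclidean_space set => 'a measure" where
 "leb S = restrict_space lborel S"

lemma space_leb [simp]: "space (leb S) = S"
 by (simp add: leb_def space_restrict_space)

lemma finite_measure_leb:
 assumes "bounded S" "S \<in> sets borel" shows "finite_measure (leb S)"
proof
 have "emeasure (leb S) (space (leb S)) = emeasure lborel S"
  using assms by (simp add: leb_def emeasure_restrict_space)
 also have "\<dots> < \<infinity>" using assms emeasure_bounded_finite by blast
 finally show "emeasure (leb S) (space (leb S)) \<noteq> \<infinity>" by simp
qed

lemma continuous_on_borel_measurable_leb:
 fixes f :: "'a::euclidean_space => 'b::topological_space"
 assumes "continuous_on S f" shows "f \<in> borel_measurable (leb S)"
proof -
 have "sets (leb S) = sets (restrict_space borel S)" unfolding leb_def by (intro sets_restrict_space_cong) simp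
 then show ?thesis using borel_measurable_continuous_on_restrict [OF assms] by (simp cong: measurable_cong_sets)
qed

lemma integrable_leb_bounded:
 fixes f :: "'a::euclidean_space => real"
 assumes S: "bounded S" "S \<in> sets borel" and f: "f \<in> borel_measurable (leb S)" and B: "\<And>x. x \<in> S ==> \<bar>f x\<bar> <= B"
 shows "integrable (leb S) f"
proof -
 interpret finite_measure "leb S" using finite_measure_leb [OF S] .
 show ?thesis using f B by (intro integrable_const_bound [of _ B]) auto
qed

lemma integral_leb:
 fixes f :: "'a::euclidean_space => real"
 assumes "S \<in> sets borel"
 shows "integral\<^sup>L (leb S) f = integral\<^sup>L lborel (\<lambda>x. if x \<in> S then f x else 0)"
proof -
 have "integral\<^sup>L (leb S) f = integral\<^sup>L lborel (\<lambda>x. indicator S x *\<^sub>R f x)"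
  unfolding leb_def using assms by (subst integral_restrict_space) auto
 also have "\<dots> = integral\<^sup>L lborel (\<lambda>x. if x \<in> S then f x else 0)"
  by (intro Bochner_Integration.integral_cong) auto
 finally show ?thesis .
qed

lemma has_derivative_line:
 assumes "(f has_derivative f') (at (x + t *\<^sub>R v))"
 shows "((\<lambda>s. f (x + s *\<^sub>R v)) has_vector_derivative f' v) (at t within S)"
proof -
 have "((\<lambda>s. x + s *\<^sub>R v) has_derivative (\<lambda>s. s *\<^sub>R v)) (at t within S)"
  by (auto intro!: derivative_eq_intros)
 from diff_chain_within [OF this has_derivative_at_withinI [OF assms]]
 have "((\<lambda>s. f (x + s *\<^sub>R v)) has_derivative (\<lambda>s. f' (s *\<^sub>R v))) (at t within S)"
  by (simp add: o_def)
 moreover have "f' (s *\<^sub>R v) = s *\<^sub>R f' v" for s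
  using has_derivative_linear [OF assms] by (simp add: linear_cmul)
 ultimately show ?thesis by (simp add: has_vector_derivative_def)
qed

lemma line_increment_bound:
 fixes f :: "'a::euclidean_space => 'b::real_normed_vector"
 assumes d: "\<And>s. 0 <= s ==> s <= 1 ==> (f has_derivative f' (x + s *\<^sub>R v)) (at (x + s *\<^sub>R v))"
  and B: "\<And>s. 0 <= s ==> s <= 1 ==> norm (f' (x + s *\<^sub>R v) v) <= B"
 shows "norm (f (x + v) - f x) <= B"
proof -
 have "norm (f (x + 1 *\<^sub>R v) - f (x + 0 *\<^sub>R v)) <= B * norm (1 - 0 :: real)"
 proof (rule differentiable_bound [of "{0..1}"])
  fix s :: real assume s: "s \<in> {0..1}"
  have "((\<lambda>s. f (x + s *\<^sub>R v)) has_vector_derivative f' (x + s *\<^sub>R v) v) (at s within {0..1})"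
   using s by (intro has_derivative_line d) auto
  then show "((\<lambda>s. f (x + s *\<^sub>R v)) has_derivative (\<lambda>h. h *\<^sub>R f' (x + s *\<^sub>R v) v)) (at s within {0..1})"
   by (simp add: has_vector_derivative_def)
  show "onorm (\<lambda>h. h *\<^sub>R f' (x + s *\<^sub>R v) v) <= B"
   using mult_left_mono [OF B [of s] abs_ge_zero] s by (intro onorm_le) (auto simp: mult.commute)
 qed auto
 then show ?thesis by simp
qed

lemma has_real_derivative_integral:
 fixes f :: "real => 'a => real"
 assumes fm: "finite_measure M" and d: "0 < d"
  and i: "\<And>t. \<bar>t - t0\<bar> < d ==> integrable M (f t)"
  and f': "\<And>t x. \<bar>t - t0\<bar> < d ==> x \<in> space M ==> ((\<lambda>s. f s x) has_real_derivative f' t x) (at t)"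
  and B: "\<And>t x. \<bar>t - t0\<bar> < d ==> x \<in> space M ==> \<bar>f' t x\<bar> <= B"
  and m: "f' t0 \<in> borel_measurable M"
 shows "((\<lambda>t. integral\<^sup>L M (f t)) has_real_derivative integral\<^sup>L M (f' t0)) (at t0)"
proof -
 interpret finite_measure M by fact
 have "((\<lambda>t. (integral\<^sup>L M (f t) - integral\<^sup>L M (f t0)) / (t - t0)) \<longlongrightarrow> integral\<^sup>L M (f' t0)) (at t0)"
  unfolding tendsto_at_iff_sequentially
 proof (intro allI impI)
  fix T :: "nat => real"
  assume T: "\<forall>n. T n \<in> UNIV - {t0}" "T \<longlonglongrightarrow> t0"
  define q where "q n x = (if \<bar>T n - t0\<bar> < d then (f (T n) x - f t0 x) / (T n - t0) else f' t0 x)" for n x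
  have ev: "eventually (\<lambda>n. \<bar>T n - t0\<bar> < d) sequentially"
   using tendstoD [OF T(2) d] by (simp add: dist_real_def)
  have "(\<lambda>n. integral\<^sup>L M (q n)) \<longlonglongrightarrow> integral\<^sup>L M (f' t0)"
  proof (rule integral_dominated_convergence [where w = "\<lambda>_. B"])
   show "q n \<in> borel_measurable M" for n
   proof (cases "\<bar>T n - t0\<bar> < d")
    case True
    then have [measurable]: "f (T n) \<in> borel_measurable M" "f t0 \<in> borel_measurable M"
     using i [of "T n"] i [of t0] d by auto
    show ?thesis unfolding q_def [abs_def] using True by simp
   next
    case False
    then show ?thesis unfolding q_def [abs_def] using m by simp
   qed
   show "AE x in M. (\<lambda>n. q n x) \<longlonglongrightarrow> f' t0 x"
   proof (rule AE_I2)
    fix x assume x: "x \<in> space M"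
    have "((\<lambda>t. (f t x - f t0 x) / (t - t0)) \<longlongrightarrow> f' t0 x) (at t0)"
     using f' [of t0 x] x d by (simp add: has_field_derivative_iff)
    then have "((\<lambda>t. (f t x - f t0 x) / (t - t0)) \<circ> T) \<longlonglongrightarrow> f' t0 x"
     using T unfolding tendsto_at_iff_sequentially by blast
    moreover have "eventually (\<lambda>n. ((\<lambda>t. (f t x - f t0 x) / (t - t0)) \<circ> T) n = q n x) sequentially"
     using ev by eventually_elim (simp add: q_def)
    ultimately show "(\<lambda>n. q n x) \<longlonglongrightarrow> f' t0 x" using tendsto_cong by fast
   qed
   show "AE x in M. norm (q n x) <= B" for n
   proof (rule AE_I2)
    fix x assume x: "x \<in> space M"
    show "norm (q n x) <= B"
    proof (cases "\<bar>T n - t0\<bar> < d")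
     case True
     have "norm (f (T n) x - f t0 x) <= B * norm (T n - t0)"
     proof (rule differentiable_bound [of "{t0 - d <..< t0 + d}"])
      fix t assume "t \<in> {t0 - d <..< t0 + d}"
      then have t: "\<bar>t - t0\<bar> < d" by auto
      show "((\<lambda>s. f s x) has_derivative (*) (f' t x)) (at t within {t0 - d <..< t0 + d})"
       using f' [OF t x] unfolding has_field_derivative_def by (rule has_derivative_at_withinI)
      show "onorm ((*) (f' t x)) <= B"
       using mult_right_mono [OF B [OF t x] abs_ge_zero] by (intro onorm_le) (auto simp: abs_mult)
     qed (use True d in auto)
     moreover have "T n \<noteq> t0" using T by auto
     ultimately show ?thesis using True by (simp add: q_def pos_divide_le_eq)
    next
     case False
     then show ?thesis using B [of t0 x] x d by (simp add: q_def)
    qed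
   qed
  qed (use m in auto)
  moreover have "eventually (\<lambda>n. integral\<^sup>L M (q n) = ((\<lambda>t. (integral\<^sup>L M (f t) - integral\<^sup>L M (f t0)) / (t - t0)) \<circ> T) n) sequentially"
   using ev
  proof eventually_elim
   case (elim n)
   then have "q n = (\<lambda>x. (f (T n) x - f t0 x) / (T n - t0))" by (simp add: q_def [abs_def])
   then show ?case using i [OF elim] i [of t0] d by simp
  qed
  ultimately show "((\<lambda>t. (integral\<^sup>L M (f t) - integral\<^sup>L M (f t0)) / (t - t0)) \<circ> T) \<longlonglongrightarrow> integral\<^sup>L M (f' t0)"
   using Lim_transform_eventually by fast
 qed
 then show ?thesis by (simp add: has_field_derivative_iff)
qed

text \<open>The integral of a translate of \<open>g\<close> does not depend on the translation; the claim is its derivative.\<close>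

lemma integral_directional_derivative_eq_0:
 fixes g :: "'a::euclidean_space => real"
 assumes g: "\<And>x. (g has_derivative g' x) (at x)" and cont: "continuous_on UNIV (\<lambda>x. g' x b)"
  and B: "\<And>x. \<bar>g' x b\<bar> <= B" and R: "\<And>x. R <= norm x ==> g x = 0"
 shows "integral\<^sup>L lborel (\<lambda>x. g' x b) = 0"
proof -
 have contg: "continuous_on UNIV g"
  by (meson g has_derivative_continuous continuous_at_imp_continuous_on)
 define K where "K = cball (0::'a) (R + norm b)"
 have K: "bounded K" "K \<in> sets borel" "compact K" by (simp_all add: K_def)
 have cs: "continuous_on S (\<lambda>x. g (x + s *\<^sub>R b))" for s S
  by (intro continuous_intros continuous_on_compose2 [OF contg]) auto
 have D: "((\<lambda>s. \<integral>x. g (x + s *\<^sub>R b) \<partial>leb K) has_real_derivative (\<integral>x. g' (x + 0 *\<^sub>R b) b \<partial>leb K)) (at 0)"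
 proof (rule has_real_derivative_integral [where d = 1 and B = B])
  show "finite_measure (leb K)" by (rule finite_measure_leb [OF K(1,2)])
  show "(\<lambda>x. g' (x + 0 *\<^sub>R b) b) \<in> borel_measurable (leb K)"
   using cont by (intro continuous_on_borel_measurable_leb) (auto intro: continuous_on_subset)
  fix s :: real
  from compact_imp_bounded [OF compact_continuous_image [OF cs K(3)]]
  obtain C where "\<And>y. y \<in> (\<lambda>x. g (x + s *\<^sub>R b)) ` K ==> norm y <= C" unfolding bounded_iff by blast
  then have "\<And>x. x \<in> K ==> \<bar>g (x + s *\<^sub>R b)\<bar> <= C" by fastforce
  from integrable_leb_bounded [OF K(1,2) continuous_on_borel_measurable_leb [OF cs] this]
  show "integrable (leb K) (\<lambda>x. g (x + s *\<^sub>R b))" .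
  fix x
  show "((\<lambda>s. g (x + s *\<^sub>R b)) has_real_derivative g' (x + s *\<^sub>R b) b) (at s)"
   using has_derivative_line [OF g [of "x + s *\<^sub>R b"]] by (simp add: has_real_derivative_iff_has_vector_derivative)
  show "\<bar>g' (x + s *\<^sub>R b) b\<bar> <= B" by (rule B)
 qed simp
 \<comment> \<open>by translation invariance the integral of the translate does not depend on the translation\<close>
 have const: "(\<integral>x. g (x + s *\<^sub>R b) \<partial>leb K) = integral\<^sup>L lborel g" if s: "\<bar>s\<bar> < 1" for s
 proof -
  have gm: "g \<in> borel_measurable borel" by (rule borel_measurable_continuous_onI [OF contg])
  have out: "g (x + s *\<^sub>R b) = 0" if "x \<notin> K" for x
  proof -
   have "norm x <= norm (x + s *\<^sub>R b) + norm (s *\<^sub>R b)" using norm_triangle_ineq4 [of "x + s *\<^sub>R b" "s *\<^sub>R b"] by simp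
   moreover have "norm (s *\<^sub>R b) <= norm b" using s by (simp add: mult_left_le_one_le)
   ultimately show ?thesis using that by (intro R) (simp add: K_def)
  qed
  have "(\<integral>x. g (x + s *\<^sub>R b) \<partial>leb K) = (\<integral>x. g (s *\<^sub>R b + x) \<partial>lborel)"
   unfolding integral_leb [OF K(2)] using out by (intro Bochner_Integration.integral_cong) (auto simp: add.commute)
  also have "\<dots> = integral\<^sup>L (distr lborel borel ((+) (s *\<^sub>R b))) g" using gm by (subst integral_distr) auto
  finally show ?thesis by (simp only: lborel_distr_plus)
 qed
 have "eventually (\<lambda>s. \<bar>s\<bar> < 1) (nhds (0::real))" by (auto simp: eventually_nhds_metric intro: exI [of _ 1])
 then have ev: "eventually (\<lambda>s. (\<integral>x. g (x + s *\<^sub>R b) \<partial>leb K) = integral\<^sup>L lborel g) (nhds 0)"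
  by eventually_elim (rule const)
 have "((\<lambda>s. integral\<^sup>L lborel g) has_real_derivative (\<integral>x. g' (x + 0 *\<^sub>R b) b \<partial>leb K)) (at 0)"
  by (rule DERIV_cong_ev [OF refl ev refl, THEN iffD1, OF D])
 from DERIV_unique [OF this DERIV_const] have z: "(\<integral>x. g' x b \<partial>leb K) = 0" by simp
 have "g' x b = 0" if x: "x \<notin> K" for x
 proof -
  have "open (- cball (0::'a) R)" by (simp add: open_Compl)
  moreover have "R + norm b < norm x" using x by (simp add: K_def)
  then have "R < norm x" using norm_ge_zero [of b] by linarith
  then have "x \<in> - cball 0 R" by simp
  ultimately have "((\<lambda>_. 0) has_derivative g' x) (at x)"
   using R by (intro has_derivative_transform_within_open [OF g]) auto
  from has_derivative_unique [OF this has_derivative_const] show ?thesis by simp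
 qed
 then have "(\<integral>x. g' x b \<partial>leb K) = (\<integral>x. g' x b \<partial>lborel)"
  unfolding integral_leb [OF K(2)] by (intro Bochner_Integration.integral_cong) auto
 with z show ?thesis by simp
qed

definition div_of :: "('a => 'a::euclidean_space) => real" where
 "div_of L = (\<Sum>b\<in>Basis. L b \<bullet> b)"

lemma integral_divergence_compact_support:
 fixes V :: "'a::euclidean_space => 'a"
 assumes S: "open S" "bounded S" and K: "compact K" "K \<subseteq> S" "\<And>x. x \<in> S ==> x \<notin> K ==> V x = 0"
  and V: "\<And>x. x \<in> S ==> (V has_derivative V' x) (at x)"
  and c: "\<And>h. continuous_on S (\<lambda>x. V' x h)"
 shows "integral\<^sup>L (leb S) (\<lambda>x. div_of (V' x)) = 0"
proof -
 define U where "U x = (if x \<in> S then V x else 0)" for x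
 define U' where "U' x = (if x \<in> K then V' x else (\<lambda>_. 0))" for x
 have V'0: "V' x = (\<lambda>_. 0)" if "x \<in> S" "x \<notin> K" for x
 proof -
  have "open (S - K)" using S K by (simp add: compact_imp_closed open_Diff)
  then have "((\<lambda>_. 0) has_derivative V' x) (at x)"
   using V [OF that(1)] that K(3) by (elim has_derivative_transform_within_open [where s="S-K"]) auto
  then show ?thesis using has_derivative_unique has_derivative_const by blast
 qed
 have U: "(U has_derivative U' x) (at x)" for x
 proof (cases "x \<in> K")
  case True
  then have "(V has_derivative U' x) (at x)" using V K by (auto simp: U'_def)
  then show ?thesis
   using True K S by (elim has_derivative_transform_within_open [where s=S]) (auto simp: U_def)
 next
  case False
  have "((\<lambda>_. 0) has_derivative U' x) (at x)" using False by (simp add: U'_def)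
  then show ?thesis
   using False K compact_imp_closed [OF K(1)]
   by (elim has_derivative_transform_within_open [where s="- K"]) (auto simp: U_def)
 qed
 have U'c: "continuous_on UNIV (\<lambda>x. U' x h)" for h
 proof -
  have "continuous_on S (\<lambda>x. U' x h)"
   using c [of h] by (rule continuous_on_eq) (use V'0 in \<open>auto simp: U'_def\<close>)
  moreover have "continuous_on (- K) (\<lambda>x. U' x h)"
   by (rule continuous_on_eq [OF continuous_on_const [of _ 0]]) (auto simp: U'_def)
  ultimately have "continuous_on (S \<union> - K) (\<lambda>x. U' x h)"
   using S K compact_imp_closed by (intro continuous_on_open_Un) auto
  moreover have "S \<union> - K = UNIV" using K by auto
  ultimately show ?thesis by simp
 qed
 obtain R where R: "\<And>x. x \<in> S ==> norm x < R"
  using S(2) by (metis bounded_pos_less)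
 have comp: "integral\<^sup>L lborel (\<lambda>x. U' x b \<bullet> b) = 0" "integrable lborel (\<lambda>x. U' x b \<bullet> b)" for b
 proof -
  have cont: "continuous_on UNIV (\<lambda>x. U' x b \<bullet> b)" by (intro continuous_intros U'c)
  have "bounded ((\<lambda>x. U' x b \<bullet> b) ` K)"
   using K cont by (intro compact_imp_bounded compact_continuous_image) (auto intro: continuous_on_subset)
  then obtain B where B: "\<And>x. x \<in> K ==> \<bar>U' x b \<bullet> b\<bar> <= B" by (auto simp: bounded_iff)
  have B': "\<bar>U' x b \<bullet> b\<bar> <= max 0 B" for x using B [of x] by (cases "x \<in> K") (auto simp: U'_def)
  show "integral\<^sup>L lborel (\<lambda>x. U' x b \<bullet> b) = 0"
  proof (rule integral_directional_derivative_eq_0 [where g="\<lambda>x. U x \<bullet> b" and g'="\<lambda>x h. U' x h \<bullet> b"])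
   show "((\<lambda>x. U x \<bullet> b) has_derivative (\<lambda>h. U' x h \<bullet> b)) (at x)" for x
    using U by (rule has_derivative_inner_left)
   show "U x \<bullet> b = 0" if "R <= norm x" for x using R [of x] that by (force simp: U_def)
  qed (use cont B' in auto)
  show "integrable lborel (\<lambda>x. U' x b \<bullet> b)"
  proof (rule Bochner_Integration.integrable_bound)
   show "integrable lborel (\<lambda>x. indicator K x * max 0 B)"
    using K by (intro integrable_mult_left integrable_real_indicator) (auto simp: emeasure_bounded_finite [unfolded infinity_ennreal_def] compact_imp_bounded borel_compact)
   show "AE x in lborel. norm (U' x b \<bullet> b) <= norm (indicator K x * max 0 B)"
    using B B' by (intro AE_I2) (auto simp: indicator_def U'_def le_max_iff_disj)
  qed (use cont in \<open>auto intro: borel_measurable_continuous_onI\<close>)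
 qed
 have "integral\<^sup>L (leb S) (\<lambda>x. div_of (V' x)) = integral\<^sup>L lborel (\<lambda>x. div_of (U' x))"
  using S V'0 K by (subst integral_leb) (auto simp: U'_def div_of_def intro!: Bochner_Integration.integral_cong)
 also have "\<dots> = 0"
  unfolding div_of_def using comp by simp
 finally show ?thesis .
qed

text \<open>The square of the positive part serves as a continuously differentiable building block for cutoffs.\<close>

definition psq :: "real => real" where "psq y = (max 0 y)\<^sup>2"

lemma psq_deriv: "(psq has_real_derivative 2 * max 0 y) (at y)"
proof -
 consider "y < 0" | "y = 0" | "0 < y" by linarith
 then show ?thesis
 proof cases
  case 1
  have "((\<lambda>_. 0) has_real_derivative 2 * max 0 y) (at y)" using 1 by simp
  then show ?thesis
   by (rule has_field_derivative_transform_within_open [where S="{..<0}"]) (use 1 in \<open>auto simp: psq_def max_def\<close>)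
 next
  case 2
  have "((\<lambda>h. (psq h - psq 0) / (h - 0)) \<longlongrightarrow> 0) (at 0)"
  proof (rule tendsto_0_le [of "\<lambda>h. h" _ _ 1])
   show "((\<lambda>h::real. h) \<longlongrightarrow> 0) (at 0)" by (simp add: tendsto_ident_at)
   show "\<forall>\<^sub>F x in at 0. norm ((psq x - psq 0) / (x - 0)) <= norm x * 1"
    by (intro always_eventually) (auto simp: psq_def max_def power2_eq_square)
  qed
  then show ?thesis using 2 by (simp add: has_field_derivative_iff)
 next
  case 3
  have "((\<lambda>y. y\<^sup>2) has_real_derivative 2 * max 0 y) (at y)" using 3
   by (auto intro!: derivative_eq_intros)
  then show ?thesis
   by (rule has_field_derivative_transform_within_open [where S="{0<..}"]) (use 3 in \<open>auto simp: psq_def max_def\<close>)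
 qed
qed

lemma psq_continuous: "continuous_on S psq"
 unfolding psq_def by (intro continuous_intros)

lemma psq_simps: "y <= 0 ==> psq y = 0" "0 <= y ==> psq y = y\<^sup>2" "0 <= psq y"
 by (auto simp: psq_def max_def)

definition step :: "real => real" where "step t = 1 - psq (1 - psq (t - 1))"
definition step' :: "real => real" where "step' t = 4 * max 0 (1 - psq (t - 1)) * max 0 (t - 1)"

lemma step_deriv: "(step has_real_derivative step' t) (at t)"
proof -
 have 1: "((\<lambda>t. psq (t - 1)) has_real_derivative 2 * max 0 (t - 1)) (at t)"
 proof -
  have "((\<lambda>t. t - 1) has_real_derivative 1) (at t)" by (auto intro!: derivative_eq_intros)
  from DERIV_chain2 [where f = psq and g = "\<lambda>t. t - 1", OF psq_deriv this] show ?thesis by simp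
 qed
 have "((\<lambda>t. psq (1 - psq (t - 1))) has_real_derivative 2 * max 0 (1 - psq (t - 1)) * (- (2 * max 0 (t - 1)))) (at t)"
  by (rule DERIV_chain2 [OF psq_deriv]) (auto intro!: derivative_eq_intros 1)
 then show ?thesis unfolding step_def step'_def by (auto intro!: derivative_eq_intros)
qed

lemma step'_continuous: "continuous_on S step'"
 unfolding step'_def by (intro continuous_intros continuous_on_compose2 [OF psq_continuous [of UNIV]]) auto

lemma step_le: "t <= 1 ==> step t = 0" "2 <= t ==> step t = 1" "t <= 1 ==> step' t = 0" "2 <= t ==> step' t = 0"
 "0 <= step' t" "0 <= step t" "step t <= 1"
proof -
 show "t <= 1 ==> step t = 0" "t <= 1 ==> step' t = 0" by (auto simp: step_def step'_def psq_def)
 have "1 <= psq (t - 1)" if "2 <= t"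
  using that by (simp add: psq_def)
 then show "2 <= t ==> step t = 1" "2 <= t ==> step' t = 0" by (auto simp: step_def step'_def psq_simps)
 show "0 <= step' t" by (simp add: step'_def)
 show "step t <= 1" by (simp add: step_def psq_simps)
 have "psq (1 - psq (t - 1)) <= 1\<^sup>2"
  unfolding psq_def [of "1 - _"] using psq_simps(3) [of "t - 1"] by (intro power_mono) auto
 then show "0 <= step t" by (simp add: step_def)
qed

text \<open>A bounded open set given by a global defining function \<open>z\<close> with gradient \<open>Z\<close> and second derivative \<open>Z'\<close>. Boundary integrals
  never occur: the boundary is only seen through layers \<open>- d < z < 0\<close>, and tangency of a field \<open>V\<close> means \<open>V \<bullet> Z = 0\<close> there.\<close>

locale C2_domain =
 fixes Om :: "'a::euclidean_space set" and z :: "'a => real" and Z :: "'a => 'a" and Z' :: "'a => 'a => 'a"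
 assumes open_Om: "open Om" and bounded_Om: "bounded Om" and Om_ne: "Om \<noteq> {}"
  and Om_eq: "Om = {x. z x < 0}"
  and z_deriv: "\<And>x. (z has_derivative (\<lambda>h. Z x \<bullet> h)) (at x)"
  and Z_deriv: "\<And>x. (Z has_derivative Z' x) (at x)"
  and Z'_cont: "\<And>h. continuous_on UNIV (\<lambda>x. Z' x h)"
  and Z_frontier: "\<And>x. x \<in> frontier Om ==> Z x \<noteq> 0"
begin

lemma z_cont: "continuous_on S z"
 by (meson z_deriv has_derivative_continuous continuous_at_imp_continuous_on)

lemma Z_cont: "continuous_on S Z"
 by (meson Z_deriv has_derivative_continuous continuous_at_imp_continuous_on)

lemma compact_closure: "compact (closure Om)" using bounded_Om by simp

lemma sets_Om [measurable]: "Om \<in> sets borel" using open_Om by simp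

lemma z_closure: "x \<in> closure Om ==> z x <= 0"
proof -
 have "closed {x. z x <= 0}" using z_cont [of UNIV] by (intro closed_Collect_le) (auto intro: continuous_intros)
 then have "closure Om \<subseteq> {x. z x <= 0}" by (intro closure_minimal) (auto simp: Om_eq)
 then show "x \<in> closure Om ==> z x <= 0" by auto
qed

lemma z_frontier: "x \<in> frontier Om ==> z x = 0"
 using z_closure [of x] open_Om by (auto simp: frontier_def interior_open Om_eq)

lemma closure_cases: "x \<in> closure Om ==> x \<in> Om \<or> x \<in> frontier Om"
 using open_Om by (auto simp: frontier_def interior_open)

lemma frontier_iff: "x \<in> closure Om ==> x \<in> frontier Om \<longleftrightarrow> z x = 0"
 using closure_cases z_frontier by (force simp: Om_eq)

lemma frontier_closure: "x \<in> frontier Om ==> x \<in> closure Om" by (simp add: frontier_def)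

lemma nondegenerate:
 obtains m where "0 < m" "\<And>x. x \<in> closure Om ==> m <= (norm (Z x))\<^sup>2 + (z x)\<^sup>2"
proof -
 have cont: "continuous_on (closure Om) (\<lambda>x. (norm (Z x))\<^sup>2 + (z x)\<^sup>2)"
  by (intro continuous_intros z_cont Z_cont)
 have ne: "closure Om \<noteq> {}" using Om_ne by simp
 obtain x where x: "x \<in> closure Om" "\<And>y. y \<in> closure Om ==> (norm (Z x))\<^sup>2 + (z x)\<^sup>2 <= (norm (Z y))\<^sup>2 + (z y)\<^sup>2"
  using continuous_attains_inf [OF compact_closure ne cont] by blast
 have "0 < (norm (Z x))\<^sup>2 + (z x)\<^sup>2"
  using x(1) frontier_iff [of x] Z_frontier [of x] by (cases "z x = 0") (auto intro: add_nonneg_pos)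
 then show ?thesis using x(2) that by blast
qed

lemma small_near_frontier:
 fixes h :: "'a => real"
 assumes "continuous_on (closure Om) h" "\<And>x. x \<in> frontier Om ==> h x = 0" "0 < e"
 obtains d where "0 < d" "\<And>x. x \<in> closure Om ==> - d < z x ==> \<bar>h x\<bar> < e"
proof (cases "{x \<in> closure Om. e <= \<bar>h x\<bar>} = {}")
 case True
 then show ?thesis using that [of 1] by force
next
 case False
 let ?K = "{x \<in> closure Om. e <= \<bar>h x\<bar>}"
 have "closedin (top_of_set (closure Om)) (closure Om \<inter> (\<lambda>x. \<bar>h x\<bar>) -` {e..})"
  using assms(1) by (intro continuous_closedin_preimage continuous_intros) auto
 then have "compact (closure Om \<inter> (\<lambda>x. \<bar>h x\<bar>) -` {e..})"
  using compact_closure closedin_compact by blast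
 moreover have "closure Om \<inter> (\<lambda>x. \<bar>h x\<bar>) -` {e..} = ?K" by auto
 ultimately have K: "compact ?K" by simp
 obtain x where x: "x \<in> ?K" "\<And>y. y \<in> ?K ==> z y <= z x"
  using continuous_attains_sup [OF K False z_cont] by blast
 have "z x < 0" using x(1) assms(2) [of x] assms(3) frontier_iff [of x] z_closure [of x] by force
 then show ?thesis using x(2) by (intro that [of "- z x"]) (auto simp: not_less [symmetric])
qed

lemma Z'_linear: "linear (Z' x)" using has_derivative_linear [OF Z_deriv] .

lemma bounded_on_closure:
 fixes f :: "'a => 'b::real_normed_vector"
 assumes "continuous_on (closure Om) f"
 obtains B where "0 < B" "\<And>x. x \<in> closure Om ==> norm (f x) <= B"
proof -
 have "bounded (f ` closure Om)"
  using assms compact_closure compact_continuous_image compact_imp_bounded by blast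
 then obtain B where "0 < B" "\<And>y. y \<in> f ` closure Om ==> norm y <= B" by (auto simp: bounded_pos)
 then show ?thesis using that by blast
qed

lemma closure_cont: "continuous_on (closure Om) f ==> continuous_on Om f"
 by (rule continuous_on_subset [OF _ closure_subset])

lemma integrable_cont:
 fixes f :: "'a => real"
 assumes c: "continuous_on (closure Om) f" shows "integrable (leb Om) f"
proof -
 obtain B where "\<And>x. x \<in> closure Om ==> norm (f x) <= B" using bounded_on_closure [OF c] by blast
 then show ?thesis using closure_subset
  by (intro integrable_leb_bounded [OF bounded_Om sets_Om continuous_on_borel_measurable_leb [OF closure_cont [OF c]]]) auto
qed

lemma div_of_cont:
 assumes "\<And>h. continuous_on S (\<lambda>x. V' x h)" shows "continuous_on S (\<lambda>x. div_of (V' x))"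
 unfolding div_of_def by (intro continuous_intros assms)

lemma cutoff_identity:
 assumes V: "\<And>x. x \<in> Om ==> (V has_derivative V' x) (at x)"
  and c: "\<And>h. continuous_on (closure Om) (\<lambda>x. V' x h)" and d: "0 < d" and cV: "continuous_on (closure Om) V"
 shows "integral\<^sup>L (leb Om) (\<lambda>x. step (- z x / d) * div_of (V' x)) =
  integral\<^sup>L (leb Om) (\<lambda>x. step' (- z x / d) / d * (Z x \<bullet> V x))"
proof -
 define U where "U x = step (- z x / d) *\<^sub>R V x" for x
 define U' where "U' x h = step (- z x / d) *\<^sub>R V' x h + (step' (- z x / d) * (- (Z x \<bullet> h) / d)) *\<^sub>R V x" for x h
 have sd: "((\<lambda>x. step (- z x / d)) has_derivative (\<lambda>h. step' (- z x / d) * (- (Z x \<bullet> h) / d))) (at x)" for x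
 proof -
  have "((\<lambda>x. - z x / d) has_derivative (\<lambda>h. - (Z x \<bullet> h) / d)) (at x)"
   using d by (auto intro!: derivative_eq_intros z_deriv)
  from has_derivative_compose [OF this step_deriv [unfolded has_field_derivative_def]] show ?thesis by simp
 qed
 have U: "(U has_derivative U' x) (at x)" if "x \<in> Om" for x
  unfolding U_def U'_def by (intro has_derivative_scaleR sd V that)
 have cs: "continuous_on S (\<lambda>x. step (- z x / d))" "continuous_on S (\<lambda>x. step' (- z x / d))" for S
 proof -
  show "continuous_on S (\<lambda>x. step (- z x / d))"
   using has_derivative_continuous [OF sd] by (intro continuous_at_imp_continuous_on) auto
  show "continuous_on S (\<lambda>x. step' (- z x / d))"
   using d by (intro continuous_on_compose2 [OF step'_continuous [of UNIV]] continuous_intros z_cont) auto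
 qed
 have U'c: "continuous_on Om (\<lambda>x. U' x h)" for h
  unfolding U'_def using d by (intro closure_cont continuous_intros c cV cs Z_cont) auto
 define K where "K = {x. z x <= - d}"
 have "closed K" unfolding K_def using z_cont [of UNIV] by (intro closed_Collect_le continuous_intros) auto
 moreover have "K \<subseteq> Om" using d by (auto simp: K_def Om_eq)
 ultimately have K: "compact K" "K \<subseteq> Om" using bounded_Om bounded_subset compact_eq_bounded_closed by blast+
 have "U x = 0" if "x \<notin> K" for x
 proof -
  have "- z x / d <= 1" using that d by (simp add: K_def field_simps)
  then show ?thesis by (simp add: U_def step_le)
 qed
 then have 0: "integral\<^sup>L (leb Om) (\<lambda>x. div_of (U' x)) = 0"
  by (intro integral_divergence_compact_support [OF open_Om bounded_Om K _ U U'c])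
 have e: "div_of (U' x) = step (- z x / d) * div_of (V' x) - step' (- z x / d) / d * (Z x \<bullet> V x)" for x
 proof -
  have "div_of (U' x) = (\<Sum>b\<in>Basis. step (- z x / d) * (V' x b \<bullet> b) - step' (- z x / d) / d * ((Z x \<bullet> b) * (V x \<bullet> b)))"
   unfolding div_of_def U'_def by (intro sum.cong) (auto simp: inner_diff_left)
  also have "\<dots> = step (- z x / d) * div_of (V' x) - step' (- z x / d) / d * (\<Sum>b\<in>Basis. (Z x \<bullet> b) * (V x \<bullet> b))"
   unfolding div_of_def by (simp only: sum_subtractf sum_distrib_left)
  also have "(\<Sum>b\<in>Basis. (Z x \<bullet> b) * (V x \<bullet> b)) = Z x \<bullet> V x" by (rule euclidean_inner [symmetric])
  finally show ?thesis .
 qed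
 have i1: "integrable (leb Om) (\<lambda>x. step (- z x / d) * div_of (V' x))"
  by (intro integrable_cont continuous_intros cs div_of_cont c)
 have i2: "integrable (leb Om) (\<lambda>x. step' (- z x / d) / d * (Z x \<bullet> V x))"
  using d by (intro integrable_cont continuous_intros cs Z_cont cV) auto
 show "integral\<^sup>L (leb Om) (\<lambda>x. step (- z x / d) * div_of (V' x)) =
  integral\<^sup>L (leb Om) (\<lambda>x. step' (- z x / d) / d * (Z x \<bullet> V x))"
  using 0 unfolding e using i1 i2 by simp
qed

text \<open>The mass of the layer of width \<open>s\<close> is at most a multiple of \<open>s\<close>: this is \<open>cutoff_identity\<close> for the field \<open>Z\<close> itself, whose
  normal component does not vanish near the boundary.\<close>

lemma layer_bound:
 obtains C d where "0 < d" "\<And>s. 0 < s ==> s <= d ==> integral\<^sup>L (leb Om) (\<lambda>x. step' (- z x / s) / s) <= C"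
proof -
 obtain m where m: "0 < m" "\<And>x. x \<in> closure Om ==> m <= (norm (Z x))\<^sup>2 + (z x)\<^sup>2" using nondegenerate by blast
 have dc: "continuous_on S (\<lambda>x. div_of (Z' x))" for S
  by (intro div_of_cont continuous_on_subset [OF Z'_cont]) auto
 obtain B where B: "0 < B" "\<And>x. x \<in> closure Om ==> norm (div_of (Z' x)) <= B"
  using bounded_on_closure [OF dc] by blast
 define d where "d = sqrt (m / 2) / 2"
 have d: "0 < d" using m by (simp add: d_def)
 interpret finite_measure "leb Om" using finite_measure_leb [OF bounded_Om sets_Om] .
 have "integral\<^sup>L (leb Om) (\<lambda>x. step' (- z x / s) / s) <= 2 / m * (B * measure (leb Om) Om)" if s: "0 < s" "s <= d" for s
 proof -
  have Zc: "continuous_on (closure Om) (\<lambda>x. Z' x h)" for h by (intro continuous_on_subset [OF Z'_cont]) auto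
  have c1: "integral\<^sup>L (leb Om) (\<lambda>x. step (- z x / s) * div_of (Z' x)) =
   integral\<^sup>L (leb Om) (\<lambda>x. step' (- z x / s) / s * (Z x \<bullet> Z x))"
   by (rule cutoff_identity [OF Z_deriv Zc s(1) Z_cont])
  have sc: "continuous_on (closure Om) (\<lambda>x. step' (- z x / s) / s)"
   using s by (intro continuous_intros continuous_on_compose2 [OF step'_continuous [of UNIV]] z_cont) auto
  have pw: "step' (- z x / s) / s <= 2 / m * (step' (- z x / s) / s * (Z x \<bullet> Z x))" if x: "x \<in> Om" for x
  proof (cases "2 <= - z x / s")
   case True then show ?thesis by (simp add: step_le)
  next
   case False
   then have "- z x < 2 * s" using s by (simp add: field_simps)
   then have "\<bar>z x\<bar> <= sqrt (m/2)" using x s by (auto simp: Om_eq d_def)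
   then have "\<bar>z x\<bar>\<^sup>2 <= (sqrt (m/2))\<^sup>2" by (rule power_mono) simp
   then have "(z x)\<^sup>2 <= m/2" using m by simp
   then have "m / 2 <= Z x \<bullet> Z x"
    using m(1) m(2) [of x] x closure_subset by (force simp: power2_norm_eq_inner)
   then have "step' (- z x / s) / s * (m/2) <= step' (- z x / s) / s * (Z x \<bullet> Z x)"
    using s step_le by (intro mult_left_mono) auto
   moreover have "a * (m/2) <= b ==> a <= 2 / m * b" for a b using m by (simp add: field_simps)
   ultimately show ?thesis by blast
  qed
  have "integral\<^sup>L (leb Om) (\<lambda>x. step' (- z x / s) / s) <= integral\<^sup>L (leb Om) (\<lambda>x. 2 / m * (step' (- z x / s) / s * (Z x \<bullet> Z x)))"
   by (intro integral_mono integrable_cont continuous_intros sc Z_cont) (use pw in simp)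
  also have "\<dots> = 2 / m * integral\<^sup>L (leb Om) (\<lambda>x. step (- z x / s) * div_of (Z' x))"
   using c1 by simp
  also have "integral\<^sup>L (leb Om) (\<lambda>x. step (- z x / s) * div_of (Z' x)) <= integral\<^sup>L (leb Om) (\<lambda>x. B)"
  proof (rule integral_mono_AE')
   show "AE x in leb Om. step (- z x / s) * div_of (Z' x) <= B"
   proof (rule AE_I2)
    fix x assume "x \<in> space (leb Om)"
    then have "\<bar>div_of (Z' x)\<bar> <= B" using B closure_subset by auto
    then have "step (- z x / s) * div_of (Z' x) <= 1 * B"
     using step_le B by (intro order_trans [OF mult_left_mono mult_right_mono]) auto
    then show "step (- z x / s) * div_of (Z' x) <= B" by simp
   qed
  qed (use B in auto)
  also have "\<dots> = B * measure (leb Om) Om" by (simp add: mult.commute)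
  finally show ?thesis using m by (simp add: divide_le_cancel)
 qed
 then show ?thesis using d that by blast
qed

text \<open>The cutoff in the defining function produces the error \<open>step' (- z x / s) / s * (Z x \<bullet> V x)\<close>, in which the first factor has
  bounded integral by \<open>layer_bound\<close> and the second one tends to 0 uniformly on the layer.\<close>

theorem no_flux:
 assumes V: "\<And>x. x \<in> Om ==> (V has_derivative V' x) (at x)"
  and c: "\<And>h. continuous_on (closure Om) (\<lambda>x. V' x h)" and cV: "continuous_on (closure Om) V"
  and tangential: "\<And>x. x \<in> frontier Om ==> V x \<bullet> Z x = 0"
 shows "integral\<^sup>L (leb Om) (\<lambda>x. div_of (V' x)) = 0"
proof -
 let ?I = "integral\<^sup>L (leb Om) (\<lambda>x. div_of (V' x))"
 let ?s = "\<lambda>n. 1 / real (Suc n)"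
 have s0: "?s \<longlonglongrightarrow> 0" using LIMSEQ_inverse_real_of_nat by (simp add: inverse_eq_divide)
 have lim: "(\<lambda>n. integral\<^sup>L (leb Om) (\<lambda>x. step (- z x / ?s n) * div_of (V' x))) \<longlonglongrightarrow> ?I"
 proof (rule integral_dominated_convergence [where w = "\<lambda>x. \<bar>div_of (V' x)\<bar>"])
  show "AE x in leb Om. (\<lambda>n. step (- z x / ?s n) * div_of (V' x)) \<longlonglongrightarrow> div_of (V' x)"
  proof (rule AE_I2)
   fix x assume "x \<in> space (leb Om)"
   then have zx: "z x < 0" by (simp add: Om_eq)
   obtain N :: nat where N: "2 / - z x <= real N" using real_arch_simple by blast
   have "step (- z x / ?s n) * div_of (V' x) = div_of (V' x)" if "N <= n" for n
   proof -
    have "2 / - z x <= real (Suc n)" using N that by simp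
    then have "2 <= - z x / ?s n" using zx by (simp add: field_simps)
    then show ?thesis by (simp add: step_le)
   qed
   then show "(\<lambda>n. step (- z x / ?s n) * div_of (V' x)) \<longlonglongrightarrow> div_of (V' x)"
    by (intro tendsto_eventually) (auto simp: eventually_sequentially)
  qed
  show "AE x in leb Om. norm (step (- z x / ?s n) * div_of (V' x)) <= \<bar>div_of (V' x)\<bar>" for n
  proof (rule AE_I2)
   fix x
   have "\<bar>step (- z x / ?s n)\<bar> <= 1" using step_le(6,7) [of "- z x / ?s n"] by simp
   then show "norm (step (- z x / ?s n) * div_of (V' x)) <= \<bar>div_of (V' x)\<bar>"
    unfolding real_norm_def abs_mult by (intro mult_left_le_one_le) auto
  qed
  show "(\<lambda>x. step (- z x / ?s n) * div_of (V' x)) \<in> borel_measurable (leb Om)" for n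
  proof (intro continuous_on_borel_measurable_leb continuous_intros div_of_cont closure_cont c)
   have "continuous_on UNIV step" by (meson step_deriv DERIV_isCont continuous_at_imp_continuous_on)
   then show "continuous_on (closure Om) (\<lambda>x. step (- z x / ?s n))"
    by (rule continuous_on_compose2) (auto intro!: continuous_intros z_cont)
  qed
 qed (use integrable_cont [OF div_of_cont [OF c]] in auto)
 obtain C d where C: "0 < d" "\<And>s. 0 < s ==> s <= d ==> integral\<^sup>L (leb Om) (\<lambda>x. step' (- z x / s) / s) <= C"
  using layer_bound by blast
 have "\<bar>?I\<bar> <= e * max C 0" if e: "0 < e" for e
 proof -
  have "continuous_on (closure Om) (\<lambda>x. Z x \<bullet> V x)" by (intro continuous_intros Z_cont cV)
  then obtain r where r: "0 < r" "\<And>x. x \<in> closure Om ==> - r < z x ==> \<bar>Z x \<bullet> V x\<bar> < e"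
   using small_near_frontier [of "\<lambda>x. Z x \<bullet> V x" e] tangential e by (auto simp: inner_commute)
  have "eventually (\<lambda>n. ?s n < min d (r/2)) sequentially"
   using order_tendstoD(2) [OF s0, of "min d (r/2)"] C r by auto
  then have "eventually (\<lambda>n. \<bar>integral\<^sup>L (leb Om) (\<lambda>x. step (- z x / ?s n) * div_of (V' x))\<bar> <= e * max C 0) sequentially"
  proof (rule eventually_mono)
   fix n assume n: "?s n < min d (r/2)"
   define s where "s = ?s n"
   have s: "0 < s" "s <= d" "2 * s < r" using n by (auto simp: s_def)
   have cst: "continuous_on (closure Om) (\<lambda>x. step' (- z x / s) / s)"
    using s by (intro continuous_intros continuous_on_compose2 [OF step'_continuous [of UNIV]] z_cont) auto
   have "\<bar>integral\<^sup>L (leb Om) (\<lambda>x. step' (- z x / s) / s * (Z x \<bullet> V x))\<bar> <=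
     integral\<^sup>L (leb Om) (\<lambda>x. norm (step' (- z x / s) / s * (Z x \<bullet> V x)))"
    using integral_norm_bound [of "leb Om" "\<lambda>x. step' (- z x / s) / s * (Z x \<bullet> V x)"] by simp
   also have "\<dots> <= integral\<^sup>L (leb Om) (\<lambda>x. e * (step' (- z x / s) / s))"
   proof (rule integral_mono)
    fix x assume x: "x \<in> space (leb Om)"
    show "norm (step' (- z x / s) / s * (Z x \<bullet> V x)) <= e * (step' (- z x / s) / s)"
    proof (cases "2 <= - z x / s")
     case True then show ?thesis by (simp add: step_le)
    next
     case False
     then have "- r < z x" using s by (simp add: field_simps)
     then have "\<bar>Z x \<bullet> V x\<bar> <= e" using r(2) [of x] x closure_subset by force
     moreover have "0 <= step' (- z x / s) / s" using s step_le by simp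
     ultimately have "\<bar>Z x \<bullet> V x\<bar> * (step' (- z x / s) / s) <= e * (step' (- z x / s) / s)"
      by (intro mult_right_mono)
     moreover have "norm (step' (- z x / s) / s * (Z x \<bullet> V x)) = \<bar>Z x \<bullet> V x\<bar> * (step' (- z x / s) / s)"
      using abs_of_nonneg [OF \<open>0 <= step' (- z x / s) / s\<close>] by (simp only: real_norm_def abs_mult mult.commute)
     ultimately show ?thesis by simp
    qed
   qed (intro integrable_cont continuous_intros cst Z_cont cV)+
   also have "\<dots> = e * integral\<^sup>L (leb Om) (\<lambda>x. step' (- z x / s) / s)" by simp
   also have "\<dots> <= e * max C 0" using C(2) [OF s(1,2)] e by (intro mult_left_mono) auto
   finally show "\<bar>integral\<^sup>L (leb Om) (\<lambda>x. step (- z x / ?s n) * div_of (V' x))\<bar> <= e * max C 0"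
    using cutoff_identity [OF V c s(1) cV] by (simp add: s_def)
  qed
  then show ?thesis
   using tendsto_rabs [OF lim] by (intro tendsto_upperbound [of "\<lambda>n. \<bar>integral\<^sup>L (leb Om) (\<lambda>x. step (- z x / ?s n) * div_of (V' x))\<bar>"]) auto
 qed
 note small = this
 show ?thesis
 proof (rule ccontr)
  assume "?I \<noteq> 0"
  then have "\<bar>?I\<bar> <= (\<bar>?I\<bar> / (2 * (max C 0 + 1))) * max C 0" by (intro small) auto
  also have "\<dots> <= (\<bar>?I\<bar> / (2 * (max C 0 + 1))) * (max C 0 + 1)" by (intro mult_left_mono) auto
  also have "\<dots> = \<bar>?I\<bar> / 2"
  proof -
   have "a / (2 * b) * b = a / 2" if "0 < b" for a b :: real using that by simp
   note half = this
   show ?thesis by (rule half) simp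
  qed
  finally show False using \<open>?I \<noteq> 0\<close> by simp
 qed
qed

end

section \<open>A global defining function\<close>

lemma has_derivative_gradient_on:
 assumes "f differentiable_on S" "x \<in> S"
 shows "(f has_derivative (\<lambda>h. gradient_on S f x \<bullet> h)) (at x within S)"
proof -
 let ?D = "frechet_derivative f (at x within S)"
 have D: "(f has_derivative ?D) (at x within S)"
  using assms by (intro frechet_derivative_works [THEN iffD1]) (simp add: differentiable_on_def)
 have lin: "linear ?D" using has_derivative_linear [OF D] .
 have "?D h = gradient_on S f x \<bullet> h" for h
 proof -
  have "?D h = ?D (\<Sum>b\<in>Basis. (h \<bullet> b) *\<^sub>R b)" by (simp add: euclidean_representation)
  also have "\<dots> = (\<Sum>b\<in>Basis. (h \<bullet> b) * ?D b)" using lin by (simp add: linear_sum linear_cmul)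
  also have "\<dots> = gradient_on S f x \<bullet> h"
   by (simp add: gradient_on_def inner_sum_left inner_sum_right inner_commute mult.commute)
  finally show ?thesis .
 qed
 then have "?D = (\<lambda>h. gradient_on S f x \<bullet> h)" by (rule ext)
 with D show ?thesis by (simp only:)
qed

definition C2_on :: "('a::euclidean_space => real) => ('a => 'a) => ('a => 'a => 'a) => 'a set => bool" where
 "C2_on f G H S \<longleftrightarrow> (\<forall>x\<in>S. (f has_derivative (\<lambda>h. G x \<bullet> h)) (at x)) \<and>
   (\<forall>x\<in>S. (G has_derivative H x) (at x)) \<and> (\<forall>h. continuous_on S (\<lambda>x. H x h))"

lemma C2_onD:
 assumes "C2_on f G H S"
 shows "\<And>x. x \<in> S ==> (f has_derivative (\<lambda>h. G x \<bullet> h)) (at x)" "\<And>x. x \<in> S ==> (G has_derivative H x) (at x)"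
  "\<And>h. continuous_on S (\<lambda>x. H x h)" "continuous_on S f" "continuous_on S G"
proof -
 show 1: "\<And>x. x \<in> S ==> (f has_derivative (\<lambda>h. G x \<bullet> h)) (at x)" "\<And>x. x \<in> S ==> (G has_derivative H x) (at x)"
  "\<And>h. continuous_on S (\<lambda>x. H x h)" using assms by (auto simp: C2_on_def)
 show "continuous_on S f" "continuous_on S G"
  using has_derivative_continuous [OF 1(1)] has_derivative_continuous [OF 1(2)]
  by (intro continuous_at_imp_continuous_on ballI; blast)+
qed

lemma Ck_on_SucD:
 assumes "Ck_on (Suc k) f S"
 shows "f differentiable_on S" "\<And>b. b \<in> Basis ==> Ck_on k (\<lambda>x. frechet_derivative f (at x within S) b) S"
 using assms by (simp_all only: Ck_on.simps)

lemma Ck_on_2_C2_on: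
 fixes f :: "'a::euclidean_space => real"
 assumes S: "open S" and f: "Ck_on (Suc (Suc 0)) f S"
 obtains H where "C2_on f (gradient_on S f) H S"
proof -
 define D where "D b = (\<lambda>x. frechet_derivative f (at x within S) b)" for b
 have f0: "f differentiable_on S" and Db: "\<And>b. b \<in> Basis ==> Ck_on (Suc 0) (D b) S"
  using Ck_on_SucD [OF f] unfolding D_def by blast+
 have at: "at x within S = at x" if "x \<in> S" for x using that S by (rule at_within_open)
 have D1: "D b differentiable_on S" and D2: "\<And>c. c \<in> Basis ==> continuous_on S (\<lambda>x. frechet_derivative (D b) (at x within S) c)"
  if "b \<in> Basis" for b
  using Ck_on_SucD [OF Db [OF that]] by (simp_all only: Ck_on.simps)
 have D': "(D b has_derivative (\<lambda>h. gradient_on S (D b) x \<bullet> h)) (at x)" if x: "x \<in> S" and b: "b \<in> Basis" for x b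
  using has_derivative_gradient_on [OF D1 [OF b] x] unfolding at [OF x] .
 have c: "continuous_on S (gradient_on S (D b))" if b: "b \<in> Basis" for b
 proof -
  have "continuous_on S (\<lambda>x. \<Sum>c\<in>Basis. frechet_derivative (D b) (at x within S) c *\<^sub>R c)"
   by (intro continuous_on_sum continuous_on_scaleR D2 [OF b] continuous_on_const)
  then show ?thesis by (simp add: gradient_on_def [abs_def])
 qed
 have G: "gradient_on S f = (\<lambda>x. \<Sum>b\<in>Basis. D b x *\<^sub>R b)" by (simp add: fun_eq_iff gradient_on_def D_def)
 define H where "H x h = (\<Sum>b\<in>Basis. (gradient_on S (D b) x \<bullet> h) *\<^sub>R b)" for x h
 have "C2_on f (gradient_on S f) H S"
  unfolding C2_on_def
 proof (intro conjI ballI allI)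
  fix x assume x: "x \<in> S"
  show "(f has_derivative (\<lambda>h. gradient_on S f x \<bullet> h)) (at x)"
   using has_derivative_gradient_on [OF f0 x] at [OF x] by simp
  show "(gradient_on S f has_derivative H x) (at x)"
   unfolding G H_def by (intro has_derivative_sum has_derivative_scaleR_left D' x)
 next
  show "continuous_on S (\<lambda>x. H x h)" for h
   unfolding H_def by (intro continuous_intros c)
 qed
 then show ?thesis using that by blast
qed

lemma C2_on_const: "C2_on (\<lambda>_. c) (\<lambda>_. 0) (\<lambda>_ _. 0) S"
 by (auto simp: C2_on_def)

lemma C2_on_add:
 assumes "C2_on f G H S" "C2_on f' G' H' S"
 shows "C2_on (\<lambda>x. f x + f' x) (\<lambda>x. G x + G' x) (\<lambda>x h. H x h + H' x h) S"
 using assms by (auto simp: C2_on_def inner_add_left intro!: has_derivative_add continuous_intros)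

lemma C2_on_sum:
 assumes "finite I" "\<And>i. i \<in> I ==> \<exists>G H. C2_on (f i) G H S"
 shows "\<exists>G H. C2_on (\<lambda>x. \<Sum>i\<in>I. f i x) G H S"
 using assms
proof (induction I)
 case empty
 have "C2_on (\<lambda>x. \<Sum>i\<in>{}. f i x) (\<lambda>_. 0) (\<lambda>_ _. 0) S" using C2_on_const [of 0 S] by simp
 then show ?case by blast
next
 case (insert i I)
 obtain G H where 1: "C2_on (f i) G H S" using insert.prems by blast
 obtain G' H' where 2: "C2_on (\<lambda>x. \<Sum>i\<in>I. f i x) G' H' S" using insert by blast
 have "(\<lambda>x. \<Sum>i\<in>insert i I. f i x) = (\<lambda>x. f i x + (\<Sum>i\<in>I. f i x))" using insert.hyps by simp
 with C2_on_add [OF 1 2] show ?case by auto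
qed

lemma C2_on_mult:
 assumes f: "C2_on f G H S" and g: "C2_on f' G' H' S"
 shows "C2_on (\<lambda>x. f x * f' x) (\<lambda>x. f x *\<^sub>R G' x + f' x *\<^sub>R G x)
  (\<lambda>x h. (f x *\<^sub>R H' x h + (G x \<bullet> h) *\<^sub>R G' x) + (f' x *\<^sub>R H x h + (G' x \<bullet> h) *\<^sub>R G x)) S"
 unfolding C2_on_def
proof (intro conjI ballI allI)
 fix x assume x: "x \<in> S"
 show "((\<lambda>x. f x * f' x) has_derivative (\<lambda>h. (f x *\<^sub>R G' x + f' x *\<^sub>R G x) \<bullet> h)) (at x)"
  using has_derivative_mult [OF C2_onD(1) [OF f x] C2_onD(1) [OF g x]]
  by (simp add: inner_add_left mult.commute)
 show "((\<lambda>x. f x *\<^sub>R G' x + f' x *\<^sub>R G x) has_derivative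
  (\<lambda>h. (f x *\<^sub>R H' x h + (G x \<bullet> h) *\<^sub>R G' x) + (f' x *\<^sub>R H x h + (G' x \<bullet> h) *\<^sub>R G x))) (at x)"
  by (intro has_derivative_add has_derivative_scaleR C2_onD(1,2) [OF f x] C2_onD(1,2) [OF g x])
next
 show "continuous_on S (\<lambda>x. (f x *\<^sub>R H' x h + (G x \<bullet> h) *\<^sub>R G' x) + (f' x *\<^sub>R H x h + (G' x \<bullet> h) *\<^sub>R G x))" for h
  by (intro continuous_intros C2_onD(3-5) [OF f] C2_onD(3-5) [OF g])
qed

definition pcube :: "real => real" where "pcube y = (max 0 y) ^ 3"

lemma pcube_deriv: "(pcube has_real_derivative 3 * psq y) (at y)"
proof -
 have "pcube = (\<lambda>y. psq y * y)" by (auto simp: fun_eq_iff pcube_def psq_def power3_eq_cube power2_eq_square max_def)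
 moreover have "((\<lambda>y. psq y * y) has_real_derivative 3 * psq y) (at y)"
 proof -
  have "2 * max 0 y * y + 1 * psq y = 3 * psq y" by (auto simp: psq_def power2_eq_square max_def)
  with DERIV_mult [OF psq_deriv DERIV_ident, of y] show ?thesis by (simp only:)
 qed
 ultimately show ?thesis by simp
qed

lemma C2_on_pcube:
 assumes w: "C2_on w G H S"
 shows "C2_on (\<lambda>x. pcube (w x)) (\<lambda>x. (3 * psq (w x)) *\<^sub>R G x)
  (\<lambda>x h. (3 * psq (w x)) *\<^sub>R H x h + (3 * (2 * max 0 (w x) * (G x \<bullet> h))) *\<^sub>R G x) S"
 unfolding C2_on_def
proof (intro conjI ballI allI)
 fix x assume x: "x \<in> S"
 show "((\<lambda>x. pcube (w x)) has_derivative (\<lambda>h. (3 * psq (w x)) *\<^sub>R G x \<bullet> h)) (at x)"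
  using has_derivative_compose [OF C2_onD(1) [OF w x] pcube_deriv [unfolded has_field_derivative_def]]
  by simp
 have "((\<lambda>x. psq (w x)) has_derivative (\<lambda>h. 2 * max 0 (w x) * (G x \<bullet> h))) (at x)"
  using has_derivative_compose [OF C2_onD(1) [OF w x] psq_deriv [unfolded has_field_derivative_def]] .
 then have "((\<lambda>x. 3 * psq (w x)) has_derivative (\<lambda>h. 3 * (2 * max 0 (w x) * (G x \<bullet> h)))) (at x)"
  by (rule has_derivative_mult_right)
 then show "((\<lambda>x. (3 * psq (w x)) *\<^sub>R G x) has_derivative
  (\<lambda>h. (3 * psq (w x)) *\<^sub>R H x h + (3 * (2 * max 0 (w x) * (G x \<bullet> h))) *\<^sub>R G x)) (at x)"
  by (intro has_derivative_scaleR C2_onD(2) [OF w x])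
next
 show "continuous_on S (\<lambda>x. (3 * psq (w x)) *\<^sub>R H x h + (3 * (2 * max 0 (w x) * (G x \<bullet> h))) *\<^sub>R G x)" for h
  by (intro continuous_intros continuous_on_compose2 [OF psq_continuous [of UNIV]] C2_onD(3-5) [OF w]) auto
qed

lemma C2_on_radial: "\<exists>G H. C2_on (\<lambda>x::'a::euclidean_space. pcube (r - (norm (x - p))\<^sup>2)) G H S"
proof -
 have "C2_on (\<lambda>x::'a. r - (norm (x - p))\<^sup>2) (\<lambda>x. - 2 *\<^sub>R (x - p)) (\<lambda>x h. - 2 *\<^sub>R h) S"
  unfolding C2_on_def power2_norm_eq_inner
  by (auto intro!: derivative_eq_intros continuous_intros simp: inner_commute algebra_simps)
 from C2_on_pcube [OF this] show ?thesis by blast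
qed

lemma C2_on_glue:
 assumes f: "C2_on f G H S" "C2_on g G' H' T" and ST: "open S" "open T" "S \<union> T = UNIV"
  and eq: "\<And>x. x \<in> S ==> x \<in> T ==> f x = g x"
 shows "\<exists>G H. C2_on (\<lambda>x. if x \<in> S then f x else g x) G H UNIV"
proof -
 let ?f = "\<lambda>x. if x \<in> S then f x else g x" and ?G = "\<lambda>x. if x \<in> S then G x else G' x"
 let ?H = "\<lambda>x. if x \<in> S then H x else H' x"
 have op: "open (S \<inter> T)" using ST by auto
 have G: "G x = G' x" if x: "x \<in> S \<inter> T" for x
 proof -
  have "(f has_derivative (\<lambda>h. G' x \<bullet> h)) (at x)"
   by (rule has_derivative_transform_within_open [OF C2_onD(1) [OF f(2)] op x]) (use x eq in auto)
  from has_derivative_unique [OF this C2_onD(1) [OF f(1), of x]] x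
  have "(\<lambda>h. G' x \<bullet> h) = (\<lambda>h. G x \<bullet> h)" by auto
  from fun_cong [OF this, of "G' x - G x"] have "(G' x - G x) \<bullet> (G' x - G x) = 0" by (simp add: inner_diff_left)
  then show ?thesis by simp
 qed
 have H: "H x = H' x" if x: "x \<in> S \<inter> T" for x
 proof -
  have "(G has_derivative H' x) (at x)"
   by (rule has_derivative_transform_within_open [OF C2_onD(2) [OF f(2)] op x]) (use x G in auto)
  from has_derivative_unique [OF this C2_onD(2) [OF f(1), of x]] x show ?thesis by auto
 qed
 have fT: "?f x = g x" "?G x = G' x" "?H x = H' x" if "x \<in> T" for x using that eq G H by auto
 have "C2_on ?f ?G ?H UNIV"
  unfolding C2_on_def
 proof (intro conjI ballI allI)
  fix x
  show "(?f has_derivative (\<lambda>h. ?G x \<bullet> h)) (at x)"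
  proof (cases "x \<in> S")
   case True
   then show ?thesis using has_derivative_transform_within_open [OF C2_onD(1) [OF f(1) True] ST(1) True, of ?f] by simp
  next
   case False
   then have "x \<in> T" using ST by auto
   then show ?thesis using has_derivative_transform_within_open [OF C2_onD(1) [OF f(2)] ST(2), of x ?f] fT False by simp
  qed
  show "(?G has_derivative ?H x) (at x)"
  proof (cases "x \<in> S")
   case True
   then show ?thesis using has_derivative_transform_within_open [OF C2_onD(2) [OF f(1) True] ST(1) True, of ?G] by simp
  next
   case False
   then have "x \<in> T" using ST by auto
   then show ?thesis using has_derivative_transform_within_open [OF C2_onD(2) [OF f(2)] ST(2), of x ?G] fT False by simp
  qed
 next
  fix h
  have "continuous_on S (\<lambda>x. ?H x h)" using C2_onD(3) [OF f(1)] by (rule continuous_on_eq) auto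
  moreover have "continuous_on T (\<lambda>x. ?H x h)" using C2_onD(3) [OF f(2)] by (rule continuous_on_eq) (simp add: fT)
  ultimately have "continuous_on (S \<union> T) (\<lambda>x. ?H x h)" using ST by (intro continuous_on_open_Un)
  then show "continuous_on UNIV (\<lambda>x. ?H x h)" using ST by simp
 qed
 then show ?thesis by blast
qed

lemma derivative_neg_eventually:
 assumes "(f has_derivative (\<lambda>h. g \<bullet> h)) (at x)" "g \<bullet> v < 0"
 shows "eventually (\<lambda>s. f (x + s *\<^sub>R v) < f x + s * (g \<bullet> v) / 2) (at_right (0::real))"
proof -
 have "((\<lambda>s. f (x + s *\<^sub>R v)) has_vector_derivative g \<bullet> v) (at 0)"
  using assms(1) by (intro has_derivative_line) simp
 then have "((\<lambda>s. f (x + s *\<^sub>R v)) has_real_derivative g \<bullet> v) (at 0)"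
  by (simp add: has_real_derivative_iff_has_vector_derivative)
 then have "((\<lambda>s. (f (x + s *\<^sub>R v) - f x) / s) \<longlongrightarrow> g \<bullet> v) (at_right 0)"
  by (auto simp: has_field_derivative_iff intro: filterlim_mono [OF _ order_refl at_le])
 then have "eventually (\<lambda>s. (f (x + s *\<^sub>R v) - f x) / s < (g \<bullet> v) / 2) (at_right 0)"
  using assms(2) by (intro order_tendstoD(2)) auto
 moreover have "eventually (\<lambda>s. s > (0::real)) (at_right 0)" by (rule eventually_at_right_less)
 ultimately show ?thesis
  by eventually_elim (simp add: field_simps)
qed

lemma local_defining_functionD:
 assumes "local_defining_function Om p U \<phi>"
 shows "open U" "p \<in> U" "Ck_on k \<phi> U" "y \<in> U ==> gradient_on U \<phi> y \<noteq> 0"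
  "y \<in> U ==> y \<in> Om \<longleftrightarrow> \<phi> y < 0"
  "y \<in> U ==> (\<phi> has_derivative (\<lambda>h. gradient_on U \<phi> y \<bullet> h)) (at y)"
proof -
 have a: "open U" "p \<in> U" "smooth_on \<phi> U" "\<forall>x\<in>U. gradient_on U \<phi> x \<noteq> 0" "Om \<inter> U = {x \<in> U. \<phi> x < 0}"
  using assms unfolding local_defining_function_def by blast+
 show "open U" "p \<in> U" "Ck_on k \<phi> U" "y \<in> U ==> gradient_on U \<phi> y \<noteq> 0"
  "y \<in> U ==> y \<in> Om \<longleftrightarrow> \<phi> y < 0" using a unfolding smooth_on_def by blast+
 assume y: "y \<in> U"
 have "Ck_on (Suc 0) \<phi> U" using a(3) unfolding smooth_on_def by blast
 from has_derivative_gradient_on [OF Ck_on_SucD(1) [OF this] y] at_within_open [OF y a(1)]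
 show "(\<phi> has_derivative (\<lambda>h. gradient_on U \<phi> y \<bullet> h)) (at y)" by (simp only:)
qed

lemma local_defining_function_frontier:
 assumes "local_defining_function Om p U \<phi>" "x \<in> frontier Om" "x \<in> U" "open Om"
 shows "\<phi> x = 0"
proof -
 note D = local_defining_functionD [OF assms(1)]
 have U: "open U" and lt: "\<And>y. y \<in> U ==> y \<in> Om \<longleftrightarrow> \<phi> y < 0" by (fact D)+
 have "continuous_on U \<phi>"
  using has_derivative_continuous [OF D(6)] by (intro continuous_at_imp_continuous_on) blast
 then have oT: "open (U \<inter> \<phi> -` {0<..})" using U by (intro continuous_open_preimage) auto
 have "x \<notin> Om" "x \<in> closure Om" using assms(2,4) by (auto simp: frontier_def interior_open)
 then have "0 <= \<phi> x" using lt assms(3) by (auto simp: not_less [symmetric])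
 moreover have "\<not> 0 < \<phi> x"
 proof
  assume "0 < \<phi> x"
  then have "U \<inter> \<phi> -` {0<..} \<inter> closure Om \<noteq> {}" using assms(3) \<open>x \<in> closure Om\<close> by auto
  then have "U \<inter> \<phi> -` {0<..} \<inter> Om \<noteq> {}" using open_Int_closure_eq_empty [OF oT] by simp
  then show False using lt by force
 qed
 ultimately show ?thesis by simp
qed

text \<open>The local defining functions are glued with bump functions \<open>max 0 (r - (norm (x - p))\<^sup>2) ^ 3\<close>. Interior points contribute
  negative and exterior points positive bumps. At a boundary point only boundary charts contribute to the gradient of the sum, and
  each of their gradients is a positive multiple of the outer normal; hence the gradient does not vanish there, and the Neumann
  condition makes the gradient of \<open>f\<close> orthogonal to it.\<close>

theorem smooth_bounded_domain_C2_domain: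
 fixes Om :: "'a::euclidean_space set"
 assumes dom: "smooth_bounded_domain Om"
 obtains z Z Z' where "C2_domain Om z Z Z'"
  "\<And>f p. neumann_condition Om f ==> p \<in> frontier Om ==> gradient_on (closure Om) f p \<bullet> Z p = 0"
proof -
 have op: "open Om" and bd: "bounded Om" and ne: "Om \<noteq> {}"
  and loc: "\<And>p. p \<in> frontier Om ==> \<exists>U \<phi>. local_defining_function Om p U \<phi>"
  using dom by (auto simp: smooth_bounded_domain_def)
 define ok where "ok p U \<phi> \<longleftrightarrow> open U \<and> p \<in> U \<and> (\<exists>G H. C2_on \<phi> G H U) \<and> Om \<inter> U = {x \<in> U. \<phi> x < 0} \<and>
   (\<forall>x\<in>frontier Om \<inter> U. local_defining_function Om p U \<phi>)" for p U and \<phi> :: "'a => real"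
 have "\<exists>U \<phi>. ok p U \<phi>" if "p \<in> closure Om" for p
 proof (cases "p \<in> Om")
  case True
  have "ok p Om (\<lambda>_. - 1)" using True op C2_on_const [of "- 1" Om]
   by (auto simp: ok_def frontier_def interior_open)
  then show ?thesis by blast
 next
  case False
  then have "p \<in> frontier Om" using that op by (auto simp: frontier_def interior_open)
  then obtain U \<phi> where l: "local_defining_function Om p U \<phi>" using loc by blast
  then have "open U" "Ck_on (Suc (Suc 0)) \<phi> U" unfolding local_defining_function_def smooth_on_def by blast+
  then have "\<exists>G H. C2_on \<phi> G H U" using Ck_on_2_C2_on by blast
  then have "ok p U \<phi>" using l by (auto simp: ok_def local_defining_function_def)
  then show ?thesis by blast
 qed
 then obtain U \<phi> where ok: "\<And>p. p \<in> closure Om ==> ok p (U p) (\<phi> p)" by metis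
 have "\<exists>r>0. cball p r \<subseteq> U p" if "p \<in> closure Om" for p
  using ok [OF that] open_contains_cball unfolding ok_def by blast
 then obtain r where r: "\<And>p. p \<in> closure Om ==> 0 < r p \<and> cball p (r p) \<subseteq> U p" by metis
 have cpt: "compact (closure Om)" using bd by simp
 have cov0: "closure Om \<subseteq> (\<Union>p\<in>closure Om. ball p (r p))" using r by (intro subsetI UN_I) auto
 obtain P where P: "P \<subseteq> closure Om" "finite P" "closure Om \<subseteq> (\<Union>p\<in>P. ball p (r p))"
  by (rule compactE_image [OF cpt _ cov0]) (use open_ball that in blast)+
 define bump where "bump p x = pcube ((r p)\<^sup>2 - (norm (x - p))\<^sup>2)" for p x
 define \<theta> where "\<theta> p x = (if x \<in> U p then bump p x * \<phi> p x else 0)" for p x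
 define z where "z x = (\<Sum>p\<in>P. \<theta> p x)" for x
 have chi0: "0 <= bump p x" for p x by (simp add: bump_def pcube_def)
 have chi_out: "bump p x = 0" if "p \<in> P" "x \<notin> cball p (r p)" for p x
 proof -
  have "r p < norm (x - p)" "0 < r p" using that r P by (auto simp: dist_norm norm_minus_commute)
  then have "(r p)\<^sup>2 < (norm (x - p))\<^sup>2" by (intro power_strict_mono) auto
  then show ?thesis by (simp add: bump_def pcube_def)
 qed
 have chi_in: "0 < bump p x" if "p \<in> P" "x \<in> ball p (r p)" for p x
 proof -
  have "(norm (x - p))\<^sup>2 < (r p)\<^sup>2" using that by (intro power_strict_mono) (auto simp: dist_norm norm_minus_commute)
  then show ?thesis by (simp add: bump_def pcube_def)
 qed
 have theta_C2: "\<exists>G H. C2_on (\<theta> p) G H UNIV" if p: "p \<in> P" for p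
 proof -
  obtain G H where 1: "C2_on (\<phi> p) G H (U p)" and oU: "open (U p)" using ok [of p] P p by (auto simp: ok_def)
  obtain G' H' where 2: "C2_on (bump p) G' H' (U p)" unfolding bump_def using C2_on_radial by blast
  have "\<exists>G H. C2_on (\<lambda>x. if x \<in> U p then bump p x * \<phi> p x else 0) G H UNIV"
  proof (rule C2_on_glue [OF C2_on_mult [OF 2 1] C2_on_const oU])
   show "open (- cball p (r p))" by auto
   show "U p \<union> - cball p (r p) = UNIV" using r [of p] p P by auto
   show "bump p x * \<phi> p x = 0" if "x \<in> - cball p (r p)" for x using chi_out [OF p] that by simp
  qed
  then show ?thesis by (simp add: \<theta>_def [abs_def])
 qed
 obtain Z Z' where zC2: "C2_on z Z Z' UNIV"
  using C2_on_sum [OF P(2), of \<theta>] theta_C2 unfolding z_def by blast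
 have lt: "x \<in> Om \<longleftrightarrow> \<phi> p x < 0" if "p \<in> P" "x \<in> U p" for p x
  using ok [of p] P that by (auto simp: ok_def set_eq_iff)
 have theta_le: "\<theta> p x <= 0" if "p \<in> P" "x \<in> Om" for p x
  using lt [of p x] that chi0 [of p x] by (auto simp: \<theta>_def mult_nonneg_nonpos)
 have theta_ge: "0 <= \<theta> p x" if "p \<in> P" "x \<notin> Om" for p x
  using lt [of p x] that chi0 [of p x] by (auto simp: \<theta>_def)
 have cov: "\<exists>p\<in>P. x \<in> ball p (r p) \<and> x \<in> U p" if x: "x \<in> closure Om" for x
 proof -
  have "x \<in> (\<Union>p\<in>P. ball p (r p))" using subsetD [OF P(3) x] .
  then obtain p where "p \<in> P" "x \<in> ball p (r p)" by (elim UN_E)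
  then show ?thesis using r [of p] P(1) ball_subset_cball by blast
 qed
 have z_neg: "z x < 0" if x: "x \<in> Om" for x
 proof -
  obtain p where p: "p \<in> P" "x \<in> ball p (r p)" "x \<in> U p" using cov [of x] x closure_subset by blast
  have "\<theta> p x < 0" using chi_in [OF p(1,2)] lt [OF p(1,3)] x p by (simp add: \<theta>_def mult_pos_neg)
  moreover have "(\<Sum>q\<in>P - {p}. \<theta> q x) <= 0" using theta_le x by (intro sum_nonpos) auto
  ultimately show ?thesis unfolding z_def using P(2) p(1) by (subst sum.remove [of P p]) auto
 qed
 have z_pos: "0 <= z x" if "x \<notin> Om" for x
  unfolding z_def using theta_ge that by (intro sum_nonneg) auto
 have Om_eq: "Om = {x. z x < 0}" using z_neg z_pos by (auto simp: not_less [symmetric])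
 have z0: "z x = 0" if "x \<in> frontier Om" for x
 proof -
  have nx: "x \<notin> Om" using that op by (auto simp: frontier_def interior_open)
  have "\<theta> p x = 0" if p: "p \<in> P" for p
  proof (cases "x \<in> U p")
   case True
   then have "local_defining_function Om p (U p) (\<phi> p)" using ok [of p] P(1) p \<open>x \<in> frontier Om\<close> by (auto simp: ok_def)
   from local_defining_function_frontier [OF this \<open>x \<in> frontier Om\<close> True op] show ?thesis by (simp add: \<theta>_def)
  qed (simp add: \<theta>_def)
  then show ?thesis by (simp add: z_def)
 qed
 note z' = C2_onD(1) [OF zC2, simplified]
 have Zpos: "0 < Z x \<bullet> gradient_on (U p) (\<phi> p) x"
  if x: "x \<in> frontier Om" and p: "p \<in> P" "x \<in> ball p (r p)" "x \<in> U p" for x p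
 proof -
  have l: "local_defining_function Om p (U p) (\<phi> p)" using ok [of p] P(1) p x by (auto simp: ok_def)
  define w where "w = gradient_on (U p) (\<phi> p) x"
  note D = local_defining_functionD [OF l]
  have w0: "w \<noteq> 0" and oU: "open (U p)" unfolding w_def by (fact D(4) [OF p(3)] D(1))+
  have fd: "((\<phi> p) has_derivative (\<lambda>h. w \<bullet> h)) (at x)" unfolding w_def by (fact D(6) [OF p(3)])
  have f0: "\<phi> p x = 0" using local_defining_function_frontier [OF l x p(3) op] .
  define a where "a = bump p x / 2"
  have a0: "0 < a" using chi_in p by (simp add: a_def)
  have ev1: "eventually (\<lambda>s. \<phi> p (x + s *\<^sub>R (- w)) < \<phi> p x + s * (w \<bullet> (- w)) / 2) (at_right 0)"
   using w0 by (intro derivative_neg_eventually fd) simp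
  have lim: "((\<lambda>s. x + s *\<^sub>R (- w)) \<longlongrightarrow> x) (at_right 0)"
  proof -
   have "((\<lambda>s. x + s *\<^sub>R (- w)) \<longlongrightarrow> x + 0 *\<^sub>R (- w)) (at_right 0)" by (intro tendsto_intros)
   then show ?thesis by simp
  qed
  have cchi: "continuous_on UNIV (bump p)"
   unfolding bump_def pcube_def by (intro continuous_intros)
  have "((\<lambda>s. bump p (x + s *\<^sub>R (- w))) \<longlongrightarrow> bump p x) (at_right 0)"
   by (rule isCont_tendsto_compose [OF _ lim]) (use cchi in \<open>simp add: continuous_on_eq_continuous_at\<close>)
  then have ev2: "eventually (\<lambda>s. a < bump p (x + s *\<^sub>R (- w))) (at_right 0)"
   using a0 by (intro order_tendstoD(1)) (auto simp: a_def)
  have ev3: "eventually (\<lambda>s. x + s *\<^sub>R (- w) \<in> U p) (at_right 0)"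
   using topological_tendstoD [OF lim oU p(3)] .
  have ev4: "eventually (\<lambda>s. s > (0::real)) (at_right 0)" by (rule eventually_at_right_less)
  have ev: "eventually (\<lambda>s. (z (x + s *\<^sub>R (- w)) - z x) / s <= - a * (norm w)\<^sup>2 / 2) (at_right 0)"
   using ev1 ev2 ev3 ev4
  proof eventually_elim
   case (elim s)
   let ?y = "x + s *\<^sub>R (- w)"
   have 1: "\<phi> p ?y < - (s * (norm w)\<^sup>2 / 2)" using elim f0 by (simp add: power2_norm_eq_inner)
   moreover have "0 <= s * (norm w)\<^sup>2 / 2" using elim(4) by simp
   ultimately have "\<phi> p ?y < 0" by linarith
   then have y: "?y \<in> Om" using lt [OF p(1) elim(3)] by simp
   have "z ?y <= \<theta> p ?y"
   proof -
    have "(\<Sum>q\<in>P - {p}. \<theta> q ?y) <= 0" using theta_le y by (intro sum_nonpos) auto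
    then show ?thesis unfolding z_def using P(2) p(1) by (subst sum.remove [of P p]) auto
   qed
   also have "\<dots> = bump p ?y * \<phi> p ?y" using elim by (simp add: \<theta>_def)
   also have "\<dots> <= a * \<phi> p ?y" using elim(2) \<open>\<phi> p ?y < 0\<close> by (intro mult_right_mono_neg) auto
   also have "\<dots> <= a * (- (s * (norm w)\<^sup>2 / 2))" using 1 a0 by (intro mult_left_mono) auto
   finally show ?case using z0 [OF x] elim(4) by (simp add: pos_divide_le_eq mult_ac)
  qed
  have "((\<lambda>s. z (x + s *\<^sub>R (- w))) has_vector_derivative Z x \<bullet> (- w)) (at 0)"
   using z' by (intro has_derivative_line) simp
  then have "((\<lambda>s. (z (x + s *\<^sub>R (- w)) - z x) / s) \<longlongrightarrow> Z x \<bullet> (- w)) (at_right 0)"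
   by (auto simp: has_real_derivative_iff_has_vector_derivative [symmetric] has_field_derivative_iff intro: filterlim_mono [OF _ order_refl at_le])
  from tendsto_upperbound [OF this ev] have "Z x \<bullet> (- w) <= - a * (norm w)\<^sup>2 / 2" by simp
  moreover have "0 < a * (norm w)\<^sup>2 / 2" using a0 w0 by simp
  ultimately show ?thesis by (simp add: w_def)
 qed
 have dom2: "C2_domain Om z Z Z'"
 proof
  show "Z x \<noteq> 0" if "x \<in> frontier Om" for x
  proof -
   have "x \<in> closure Om" using that by (simp add: frontier_def)
   then obtain p where "p \<in> P" "x \<in> ball p (r p)" "x \<in> U p" using cov by blast
   from Zpos [OF that this] show ?thesis by auto
  qed
  show "open Om" "bounded Om" "Om \<noteq> {}" "Om = {x. z x < 0}" by (fact op bd ne Om_eq)+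
  show "\<And>x. (z has_derivative (\<lambda>h. Z x \<bullet> h)) (at x)" "\<And>x. (Z has_derivative Z' x) (at x)"
   "\<And>h. continuous_on UNIV (\<lambda>x. Z' x h)" using C2_onD(1-3) [OF zC2] by simp_all
 qed
 have "gradient_on (closure Om) f x \<bullet> Z x = 0" if N: "neumann_condition Om f" and x: "x \<in> frontier Om" for f x
 proof -
  obtain V \<psi> where l: "local_defining_function Om x V \<psi>" using loc x by blast
  define w where "w = gradient_on V \<psi> x"
  define g where "g = gradient_on (closure Om) f x"
  note D = local_defining_functionD [OF l]
  have oV: "open V" and xV: "x \<in> V" and ltV: "\<And>y. y \<in> V ==> y \<in> Om \<longleftrightarrow> \<psi> y < 0" by (fact D)+
  have w0: "w \<noteq> 0" unfolding w_def by (fact D(4) [OF xV])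
  have fd: "(\<psi> has_derivative (\<lambda>h. w \<bullet> h)) (at x)" unfolding w_def by (fact D(6) [OF xV])
  have f0: "\<psi> x = 0" using local_defining_function_frontier [OF l x xV op] .
  have "outer_unit_normal Om x (w /\<^sub>R norm w)"
   unfolding outer_unit_normal_def w_def using x l by blast
  then have "g \<bullet> (w /\<^sub>R norm w) = 0" using N unfolding neumann_condition_def g_def by blast
  then have gw: "g \<bullet> w = 0" using w0 by simp
  have half: "0 <= Z x \<bullet> v" if v: "0 < w \<bullet> v" for v
  proof -
   have ev1: "eventually (\<lambda>s. \<psi> (x + s *\<^sub>R (- v)) < \<psi> x + s * (w \<bullet> (- v)) / 2) (at_right 0)"
    using v by (intro derivative_neg_eventually fd) simp
   have "((\<lambda>s. x + s *\<^sub>R (- v)) \<longlongrightarrow> x + 0 *\<^sub>R (- v)) (at_right 0)" by (intro tendsto_intros)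
   then have lim: "((\<lambda>s. x + s *\<^sub>R (- v)) \<longlongrightarrow> x) (at_right 0)" by simp
   have ev3: "eventually (\<lambda>s. x + s *\<^sub>R (- v) \<in> V) (at_right 0)"
    using topological_tendstoD [OF lim oV xV] .
   have ev4: "eventually (\<lambda>s. s > (0::real)) (at_right 0)" by (rule eventually_at_right_less)
   have ev: "eventually (\<lambda>s. (z (x + s *\<^sub>R (- v)) - z x) / s <= 0) (at_right 0)"
    using ev1 ev3 ev4
   proof eventually_elim
    case (elim s)
    have "s * (w \<bullet> (- v)) / 2 < 0" using v elim(3) by (simp add: mult_pos_pos)
    then have "\<psi> (x + s *\<^sub>R (- v)) < 0" using elim(1) f0 by linarith
    then have "z (x + s *\<^sub>R (- v)) < 0" using ltV [OF elim(2)] Om_eq by auto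
    then show ?case using z0 [OF x] elim(3) by (simp add: divide_nonpos_pos)
   qed
   have "((\<lambda>s. z (x + s *\<^sub>R (- v))) has_vector_derivative Z x \<bullet> (- v)) (at 0)"
    using z' by (intro has_derivative_line) simp
   then have "((\<lambda>s. (z (x + s *\<^sub>R (- v)) - z x) / s) \<longlongrightarrow> Z x \<bullet> (- v)) (at_right 0)"
    by (auto simp: has_real_derivative_iff_has_vector_derivative [symmetric] has_field_derivative_iff intro: filterlim_mono [OF _ order_refl at_le])
   from tendsto_upperbound [OF this ev] show ?thesis by simp
  qed
  have ge: "0 <= Z x \<bullet> v" if v: "w \<bullet> v = 0" for v
  proof -
   have "((\<lambda>d. Z x \<bullet> (v + d *\<^sub>R w)) \<longlongrightarrow> Z x \<bullet> (v + 0 *\<^sub>R w)) (at_right 0)" by (intro tendsto_intros)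
   then have lim: "((\<lambda>d. Z x \<bullet> (v + d *\<^sub>R w)) \<longlongrightarrow> Z x \<bullet> v) (at_right 0)" by simp
   have "eventually (\<lambda>d. 0 <= Z x \<bullet> (v + d *\<^sub>R w)) (at_right 0)"
    using eventually_at_right_less [of 0]
   proof eventually_elim
    case (elim d)
    then show ?case using w0 v by (intro half) (simp add: inner_add_right)
   qed
   from tendsto_lowerbound [OF lim this] show ?thesis by simp
  qed
  show ?thesis using ge [of g] ge [of "- g"] gw by (simp add: g_def [symmetric] inner_commute)
 qed
 with dom2 show ?thesis using that by blast
qed

section \<open>The first variation at a fixed time\<close>

lemma div_of_scaleR: "div_of (\<lambda>h. c *\<^sub>R L h) = c * div_of L"
 by (simp add: div_of_def sum_distrib_left)

lemma div_of_add: "div_of (\<lambda>h. L h + L' h) = div_of L + div_of L'"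
 by (simp add: div_of_def inner_add_left sum.distrib)

lemma div_of_diff: "div_of (\<lambda>h. L h - L' h) = div_of L - div_of L'"
 by (simp add: div_of_def inner_diff_left sum_subtractf)

lemma div_of_rank1:
 assumes "linear l" shows "div_of (\<lambda>h. l h *\<^sub>R v) = l v"
proof -
 have "l v = l (\<Sum>b\<in>Basis. (v \<bullet> b) *\<^sub>R b)" by (simp add: euclidean_representation)
 also have "\<dots> = (\<Sum>b\<in>Basis. (v \<bullet> b) * l b)" using assms by (simp add: linear_sum linear_cmul)
 finally show ?thesis by (simp add: div_of_def mult.commute)
qed

lemma div_of_id: "div_of (\<lambda>h::'a::euclidean_space. h) = DIM('a)"
 by (simp add: div_of_def inner_Basis)

lemma div_of_bound:
 fixes L :: "'a::euclidean_space => 'a" and B :: real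
 assumes "\<And>b. b \<in> Basis ==> norm (L b) <= B" shows "\<bar>div_of L\<bar> <= DIM('a) * B"
proof -
 have "\<bar>div_of L\<bar> <= (\<Sum>b\<in>Basis. \<bar>L b \<bullet> b\<bar>)" unfolding div_of_def by (rule sum_abs)
 also have "\<dots> <= (\<Sum>b\<in>(Basis::'a set). B)"
  using assms by (intro sum_mono) (metis Basis_le_norm order_trans)
 finally show ?thesis by simp
qed

context C2_domain
begin

lemma integral_has_real_derivative:
 fixes f f' :: "real => 'a => real"
 assumes t: "a < t" "t < b" and f: "\<And>s. a < s ==> s < b ==> continuous_on (closure Om) (f s)"
  and f': "\<And>s x. a < s ==> s < b ==> x \<in> Om ==> ((\<lambda>s. f s x) has_real_derivative f' s x) (at s)"
  and c: "continuous_on ({a..b} \<times> closure Om) (\<lambda>(s, x). f' s x)"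
 shows "((\<lambda>s. integral\<^sup>L (leb Om) (f s)) has_real_derivative integral\<^sup>L (leb Om) (f' t)) (at t)"
proof -
 have "compact ({a..b} \<times> closure Om)" by (intro compact_Times compact_Icc compact_closure)
 from compact_imp_bounded [OF compact_continuous_image [OF c this]]
 obtain B where B: "\<And>y. y \<in> (\<lambda>(s, x). f' s x) ` ({a..b} \<times> closure Om) ==> norm y <= B" unfolding bounded_iff by blast
 show ?thesis
 proof (rule has_real_derivative_integral [where d = "min (t - a) (b - t)" and B = B])
  show "finite_measure (leb Om)" by (rule finite_measure_leb [OF bounded_Om sets_Om])
  show "0 < min (t - a) (b - t)" using t by simp
  have 1: "continuous_on Om (\<lambda>x. (t, x))" by (intro continuous_intros)
  have 2: "(\<lambda>x. (t, x)) ` Om \<subseteq> {a..b} \<times> closure Om" using t closure_subset [of Om] by auto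
  have "continuous_on Om (f' t)" using continuous_on_compose2 [OF c 1 2] by simp
  then show "f' t \<in> borel_measurable (leb Om)" by (rule continuous_on_borel_measurable_leb)
  fix s assume "\<bar>s - t\<bar> < min (t - a) (b - t)"
  then have s: "a < s" "s < b" by linarith+
  show "integrable (leb Om) (f s)" by (rule integrable_cont [OF f [OF s]])
  fix x assume "x \<in> space (leb Om)"
  then have x: "x \<in> Om" by simp
  show "((\<lambda>s. f s x) has_real_derivative f' s x) (at s)" by (rule f' [OF s x])
  have "f' s x \<in> (\<lambda>(s, x). f' s x) ` ({a..b} \<times> closure Om)"
   by (rule image_eqI [of _ _ "(s, x)"]) (use s x closure_subset in auto)
  then show "\<bar>f' s x\<bar> <= B" using B by simp
 qed
qed

definition dens :: "('a => real) => 'a measure" where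
 "dens g = density lborel (\<lambda>x. ennreal (if x \<in> Om then g x else 0))"

lemma sets_dens [simp]: "sets (dens g) = sets borel"
 by (simp add: dens_def)

lemma dens_measurable:
 fixes g :: "'a => real"
 assumes "continuous_on Om g" shows "(\<lambda>x. if x \<in> Om then g x else 0) \<in> borel_measurable borel"
proof -
 have "(\<lambda>x. indicator Om x *\<^sub>R g x) \<in> borel_measurable borel"
  using assms by (intro borel_measurable_continuous_on_indicator) auto
 moreover have "(\<lambda>x. indicator Om x *\<^sub>R g x) = (\<lambda>x. if x \<in> Om then g x else 0)" by auto
 ultimately show ?thesis by simp
qed

lemma emeasure_dens:
 assumes cc: "continuous_on (closure Om) g" and nn: "\<And>x. 0 <= g x" and S: "S \<in> sets borel"
 shows "emeasure (dens g) S = ennreal (\<integral>x. indicator S x * g x \<partial>leb Om)"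
  "integrable (leb Om) (\<lambda>x. indicator S x * g x)"
proof -
 note c = closure_cont [OF cc]
 show i: "integrable (leb Om) (\<lambda>x. indicator S x * g x)"
 proof (rule Bochner_Integration.integrable_bound [OF integrable_cont [OF cc]])
  have "S \<inter> Om \<in> sets (leb Om)" using S sets_Om by (auto simp: leb_def sets_restrict_space_iff)
  then have "(\<lambda>x. indicator (S \<inter> Om) x * g x) \<in> borel_measurable (leb Om)"
   by (intro borel_measurable_times borel_measurable_indicator continuous_on_borel_measurable_leb [OF c])
  then show "(\<lambda>x. indicator S x * g x) \<in> borel_measurable (leb Om)"
   by (rule measurable_cong [THEN iffD1, rotated]) (auto simp: indicator_def)
 qed (auto simp: indicator_def)
 have "emeasure (dens g) S = (\<integral>\<^sup>+x. ennreal (if x \<in> Om then g x else 0) * indicator S x \<partial>lborel)"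
  unfolding dens_def using dens_measurable [OF c] S by (subst emeasure_density) auto
 also have "\<dots> = (\<integral>\<^sup>+x. ennreal (indicator S x * g x) * indicator Om x \<partial>lborel)"
  by (intro nn_integral_cong) (auto simp: indicator_def)
 also have "\<dots> = (\<integral>\<^sup>+x. ennreal (indicator S x * g x) \<partial>leb Om)"
  unfolding leb_def using sets_Om by (subst nn_integral_restrict_space) auto
 also have "\<dots> = ennreal (\<integral>x. indicator S x * g x \<partial>leb Om)"
  using i nn by (intro nn_integral_eq_integral) (auto simp: indicator_def)
 finally show "emeasure (dens g) S = ennreal (\<integral>x. indicator S x * g x \<partial>leb Om)" .
qed

lemma measure_dens:
 assumes "continuous_on (closure Om) g" "\<And>x. 0 <= g x" "S \<in> sets borel"
 shows "measure (dens g) S = (\<integral>x. indicator S x * g x \<partial>leb Om)"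
proof -
 have "0 <= (\<integral>x. indicator S x * g x \<partial>leb Om)"
  using assms(2) by (intro integral_nonneg_AE AE_I2) (auto simp: indicator_def)
 then show ?thesis using emeasure_dens(1) [OF assms] by (simp add: measure_def)
qed

lemma finite_measure_dens:
 assumes "continuous_on (closure Om) g" "\<And>x. 0 <= g x"
 shows "finite_measure (dens g)"
proof
 have "space (dens g) = UNIV" by (simp add: dens_def)
 then show "emeasure (dens g) (space (dens g)) \<noteq> \<infinity>" using emeasure_dens(1) [OF assms, of UNIV] by simp
qed

end

text \<open>A function \<open>u\<close> on the domain at a fixed time, with gradient \<open>Du\<close> and Hessian \<open>H\<close>, satisfying the Neumann condition. Below,
  \<open>f\<close> is the right-hand side of the equation, \<open>e\<close> the energy density and \<open>xi\<close> the discrepancy.\<close>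

locale slice = C2_domain Om z Z Z' for Om :: "'a::euclidean_space set" and z Z Z' +
 fixes W W' :: "real => real" and eps :: real
  and u :: "'a => real" and Du :: "'a => 'a" and H :: "'a => 'a => 'a"
 assumes eps: "0 < eps"
  and W_deriv: "\<And>s. (W has_real_derivative W' s) (at s)" and W'_cont: "continuous_on UNIV W'"
  and W_nonneg: "\<And>s. 0 <= W s"
  and u_deriv: "\<And>x. x \<in> Om ==> (u has_derivative (\<lambda>h. Du x \<bullet> h)) (at x)"
  and Du_deriv: "\<And>x. x \<in> Om ==> (Du has_derivative H x) (at x)"
  and H_sym: "\<And>x h k. x \<in> Om ==> H x h \<bullet> k = h \<bullet> H x k"
  and u_cont: "continuous_on (closure Om) u" and Du_cont: "continuous_on (closure Om) Du"
  and H_cont: "\<And>h. continuous_on (closure Om) (\<lambda>x. H x h)"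
  and neumann: "\<And>x. x \<in> frontier Om ==> Du x \<bullet> Z x = 0"
begin

definition f :: "'a => real" where "f x = div_of (H x) - W' (u x) / eps\<^sup>2"
definition e :: "'a => real" where "e x = eps * (norm (Du x))\<^sup>2 / 2 + W (u x) / eps"
definition xi :: "'a => real" where "xi x = eps * (norm (Du x))\<^sup>2 / 2 - W (u x) / eps"

lemma W_cont: "continuous_on S W"
 by (meson W_deriv DERIV_isCont continuous_at_imp_continuous_on)

lemma e_cont: "continuous_on (closure Om) e" "continuous_on (closure Om) xi"
 unfolding e_def [abs_def] xi_def [abs_def] using eps
 by (intro continuous_intros Du_cont continuous_on_compose2 [OF W_cont [of UNIV] u_cont]; simp)+

lemma e_nonneg: "0 <= e x" using eps W_nonneg by (simp add: e_def)

lemma xi_le_e: "\<bar>xi x\<bar> <= e x"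
 using eps W_nonneg [of "u x"] unfolding xi_def e_def by (intro abs_leI) (auto simp: divide_nonneg_pos)

lemma f_cont: "continuous_on (closure Om) f"
 unfolding f_def [abs_def] using eps
 by (intro continuous_intros div_of_cont H_cont continuous_on_compose2 [OF W'_cont u_cont]) auto

text \<open>The field \<open>e Y - eps (Du \<bullet> Y) Du\<close> is tangential on the boundary if \<open>Y\<close> is, by the Neumann condition; its divergence is the
  integrand.\<close>

theorem first_variation:
 assumes Y: "\<And>x. x \<in> Om ==> (Y has_derivative Y' x) (at x)"
  and c: "\<And>h. continuous_on (closure Om) (\<lambda>x. Y' x h)" and cY: "continuous_on (closure Om) Y"
  and t: "\<And>x. x \<in> frontier Om ==> Y x \<bullet> Z x = 0"
 shows "(\<integral>x. e x * div_of (Y' x) - eps * (Du x \<bullet> Y' x (Du x)) - eps * f x * (Du x \<bullet> Y x) \<partial>leb Om) = 0"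
  "integrable (leb Om) (\<lambda>x. e x * div_of (Y' x) - eps * (Du x \<bullet> Y' x (Du x)) - eps * f x * (Du x \<bullet> Y x))"
proof -
 define V where "V x = e x *\<^sub>R Y x - (eps * (Du x \<bullet> Y x)) *\<^sub>R Du x" for x
 define V' where "V' x h = (e x *\<^sub>R Y' x h + (eps * (H x h \<bullet> Du x) + W' (u x) * (Du x \<bullet> h) / eps) *\<^sub>R Y x)
   - ((eps * (Du x \<bullet> Y x)) *\<^sub>R H x h + (eps * (Du x \<bullet> Y' x h + H x h \<bullet> Y x)) *\<^sub>R Du x)" for x h
 have ed: "(e has_derivative (\<lambda>h. eps * (H x h \<bullet> Du x) + W' (u x) * (Du x \<bullet> h) / eps)) (at x)" if x: "x \<in> Om" for x
 proof -
  have "((\<lambda>x. W (u x)) has_derivative (\<lambda>h. W' (u x) * (Du x \<bullet> h))) (at x)"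
   using has_derivative_compose [OF u_deriv [OF x] W_deriv [unfolded has_field_derivative_def]] .
  then have "((\<lambda>x. eps * (Du x \<bullet> Du x) / 2 + W (u x) / eps) has_derivative
    (\<lambda>h. eps * (Du x \<bullet> H x h + H x h \<bullet> Du x) / 2 + W' (u x) * (Du x \<bullet> h) / eps)) (at x)"
   using eps by (auto intro!: derivative_eq_intros has_derivative_inner Du_deriv [OF x])
  then show ?thesis unfolding e_def [abs_def] power2_norm_eq_inner by (simp add: inner_commute)
 qed
 have V: "(V has_derivative V' x) (at x)" if x: "x \<in> Om" for x
  unfolding V_def V'_def
  by (intro has_derivative_diff has_derivative_scaleR ed x Y has_derivative_mult_right has_derivative_inner Du_deriv)
 have cV': "continuous_on (closure Om) (\<lambda>x. V' x h)" for h
  unfolding V'_def using eps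
  by (intro continuous_intros u_cont Du_cont e_cont cY c H_cont continuous_on_compose2 [OF W'_cont u_cont]) auto
 have cV: "continuous_on (closure Om) V"
  unfolding V_def by (intro continuous_intros e_cont cY Du_cont)
 have div: "div_of (V' x) = e x * div_of (Y' x) - eps * (Du x \<bullet> Y' x (Du x)) - eps * f x * (Du x \<bullet> Y x)" if x: "x \<in> Om" for x
 proof -
  have lH: "linear (H x)" using has_derivative_linear [OF Du_deriv [OF x]] .
  have lY: "linear (Y' x)" using has_derivative_linear [OF Y [OF x]] .
  have l1: "linear (\<lambda>h. eps * (H x h \<bullet> Du x) + W' (u x) * (Du x \<bullet> h) / eps)"
   using lH by (intro linearI) (auto simp: linear_add linear_cmul inner_add_left inner_add_right algebra_simps add_divide_distrib)
  have l2: "linear (\<lambda>h. eps * (Du x \<bullet> Y' x h + H x h \<bullet> Y x))"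
   using lH lY by (intro linearI) (auto simp: linear_add linear_cmul inner_add_left inner_add_right algebra_simps)
  have "div_of (V' x) = e x * div_of (Y' x) + (eps * (H x (Y x) \<bullet> Du x) + W' (u x) * (Du x \<bullet> Y x) / eps)
    - (eps * (Du x \<bullet> Y x) * div_of (H x) + eps * (Du x \<bullet> Y' x (Du x) + H x (Du x) \<bullet> Y x))"
   unfolding V'_def div_of_diff div_of_add div_of_scaleR div_of_rank1 [OF l1] div_of_rank1 [OF l2] by simp
  moreover have "H x (Y x) \<bullet> Du x = H x (Du x) \<bullet> Y x" using H_sym [OF x, of "Y x" "Du x"] by (simp add: inner_commute)
  moreover have "eps * f x * (Du x \<bullet> Y x) = eps * (Du x \<bullet> Y x) * div_of (H x) - W' (u x) * (Du x \<bullet> Y x) / eps"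
   using eps by (simp add: f_def field_simps power2_eq_square)
  ultimately show ?thesis by (simp add: algebra_simps)
 qed
 have i: "integrable (leb Om) (\<lambda>x. div_of (V' x))" by (intro integrable_cont div_of_cont cV')
 have "(\<integral>x. div_of (V' x) \<partial>leb Om) = 0"
 proof (rule no_flux [OF V cV' cV])
  show "V x \<bullet> Z x = 0" if "x \<in> frontier Om" for x
   using t [OF that] neumann [OF that] by (simp add: V_def inner_diff_left)
 qed
 moreover have "(\<integral>x. div_of (V' x) \<partial>leb Om) = (\<integral>x. e x * div_of (Y' x) - eps * (Du x \<bullet> Y' x (Du x)) - eps * f x * (Du x \<bullet> Y x) \<partial>leb Om)"
  using div by (intro Bochner_Integration.integral_cong) auto
 ultimately show "(\<integral>x. e x * div_of (Y' x) - eps * (Du x \<bullet> Y' x (Du x)) - eps * f x * (Du x \<bullet> Y x) \<partial>leb Om) = 0" by simp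
 show "integrable (leb Om) (\<lambda>x. e x * div_of (Y' x) - eps * (Du x \<bullet> Y' x (Du x)) - eps * f x * (Du x \<bullet> Y x))"
  using i div by (subst Bochner_Integration.integrable_cong [OF refl]) (auto simp: )
qed

definition cut :: "'a => real => 'a => real" where "cut p r x = psq (1 - (norm (x - p))\<^sup>2 / r\<^sup>2)"
definition cut' :: "'a => real => 'a => real" where "cut' p r x = max 0 (1 - (norm (x - p))\<^sup>2 / r\<^sup>2)"
definition J :: "'a => real => real" where "J p r = (\<integral>x. cut p r x * e x \<partial>leb Om) / r ^ (DIM('a) - 1)"

lemma cut_props:
 assumes "0 < r"
 shows "0 <= cut p r x" "cut p r x <= indicator (ball p r) x" "indicator (ball p (r/2)) x / 2 <= cut p r x"
  "0 <= cut' p r x" "cut' p r x <= indicator (ball p r) x" "cut p r x = (cut' p r x)\<^sup>2"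
proof -
 show 0: "0 <= cut p r x" "0 <= cut' p r x" "cut p r x = (cut' p r x)\<^sup>2" by (simp_all add: cut_def cut'_def psq_def)
 show 1: "cut' p r x <= indicator (ball p r) x"
 proof (cases "x \<in> ball p r")
  case True then show ?thesis using assms by (simp add: cut'_def)
 next
  case False
  then have "r <= norm (x - p)" by (simp add: dist_norm norm_minus_commute)
  then have "r\<^sup>2 <= (norm (x - p))\<^sup>2" using assms by (intro power_mono) auto
  then show ?thesis using False assms by (simp add: cut'_def)
 qed
 show "cut p r x <= indicator (ball p r) x"
 proof (cases "x \<in> ball p r")
  case True
  have "(cut' p r x)\<^sup>2 <= 1\<^sup>2" using 1 0 True by (intro power_mono) auto
  then show ?thesis using True 0 by simp
 next
  case False
  then have "cut' p r x = 0" using 1 0(2) by (simp add: order_antisym)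
  then show ?thesis using 0 by simp
 qed
 show "indicator (ball p (r/2)) x / 2 <= cut p r x"
 proof (cases "x \<in> ball p (r/2)")
  case True
  then have "norm (x - p) <= r/2" by (simp add: dist_norm norm_minus_commute)
  then have "(norm (x - p))\<^sup>2 <= (r/2)\<^sup>2" by (intro power_mono) auto
  then have "(norm (x - p))\<^sup>2 / r\<^sup>2 <= 1/4" using assms by (simp add: power_divide field_simps)
  then have "3/4 <= cut' p r x" by (simp add: cut'_def le_max_iff_disj)
  then have "(3/4)\<^sup>2 <= (cut' p r x)\<^sup>2" by (intro power_mono) auto
  then have "1/2 <= cut p r x" using 0(3) by (simp add: power2_eq_square)
  then show ?thesis using True by simp
 qed (use 0 in simp)
qed

lemma cut_le_1: "0 < r ==> cut p r x <= 1" "0 < r ==> cut' p r x <= 1"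
 using cut_props(2,5) [of r p x] by (auto intro: order_trans [OF _ indicator_le_1])

lemma cut_cont: "0 < r ==> continuous_on S (cut p r)" "0 < r ==> continuous_on S (cut' p r)"
 unfolding cut_def [abs_def] cut'_def [abs_def]
 by (intro continuous_intros continuous_on_compose2 [OF psq_continuous [of UNIV]]; simp)+

lemma J_has_derivative:
 assumes r: "0 < r"
 shows "(J p has_real_derivative
  (\<integral>x. 4 * cut' p r x * ((norm (x - p))\<^sup>2 / r\<^sup>2) * e x - real (DIM('a) - 1) * cut p r x * e x \<partial>leb Om) / r ^ DIM('a)) (at r)"
proof -
 define m where "m = DIM('a) - 1"
 have dm: "DIM('a) = Suc m" using DIM_positive [where 'a='a] by (simp add: m_def)
 define g where "g s x = 4 * cut' p s x * ((norm (x - p))\<^sup>2 / s^3) * e x" for s x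
 have ie: "integrable (leb Om) (\<lambda>x. cut p r x * e x)" by (intro integrable_cont continuous_intros cut_cont r e_cont)
 have gi: "integrable (leb Om) (g r)"
  unfolding g_def [abs_def] using r by (intro integrable_cont continuous_intros cut_cont e_cont) auto
 have gr: "g r x = (4 * cut' p r x * ((norm (x - p))\<^sup>2 / r\<^sup>2) * e x) / r" for x
  using r by (simp add: g_def power2_eq_square power3_eq_cube)
 have "((\<lambda>s. \<integral>x. cut p s x * e x \<partial>leb Om) has_real_derivative (\<integral>x. g r x \<partial>leb Om)) (at r)"
 proof (rule integral_has_real_derivative [where a = "r/2" and b = "2 * r"])
  show "continuous_on ({r/2..2 * r} \<times> closure Om) (\<lambda>(s, x). g s x)"
   unfolding g_def cut'_def case_prod_beta using r by (intro continuous_intros continuous_on_compose2 [OF e_cont(1)]) auto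
  fix s assume "r/2 < s"
  then have s: "0 < s" using r by simp
  show "continuous_on (closure Om) (\<lambda>x. cut p s x * e x)" by (intro continuous_intros cut_cont s e_cont)
  fix x
  have "((\<lambda>s. 1 - (norm (x - p))\<^sup>2 / s\<^sup>2) has_real_derivative 2 * (norm (x - p))\<^sup>2 / s^3) (at s)"
   using s by (auto intro!: derivative_eq_intros simp: field_simps power2_eq_square power3_eq_cube power4_eq_xxxx)
  from DERIV_chain2 [where f = psq, OF psq_deriv this]
  have "((\<lambda>s. cut p s x) has_real_derivative 2 * cut' p s x * (2 * (norm (x - p))\<^sup>2 / s^3)) (at s)"
   by (simp add: cut_def [abs_def] cut'_def)
  then have "((\<lambda>s. cut p s x * e x) has_real_derivative 2 * cut' p s x * (2 * (norm (x - p))\<^sup>2 / s^3) * e x) (at s)"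
   by (rule DERIV_cmult_right)
  then show "((\<lambda>s. cut p s x * e x) has_real_derivative g s x) (at s)" by (simp add: g_def mult_ac)
 qed (use r in auto)
 then have "(J p has_real_derivative ((\<integral>x. g r x \<partial>leb Om) * r ^ m - (\<integral>x. cut p r x * e x \<partial>leb Om) * (real m * r ^ (m - 1))) / (r ^ m * r ^ m)) (at r)"
  unfolding J_def m_def [symmetric] using r by (intro DERIV_divide) (auto intro!: derivative_eq_intros)
 moreover have "((\<integral>x. g r x \<partial>leb Om) * r ^ m - (\<integral>x. cut p r x * e x \<partial>leb Om) * (real m * r ^ (m - 1))) / (r ^ m * r ^ m) =
  (\<integral>x. 4 * cut' p r x * ((norm (x - p))\<^sup>2 / r\<^sup>2) * e x - real (DIM('a) - 1) * cut p r x * e x \<partial>leb Om) / r ^ DIM('a)"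
 proof -
  have I: "(\<integral>x. 4 * cut' p r x * ((norm (x - p))\<^sup>2 / r\<^sup>2) * e x - real (DIM('a) - 1) * cut p r x * e x \<partial>leb Om) =
   r * (\<integral>x. g r x \<partial>leb Om) - real m * (\<integral>x. cut p r x * e x \<partial>leb Om)"
  proof -
   have "(\<integral>x. 4 * cut' p r x * ((norm (x - p))\<^sup>2 / r\<^sup>2) * e x - real (DIM('a) - 1) * cut p r x * e x \<partial>leb Om) =
    (\<integral>x. r * g r x - real m * (cut p r x * e x) \<partial>leb Om)"
    using gr r by (intro Bochner_Integration.integral_cong) (auto simp: m_def mult.assoc)
   also have "\<dots> = r * (\<integral>x. g r x \<partial>leb Om) - real m * (\<integral>x. cut p r x * e x \<partial>leb Om)"
    using gi ie by simp
   finally show ?thesis .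
  qed
  have "(G * r ^ m - K * (real m * r ^ (m - 1))) / (r ^ m * r ^ m) = (r * G - real m * K) / r ^ Suc m" for G K :: real
  proof (cases m)
   case (Suc j)
   then show ?thesis using r by (simp add: field_simps)
  qed (use r in simp)
  note quot = this
  show ?thesis unfolding I quot by (simp only: dm)
 qed
 ultimately show "(J p has_real_derivative
  (\<integral>x. 4 * cut' p r x * ((norm (x - p))\<^sup>2 / r\<^sup>2) * e x - real (DIM('a) - 1) * cut p r x * e x \<partial>leb Om) / r ^ DIM('a)) (at r)"
  by simp
qed

end

section \<open>Monotonicity up to the boundary\<close>

lemma linear_uniform_bound:
 fixes L :: "'a::euclidean_space => 'a => 'b::real_normed_vector"
 assumes K: "compact K" and lin: "\<And>x. x \<in> K ==> linear (L x)" and c: "\<And>h. continuous_on K (\<lambda>x. L x h)"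
 shows "\<exists>B>0. \<forall>x\<in>K. \<forall>h. norm (L x h) <= B * norm h"
proof -
 have "\<exists>B>0. \<forall>x\<in>K. norm (L x b) <= B" for b
  using compact_imp_bounded [OF compact_continuous_image [OF c [of b] K]] by (auto simp: bounded_pos)
 then obtain \<beta> where \<beta>: "\<And>b. 0 < \<beta> b" "\<And>b x. x \<in> K ==> norm (L x b) <= \<beta> b" by metis
 have "norm (L x h) <= (\<Sum>b\<in>Basis. \<beta> b) * norm h" if x: "x \<in> K" for x h
 proof -
  have "L x h = L x (\<Sum>b\<in>Basis. (h \<bullet> b) *\<^sub>R b)" by (simp add: euclidean_representation)
  also have "\<dots> = (\<Sum>b\<in>Basis. (h \<bullet> b) *\<^sub>R L x b)" using lin [OF x] by (simp add: linear_sum linear_cmul)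
  finally have e: "L x h = (\<Sum>b\<in>Basis. (h \<bullet> b) *\<^sub>R L x b)" .
  have "norm (L x h) <= (\<Sum>b\<in>Basis. norm ((h \<bullet> b) *\<^sub>R L x b))" unfolding e by (rule norm_sum)
  also have "\<dots> <= (\<Sum>b\<in>Basis. norm h * \<beta> b)"
   using \<beta>(2) [OF x] by (intro sum_mono) (auto intro!: mult_mono Basis_le_norm)
  also have "\<dots> = (\<Sum>b\<in>Basis. \<beta> b) * norm h" by (simp add: sum_distrib_left mult.commute)
  finally show ?thesis .
 qed
 moreover have "0 < (\<Sum>b\<in>(Basis::'a set). \<beta> b)" using \<beta> by (intro sum_pos) auto
 ultimately show ?thesis by blast
qed

context C2_domain
begin

text \<open>For a centre \<open>p\<close> on the frontier the radial field \<open>x - p\<close> is corrected by a multiple of \<open>Z\<close> so that it becomes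
  tangential. Since \<open>(x - p) \<bullet> Z x - z x\<close> vanishes to second order at \<open>p\<close>, the correction is of higher order.\<close>

lemma tangential_radial_field:
 obtains c X X' where "0 <= c"
  "\<And>p x. x \<in> Om ==> (X p has_derivative X' p x) (at x)"
  "\<And>p h. continuous_on (closure Om) (\<lambda>x. X' p x h)" "\<And>p. continuous_on (closure Om) (X p)"
  "\<And>p x. x \<in> frontier Om ==> X p x \<bullet> Z x = 0"
  "\<And>p x r. p \<in> frontier Om ==> x \<in> Om ==> x \<in> ball p r ==> r <= 1 ==> norm (X p x - (x - p)) <= c * r\<^sup>2"
  "\<And>p x h r. p \<in> frontier Om ==> x \<in> Om ==> x \<in> ball p r ==> r <= 1 ==> norm (X' p x h - h) <= c * r * norm h"
proof -
 obtain m where m: "0 < m" "\<And>x. x \<in> closure Om ==> m <= (norm (Z x))\<^sup>2 + (z x)\<^sup>2" using nondegenerate by blast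
 define q where "q x = Z x \<bullet> Z x + z x * z x" for x
 have q: "0 < q x" if "x \<in> closure Om" for x using m(1) m(2) [OF that] unfolding q_def power2_norm_eq_inner power2_eq_square [of "z x"] by linarith
 define q' where "q' x h = (Z x \<bullet> Z' x h + Z' x h \<bullet> Z x) + (z x * (Z x \<bullet> h) + (Z x \<bullet> h) * z x)" for x h
 have q': "(q has_derivative q' x) (at x)" for x
  unfolding q_def q'_def by (intro has_derivative_add has_derivative_inner has_derivative_mult Z_deriv z_deriv)
 have Z'c: "continuous_on S (\<lambda>x. Z' x h)" for S h
  by (rule continuous_on_subset [OF Z'_cont subset_UNIV])
 define N where "N x = inverse (q x) *\<^sub>R Z x" for x
 define N' where "N' x h = inverse (q x) *\<^sub>R Z' x h + (- (inverse (q x) * q' x h * inverse (q x))) *\<^sub>R Z x" for x h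
 have N': "(N has_derivative N' x) (at x)" if "x \<in> closure Om" for x
 proof -
  have "q x \<noteq> 0" using q [OF that] by simp
  from has_derivative_scaleR [OF Deriv.has_derivative_inverse [OF this q'] Z_deriv]
  show ?thesis unfolding N_def N'_def .
 qed
 have qc: "continuous_on (closure Om) q" unfolding q_def by (intro continuous_intros Z_cont z_cont)
 have q0: "\<forall>x\<in>closure Om. q x \<noteq> 0" using q by (simp add: less_imp_neq [symmetric])
 have N'c: "continuous_on (closure Om) (\<lambda>x. N' x h)" for h
  unfolding N'_def q'_def using q0 by (intro continuous_intros Z'c Z_cont z_cont qc) auto
 have Nc: "continuous_on (closure Om) N"
  unfolding N_def using q0 by (intro continuous_intros Z_cont qc) auto
 obtain BN where BN: "0 < BN" "\<And>x. x \<in> closure Om ==> norm (N x) <= BN" using bounded_on_closure [OF Nc] by blast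
 obtain BN' where BN': "0 < BN'" "\<And>x h. x \<in> closure Om ==> norm (N' x h) <= BN' * norm h"
  using linear_uniform_bound [OF compact_closure has_derivative_linear [OF N'] N'c] by blast
 obtain R where R: "\<And>x. x \<in> closure Om ==> norm x <= R"
  using compact_imp_bounded [OF compact_closure] by (auto simp: bounded_iff)
 obtain B1 where B1: "0 < B1" "\<And>x h. x \<in> cball 0 (R + 1) ==> norm (Z' x h) <= B1 * norm h"
  using linear_uniform_bound [OF compact_cball Z'_linear Z'c] by blast
 define a where "a p x = (x - p) \<bullet> Z x - z x" for p x
 have a': "(a p has_derivative (\<lambda>h. (x - p) \<bullet> Z' x h)) (at x)" for p x
 proof -
  have "(a p has_derivative (\<lambda>h. ((x - p) \<bullet> Z' x h + h \<bullet> Z x) - Z x \<bullet> h)) (at x)"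
   unfolding a_def [abs_def]
   by (intro has_derivative_diff has_derivative_inner Z_deriv z_deriv) (auto intro!: derivative_eq_intros)
  then show ?thesis by (simp add: inner_commute)
 qed
 have ac: "continuous_on S (a p)" for S p unfolding a_def by (intro continuous_intros Z_cont z_cont)
 have a_small: "\<bar>a p x\<bar> <= B1 * (norm (x - p))\<^sup>2" if p: "p \<in> frontier Om" and x: "norm (x - p) <= 1" for p x
 proof -
  have "norm (a p (p + (x - p)) - a p p) <= B1 * (norm (x - p))\<^sup>2"
  proof (rule line_increment_bound [where f' = "\<lambda>x h. (x - p) \<bullet> Z' x h"])
   fix s :: real assume s: "0 <= s" "s <= 1"
   let ?y = "p + s *\<^sub>R (x - p)"
   show "(a p has_derivative (\<lambda>h. (?y - p) \<bullet> Z' ?y h)) (at ?y)" by (rule a')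
   have "norm ?y <= norm p + s * norm (x - p)" using s norm_triangle_ineq [of p "s *\<^sub>R (x - p)"] by simp
   also have "\<dots> <= R + 1" using s x R [OF frontier_closure [OF p]] by (intro add_mono mult_le_one) auto
   finally have "norm (Z' ?y (x - p)) <= B1 * norm (x - p)" by (intro B1) simp
   moreover have "norm (?y - p) <= norm (x - p)" using s by (simp add: mult_left_le_one_le)
   ultimately have "norm (?y - p) * norm (Z' ?y (x - p)) <= norm (x - p) * (B1 * norm (x - p))"
    by (intro mult_mono) auto
   then show "norm ((?y - p) \<bullet> Z' ?y (x - p)) <= B1 * (norm (x - p))\<^sup>2"
    using Cauchy_Schwarz_ineq2 [of "?y - p" "Z' ?y (x - p)"] by (simp add: power2_eq_square mult_ac)
  qed
  then show ?thesis using z_frontier [OF p] by (simp add: a_def)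
 qed
 define c where "c = B1 * (BN + BN')"
 define X where "X p x = (x - p) - a p x *\<^sub>R N x" for p x
 define X' where "X' p x h = h - (a p x *\<^sub>R N' x h + ((x - p) \<bullet> Z' x h) *\<^sub>R N x)" for p x h
 have Omc: "x \<in> closure Om" if "x \<in> Om" for x using that closure_subset by auto
 show ?thesis
 proof (rule that [of c X X'])
  show "0 <= c" using B1 BN BN' by (simp add: c_def)
  fix p
  show "(X p has_derivative X' p x) (at x)" if x: "x \<in> Om" for x
   unfolding X_def X'_def
   by (intro has_derivative_diff has_derivative_scaleR N' a' Omc x) (auto intro!: derivative_eq_intros)
  show "continuous_on (closure Om) (\<lambda>x. X' p x h)" for h
   unfolding X'_def by (intro continuous_intros Z'c ac N'c Nc)
  show "continuous_on (closure Om) (X p)"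
   unfolding X_def by (intro continuous_intros ac Nc)
  show "X p x \<bullet> Z x = 0" if "x \<in> frontier Om" for x
  proof -
   have "N x \<bullet> Z x = 1" using z_frontier [OF that] Z_frontier [OF that] by (simp add: N_def q_def)
   then show ?thesis using z_frontier [OF that] by (simp add: X_def a_def inner_diff_left)
  qed
  fix x h and r :: real
  assume p: "p \<in> frontier Om" and x: "x \<in> Om" and xr: "x \<in> ball p r" and r: "r <= 1"
  have d: "norm (x - p) <= r" "0 <= r" using xr by (auto simp: dist_norm norm_minus_commute intro: order_trans [OF norm_ge_zero less_imp_le])
  then have d1: "norm (x - p) <= 1" using r by simp
  have "(norm (x - p))\<^sup>2 <= r\<^sup>2" using d by (intro power_mono) auto
  then have "B1 * (norm (x - p))\<^sup>2 <= B1 * r\<^sup>2" using B1 by simp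
  then have as: "\<bar>a p x\<bar> <= B1 * r\<^sup>2" using a_small [OF p d1] by simp
  have "norm (X p x - (x - p)) = \<bar>a p x\<bar> * norm (N x)" by (simp add: X_def)
  also have "\<dots> <= (B1 * r\<^sup>2) * BN" using as BN Omc [OF x] by (intro mult_mono) auto
  also have "\<dots> = B1 * BN * r\<^sup>2" by simp
  also have "\<dots> <= c * r\<^sup>2"
   using B1 BN BN' by (intro mult_right_mono) (auto simp: c_def)
  finally show "norm (X p x - (x - p)) <= c * r\<^sup>2" .
  have 1: "norm (a p x *\<^sub>R N' x h) <= (B1 * r\<^sup>2) * (BN' * norm h)"
   unfolding norm_scaleR using as BN' Omc [OF x] B1 by (intro mult_mono) auto
  have "r\<^sup>2 <= r" using d r by (simp add: power2_eq_square mult_left_le_one_le)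
  then have "(B1 * r\<^sup>2) * (BN' * norm h) <= (B1 * r) * (BN' * norm h)"
   using B1 BN' by (intro mult_right_mono mult_left_mono) auto
  with 1 have 1: "norm (a p x *\<^sub>R N' x h) <= (B1 * r) * (BN' * norm h)" by simp
  have "x \<in> cball 0 (R + 1)" using R [OF Omc [OF x]] by simp
  then have "norm (x - p) * norm (Z' x h) <= r * (B1 * norm h)" using d by (intro mult_mono B1) auto
  then have 2: "\<bar>(x - p) \<bullet> Z' x h\<bar> <= r * (B1 * norm h)" using Cauchy_Schwarz_ineq2 [of "x - p" "Z' x h"] by linarith
  have 3: "norm (((x - p) \<bullet> Z' x h) *\<^sub>R N x) <= (r * (B1 * norm h)) * BN"
   unfolding norm_scaleR using 2 BN Omc [OF x] B1 d by (intro mult_mono) auto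
  have "norm (X' p x h - h) <= norm (a p x *\<^sub>R N' x h) + norm (((x - p) \<bullet> Z' x h) *\<^sub>R N x)"
  proof -
   have "X' p x h - h = - (a p x *\<^sub>R N' x h + ((x - p) \<bullet> Z' x h) *\<^sub>R N x)" by (simp add: X'_def)
   then show ?thesis by (simp only: norm_minus_cancel norm_triangle_ineq)
  qed
  also have "\<dots> <= (B1 * r) * (BN' * norm h) + (r * (B1 * norm h)) * BN" using 1 3 by linarith
  also have "\<dots> = c * r * norm h" by (simp add: c_def algebra_simps)
  finally show "norm (X' p x h - h) <= c * r * norm h" .
 qed
qed

end

context slice
begin

lemma eps_Du_le: "eps * (norm (Du x))\<^sup>2 <= 2 * e x"
 using W_nonneg eps by (simp add: e_def)

text \<open>The error density in the monotonicity formula. It stems from the right-hand side \<open>f\<close> and from the correction of the radial field.\<close>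

definition al :: "real => 'a => real" where
 "al c x = (1 + c) * (eps * \<bar>f x\<bar> * norm (Du x)) + c * (DIM('a) + 14) * e x"

lemma al_nonneg: "0 <= c ==> 0 <= al c x" unfolding al_def using eps e_nonneg [of x] by simp

lemma al_cont: "continuous_on (closure Om) (al c)"
 unfolding al_def [abs_def] by (intro continuous_intros f_cont Du_cont e_cont)

text \<open>The integrand of the first variation for the field \<open>cut p r *\<^sub>R X\<close> at a single point, with \<open>v = x - p\<close>, \<open>k\<close> and \<open>k'\<close> the
  values of the cutoff and of its profile, \<open>L\<close> the derivative of \<open>X\<close>, and \<open>E\<close>, \<open>D\<close>, \<open>ff\<close> those of \<open>e\<close>, \<open>Du\<close>, \<open>f\<close>. For \<open>X = v\<close> it holds with \<open>c = 0\<close>; all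
  the other terms are bounded by \<open>c * r\<close> times the energy.\<close>

lemma pointwise_first_variation:
 fixes v X D :: 'a and L :: "'a => 'a" and k k' r c E ff :: real
 assumes r: "0 < r" "r <= 1" and v: "norm v <= r" and c: "0 <= c" and k: "0 <= k" "k <= 1" "0 <= k'" "k' <= 1"
  and X: "norm (X - v) <= c * r\<^sup>2" and L: "\<And>h. norm (L h - h) <= c * r * norm h"
  and E: "0 <= E" "eps * (norm D)\<^sup>2 <= 2 * E"
 shows "k * (E - eps * (norm D)\<^sup>2) - r * ((1 + c) * (eps * \<bar>ff\<bar> * norm D) + c * (DIM('a) + 14) * E) <=
   4 * k' * ((norm v)\<^sup>2 / r\<^sup>2) * E - (real DIM('a) - 1) * k * E +
   (E * (k * div_of L + 2 * k' * (- 2 * (v \<bullet> X) / r\<^sup>2)) - eps * (k * (D \<bullet> L D) + 2 * k' * (- 2 * (v \<bullet> D) / r\<^sup>2) * (D \<bullet> X)) - eps * ff * (k * (D \<bullet> X)))"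
proof -
 define n where "n = real DIM('a)"
 define A where "A = div_of L - n"
 define B where "B = D \<bullet> L D - (norm D)\<^sup>2"
 have cr: "0 <= c * r" using c r by simp
 have "A = div_of (\<lambda>h. L h - h)" by (simp add: A_def n_def div_of_diff div_of_id)
 also have "\<bar>\<dots>\<bar> <= DIM('a) * (c * r)"
 proof (rule div_of_bound)
  fix b :: 'a assume "b \<in> Basis" then show "norm (L b - b) <= c * r" using L [of b] by simp
 qed
 finally have A: "\<bar>A\<bar> <= n * (c * r)" by (simp add: n_def)
 have "B = D \<bullet> (L D - D)" by (simp add: B_def inner_diff_right power2_norm_eq_inner)
 also have "\<bar>\<dots>\<bar> <= norm D * norm (L D - D)" by (rule Cauchy_Schwarz_ineq2)
 also have "\<dots> <= norm D * (c * r * norm D)" by (intro mult_left_mono L) auto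
 also have "\<dots> = c * r * (norm D)\<^sup>2" by (simp add: power2_eq_square)
 finally have "eps * \<bar>B\<bar> <= eps * (c * r * (norm D)\<^sup>2)" using eps by (intro mult_left_mono) auto
 also have "\<dots> = c * r * (eps * (norm D)\<^sup>2)" by simp
 also have "\<dots> <= c * r * (2 * E)" using cr E by (intro mult_left_mono)
 finally have B: "eps * \<bar>B\<bar> <= c * r * (2 * E)" .
 define w where "w = v \<bullet> (X - v)"
 have "\<bar>w\<bar> <= norm v * norm (X - v)" unfolding w_def by (rule Cauchy_Schwarz_ineq2)
 also have "\<dots> <= r * (c * r\<^sup>2)" using v X r by (intro mult_mono) auto
 finally have w: "\<bar>w\<bar> / r\<^sup>2 <= c * r" using r by (simp add: pos_divide_le_eq mult_ac)
 define y where "y = (v \<bullet> D) * (D \<bullet> (X - v))"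
 have "\<bar>y\<bar> = \<bar>v \<bullet> D\<bar> * \<bar>D \<bullet> (X - v)\<bar>" by (simp add: y_def abs_mult)
 also have "\<dots> <= (norm v * norm D) * (norm D * norm (X - v))" by (intro mult_mono Cauchy_Schwarz_ineq2) auto
 also have "\<dots> <= (r * norm D) * (norm D * (c * r\<^sup>2))" using v X r by (intro mult_mono) auto
 also have "\<dots> = (c * r * (norm D)\<^sup>2) * r\<^sup>2" by (simp add: power2_eq_square)
 finally have "\<bar>y\<bar> / r\<^sup>2 <= c * r * (norm D)\<^sup>2" using r by (simp add: pos_divide_le_eq)
 then have "eps * (\<bar>y\<bar> / r\<^sup>2) <= eps * (c * r * (norm D)\<^sup>2)" using eps by (intro mult_left_mono) auto
 also have "\<dots> = c * r * (eps * (norm D)\<^sup>2)" by simp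
 also have "\<dots> <= c * r * (2 * E)" using cr E by (intro mult_left_mono)
 finally have y: "eps * (\<bar>y\<bar> / r\<^sup>2) <= c * r * (2 * E)" .
 have "norm X <= norm v + norm (X - v)" using norm_triangle_ineq [of v "X - v"] by simp
 also have "\<dots> <= r + c * r\<^sup>2" using v X by (intro add_mono)
 also have "\<dots> <= r + c * r" using r c by (simp add: power2_eq_square mult_left_le_one_le mult_left_mono)
 finally have nX: "norm X <= (1 + c) * r" by (simp add: algebra_simps)
 have "\<bar>eps * ff * (k * (D \<bullet> X))\<bar> = (eps * \<bar>ff\<bar>) * (k * \<bar>D \<bullet> X\<bar>)" using eps k by (simp add: abs_mult)
 also have "\<dots> <= (eps * \<bar>ff\<bar>) * (1 * (norm D * norm X))"
  using eps k by (intro mult_left_mono mult_mono Cauchy_Schwarz_ineq2) auto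
 also have "\<dots> <= (eps * \<bar>ff\<bar>) * (1 * (norm D * ((1 + c) * r)))"
  using eps nX by (intro mult_left_mono) auto
 finally have F: "\<bar>eps * ff * (k * (D \<bullet> X))\<bar> <= r * ((1 + c) * (eps * \<bar>ff\<bar> * norm D))" by (simp add: mult_ac)
 have kA: "- (n * (c * r) * E) <= k * (A * E)"
 proof -
  have "\<bar>k * (A * E)\<bar> = k * (\<bar>A\<bar> * E)" using k E by (simp add: abs_mult)
  also have "\<dots> <= 1 * (n * (c * r) * E)" using k A E by (intro mult_mono) auto
  finally show ?thesis by simp
 qed
 have kB: "k * (eps * B) <= c * r * (2 * E)"
 proof -
  have "k * (eps * B) <= k * (eps * \<bar>B\<bar>)" using k eps by (intro mult_left_mono) auto
  also have "\<dots> <= 1 * (c * r * (2 * E))" using k B eps E cr by (intro mult_mono [OF k(2) B]) auto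
  finally show ?thesis by simp
 qed
 have kw: "k' * (E * (w / r\<^sup>2)) <= E * (c * r)"
 proof -
  have "w / r\<^sup>2 <= \<bar>w\<bar> / r\<^sup>2" using r by (intro divide_right_mono) auto
  then have "w / r\<^sup>2 <= c * r" using w by linarith
  then have "k' * (E * (w / r\<^sup>2)) <= k' * (E * (c * r))" using k E by (intro mult_left_mono) auto
  also have "\<dots> <= 1 * (E * (c * r))" using k E cr by (intro mult_right_mono) auto
  finally show ?thesis by simp
 qed
 have ky: "- (c * r * (2 * E)) <= k' * (eps * (y / r\<^sup>2))"
 proof -
  have "\<bar>k' * (eps * (y / r\<^sup>2))\<bar> = k' * (eps * (\<bar>y\<bar> / r\<^sup>2))" using k eps by (simp add: abs_mult)
  also have "\<dots> <= 1 * (c * r * (2 * E))" using k y eps E cr by (intro mult_mono [OF k(4) y]) auto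
  finally have "\<bar>k' * (eps * (y / r\<^sup>2))\<bar> <= c * r * (2 * E)" by (simp only: mult_1)
  from abs_le_D2 [OF this] show ?thesis by linarith
 qed
 have vD: "0 <= k' * (eps * ((v \<bullet> D)\<^sup>2 / r\<^sup>2))" using k eps by simp
 have eqR: "4 * k' * ((norm v)\<^sup>2 / r\<^sup>2) * E - (real DIM('a) - 1) * k * E +
   (E * (k * div_of L + 2 * k' * (- 2 * (v \<bullet> X) / r\<^sup>2)) - eps * (k * (D \<bullet> L D) + 2 * k' * (- 2 * (v \<bullet> D) / r\<^sup>2) * (D \<bullet> X)) - eps * ff * (k * (D \<bullet> X)))
  = k * (E - eps * (norm D)\<^sup>2) + k * (A * E) - k * (eps * B) - 4 * (k' * (E * (w / r\<^sup>2)))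
   + 4 * (k' * (eps * ((v \<bullet> D)\<^sup>2 / r\<^sup>2))) + 4 * (k' * (eps * (y / r\<^sup>2))) - eps * ff * (k * (D \<bullet> X))"
 proof -
  have 1: "div_of L = A + n" "D \<bullet> L D = B + (norm D)\<^sup>2" by (simp_all add: A_def B_def)
  have 2: "v \<bullet> X = w + (norm v)\<^sup>2" by (simp add: w_def inner_diff_right power2_norm_eq_inner)
  have 3: "(v \<bullet> D) * (D \<bullet> X) = y + (v \<bullet> D)\<^sup>2"
   by (simp add: y_def inner_diff_right power2_eq_square inner_commute algebra_simps)
  have "2 * k' * (- 2 * (v \<bullet> D) / r\<^sup>2) * (D \<bullet> X) = - 4 * k' * (((v \<bullet> D) * (D \<bullet> X)) / r\<^sup>2)" by simp
  then have 4: "2 * k' * (- 2 * (v \<bullet> D) / r\<^sup>2) * (D \<bullet> X) = - 4 * k' * ((y + (v \<bullet> D)\<^sup>2) / r\<^sup>2)" unfolding 3 .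
  show ?thesis unfolding 4 unfolding 1 2 n_def [symmetric] by (simp add: algebra_simps add_divide_distrib diff_divide_distrib)
 qed
 define q where "q = c * r * E"
 have eqL: "r * ((1 + c) * (eps * \<bar>ff\<bar> * norm D) + c * (DIM('a) + 14) * E) =
  r * ((1 + c) * (eps * \<bar>ff\<bar> * norm D)) + n * q + 14 * q"
  by (simp add: algebra_simps q_def n_def)
 have "- (n * q) <= k * (A * E)" "k * (eps * B) <= 2 * q" "k' * (E * (w / r\<^sup>2)) <= q" "- (2 * q) <= k' * (eps * (y / r\<^sup>2))"
  using kA kB kw ky by (simp_all add: q_def mult_ac)
 then show ?thesis unfolding eqR eqL using vD abs_le_D1 [OF F] by linarith
qed

text \<open>The derivative of the density ratio is the first variation in the direction of a truncated radial field. The energy density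
  minus \<open>eps * (norm Du)\<^sup>2\<close> is minus the discrepancy, which is why the ratio grows where the discrepancy is negative.\<close>

theorem monotonicity:
 assumes r: "0 < r" "r <= 1" and c: "0 <= c"
  and X: "\<And>x. x \<in> Om ==> (X has_derivative X' x) (at x)"
  and cX': "\<And>h. continuous_on (closure Om) (\<lambda>x. X' x h)" and cX: "continuous_on (closure Om) X"
  and t: "\<And>x. x \<in> frontier Om ==> cut p r x = 0 \<or> X x \<bullet> Z x = 0"
  and X1: "\<And>x. x \<in> Om ==> x \<in> ball p r ==> norm (X x - (x - p)) <= c * r\<^sup>2"
  and X2: "\<And>x h. x \<in> Om ==> x \<in> ball p r ==> norm (X' x h - h) <= c * r * norm h"
 shows "\<exists>D. (J p has_real_derivative D) (at r) \<and>
  ((\<integral>x. cut p r x * max 0 (- xi x) \<partial>leb Om) - (\<integral>x. indicator (ball p r) x * max 0 (xi x) \<partial>leb Om)) / r ^ DIM('a)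
   - (\<integral>x. indicator (ball p r) x * al c x \<partial>leb Om) / r ^ (DIM('a) - 1) <= D"
proof -
 define Y where "Y x = cut p r x *\<^sub>R X x" for x
 define Y' where "Y' x h = cut p r x *\<^sub>R X' x h + (2 * cut' p r x * (- 2 * ((x - p) \<bullet> h) / r\<^sup>2)) *\<^sub>R X x" for x h
 have cutd: "(cut p r has_derivative (\<lambda>h. 2 * cut' p r x * (- 2 * ((x - p) \<bullet> h) / r\<^sup>2))) (at x)" for x
 proof -
  have "((\<lambda>x. 1 - ((x - p) \<bullet> (x - p)) / r\<^sup>2) has_derivative (\<lambda>h. - 2 * ((x - p) \<bullet> h) / r\<^sup>2)) (at x)"
   using r by (auto intro!: derivative_eq_intros simp: inner_commute fun_eq_iff power4_eq_xxxx power2_eq_square)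
  from has_derivative_compose [OF this psq_deriv [unfolded has_field_derivative_def]]
  show ?thesis by (simp add: cut_def [abs_def] cut'_def power2_norm_eq_inner)
 qed
 have Yd: "(Y has_derivative Y' x) (at x)" if "x \<in> Om" for x
  unfolding Y_def Y'_def by (intro has_derivative_scaleR cutd X that)
 have cY': "continuous_on (closure Om) (\<lambda>x. Y' x h)" for h
  unfolding Y'_def using r by (intro continuous_intros cut_cont cX' cX) auto
 have cY: "continuous_on (closure Om) Y"
  unfolding Y_def using r by (intro continuous_intros cut_cont cX) auto
 have out: "cut p r x = 0" "cut' p r x = 0" if "x \<notin> ball p r" for x
  using cut_props(1,2,4,5) [OF r(1), of p x] that by auto
 have tY: "Y x \<bullet> Z x = 0" if "x \<in> frontier Om" for x using t [OF that] by (auto simp: Y_def)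
 define G where "G x = e x * div_of (Y' x) - eps * (Du x \<bullet> Y' x (Du x)) - eps * f x * (Du x \<bullet> Y x)" for x
 have G: "(\<integral>x. G x \<partial>leb Om) = 0" "integrable (leb Om) G"
  using first_variation [OF Yd cY' cY tY] by (simp_all add: G_def [abs_def])
 define P where "P x = 4 * cut' p r x * ((norm (x - p))\<^sup>2 / r\<^sup>2) * e x - real (DIM('a) - 1) * cut p r x * e x" for x
 note Jd = J_has_derivative [OF r(1), of p]
 have Pi: "integrable (leb Om) P"
  unfolding P_def [abs_def] using r by (intro integrable_cont continuous_intros cut_cont e_cont) auto
 let ?b = "indicator (ball p r) :: 'a => real"
 have Q1: "integrable (leb Om) (\<lambda>x. cut p r x * max 0 (- xi x))"
  using r by (intro integrable_cont continuous_intros cut_cont e_cont)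
 have Q2: "integrable (leb Om) (\<lambda>x. ?b x * max 0 (xi x))"
  by (intro emeasure_dens(2) continuous_intros e_cont) auto
 have Q3: "integrable (leb Om) (\<lambda>x. ?b x * al c x)"
  by (intro emeasure_dens(2) al_cont al_nonneg c) auto
 have pw: "cut p r x * max 0 (- xi x) - ?b x * max 0 (xi x) - r * (?b x * al c x) <= P x + G x" if x: "x \<in> Om" for x
 proof (cases "x \<in> ball p r")
  case False
  then have "Y' x = (\<lambda>h. 0)" "Y x = 0" using out by (simp_all add: Y'_def Y_def fun_eq_iff)
  then show ?thesis using False out by (simp add: P_def G_def div_of_def)
 next
  case True
  have lin: "linear (\<lambda>h. 2 * cut' p r x * (- 2 * ((x - p) \<bullet> h) / r\<^sup>2))"
   by (intro linearI) (auto simp: inner_add_right algebra_simps add_divide_distrib diff_divide_distrib)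
  have d: "div_of (Y' x) = cut p r x * div_of (X' x) + 2 * cut' p r x * (- 2 * ((x - p) \<bullet> X x) / r\<^sup>2)"
   unfolding Y'_def div_of_add div_of_scaleR div_of_rank1 [OF lin] ..
  have i: "Du x \<bullet> Y' x (Du x) = cut p r x * (Du x \<bullet> X' x (Du x)) + 2 * cut' p r x * (- 2 * ((x - p) \<bullet> Du x) / r\<^sup>2) * (Du x \<bullet> X x)"
   "Du x \<bullet> Y x = cut p r x * (Du x \<bullet> X x)" "real (DIM('a) - 1) = real DIM('a) - 1"
   by (simp_all only: Y'_def Y_def inner_add_right inner_scaleR_right of_nat_diff DIM_ge_Suc0 One_nat_def of_nat_Suc of_nat_0 add_0_left)
  have "cut p r x * (e x - eps * (norm (Du x))\<^sup>2) - r * al c x <= P x + G x"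
   unfolding P_def G_def al_def d i
   by (rule pointwise_first_variation [OF r _ c cut_props(1) [OF r(1)] cut_le_1(1) [OF r(1)] cut_props(4) [OF r(1)] cut_le_1(2) [OF r(1)]
      X1 [OF x True] X2 [OF x True] e_nonneg eps_Du_le])
    (use True in \<open>simp add: dist_norm norm_minus_commute\<close>)
  moreover have "e x - eps * (norm (Du x))\<^sup>2 = max 0 (- xi x) - max 0 (xi x)" by (simp add: e_def xi_def max_def)
  moreover have "cut p r x * max 0 (xi x) <= 1 * max 0 (xi x)"
   using cut_le_1 [OF r(1)] by (intro mult_right_mono) auto
  ultimately show ?thesis using True by (simp add: algebra_simps)
 qed
 have "(\<integral>x. cut p r x * max 0 (- xi x) - ?b x * max 0 (xi x) - r * (?b x * al c x) \<partial>leb Om) <= (\<integral>x. P x + G x \<partial>leb Om)"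
  using pw by (intro integral_mono Bochner_Integration.integrable_diff Bochner_Integration.integrable_add Q1 Q2 Pi G integrable_mult_right Q3) auto
 also have "\<dots> = (\<integral>x. P x \<partial>leb Om)" using Pi G by simp
 also have "(\<integral>x. cut p r x * max 0 (- xi x) - ?b x * max 0 (xi x) - r * (?b x * al c x) \<partial>leb Om) =
   (\<integral>x. cut p r x * max 0 (- xi x) \<partial>leb Om) - (\<integral>x. ?b x * max 0 (xi x) \<partial>leb Om) - r * (\<integral>x. ?b x * al c x \<partial>leb Om)"
  using Q1 Q2 Q3 by simp
 finally have I: "(\<integral>x. cut p r x * max 0 (- xi x) \<partial>leb Om) - (\<integral>x. ?b x * max 0 (xi x) \<partial>leb Om) - r * (\<integral>x. ?b x * al c x \<partial>leb Om)
  <= (\<integral>x. P x \<partial>leb Om)" .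
 obtain m where m: "DIM('a) = Suc m" using DIM_positive [where 'a='a] by (metis Suc_pred)
 have e: "(a - b) / r ^ DIM('a) - l / r ^ (DIM('a) - 1) = (a - b - r * l) / r ^ DIM('a)" for a b l
  using r by (simp add: m diff_divide_distrib)
 show ?thesis
  by (intro exI conjI, rule Jd, unfold e, rule divide_right_mono)
   (use I r in \<open>simp_all add: P_def\<close>)
qed

end

section \<open>The double well\<close>

lemma well_side:
 fixes W W' W'' :: "real => real"
 assumes W: "\<And>s. (W has_real_derivative W' s) (at s)" "\<And>s. (W' has_real_derivative W'' s) (at s)"
  and 1: "W 1 = 0" "W' 1 = 0" and b: "\<And>s. a <= s ==> s <= 1 ==> \<beta> <= W'' s \<and> W'' s <= C"
  and s: "a <= s" "s <= 1"
 shows "W' s <= \<beta> * (s - 1)" "\<beta> / 2 * (1 - s)\<^sup>2 <= W s" "W s <= C / 2 * (1 - s)\<^sup>2"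
proof -
 have lo: "W' t <= \<beta> * (t - 1)" if t: "a <= t" "t <= 1" for t
 proof -
  have "W' t - \<beta> * (t - 1) <= W' 1 - \<beta> * (1 - 1)"
  proof (rule DERIV_nonneg_imp_nondecreasing [OF t(2)])
   fix x assume "t <= x" "x <= 1"
   then have "((\<lambda>t. W' t - \<beta> * (t - 1)) has_real_derivative W'' x - \<beta>) (at x) \<and> 0 <= W'' x - \<beta>"
    using b [of x] t by (auto intro!: derivative_eq_intros W)
   then show "\<exists>y. ((\<lambda>t. W' t - \<beta> * (t - 1)) has_real_derivative y) (at x) \<and> 0 <= y" by blast
  qed
  then show ?thesis using 1 by simp
 qed
 have hi: "C * (t - 1) <= W' t" if t: "a <= t" "t <= 1" for t
 proof -
  have "W' 1 - C * (1 - 1) <= W' t - C * (t - 1)"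
  proof (rule DERIV_nonpos_imp_nonincreasing [OF t(2)])
   fix x assume "t <= x" "x <= 1"
   then have "((\<lambda>t. W' t - C * (t - 1)) has_real_derivative W'' x - C) (at x) \<and> W'' x - C <= 0"
    using b [of x] t by (auto intro!: derivative_eq_intros W)
   then show "\<exists>y. ((\<lambda>t. W' t - C * (t - 1)) has_real_derivative y) (at x) \<and> y <= 0" by blast
  qed
  then show ?thesis using 1 by simp
 qed
 show "W' s <= \<beta> * (s - 1)" using lo s .
 have "W 1 - \<beta> / 2 * (1 - 1)\<^sup>2 <= W s - \<beta> / 2 * (1 - s)\<^sup>2"
 proof (rule DERIV_nonpos_imp_nonincreasing [OF s(2)])
  fix x assume "s <= x" "x <= 1"
  then have "((\<lambda>t. W t - \<beta> / 2 * (1 - t)\<^sup>2) has_real_derivative W' x - \<beta> * (x - 1)) (at x) \<and> W' x - \<beta> * (x - 1) <= 0"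
   using lo [of x] s by (auto intro!: derivative_eq_intros W simp: field_simps)
  then show "\<exists>y. ((\<lambda>t. W t - \<beta> / 2 * (1 - t)\<^sup>2) has_real_derivative y) (at x) \<and> y <= 0" by blast
 qed
 then show "\<beta> / 2 * (1 - s)\<^sup>2 <= W s" using 1 by simp
 have "W s - C / 2 * (1 - s)\<^sup>2 <= W 1 - C / 2 * (1 - 1)\<^sup>2"
 proof (rule DERIV_nonneg_imp_nondecreasing [OF s(2)])
  fix x assume "s <= x" "x <= 1"
  then have "((\<lambda>t. W t - C / 2 * (1 - t)\<^sup>2) has_real_derivative W' x - C * (x - 1)) (at x) \<and> 0 <= W' x - C * (x - 1)"
   using hi [of x] s by (auto intro!: derivative_eq_intros W simp: field_simps)
  then show "\<exists>y. ((\<lambda>t. W t - C / 2 * (1 - t)\<^sup>2) has_real_derivative y) (at x) \<and> 0 <= y" by blast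
 qed
 then show "W s <= C / 2 * (1 - s)\<^sup>2" using 1 by simp
qed

locale well =
 fixes W W' W'' :: "real => real" and \<alpha> \<beta> \<gamma> :: real
 assumes W_deriv: "\<And>s. (W has_real_derivative W' s) (at s)" and W'_deriv: "\<And>s. (W' has_real_derivative W'' s) (at s)"
  and W''_cont: "continuous_on UNIV W''"
  and W_zero: "W 1 = 0" "W (- 1) = 0" and W_pos: "\<And>s. s \<noteq> 1 ==> s \<noteq> - 1 ==> 0 < W s"
  and ab: "0 < \<alpha>" "\<alpha> < 1" "0 < \<beta>" and W''_ge: "\<And>s. \<alpha> <= \<bar>s\<bar> ==> \<bar>s\<bar> <= 1 ==> \<beta> <= W'' s"
  and \<gamma>: "- 1 < \<gamma>" "\<gamma> < 1" "\<And>s. \<bar>s\<bar> <= 1 ==> W' s * (s - \<gamma>) <= 0"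
begin

lemma W_nonneg: "0 <= W s" using W_pos [of s] W_zero by (cases "s = 1 \<or> s = - 1") auto

lemma W'_cont: "continuous_on S W'" and W_cont: "continuous_on S W"
 by (meson W_deriv W'_deriv DERIV_isCont continuous_at_imp_continuous_on)+

lemma W'_zero: "W' 1 = 0" "W' (- 1) = 0"
 using DERIV_local_min [OF W_deriv [of 1], of 1] DERIV_local_min [OF W_deriv [of "- 1"], of 1] W_zero W_nonneg by auto

lemma estimates:
 obtains c C where "0 < c" "0 < C" "\<And>s. \<bar>s\<bar> <= 1 ==> c * (1 - \<bar>s\<bar>)\<^sup>2 <= W s"
  "\<And>s. \<alpha> <= \<bar>s\<bar> ==> \<bar>s\<bar> <= 1 ==> W s <= C * (1 - \<bar>s\<bar>)\<^sup>2"
  "\<And>s. \<alpha> <= s ==> s <= 1 ==> W' s <= - (\<beta> * (1 - s))"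
  "\<And>s. \<alpha> <= - s ==> - 1 <= s ==> \<beta> * (1 + s) <= W' s"
  "\<And>s. \<bar>s\<bar> <= \<alpha> ==> \<bar>W' s\<bar> <= C * W s"
proof -
 have bd: "\<exists>C. \<forall>s. \<bar>s\<bar> <= 1 --> \<bar>f s\<bar> <= C" if "continuous_on UNIV f" for f :: "real => real"
 proof -
  have "bounded (f ` {-1..1})"
   using that by (intro compact_imp_bounded compact_continuous_image) (auto intro: continuous_on_subset)
  then obtain C where C: "\<forall>x\<in>f ` {-1..1}. norm x <= C" unfolding bounded_iff by blast
  have "\<bar>f s\<bar> <= C" if "\<bar>s\<bar> <= 1" for s using C that by (simp add: abs_le_iff)
  then show ?thesis by blast
 qed
 obtain C2 where C2: "\<And>s. \<bar>s\<bar> <= 1 ==> \<bar>W'' s\<bar> <= C2"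
  using bd [OF W''_cont] by blast
 obtain C1 where C1: "\<And>s. \<bar>s\<bar> <= 1 ==> \<bar>W' s\<bar> <= C1"
  using bd [OF W'_cont] by blast
 obtain s0 where "s0 \<in> {- \<alpha>..\<alpha>}" "\<forall>s\<in>{- \<alpha>..\<alpha>}. W s0 <= W s"
  using continuous_attains_inf [OF compact_Icc _ W_cont, of "- \<alpha>" \<alpha>] ab by auto
 then have s0: "\<bar>s0\<bar> <= \<alpha>" "\<And>s. \<bar>s\<bar> <= \<alpha> ==> W s0 <= W s" by (auto simp: abs_le_iff)
 define w0 where "w0 = W s0"
 have w0: "0 < w0" using s0(1) ab unfolding w0_def by (intro W_pos) auto
 have right: "W' s <= \<beta> * (s - 1) \<and> \<beta> / 2 * (1 - s)\<^sup>2 <= W s \<and> W s <= C2 / 2 * (1 - s)\<^sup>2" if s: "\<alpha> <= s" "s <= 1" for s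
 proof -
  have b: "\<beta> <= W'' s \<and> W'' s <= C2" if "\<alpha> <= s" "s <= 1" for s
   using W''_ge [of s] C2 [of s] that ab by auto
  show ?thesis using well_side [OF W_deriv W'_deriv W_zero(1) W'_zero(1) b s] by blast
 qed
 have left: "\<beta> * (1 + s) <= W' s \<and> \<beta> / 2 * (1 + s)\<^sup>2 <= W s \<and> W s <= C2 / 2 * (1 + s)\<^sup>2" if s: "\<alpha> <= - s" "- 1 <= s" for s
 proof -
  have b: "\<beta> <= W'' (- s) \<and> W'' (- s) <= C2" if "\<alpha> <= s" "s <= 1" for s
   using W''_ge [of "- s"] C2 [of "- s"] that ab by auto
  have d1: "((\<lambda>s. W (- s)) has_real_derivative - W' (- s)) (at s)" for s
   using DERIV_chain2 [where f = W and g = uminus and x = s, OF W_deriv DERIV_minus [OF DERIV_ident]] by simp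
  have d2: "((\<lambda>s. - W' (- s)) has_real_derivative W'' (- s)) (at s)" for s
   using DERIV_minus [OF DERIV_chain2 [where f = W' and g = uminus and x = s, OF W'_deriv DERIV_minus [OF DERIV_ident]]] by simp
  show ?thesis using well_side [OF d1 d2 _ _ b, of \<alpha> "- s"] s W_zero W'_zero by (auto simp: algebra_simps)
 qed
 define c where "c = min (\<beta> / 2) w0"
 define C where "C = max 1 (max (C2 / 2) (C1 / w0))"
 have lower: "c * (1 - \<bar>s\<bar>)\<^sup>2 <= W s" if s: "\<bar>s\<bar> <= 1" for s
 proof -
  consider "\<bar>s\<bar> <= \<alpha>" | "\<alpha> <= s" | "\<alpha> <= - s" by linarith
  then show ?thesis
  proof cases
   case 1
   have "c * (1 - \<bar>s\<bar>)\<^sup>2 <= w0 * 1" using s w0 ab by (intro mult_mono) (auto simp: c_def power_le_one)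
   also have "\<dots> <= W s" using s0(2) [OF 1] by (simp add: w0_def)
   finally show ?thesis .
  next
   case 2
   have "c * (1 - \<bar>s\<bar>)\<^sup>2 <= \<beta> / 2 * (1 - \<bar>s\<bar>)\<^sup>2" by (intro mult_right_mono) (auto simp: c_def)
   then show ?thesis using right [of s] 2 s ab by simp
  next
   case 3
   have "c * (1 - \<bar>s\<bar>)\<^sup>2 <= \<beta> / 2 * (1 - \<bar>s\<bar>)\<^sup>2" by (intro mult_right_mono) (auto simp: c_def)
   then show ?thesis using left [of s] 3 s ab by simp
  qed
 qed
 have upper: "W s <= C * (1 - \<bar>s\<bar>)\<^sup>2" if s: "\<alpha> <= \<bar>s\<bar>" "\<bar>s\<bar> <= 1" for s
 proof -
  have "C2 / 2 * (1 - \<bar>s\<bar>)\<^sup>2 <= C * (1 - \<bar>s\<bar>)\<^sup>2"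
   unfolding C_def by (intro mult_right_mono max.coboundedI2 max.coboundedI1 order_refl) simp
  moreover have "W s <= C2 / 2 * (1 - \<bar>s\<bar>)\<^sup>2" using right [of s] left [of s] s by (cases "0 <= s") auto
  ultimately show ?thesis by linarith
 qed
 have mid: "\<bar>W' s\<bar> <= C * W s" if "\<bar>s\<bar> <= \<alpha>" for s
 proof -
  have "\<bar>W' s\<bar> <= C1" using C1 [of s] that ab by simp
  also have "\<dots> = (C1 / w0) * w0" using w0 by simp
  also have "\<dots> <= C * W s" using w0 s0(2) [OF that] by (intro mult_mono) (auto simp: C_def w0_def)
  finally show ?thesis .
 qed
 show ?thesis
 proof (rule that [of c C])
  show "0 < c" "0 < C" using ab w0 by (auto simp: c_def C_def)
  show "W' s <= - (\<beta> * (1 - s))" if "\<alpha> <= s" "s <= 1" for s using right [OF that] by (simp add: algebra_simps)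
  show "\<beta> * (1 + s) <= W' s" if "\<alpha> <= - s" "- 1 <= s" for s using left [OF that] by blast
 qed (use lower upper mid in blast)+
qed

text \<open>A test function of \<open>u\<close> that vanishes at the wells, is of size \<open>1 / k\<close>, and has derivative at least 1/4 within distance \<open>1 / (4 * k)\<close> of the
  wells, while its derivative is bounded below by \<open>- 1 / (2 * k)\<close> elsewhere.\<close>

definition g :: "nat => real => real" where "g k s = (s ^ (2 * k + 1) - s) / (2 * k)"
definition g' :: "nat => real => real" where "g' k s = (real (2 * k + 1) * s ^ (2 * k) - 1) / (2 * k)"

lemma g_deriv: "(g k has_real_derivative g' k s) (at s)"
proof -
 have "((\<lambda>s. s ^ (2 * k + 1)) has_real_derivative real (2 * k + 1) * s ^ (2 * k)) (at s)"
  using DERIV_pow [of "2 * k + 1" s] by simp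
 from DERIV_cdivide [OF DERIV_diff [OF this DERIV_ident]] show ?thesis
  unfolding g_def [abs_def] g'_def .
qed

lemma g_bounds:
 fixes k :: nat
 assumes k: "1 <= k" and s: "\<bar>s\<bar> <= 1"
 shows "\<bar>g k s\<bar> <= 1 / (2 * real k)" "- (1 / (2 * real k)) <= g' k s" "g k s * s <= 0"
  "1 - 1 / (4 * real k) <= \<bar>s\<bar> ==> 1/4 <= g' k s"
  "1 - 1 / (4 * real k) <= \<bar>s\<bar> ==> (1 - \<bar>s\<bar>) / 4 <= \<bar>g k s\<bar>"
proof -
 have k0: "0 < real k" "1 <= real k" using k by auto
 define p where "p = \<bar>s\<bar> ^ (2 * k)"
 have p: "s ^ (2 * k) = p" "0 <= p" "p <= 1"
  using s by (auto simp: p_def power_mult power_le_one abs_square_le_1)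
 have gs: "g k s = - (s * (1 - p) / (2 * k))" "g' k s = ((2 * k + 1) * p - 1) / (2 * k)"
  using p by (simp_all add: g_def g'_def algebra_simps diff_divide_distrib)
 have "\<bar>s * (1 - p)\<bar> <= 1 * 1" unfolding abs_mult using s p by (intro mult_mono) auto
 then show "\<bar>g k s\<bar> <= 1 / (2 * real k)" unfolding gs abs_minus abs_divide using k0 by (simp add: divide_right_mono)
 show "- (1 / (2 * real k)) <= g' k s" unfolding gs using k0 p by (simp add: field_simps)
 have "g k s * s = - (s\<^sup>2 * (1 - p) / (2 * k))" unfolding gs by (simp add: power2_eq_square)
 then show "g k s * s <= 0" using p k0 by simp
 assume n: "1 - 1 / (4 * real k) <= \<bar>s\<bar>"
 have q: "0 <= 1 / (4 * real k)" "1 / (4 * real k) <= 1/4" using k0 by (auto simp: field_simps)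
 have "1 + real (2 * k) * (- (1 / (4 * real k))) <= (1 + (- (1 / (4 * real k)))) ^ (2 * k)"
  using q by (intro Bernoulli_inequality) linarith
 also have "\<dots> <= p" unfolding p_def using n q by (intro power_mono) linarith+
 finally have p2: "1/2 <= p" using k0 by (simp add: field_simps)
 show "1/4 <= g' k s"
 proof -
  have "(2 * k + 1) * (1/2) <= (2 * k + 1) * p" using p2 by (intro mult_left_mono) auto
  then have "real k / 2 <= (2 * k + 1) * p - 1" using k0 by (simp add: algebra_simps)
  then have "(real k / 2) / (2 * k) <= g' k s" unfolding gs using k0 by (intro divide_right_mono) auto
  then show ?thesis using k0 by simp
 qed
 have "(1 - \<bar>s\<bar>) * (real (2 * k) * p) <= 1 - p"
 proof -
  have "1 - p = (1 - \<bar>s\<bar>) * (\<Sum>i<2 * k. \<bar>s\<bar> ^ i)" unfolding p_def by (rule one_diff_power_eq)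
  moreover have "(\<Sum>i<2 * k. p) <= (\<Sum>i<2 * k. \<bar>s\<bar> ^ i)"
   unfolding p_def using s by (intro sum_mono power_decreasing) auto
  then have "real (2 * k) * p <= (\<Sum>i<2 * k. \<bar>s\<bar> ^ i)" by simp
  ultimately show ?thesis using s by (simp add: mult_left_mono)
 qed
 moreover have "(1 - \<bar>s\<bar>) * (real (2 * k) * (1/2)) <= (1 - \<bar>s\<bar>) * (real (2 * k) * p)"
  using p2 s by (intro mult_left_mono) auto
 ultimately have "(1 - \<bar>s\<bar>) * k <= 1 - p" by simp
 then have 1: "(1 - \<bar>s\<bar>) / 2 <= (1 - p) / (2 * k)" using k0 by (simp add: field_simps)
 have "3/4 <= \<bar>s\<bar>" using n q by linarith
 then have "(1/2) * ((1 - \<bar>s\<bar>) / 2) <= \<bar>s\<bar> * ((1 - p) / (2 * k))" using 1 s by (intro mult_mono) auto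
 also have "\<dots> = \<bar>g k s\<bar>" unfolding gs abs_minus using p k0 by (simp add: abs_mult)
 finally show "(1 - \<bar>s\<bar>) / 4 <= \<bar>g k s\<bar>" by simp
qed

lemma gW'_bounds:
 obtains c C where "0 < c" "0 < C"
  "\<And>k s. 1 <= k ==> \<bar>s\<bar> <= 1 ==> - (C / real k * W s) <= g k s * W' s"
  "\<And>k s. 1 <= k ==> \<bar>s\<bar> <= 1 ==> \<alpha> <= 1 - 1 / (4 * real k) ==> 1 - 1 / (4 * real k) <= \<bar>s\<bar> ==> c * W s <= g k s * W' s"
proof -
 obtain c C where c: "0 < c" "0 < C" "\<And>s. \<bar>s\<bar> <= 1 ==> c * (1 - \<bar>s\<bar>)\<^sup>2 <= W s"
  "\<And>s. \<alpha> <= \<bar>s\<bar> ==> \<bar>s\<bar> <= 1 ==> W s <= C * (1 - \<bar>s\<bar>)\<^sup>2"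
  "\<And>s. \<alpha> <= s ==> s <= 1 ==> W' s <= - (\<beta> * (1 - s))"
  "\<And>s. \<alpha> <= - s ==> - 1 <= s ==> \<beta> * (1 + s) <= W' s"
  "\<And>s. \<bar>s\<bar> <= \<alpha> ==> \<bar>W' s\<bar> <= C * W s" by (rule estimates) (rule that)
 have sg: "\<bar>g k s\<bar> * (\<beta> * (1 - \<bar>s\<bar>)) <= g k s * W' s" if k: "1 <= k" and s: "\<bar>s\<bar> <= 1" "\<alpha> <= \<bar>s\<bar>" for k s
 proof (cases "0 <= s")
  case True
  then have "g k s <= 0" using g_bounds(3) [OF k s(1)] s ab by (auto simp: mult_le_0_iff)
  moreover have "W' s <= - (\<beta> * (1 - s))" using c(5) s True by simp
  ultimately have "(- g k s) * (\<beta> * (1 - s)) <= (- g k s) * (- W' s)" by (intro mult_left_mono) auto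
  then show ?thesis using True \<open>g k s <= 0\<close> by simp
 next
  case False
  then have "0 <= g k s" using g_bounds(3) [OF k s(1)] s ab by (auto simp: mult_le_0_iff)
  moreover have "\<beta> * (1 + s) <= W' s" using c(6) s False by simp
  ultimately have "g k s * (\<beta> * (1 + s)) <= g k s * W' s" by (intro mult_left_mono) auto
  then show ?thesis using False \<open>0 <= g k s\<close> by simp
 qed
 show ?thesis
 proof (rule that [of "\<beta> / (4 * C)" C])
  show "0 < \<beta> / (4 * C)" "0 < C" using c ab by auto
  fix k :: nat and s :: real assume k: "1 <= k" and s: "\<bar>s\<bar> <= 1"
  show "- (C / real k * W s) <= g k s * W' s"
  proof (cases "\<alpha> <= \<bar>s\<bar>")
   case True
   have "0 <= \<bar>g k s\<bar> * (\<beta> * (1 - \<bar>s\<bar>))" using s ab by simp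
   also have "\<dots> <= g k s * W' s" by (rule sg [OF k s True])
   finally have "0 <= g k s * W' s" .
   moreover have "0 <= C / real k * W s" using c W_nonneg by simp
   ultimately show ?thesis by linarith
  next
   case False
   have "\<bar>g k s * W' s\<bar> <= (1 / (2 * real k)) * (C * W s)"
    unfolding abs_mult using g_bounds(1) [OF k s] c(7) [of s] False by (intro mult_mono) auto
   also have "\<dots> = (C / real k * W s) / 2" by simp
   finally have 1: "\<bar>g k s * W' s\<bar> <= (C / real k * W s) / 2" .
   have 2: "0 <= C / real k * W s" using c W_nonneg by simp
   have "- q <= w" if "\<bar>w\<bar> <= q / 2" "0 <= q" for q w :: real using that by linarith
   from this [OF 1 2] show ?thesis .
  qed
  assume a: "\<alpha> <= 1 - 1 / (4 * real k)" and n: "1 - 1 / (4 * real k) <= \<bar>s\<bar>"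
  have as: "\<alpha> <= \<bar>s\<bar>" using a n by linarith
  have "\<beta> / (4 * C) * W s <= \<beta> / (4 * C) * (C * (1 - \<bar>s\<bar>)\<^sup>2)"
   using c ab by (intro mult_left_mono c(4) as s) auto
  also have "\<dots> = (1 - \<bar>s\<bar>) / 4 * (\<beta> * (1 - \<bar>s\<bar>))" using c by (simp add: power2_eq_square)
  also have "\<dots> <= \<bar>g k s\<bar> * (\<beta> * (1 - \<bar>s\<bar>))"
   using s ab by (intro mult_right_mono g_bounds(5) k n) auto
  also have "\<dots> <= g k s * W' s" by (rule sg [OF k s as])
  finally show "\<beta> / (4 * C) * W s <= g k s * W' s" .
 qed
qed

end

section \<open>Interior cones and the energy near the wells\<close>

context C2_domain
begin

lemma z_taylor:
 obtains B where "0 < B" "\<And>x h. x \<in> closure Om ==> norm h <= 2 ==> \<bar>z (x + h) - z x - Z x \<bullet> h\<bar> <= B * (norm h)\<^sup>2"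
proof -
 obtain R where R: "\<And>x. x \<in> closure Om ==> norm x <= R"
  using compact_imp_bounded [OF compact_closure] by (auto simp: bounded_iff)
 have Z'c: "continuous_on S (\<lambda>x. Z' x h)" for S h
  by (rule continuous_on_subset [OF Z'_cont subset_UNIV])
 obtain B where B: "0 < B" "\<And>x h. x \<in> cball 0 (R + 2) ==> norm (Z' x h) <= B * norm h"
  using linear_uniform_bound [OF compact_cball Z'_linear Z'c] by blast
 have "\<bar>z (x + h) - z x - Z x \<bullet> h\<bar> <= B * (norm h)\<^sup>2" if x: "x \<in> closure Om" and h: "norm h <= 2" for x h
 proof -
  have sh: "norm (s *\<^sub>R h) <= norm h" if "0 <= s" "s <= 1" for s using that by (simp add: mult_left_le_one_le)
  have K: "norm (x + k) <= R + 2" if "norm k <= norm h" for k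
   using norm_triangle_ineq [of x k] R [OF x] h that by linarith
  have Zd: "norm (Z (x + k) - Z x) <= B * norm h" if k: "norm k <= norm h" for k
  proof -
   have "norm (Z (x + k) - Z x) <= B * norm k"
   proof (rule line_increment_bound [where f' = Z'])
    fix s :: real assume s: "0 <= s" "s <= 1"
    show "(Z has_derivative Z' (x + s *\<^sub>R k)) (at (x + s *\<^sub>R k))" by (rule Z_deriv)
    have "norm (s *\<^sub>R k) <= norm k" using s by (simp add: mult_left_le_one_le)
    then show "norm (Z' (x + s *\<^sub>R k) k) <= B * norm k" using K [of "s *\<^sub>R k"] k by (intro B) auto
   qed
   also have "\<dots> <= B * norm h" using k B by simp
   finally show ?thesis .
  qed
  define w where "w y = z y - Z x \<bullet> y" for y
  have "norm (w (x + h) - w x) <= B * (norm h)\<^sup>2"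
  proof (rule line_increment_bound [where f' = "\<lambda>y k. (Z y - Z x) \<bullet> k"])
   fix s :: real assume s: "0 <= s" "s <= 1"
   have "(w has_derivative (\<lambda>k. Z (x + s *\<^sub>R h) \<bullet> k - Z x \<bullet> k)) (at (x + s *\<^sub>R h))"
    unfolding w_def [abs_def] by (intro has_derivative_diff z_deriv has_derivative_inner_right has_derivative_ident)
   then show "(w has_derivative (\<lambda>k. (Z (x + s *\<^sub>R h) - Z x) \<bullet> k)) (at (x + s *\<^sub>R h))"
    by (simp only: inner_diff_left)
   have "norm ((Z (x + s *\<^sub>R h) - Z x) \<bullet> h) <= norm (Z (x + s *\<^sub>R h) - Z x) * norm h"
    using Cauchy_Schwarz_ineq2 by simp
   also have "\<dots> <= (B * norm h) * norm h" using Zd [OF sh [OF s]] by (intro mult_right_mono) auto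
   finally show "norm ((Z (x + s *\<^sub>R h) - Z x) \<bullet> h) <= B * (norm h)\<^sup>2" by (simp add: power2_eq_square mult.assoc)
  qed
  then show ?thesis by (simp add: w_def inner_add_right algebra_simps)
 qed
 then show ?thesis using B(1) that by blast
qed

text \<open>Where \<open>z\<close> is close to 0 the gradient is not, and \<open>- Z x\<close> is a direction of uniform decrease; elsewhere \<open>z\<close> is so negative that
  every short step stays inside.\<close>

lemma interior_cone:
 obtains \<rho> c where "0 < \<rho>" "0 < c" "c <= 1"
  "\<And>x. x \<in> closure Om ==> \<exists>w. norm w <= 1 \<and> (\<forall>t v. 0 < t --> t <= \<rho> --> norm v < c --> x + t *\<^sub>R (w + v) \<in> Om)"
proof -
 obtain m where m: "0 < m" "\<And>x. x \<in> closure Om ==> m <= (norm (Z x))\<^sup>2 + (z x)\<^sup>2" using nondegenerate by blast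
 obtain B where B: "0 < B" "\<And>x h. x \<in> closure Om ==> norm h <= 2 ==> \<bar>z (x + h) - z x - Z x \<bullet> h\<bar> <= B * (norm h)\<^sup>2"
  using z_taylor by blast
 obtain C where C: "0 < C" "\<And>x. x \<in> closure Om ==> norm (Z x) <= C" using bounded_on_closure [OF Z_cont] by blast
 define b where "b = m / (8 * C)"
 have b: "0 < b" using m C by (simp add: b_def)
 define c where "c = min 1 (b / C)"
 define \<rho> where "\<rho> = min 1 (min (b / (4 * B)) (sqrt (m/2) / (2 * (C + 4 * B))))"
 have pos: "0 < c" "c <= 1" "0 < \<rho>" "\<rho> <= 1" using b B C m by (auto simp: c_def \<rho>_def)
 have "\<exists>w. norm w <= 1 \<and> (\<forall>t v. 0 < t --> t <= \<rho> --> norm v < c --> x + t *\<^sub>R (w + v) \<in> Om)"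
  if x: "x \<in> closure Om" for x
 proof -
  have taylor: "z (x + t *\<^sub>R (w + v)) <= z x + t * (Z x \<bullet> (w + v)) + 4 * B * t\<^sup>2"
   if t: "0 < t" "t <= \<rho>" and v: "norm v < c" and w: "norm w <= 1" for t v w
  proof -
   have n: "norm (w + v) <= 2" using norm_triangle_ineq [of w v] v w pos by linarith
   then have nt: "norm (t *\<^sub>R (w + v)) <= t * 2" using t by (simp add: mult_left_mono)
   then have "norm (t *\<^sub>R (w + v)) <= 2" using t pos by linarith
   from B(2) [OF x this]
   have "\<bar>z (x + t *\<^sub>R (w + v)) - z x - Z x \<bullet> (t *\<^sub>R (w + v))\<bar> <= B * (norm (t *\<^sub>R (w + v)))\<^sup>2" .
   also have "\<dots> <= B * (t * 2)\<^sup>2" using nt B by (intro mult_left_mono power_mono) auto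
   finally show ?thesis by (simp add: power_mult_distrib)
  qed
  consider "m/2 <= (norm (Z x))\<^sup>2" | "m/2 <= (z x)\<^sup>2" using m(2) [OF x] by linarith
  then show ?thesis
  proof cases
   case 1
   define w where "w = - (1 / C) *\<^sub>R Z x"
   have w1: "norm w <= 1" using C x by (simp add: w_def divide_le_eq)
   have "x + t *\<^sub>R (w + v) \<in> Om" if t: "0 < t" "t <= \<rho>" and v: "norm v < c" for t v
   proof -
    have "Z x \<bullet> w = - ((norm (Z x))\<^sup>2 / C)" by (simp add: w_def power2_norm_eq_inner)
    also have "\<dots> <= - (4 * b)" using 1 C by (simp add: b_def field_simps)
    finally have zw: "Z x \<bullet> w <= - (4 * b)" .
    have "Z x \<bullet> v <= norm (Z x) * norm v" by (rule norm_cauchy_schwarz)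
    also have "\<dots> <= C * (b / C)" using C x v by (intro mult_mono) (auto simp: c_def)
    finally have zv: "Z x \<bullet> v <= b" using C by simp
    have "4 * B * t <= b" using t B by (simp add: \<rho>_def field_simps)
    then have "4 * B * t\<^sup>2 <= t * b" using t by (simp add: power2_eq_square mult.commute mult_left_mono)
    moreover have "t * (Z x \<bullet> (w + v)) <= t * (- 3 * b)"
     using zw zv t by (intro mult_left_mono) (auto simp: inner_add_right)
    moreover have "0 < t * b" using t b by simp
    ultimately have "z (x + t *\<^sub>R (w + v)) < 0" using taylor [OF t v w1] z_closure [OF x] by simp
    then show ?thesis by (simp add: Om_eq)
   qed
   then show ?thesis using w1 by blast
  next
   case 2
   define s where "s = sqrt (m/2)"
   have s: "0 < s" using m by (simp add: s_def)
   have "s <= \<bar>z x\<bar>" using real_sqrt_le_mono [OF 2] by (simp add: s_def)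
   then have zs: "z x <= - s" using z_closure [OF x] by simp
   have "x + t *\<^sub>R (0 + v) \<in> Om" if t: "0 < t" "t <= \<rho>" and v: "norm v < c" for t v
   proof -
    have "Z x \<bullet> (0 + v) <= norm (Z x) * norm v" by (simp add: norm_cauchy_schwarz)
    also have "\<dots> <= C * 1" using C x v pos by (intro mult_mono) auto
    finally have "t * (Z x \<bullet> (0 + v)) <= t * C" using t by (intro mult_left_mono) auto
    moreover have "4 * B * t\<^sup>2 <= 4 * B * t"
    proof -
     have "t * t <= t * 1" using t pos by (intro mult_left_mono) auto
     then show ?thesis using B by (simp add: power2_eq_square)
    qed
    moreover have "t * (C + 4 * B) < s"
    proof -
     have "t <= s / (2 * (C + 4 * B))" using t by (simp add: \<rho>_def s_def)
     then have "t * (C + 4 * B) <= s / 2" using C B by (simp add: field_simps)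
     then show ?thesis using s by simp
    qed
    then have "t * C + 4 * B * t < s" by (simp add: algebra_simps)
    ultimately have "z (x + t *\<^sub>R (0 + v)) < 0" using taylor [OF t v, of 0] zs by simp
    then show ?thesis by (simp add: Om_eq)
   qed
   then show ?thesis by (intro exI [of _ 0]) auto
  qed
 qed
 then show ?thesis using pos that by blast
qed

end

context slice
begin

lemma frontier_ne: "frontier Om \<noteq> {}"
 using Om_ne bounded_Om not_bounded_UNIV frontier_eq_empty by metis

lemma almost_monotone_slice:
 assumes c: "0 <= c"
  and X: "\<And>p x. x \<in> Om ==> (X p has_derivative X' p x) (at x)"
  and cX': "\<And>p h. continuous_on (closure Om) (\<lambda>x. X' p x h)" and cX: "\<And>p. continuous_on (closure Om) (X p)"
  and t: "\<And>p x. x \<in> frontier Om ==> X p x \<bullet> Z x = 0"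
  and X1: "\<And>p x r. p \<in> frontier Om ==> x \<in> Om ==> x \<in> ball p r ==> r <= 1 ==> norm (X p x - (x - p)) <= c * r\<^sup>2"
  and X2: "\<And>p x h r. p \<in> frontier Om ==> x \<in> Om ==> x \<in> ball p r ==> r <= 1 ==> norm (X' p x h - h) <= c * r * norm h"
 shows "almost_monotone (DIM('a) - 1) (dens e) (dens (\<lambda>x. max 0 (xi x))) (dens (\<lambda>x. max 0 (- xi x))) (dens (al c))
  (frontier Om) Om J"
proof -
 have cp: "continuous_on (closure Om) (\<lambda>x. max 0 (xi x))" and cm: "continuous_on (closure Om) (\<lambda>x. max 0 (- xi x))"
  by (intro continuous_intros e_cont)+
 note me = measure_dens [OF e_cont(1) e_nonneg] and mp = measure_dens [OF cp max.cobounded1]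
  and mm = measure_dens [OF cm max.cobounded1] and ma = measure_dens [OF al_cont al_nonneg [OF c]]
 obtain m where m: "DIM('a) = Suc m" using DIM_positive [where 'a='a] by (metis Suc_pred)
 have rJ: "r ^ (DIM('a) - 1) * J p r = (\<integral>x. cut p r x * e x \<partial>leb Om)" if "0 < r" for p r
  using that by (simp add: J_def)
 show ?thesis
 proof (rule almost_monotone.intro)
  show "finite_measure (dens e)" "finite_measure (dens (\<lambda>x. max 0 (xi x)))" "finite_measure (dens (\<lambda>x. max 0 (- xi x)))" "finite_measure (dens (al c))"
   using finite_measure_dens [OF e_cont(1) e_nonneg] finite_measure_dens [OF cp max.cobounded1]
    finite_measure_dens [OF cm max.cobounded1] finite_measure_dens [OF al_cont al_nonneg [OF c]] by simp_all
  show "closed (frontier Om)" "frontier Om \<noteq> {}" "frontier Om \<inter> Om = {}"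
   using frontier_ne open_Om by (auto simp: frontier_def interior_open)
  fix p r assume r: "0 < (r::real)"
  have ir: "integrable (leb Om) (\<lambda>x. indicator (ball p s) x * e x)" for s
   by (intro emeasure_dens(2) e_cont e_nonneg) auto
  have icut: "integrable (leb Om) (\<lambda>x. cut p r x * e x)" by (intro integrable_cont continuous_intros cut_cont r e_cont)
  have "measure (dens e) (ball p (r/2)) / 2 = (\<integral>x. (indicator (ball p (r/2)) x / 2) * e x \<partial>leb Om)"
   by (subst me) auto
  also have "\<dots> <= (\<integral>x. cut p r x * e x \<partial>leb Om)"
  proof (rule integral_mono)
   show "integrable (leb Om) (\<lambda>x. (indicator (ball p (r/2)) x / 2) * e x)" using ir [of "r/2"] by simp
  qed (rule icut mult_right_mono [OF cut_props(3) [OF r] e_nonneg])+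
  finally show "measure (dens e) (ball p (r/2)) / 2 <= r ^ (DIM('a) - 1) * J p r" unfolding rJ [OF r] .
  have "(\<integral>x. cut p r x * e x \<partial>leb Om) <= (\<integral>x. indicator (ball p r) x * e x \<partial>leb Om)"
   using icut cut_props(2) [OF r] e_nonneg ir by (intro integral_mono mult_right_mono) auto
  then show "r ^ (DIM('a) - 1) * J p r <= measure (dens e) (ball p r)" unfolding rJ [OF r] by (subst me) auto
  assume r1: "r <= 1" and p: "p \<in> frontier Om \<or> p \<in> Om \<and> r <= infdist p (frontier Om)"
  have "\<exists>D. (J p has_real_derivative D) (at r) \<and>
   ((\<integral>x. cut p r x * max 0 (- xi x) \<partial>leb Om) - (\<integral>x. indicator (ball p r) x * max 0 (xi x) \<partial>leb Om)) / r ^ DIM('a)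
    - (\<integral>x. indicator (ball p r) x * al c x \<partial>leb Om) / r ^ (DIM('a) - 1) <= D"
  proof (cases "p \<in> frontier Om")
   case True
   show ?thesis
   proof (rule monotonicity [OF r r1 c, where X = "X p" and X' = "X' p"])
    show "cut p r x = 0 \<or> X p x \<bullet> Z x = 0" if "x \<in> frontier Om" for x using t [OF that] by blast
    show "norm (X p x - (x - p)) <= c * r\<^sup>2" if "x \<in> Om" "x \<in> ball p r" for x by (rule X1 [OF True that r1])
    show "norm (X' p x h - h) <= c * r * norm h" if "x \<in> Om" "x \<in> ball p r" for x h by (rule X2 [OF True that r1])
   qed (rule X cX' cX; assumption)+
  next
   case False
   then have pr: "r <= infdist p (frontier Om)" using p by simp
   show ?thesis
   proof (rule monotonicity [OF r r1 c, where X = "\<lambda>x. x - p" and X' = "\<lambda>x h. h"])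
    show "cut p r x = 0 \<or> (x - p) \<bullet> Z x = 0" if x: "x \<in> frontier Om" for x
    proof -
     have "r <= dist p x" using infdist_le [OF x, of p] pr by linarith
     then have "x \<notin> ball p r" by simp
     then show ?thesis using cut_props(1,2) [OF r, of p x] by simp
    qed
   qed (use c r in \<open>auto intro!: derivative_eq_intros continuous_intros\<close>)
  qed
  then obtain D where D: "(J p has_real_derivative D) (at r)"
   "((\<integral>x. cut p r x * max 0 (- xi x) \<partial>leb Om) - (\<integral>x. indicator (ball p r) x * max 0 (xi x) \<partial>leb Om)) / r ^ DIM('a)
    - (\<integral>x. indicator (ball p r) x * al c x \<partial>leb Om) / r ^ (DIM('a) - 1) <= D" by blast
  have im: "integrable (leb Om) (\<lambda>x. indicator (ball p s) x * max 0 (- xi x))" for s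
   by (intro emeasure_dens(2) cm) auto
  have "measure (dens (\<lambda>x. max 0 (- xi x))) (ball p (r/2)) / 2 = (\<integral>x. (indicator (ball p (r/2)) x / 2) * max 0 (- xi x) \<partial>leb Om)"
   by (subst mm) auto
  also have "\<dots> <= (\<integral>x. cut p r x * max 0 (- xi x) \<partial>leb Om)"
  proof (rule integral_mono)
   show "integrable (leb Om) (\<lambda>x. (indicator (ball p (r/2)) x / 2) * max 0 (- xi x))" using im [of "r/2"] by simp
   show "integrable (leb Om) (\<lambda>x. cut p r x * max 0 (- xi x))"
    by (intro integrable_cont continuous_intros cut_cont r e_cont)
  qed (rule mult_right_mono [OF cut_props(3) [OF r]], simp)
  finally have "(measure (dens (\<lambda>x. max 0 (- xi x))) (ball p (r/2)) / 2 - measure (dens (\<lambda>x. max 0 (xi x))) (ball p r)) / r ^ DIM('a)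
   <= ((\<integral>x. cut p r x * max 0 (- xi x) \<partial>leb Om) - (\<integral>x. indicator (ball p r) x * max 0 (xi x) \<partial>leb Om)) / r ^ DIM('a)"
   using r by (subst mp) (auto intro!: divide_right_mono)
  moreover have "measure (dens (al c)) (ball p r) = (\<integral>x. indicator (ball p r) x * al c x \<partial>leb Om)"
   by (subst ma) auto
  ultimately show "\<exists>D. (J p has_real_derivative D) (at r) \<and>
    (measure (dens (\<lambda>x. max 0 (- xi x))) (ball p (r/2)) / 2 - measure (dens (\<lambda>x. max 0 (xi x))) (ball p r)) / r ^ Suc (DIM('a) - 1)
    - measure (dens (al c)) (ball p r) / r ^ (DIM('a) - 1) <= D"
   using D by (intro exI [of _ D]) (auto simp: m)
 qed auto
qed

text \<open>The field \<open>g k (u x) *\<^sub>R Du x\<close> has no flux. Its divergence dominates the energy density on the set where \<open>u\<close> is near the wells, and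
  elsewhere it is negative by at most \<open>1 / k\<close> times energy and right-hand side.\<close>

lemma near_well_energy:
 assumes w: "well W W' W'' \<alpha> \<beta> \<gamma>" and u1: "\<And>x. x \<in> Om ==> \<bar>u x\<bar> <= 1" and k: "1 <= k" "\<alpha> <= 1 - 1 / (4 * real k)"
  and c: "0 < c" "c <= 1/2" "0 < C" "1 <= C"
   "\<And>k s. 1 <= k ==> \<bar>s\<bar> <= 1 ==> - (C / real k * W s) <= well.g k s * W' s"
   "\<And>k s. 1 <= k ==> \<bar>s\<bar> <= 1 ==> \<alpha> <= 1 - 1 / (4 * real k) ==> 1 - 1 / (4 * real k) <= \<bar>s\<bar> ==> c * W s <= well.g k s * W' s"
  and E: "(\<integral>x. e x \<partial>leb Om) <= E" and A: "(\<integral>x. eps * (f x)\<^sup>2 \<partial>leb Om) <= A" and e1: "eps <= 1"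
 shows "c * (\<integral>x. indicator {x. 1 - 1 / (4 * real k) <= \<bar>u x\<bar>} x * e x \<partial>leb Om) <= (C * E + A + measure (leb Om) Om) / real k"
  "integrable (leb Om) (\<lambda>x. indicator {x. 1 - 1 / (4 * real k) <= \<bar>u x\<bar>} x * e x)"
proof -
 interpret w: well W W' W'' \<alpha> \<beta> \<gamma> by fact
 interpret finite_measure "leb Om" using finite_measure_leb [OF bounded_Om sets_Om] .
 have k0: "0 < real k" "1 <= real k" using k by auto
 let ?N = "{x. 1 - 1 / (4 * real k) <= \<bar>u x\<bar>}"
 have mN: "?N \<inter> Om \<in> sets (leb Om)"
 proof -
  have [measurable]: "u \<in> borel_measurable (leb Om)" by (intro continuous_on_borel_measurable_leb closure_cont u_cont)
  have "{x \<in> space (leb Om). 1 - 1 / (4 * real k) <= \<bar>u x\<bar>} \<in> sets (leb Om)" by measurable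
  moreover have "{x \<in> space (leb Om). 1 - 1 / (4 * real k) <= \<bar>u x\<bar>} = ?N \<inter> Om" by auto
  ultimately show ?thesis by (simp only:)
 qed
 have iN: "integrable (leb Om) (\<lambda>x. indicator (?N \<inter> Om) x * e x)"
 proof (rule Bochner_Integration.integrable_bound [OF integrable_cont [OF e_cont(1)]])
  show "(\<lambda>x. indicator (?N \<inter> Om) x * e x) \<in> borel_measurable (leb Om)"
   using mN by (intro borel_measurable_times borel_measurable_indicator continuous_on_borel_measurable_leb closure_cont e_cont)
 qed (auto simp: indicator_def)
 then show iN': "integrable (leb Om) (\<lambda>x. indicator ?N x * e x)"
  by (rule Bochner_Integration.integrable_cong [OF refl, THEN iffD1, rotated]) (simp add: indicator_def)
 have gc: "continuous_on UNIV (w.g k)" by (meson w.g_deriv DERIV_isCont continuous_at_imp_continuous_on)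
 have g'c: "continuous_on UNIV (w.g' k)" unfolding w.g'_def [abs_def] using k0 by (intro continuous_intros) auto
 define V where "V x = w.g k (u x) *\<^sub>R Du x" for x
 define V' where "V' x h = w.g k (u x) *\<^sub>R H x h + (w.g' k (u x) * (Du x \<bullet> h)) *\<^sub>R Du x" for x h
 have Vd: "(V has_derivative V' x) (at x)" if x: "x \<in> Om" for x
  unfolding V_def V'_def
  using has_derivative_scaleR [OF has_derivative_compose [OF u_deriv [OF x] w.g_deriv [unfolded has_field_derivative_def]] Du_deriv [OF x]] .
 have cV': "continuous_on (closure Om) (\<lambda>x. V' x h)" for h
  unfolding V'_def by (intro continuous_intros Du_cont H_cont continuous_on_compose2 [OF gc u_cont] continuous_on_compose2 [OF g'c u_cont]) auto
 have cV: "continuous_on (closure Om) V"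
  unfolding V_def by (intro continuous_intros Du_cont continuous_on_compose2 [OF gc u_cont]) auto
 have tV: "V x \<bullet> Z x = 0" if "x \<in> frontier Om" for x using neumann [OF that] by (simp add: V_def)
 have lin: "linear (\<lambda>h. w.g' k (u x) * (Du x \<bullet> h))" for x by (intro linearI) (auto simp: inner_add_right algebra_simps)
 have dV: "div_of (V' x) = w.g k (u x) * div_of (H x) + w.g' k (u x) * (norm (Du x))\<^sup>2" for x
  unfolding V'_def div_of_add div_of_scaleR div_of_rank1 [OF lin] by (simp add: power2_norm_eq_inner)
 have eq: "eps * div_of (V' x) = eps * w.g' k (u x) * (norm (Du x))\<^sup>2 + w.g k (u x) * W' (u x) / eps + eps * f x * w.g k (u x)" for x
  unfolding dV f_def using eps by (simp add: field_simps power2_eq_square)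
 have gb: "\<bar>w.g k (u x)\<bar> <= 1 / (2 * real k)" "- (1 / (2 * real k)) <= w.g' k (u x)" if "x \<in> Om" for x
  using w.g_bounds [OF k(1) u1 [OF that]] by auto
 have iV: "integrable (leb Om) (\<lambda>x. div_of (V' x))" by (intro integrable_cont div_of_cont cV')
 have "(\<integral>x. div_of (V' x) \<partial>leb Om) = 0" by (rule no_flux [OF Vd cV' cV tV])
 then have zero: "(\<integral>x. eps * div_of (V' x) \<partial>leb Om) = 0" by simp
 have ie: "integrable (leb Om) e" and iff: "integrable (leb Om) (\<lambda>x. eps * (f x)\<^sup>2)"
  by (intro integrable_cont continuous_intros e_cont f_cont)+
 have pw: "c * (indicator ?N x * e x) - C / real k * e x - 1 / real k * (eps * (f x)\<^sup>2 + 1) <= eps * div_of (V' x)" if x: "x \<in> Om" for x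
 proof -
  have s: "\<bar>u x\<bar> <= 1" by (rule u1 [OF x])
  define P where "P = eps * (norm (Du x))\<^sup>2 / 2"
  define Q where "Q = W (u x) / eps"
  have PQ: "0 <= P" "0 <= Q" "e x = P + Q" using eps W_nonneg by (simp_all add: P_def Q_def e_def)
  define ik where "ik = 1 / real k"
  have ik: "0 <= ik" using k0 by (simp add: ik_def)
  have F: "- (ik * (eps * (f x)\<^sup>2 + 1)) <= eps * f x * w.g k (u x)"
  proof -
   have "\<bar>eps * f x * w.g k (u x)\<bar> <= (eps * \<bar>f x\<bar>) * (1 / (2 * real k))"
    unfolding abs_mult using gb(1) [OF x] eps by (intro mult_mono) auto
   also have "\<dots> = ik * (eps * \<bar>f x\<bar> / 2)" by (simp add: ik_def)
   also have "eps * \<bar>f x\<bar> / 2 <= eps * (f x)\<^sup>2 + 1"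
   proof -
    have "0 <= (\<bar>f x\<bar> - 1)\<^sup>2" by simp
    then have "2 * \<bar>f x\<bar> <= (f x)\<^sup>2 + 1" by (simp add: power2_diff)
    then have "eps * (2 * \<bar>f x\<bar>) <= eps * ((f x)\<^sup>2 + 1)" using eps by (intro mult_left_mono) auto
    moreover have "0 <= eps * (f x)\<^sup>2" "0 <= eps * \<bar>f x\<bar>" using eps by auto
    ultimately show ?thesis using e1 by (simp add: algebra_simps)
   qed
   finally show ?thesis using ik by (auto simp: mult_left_mono abs_le_iff)
  qed
  have G': "eps * w.g' k (u x) * (norm (Du x))\<^sup>2 = 2 * (w.g' k (u x) * P)" by (simp add: P_def)
  have P2: "- (ik * P) <= 2 * (w.g' k (u x) * P)"
  proof -
   have "- (1 / (2 * real k)) * P <= w.g' k (u x) * P" using gb(2) [OF x] PQ by (intro mult_right_mono) auto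
   then show ?thesis by (simp add: ik_def)
  qed
  have Q2: "- (C * ik * Q) <= w.g k (u x) * W' (u x) / eps"
  proof -
   have "- (C / real k * W (u x)) / eps <= w.g k (u x) * W' (u x) / eps"
    using c(5) [OF k(1) s] eps by (intro divide_right_mono) auto
   then show ?thesis by (simp add: Q_def ik_def)
  qed
  have CP: "ik * P <= C * ik * P" using ik PQ c mult_right_mono [of 1 C "ik * P"] by (simp add: mult.assoc)
  have "c * (indicator ?N x * (P + Q)) - C * ik * (P + Q) <= 2 * (w.g' k (u x) * P) + w.g k (u x) * W' (u x) / eps"
  proof (cases "x \<in> ?N")
   case True
   then have n: "1 - 1 / (4 * real k) <= \<bar>u x\<bar>" by simp
   have "1/4 * P <= w.g' k (u x) * P" using w.g_bounds(4) [OF k(1) s n] PQ by (intro mult_right_mono) auto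
   moreover have "c * P <= 1/2 * P" using c PQ by (intro mult_right_mono) auto
   moreover have "c * W (u x) / eps <= w.g k (u x) * W' (u x) / eps"
    using c(6) [OF k(1) s k(2) n] eps by (intro divide_right_mono) auto
   then have "c * Q <= w.g k (u x) * W' (u x) / eps" by (simp add: Q_def)
   moreover have "0 <= C * ik * (P + Q)" using c ik PQ by simp
   ultimately show ?thesis using True by (simp add: algebra_simps)
  next
   case False
   then show ?thesis using P2 Q2 CP by (simp add: algebra_simps)
  qed
  then show ?thesis unfolding eq PQ(3) G' using F by (simp add: ik_def)
 qed
 have "(\<integral>x. c * (indicator ?N x * e x) - C / real k * e x - 1 / real k * (eps * (f x)\<^sup>2 + 1) \<partial>leb Om) <= (\<integral>x. eps * div_of (V' x) \<partial>leb Om)"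
  using pw iN' ie iff iV by (intro integral_mono Bochner_Integration.integrable_diff integrable_mult_right Bochner_Integration.integrable_add) auto
 also have "\<dots> = 0" by (rule zero)
 also have "(\<integral>x. c * (indicator ?N x * e x) - C / real k * e x - 1 / real k * (eps * (f x)\<^sup>2 + 1) \<partial>leb Om) =
   c * (\<integral>x. indicator ?N x * e x \<partial>leb Om) - C / real k * (\<integral>x. e x \<partial>leb Om) - 1 / real k * ((\<integral>x. eps * (f x)\<^sup>2 \<partial>leb Om) + measure (leb Om) Om)"
 proof -
  have i3: "integrable (leb Om) (\<lambda>x. eps * (f x)\<^sup>2 + 1)" using iff by simp
  have "(\<integral>x. eps * (f x)\<^sup>2 + 1 \<partial>leb Om) = (\<integral>x. eps * (f x)\<^sup>2 \<partial>leb Om) + measure (leb Om) Om"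
   using iff by (subst Bochner_Integration.integral_add) auto
  then show ?thesis using iN' ie i3
   by (subst Bochner_Integration.integral_diff, simp, simp, subst Bochner_Integration.integral_diff, simp, simp, simp)
 qed
 finally have "c * (\<integral>x. indicator ?N x * e x \<partial>leb Om) <= C / real k * (\<integral>x. e x \<partial>leb Om) + 1 / real k * ((\<integral>x. eps * (f x)\<^sup>2 \<partial>leb Om) + measure (leb Om) Om)"
  by linarith
 also have "\<dots> <= C / real k * E + 1 / real k * (A + measure (leb Om) Om)"
  using E A c k0 by (intro add_mono mult_left_mono) auto
 finally show "c * (\<integral>x. indicator ?N x * e x \<partial>leb Om) <= (C * E + A + measure (leb Om) Om) / real k"
  by (simp add: add_divide_distrib)
qed

end

section \<open>Equipartition of energy at a fixed time\<close>

context slice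
begin

lemma integrable_e: "integrable (leb Om) e" "integrable (leb Om) (\<lambda>x. max 0 (xi x))" "integrable (leb Om) (\<lambda>x. max 0 (- xi x))"
  "integrable (leb Om) (\<lambda>x. eps * (f x)\<^sup>2)"
 by (intro integrable_cont continuous_intros e_cont f_cont)+

lemma al_total:
 assumes c: "0 <= c" and E: "(\<integral>x. e x \<partial>leb Om) <= E" and A: "(\<integral>x. eps * (f x)\<^sup>2 \<partial>leb Om) <= A"
 shows "(\<integral>x. al c x \<partial>leb Om) <= (1 + c) * (A + E) + c * (DIM('a) + 14) * E"
proof -
 have "(\<integral>x. al c x \<partial>leb Om) <= (\<integral>x. (1 + c) * (eps * (f x)\<^sup>2 + e x) + c * (DIM('a) + 14) * e x \<partial>leb Om)"
 proof (rule integral_mono)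
  show "integrable (leb Om) (al c)" by (intro integrable_cont al_cont)
  show "integrable (leb Om) (\<lambda>x. (1 + c) * (eps * (f x)\<^sup>2 + e x) + c * (DIM('a) + 14) * e x)"
   by (intro Bochner_Integration.integrable_add integrable_mult_right integrable_e(1) integrable_e(4))
  fix x
  have "0 <= (\<bar>f x\<bar> - norm (Du x))\<^sup>2" by simp
  then have "2 * (\<bar>f x\<bar> * norm (Du x)) <= (f x)\<^sup>2 + (norm (Du x))\<^sup>2" by (simp add: power2_diff)
  then have "eps * (2 * (\<bar>f x\<bar> * norm (Du x))) <= eps * ((f x)\<^sup>2 + (norm (Du x))\<^sup>2)"
   using eps by (intro mult_left_mono) auto
  moreover have "eps * (norm (Du x))\<^sup>2 <= 2 * e x" by (rule eps_Du_le)
  moreover have "0 <= eps * (f x)\<^sup>2" using eps by simp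
  ultimately have "eps * \<bar>f x\<bar> * norm (Du x) <= eps * (f x)\<^sup>2 + e x" by (simp add: algebra_simps)
  then show "al c x <= (1 + c) * (eps * (f x)\<^sup>2 + e x) + c * (DIM('a) + 14) * e x"
   unfolding al_def using c by (simp add: mult_left_mono)
 qed
 also have "\<dots> = (1 + c) * ((\<integral>x. eps * (f x)\<^sup>2 \<partial>leb Om) + (\<integral>x. e x \<partial>leb Om)) + c * (DIM('a) + 14) * (\<integral>x. e x \<partial>leb Om)"
 proof -
  have "(\<integral>x. (1 + c) * (eps * (f x)\<^sup>2 + e x) + c * (DIM('a) + 14) * e x \<partial>leb Om) =
   (\<integral>x. (1 + c) * (eps * (f x)\<^sup>2 + e x) \<partial>leb Om) + (\<integral>x. c * (DIM('a) + 14) * e x \<partial>leb Om)"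
   by (intro Bochner_Integration.integral_add integrable_mult_right Bochner_Integration.integrable_add integrable_e(1) integrable_e(4))
  moreover have "(\<integral>x. eps * (f x)\<^sup>2 + e x \<partial>leb Om) = (\<integral>x. eps * (f x)\<^sup>2 \<partial>leb Om) + (\<integral>x. e x \<partial>leb Om)"
   by (rule Bochner_Integration.integral_add [OF integrable_e(4) integrable_e(1)])
  ultimately show ?thesis by (simp only: integral_mult_right_zero)
 qed
 also have "\<dots> <= (1 + c) * (A + E) + c * (DIM('a) + 14) * E"
  using c E A by (intro add_mono mult_left_mono) auto
 finally show ?thesis .
qed

text \<open>Where \<open>u\<close> is away from the wells, the gradient bound keeps it away from them on a ball of radius comparable to \<open>eps\<close>. An interior
  cone provides such a ball inside the domain.\<close>

lemma lower_start:
 assumes cone: "\<And>x. x \<in> closure Om ==> \<exists>w. norm w <= 1 \<and> (\<forall>t v. 0 < t --> t <= \<rho> --> norm v < c0 --> x + t *\<^sub>R (w + v) \<in> Om)"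
  and c0: "0 < c0" "c0 <= 1"
  and cw: "0 < cw" "\<And>s. \<bar>s\<bar> <= 1 ==> cw * (1 - \<bar>s\<bar>)\<^sup>2 <= W s"
  and u1: "\<And>x. x \<in> Om ==> \<bar>u x\<bar> <= 1" and L: "0 <= L" "\<And>x. x \<in> Om ==> eps * norm (Du x) <= L"
  and b: "0 < b" and \<theta>: "0 < \<theta>" "\<theta> <= 1/2" "2 * L * \<theta> <= b" "\<theta> * eps <= \<rho>"
  and x: "x \<in> Om" "\<bar>u x\<bar> <= 1 - 2 * b"
 shows "(cw * b\<^sup>2 * (unit_ball_vol DIM('a) * (c0 * \<theta>) ^ DIM('a))) * eps ^ (DIM('a) - 1) <= measure (dens e) (ball x eps)"
proof -
 obtain w where w: "norm w <= 1" "\<And>t v. 0 < t ==> t <= \<rho> ==> norm v < c0 ==> x + t *\<^sub>R (w + v) \<in> Om"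
  using cone [of x] x(1) closure_subset by blast
 define t where "t = \<theta> * eps"
 have t: "0 < t" "t <= \<rho>" "2 * t <= eps" using \<theta> eps by (auto simp: t_def)
 define B' where "B' = ball (x + t *\<^sub>R w) (c0 * t)"
 define K where "K = cw * b\<^sup>2 / eps"
 have B': "y \<in> Om \<and> y \<in> ball x eps \<and> K <= e y" if y: "y \<in> B'" for y
 proof -
  define v where "v = (1 / t) *\<^sub>R (y - x - t *\<^sub>R w)"
  have y_eq: "y = x + t *\<^sub>R (w + v)" using t by (simp add: v_def algebra_simps)
  have "norm (y - x - t *\<^sub>R w) < c0 * t" using y by (simp add: B'_def dist_norm norm_minus_commute algebra_simps)
  then have v: "norm v < c0" using t by (simp add: v_def pos_divide_less_eq)
  have n2: "norm (w + v) < 2" using norm_triangle_ineq [of w v] w v c0 by linarith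
  have seg: "x + s *\<^sub>R (t *\<^sub>R (w + v)) \<in> Om" if s: "0 <= s" "s <= 1" for s
  proof (cases "s = 0")
   case False
   have "s * t <= t" using s t by (simp add: mult_left_le_one_le)
   then have "s * t <= \<rho>" using t by linarith
   then have "x + (s * t) *\<^sub>R (w + v) \<in> Om" using w(2) [of "s * t" v] s t v False by simp
   then show ?thesis by simp
  qed (use x in simp)
  have "norm (u (x + t *\<^sub>R (w + v)) - u x) <= b"
  proof (rule line_increment_bound [where f' = "\<lambda>y h. Du y \<bullet> h"])
   fix s :: real assume s: "0 <= s" "s <= 1"
   let ?p = "x + s *\<^sub>R (t *\<^sub>R (w + v))"
   show "(u has_derivative (\<lambda>h. Du ?p \<bullet> h)) (at ?p)" by (rule u_deriv [OF seg [OF s]])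
   have "norm (Du ?p \<bullet> (t *\<^sub>R (w + v))) <= norm (Du ?p) * norm (t *\<^sub>R (w + v))"
    unfolding real_norm_def by (rule Cauchy_Schwarz_ineq2)
   also have "\<dots> <= (L / eps) * (t * 2)"
   proof (rule mult_mono)
    show "norm (Du ?p) <= L / eps" using L(2) [OF seg [OF s]] eps by (simp add: pos_le_divide_eq mult.commute)
    show "norm (t *\<^sub>R (w + v)) <= t * 2" using n2 t by simp
   qed (use L eps in auto)
   also have "\<dots> = 2 * L * \<theta>" using eps by (simp add: t_def)
   finally show "norm (Du ?p \<bullet> (t *\<^sub>R (w + v))) <= b" using \<theta>(3) by linarith
  qed
  then have "\<bar>u y - u x\<bar> <= b" using y_eq by simp
  then have uy: "\<bar>u y\<bar> <= 1 - b" using x(2) by linarith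
  have "b\<^sup>2 <= (1 - \<bar>u y\<bar>)\<^sup>2" using uy b by (intro power_mono) auto
  then have "cw * b\<^sup>2 <= cw * (1 - \<bar>u y\<bar>)\<^sup>2" using cw by (intro mult_left_mono) auto
  also have "\<dots> <= W (u y)" using uy b by (intro cw) auto
  finally have "K <= W (u y) / eps" unfolding K_def using eps by (intro divide_right_mono) auto
  also have "\<dots> <= e y" using eps by (simp add: e_def)
  finally have "K <= e y" .
  moreover have "y \<in> Om" using w(2) [OF t(1,2) v] y_eq by simp
  moreover have "norm (y - x) < eps"
  proof -
   have "norm (y - x) = t * norm (w + v)" using y_eq t by simp
   also have "\<dots> < t * 2" using n2 t by (intro mult_strict_left_mono) auto
   finally show ?thesis using t by simp
  qed
  then have "y \<in> ball x eps" by (simp add: dist_norm norm_minus_commute)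
  ultimately show ?thesis by blast
 qed
 interpret finite_measure "leb Om" using finite_measure_leb [OF bounded_Om sets_Om] .
 have B'm: "B' \<in> sets (leb Om)" using B' sets_Om by (auto simp: leb_def sets_restrict_space_iff B'_def)
 have "measure (leb Om) B' = measure lborel B'"
  unfolding leb_def using B' sets_Om by (intro measure_restrict_space) auto
 also have "\<dots> = unit_ball_vol DIM('a) * (c0 * t) ^ DIM('a)"
  unfolding B'_def using c0 t by (subst content_ball) auto
 finally have m: "measure (leb Om) B' = unit_ball_vol DIM('a) * (c0 * t) ^ DIM('a)" .
 have "K * measure (leb Om) B' = (\<integral>y. K * indicator B' y \<partial>leb Om)"
 proof -
  have "B' \<inter> Om = B'" using B' by auto
  then show ?thesis using B'm by simp
 qed
 also have "\<dots> <= (\<integral>y. indicator (ball x eps) y * e y \<partial>leb Om)"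
 proof (rule integral_mono)
  show "integrable (leb Om) (\<lambda>y. K * indicator B' y)"
   using B'm by (intro integrable_mult_right integrable_real_indicator) (auto simp: less_top [symmetric])
  show "integrable (leb Om) (\<lambda>y. indicator (ball x eps) y * e y)"
   by (intro emeasure_dens(2) e_cont e_nonneg) auto
  show "K * indicator B' y <= indicator (ball x eps) y * e y" for y
   using B' [of y] e_nonneg [of y] by (auto simp: indicator_def)
 qed
 also have "\<dots> = measure (dens e) (ball x eps)"
  by (rule measure_dens [OF e_cont(1) e_nonneg, symmetric]) auto
 finally have 1: "K * measure (leb Om) B' <= measure (dens e) (ball x eps)" .
 obtain j where j: "DIM('a) = Suc j" using DIM_positive [where 'a='a] by (metis Suc_pred)
 have "K * measure (leb Om) B' = (cw * b\<^sup>2 * (unit_ball_vol DIM('a) * (c0 * \<theta>) ^ DIM('a))) * eps ^ (DIM('a) - 1)"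
  unfolding m K_def t_def using eps by (simp add: j power_mult_distrib)
 with 1 show ?thesis by simp
qed

end

lemma powr_tendsto_0:
 assumes "0 < (p::real)" shows "((\<lambda>x. x powr p) \<longlongrightarrow> 0) (at_right 0)"
 by (rule tendsto_zero_powrI [OF tendsto_ident_at tendsto_const])
  (use assms eventually_at_right_less [of 0] in \<open>auto elim: eventually_mono\<close>)

lemma powr_ln_tendsto_0: "0 < (p::real) ==> ((\<lambda>x. x powr p * ln (1 / x)) \<longlongrightarrow> 0) (at_right 0)"
 by real_asymp

text \<open>The domain is split at \<open>\<bar>u x\<bar> = 1 - 1 / (4 * k1)\<close> for a fixed large \<open>k1\<close>. Near the wells the whole energy is small. On the
  remaining set \<open>P\<close> the energy has a lower density at scale \<open>eps\<close>, and \<open>vanishing_defect\<close> bounds the negative part there.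
  The integral of the positive part tends to 0: for \<open>k\<close> of order \<open>eps powr (- a/3)\<close> the energy near the wells is of order
  \<open>1 / k\<close>, and elsewhere \<open>W\<close> is at least of order \<open>1 / k\<^sup>2\<close>, so that the pointwise bound is a small multiple of the energy density.\<close>

theorem slice_equipartition:
 fixes Om :: "'a::euclidean_space set"
 assumes dom: "C2_domain Om z Z Z'" and well: "well W W' W'' \<alpha> \<beta> \<gamma>"
  and E: "0 <= E" and A: "0 <= A" and K0: "0 <= K0" and a: "0 < a" and L: "0 <= L" and \<kappa>: "0 < \<kappa>"
 obtains eps0 where "0 < eps0"
  "\<And>eps u Du H. slice Om z Z Z' W W' eps u Du H ==> eps < eps0 ==> (\<And>x. x \<in> Om ==> \<bar>u x\<bar> <= 1) ==>
   (\<And>x. x \<in> Om ==> eps * norm (Du x) <= L) ==> (\<And>x. x \<in> Om ==> slice.xi W eps u Du x <= K0 * eps powr a / eps) ==>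
   (\<integral>x. slice.e W eps u Du x \<partial>leb Om) <= E ==> (\<integral>x. eps * (slice.f W' eps u H x)\<^sup>2 \<partial>leb Om) <= A ==>
   (\<integral>x. \<bar>slice.xi W eps u Du x\<bar> \<partial>leb Om) <= \<kappa>"
proof -
 interpret C2_domain Om z Z Z' by fact
 interpret w: well W W' W'' \<alpha> \<beta> \<gamma> by fact
 show thesis
 proof (rule tangential_radial_field, goal_cases)
 case (1 c X X')
 note c0 = 1(1) and X = 1(2-7)
 obtain cw Cw where cw: "0 < cw" "\<And>s. \<bar>s\<bar> <= 1 ==> cw * (1 - \<bar>s\<bar>)\<^sup>2 <= W s"
  using w.estimates by metis
 show ?case
 proof (rule w.gW'_bounds, goal_cases)
 case (1 cg0 Cg0)
 note cg0 = 1
 define cg where "cg = min (1/2) cg0"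
 define Cg where "Cg = max 1 Cg0"
 have cg: "0 < cg" "cg <= 1/2" "0 < Cg" "1 <= Cg" using cg0 by (auto simp: cg_def Cg_def)
 have cg1: "- (Cg / real k * W s) <= w.g k s * W' s" if "1 <= k" "\<bar>s\<bar> <= 1" for k s
 proof -
  have "Cg0 / real k * W s <= Cg / real k * W s"
   using w.W_nonneg by (intro mult_right_mono divide_right_mono) (auto simp: Cg_def)
  then show ?thesis using cg0(3) [OF that] by linarith
 qed
 have cg2: "cg * W s <= w.g k s * W' s"
  if "1 <= k" "\<bar>s\<bar> <= 1" "\<alpha> <= 1 - 1 / (4 * real k)" "1 - 1 / (4 * real k) <= \<bar>s\<bar>" for k s
 proof -
  have "cg * W s <= cg0 * W s" using w.W_nonneg by (intro mult_right_mono) (auto simp: cg_def)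
  then show ?thesis using cg0(4) [OF that] by linarith
 qed
 define V where "V = measure (leb Om) Om"
 have V: "0 <= V" by (simp add: V_def)
 define CT where "CT = (Cg * E + A + V) / cg"
 have CT: "0 <= CT" using cg E A V by (simp add: CT_def)
 obtain k0 :: nat where k0: "1 / (4 * (1 - \<alpha>)) <= real k0" using real_arch_simple by blast
 have k0': "\<alpha> <= 1 - 1 / (4 * real k)" if "k0 <= k" "1 <= k" for k
 proof -
  have "1 / (4 * (1 - \<alpha>)) <= real k" using k0 that by linarith
  then have "1 <= real k * (4 * (1 - \<alpha>))" using w.ab by (simp add: pos_divide_le_eq)
  then have "1 / (4 * real k) <= 1 - \<alpha>" using that by (simp add: pos_divide_le_eq mult_ac)
  then show ?thesis by linarith
 qed
 obtain k1 :: nat where k1: "max (real k0 + 1) (3 * CT / \<kappa>) <= real k1" using real_arch_simple by blast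
 have k1': "k0 <= k1" "1 <= k1" using k1 by linarith+
 have k1T: "CT / real k1 <= \<kappa> / 3"
 proof -
  have "3 * CT <= real k1 * \<kappa>" using k1 \<kappa> by (simp add: pos_divide_le_eq)
  then show ?thesis using k1' by (simp add: field_simps)
 qed
 define b where "b = 1 / (8 * real k1)"
 have b: "0 < b" "1 - 1 / (4 * real k1) = 1 - 2 * b" using k1' by (auto simp: b_def)
 define \<theta> where "\<theta> = min (1/2) (b / (2 * L + 1))"
 have \<theta>: "0 < \<theta>" "\<theta> <= 1/2" using b L unfolding \<theta>_def by (simp, intro min.cobounded1)
 have \<theta>L: "2 * L * \<theta> <= b"
 proof -
  have "2 * L * \<theta> <= (2 * L + 1) * (b / (2 * L + 1))" using \<theta> L b by (intro mult_mono) (auto simp: \<theta>_def)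
  also have "\<dots> = b" using L by simp
  finally show ?thesis .
 qed
 obtain \<rho> cc where cone: "0 < \<rho>" "0 < cc" "cc <= 1"
  "\<And>x. x \<in> closure Om ==> \<exists>w. norm w <= 1 \<and> (\<forall>t v. 0 < t --> t <= \<rho> --> norm v < cc --> x + t *\<^sub>R (w + v) \<in> Om)"
  by (rule interior_cone) (rule that)
 define cs where "cs = cw * b\<^sup>2 * (unit_ball_vol DIM('a) * (cc * \<theta>) ^ DIM('a))"
 have cs: "0 < cs" using cw b cone \<theta> by (simp add: cs_def)
 define A' where "A' = (1 + c) * (A + E) + c * (DIM('a) + 14) * E"
 have A': "0 <= A'" using c0 A E by (simp add: A'_def)
 have \<tau>: "0 < \<kappa> / 3" using \<kappa> by simp
 obtain \<delta> where \<delta>: "0 < \<delta>" "is_threshold TYPE('a) (DIM('a) - 1) E A' cs (\<kappa> / 3) \<delta>"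
  using vanishing_defect [OF E A' cs \<tau>] by metis
 define C5 where "C5 = CT + 64 * K0 * E / cw + 1"
 have C5: "0 < C5" using CT K0 E cw by (simp add: C5_def add_nonneg_pos)
 define h where "h e = sqrt C5 * e powr (a/6)" for e
 have h_lim: "(h \<longlongrightarrow> 0) (at_right 0)"
  using tendsto_mult [OF tendsto_const powr_tendsto_0 [of "a/6"], of "sqrt C5"] a by (simp add: h_def [abs_def])
 have hl_lim: "((\<lambda>e. h e * ln (1/e)) \<longlongrightarrow> 0) (at_right 0)"
  using tendsto_mult [OF tendsto_const powr_ln_tendsto_0 [of "a/6"], of "sqrt C5"] a by (simp add: h_def mult.assoc)
 have p_lim: "((\<lambda>e. (real k0 + 1) * e powr (a/3)) \<longlongrightarrow> 0) (at_right 0)"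
  using tendsto_mult [OF tendsto_const powr_tendsto_0 [of "a/3"], of "real k0 + 1"] a by simp
 have h2_lim: "((\<lambda>e. (h e)\<^sup>2) \<longlongrightarrow> 0) (at_right 0)" using tendsto_power [OF h_lim, of 2] by simp
 have id_lim: "((\<lambda>e::real. e) \<longlongrightarrow> 0) (at_right 0)" by (rule tendsto_ident_at)
 have "eventually (\<lambda>e. h e < \<delta> \<and> h e * ln (1/e) < \<delta> \<and> (real k0 + 1) * e powr (a/3) < 1 \<and> (h e)\<^sup>2 < \<kappa> / 3 \<and> e < min \<delta> (min \<rho> 1)) (at_right 0)"
  using order_tendstoD(2) [OF h_lim \<delta>(1)] order_tendstoD(2) [OF hl_lim \<delta>(1)] order_tendstoD(2) [OF p_lim zero_less_one]
   order_tendstoD(2) [OF h2_lim \<tau>] order_tendstoD(2) [OF id_lim, of "min \<delta> (min \<rho> 1)"] \<delta>(1) cone(1)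
  by (auto intro!: eventually_conj)
 then obtain e0 where e0: "0 < e0" and small: "\<And>e. 0 < e ==> e < e0 ==>
   h e < \<delta> \<and> h e * ln (1/e) < \<delta> \<and> (real k0 + 1) * e powr (a/3) < 1 \<and> (h e)\<^sup>2 < \<kappa> / 3 \<and> e < min \<delta> (min \<rho> 1)"
  by (auto simp: eventually_at_right_field)
 have "(\<integral>x. \<bar>slice.xi W eps u Du x\<bar> \<partial>leb Om) <= \<kappa>"
  if sl: "slice Om z Z Z' W W' eps u Du H" and lt: "eps < e0" and u1: "\<And>x. x \<in> Om ==> \<bar>u x\<bar> <= 1"
   and DL: "\<And>x. x \<in> Om ==> eps * norm (Du x) <= L" and xiK: "\<And>x. x \<in> Om ==> slice.xi W eps u Du x <= K0 * eps powr a / eps"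
   and eE: "(\<integral>x. slice.e W eps u Du x \<partial>leb Om) <= E" and fA: "(\<integral>x. eps * (slice.f W' eps u H x)\<^sup>2 \<partial>leb Om) <= A"
  for eps u Du H
 proof -
  interpret s: slice Om z Z Z' W W' eps u Du H by fact
  let ?N = "\<lambda>k x. indicator {x. 1 - 1 / (4 * real k) <= \<bar>u x\<bar>} x * s.e x"
  note sm = small [OF s.eps lt]
  have e1: "eps <= 1" "eps < \<delta>" "eps <= \<rho>" using sm by auto
  note amon = s.almost_monotone_slice [OF c0 X]
  have near: "(\<integral>x. ?N k x \<partial>leb Om) <= CT / real k"
   "integrable (leb Om) (\<lambda>x. ?N k x)" if k: "1 <= k" "k0 <= k" for k
  proof -
   note nw = s.near_well_energy [OF well u1 k(1) k0' [OF k(2,1)] cg cg1 cg2 eE fA e1(1)]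
   show "integrable (leb Om) (\<lambda>x. ?N k x)" by (rule nw(2))
   have "(\<integral>x. ?N k x \<partial>leb Om) <= ((Cg * E + A + V) / real k) / cg"
   proof -
    have "cg * I <= R ==> I <= R / cg" for I R using cg by (simp add: pos_le_divide_eq mult.commute)
    from this [OF nw(1)] show ?thesis unfolding V_def .
   qed
   then show "(\<integral>x. ?N k x \<partial>leb Om) <= CT / real k"
    by (simp add: CT_def mult.commute)
  qed
  have ppos: "0 < eps powr (a/3)" using s.eps by simp
  \<comment> \<open>the truncation level that balances the two contributions to the positive part\<close>
  define k where "k = nat \<lceil>eps powr (- (a/3))\<rceil>"
  have inv: "eps powr (- (a/3)) = 1 / eps powr (a/3)" by (simp add: powr_minus inverse_eq_divide)
  have big: "real k0 + 1 <= eps powr (- (a/3))"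
   unfolding inv using sm ppos by (simp add: pos_le_divide_eq less_imp_le)
  have kr: "eps powr (- (a/3)) <= real k" unfolding k_def by linarith
  have kr2: "real k <= 2 * eps powr (- (a/3))" unfolding k_def using big by linarith
  have k: "1 <= k" "k0 <= k" using big kr by linarith+
  have kp: "1 / real k <= eps powr (a/3)"
  proof -
   have "1 / real k <= 1 / (eps powr (- (a/3)))" using kr k s.eps by (intro divide_left_mono mult_pos_pos) auto
   then show ?thesis unfolding inv by simp
  qed
  have xip: "(\<integral>x. max 0 (s.xi x) \<partial>leb Om) <= (h eps)\<^sup>2"
  proof -
   define q where "q = K0 * eps powr a * (16 * (real k)\<^sup>2 / cw)"
   have q0: "0 <= q" using K0 cw by (simp add: q_def)
   have "(\<integral>x. max 0 (s.xi x) \<partial>leb Om) <= (\<integral>x. ?N k x + q * s.e x \<partial>leb Om)"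
   proof (rule integral_mono [OF s.integrable_e(2)])
    show "integrable (leb Om) (\<lambda>x. ?N k x + q * s.e x)"
     by (intro Bochner_Integration.integrable_add near(2) k integrable_mult_right s.integrable_e(1))
    fix x assume "x \<in> space (leb Om)"
    then have x: "x \<in> Om" by simp
    show "max 0 (s.xi x) <= ?N k x + q * s.e x"
    proof (cases "1 - 1 / (4 * real k) <= \<bar>u x\<bar>")
     case True
     moreover have "0 <= q * s.e x" using q0 s.e_nonneg by simp
     moreover have "max 0 (s.xi x) <= s.e x" using s.xi_le_e [of x] s.e_nonneg [of x] by simp
     ultimately show ?thesis by simp
    next
     case False
     have "(1 / (4 * real k))\<^sup>2 <= (1 - \<bar>u x\<bar>)\<^sup>2" using False by (intro power_mono) auto
     then have "cw * (1 / (4 * real k))\<^sup>2 <= cw * (1 - \<bar>u x\<bar>)\<^sup>2" using cw by (intro mult_left_mono) auto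
     also have "\<dots> <= W (u x)" by (rule cw(2) [OF u1 [OF x]])
     finally have "cw / (16 * (real k)\<^sup>2) <= W (u x)" by (simp add: power_divide power_mult_distrib)
     then have "1 <= W (u x) * (16 * (real k)\<^sup>2 / cw)" using k cw by (simp add: field_simps)
     then have "K0 * eps powr a / eps * 1 <= K0 * eps powr a / eps * (W (u x) * (16 * (real k)\<^sup>2 / cw))"
      using K0 s.eps by (intro mult_left_mono) auto
     also have "\<dots> = q * (W (u x) / eps)" by (simp add: q_def mult_ac)
     also have "\<dots> <= q * s.e x" using q0 s.eps by (intro mult_left_mono) (auto simp: s.e_def)
     finally have "s.xi x <= q * s.e x" using xiK [OF x] by simp
     moreover have "0 <= q * s.e x" using q0 s.e_nonneg by simp
     ultimately show ?thesis using False by simp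
    qed
   qed
   also have "\<dots> = (\<integral>x. ?N k x \<partial>leb Om) + q * (\<integral>x. s.e x \<partial>leb Om)"
    using near(2) [OF k] s.integrable_e(1) by simp
   also have "\<dots> <= CT * eps powr (a/3) + (64 * K0 / cw * eps powr (a/3)) * E"
   proof (intro add_mono mult_mono eE)
    have "CT / real k = CT * (1 / real k)" by simp
    also have "\<dots> <= CT * eps powr (a/3)" using CT kp by (intro mult_left_mono)
    finally show "(\<integral>x. ?N k x \<partial>leb Om) <= CT * eps powr (a/3)"
     using near(1) [OF k] by linarith
    have "(real k)\<^sup>2 <= (2 * eps powr (- (a/3)))\<^sup>2" using kr2 by (intro power_mono) auto
    also have "\<dots> = 4 * (eps powr (- (a/3)) * eps powr (- (a/3)))" by (simp add: power2_eq_square)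
    also have "\<dots> = 4 * eps powr (- (a/3) - a/3)" by (simp flip: powr_add)
    finally have "q <= K0 * eps powr a * (16 * (4 * eps powr (- (a/3) - a/3)) / cw)"
     unfolding q_def using K0 cw by (intro mult_left_mono divide_right_mono) auto
    also have "\<dots> = 64 * K0 / cw * (eps powr a * eps powr (- (a/3) - a/3))" by simp
    also have "eps powr a * eps powr (- (a/3) - a/3) = eps powr (a/3)" by (simp flip: powr_add)
    finally show "q <= 64 * K0 / cw * eps powr (a/3)" .
    show "0 <= 64 * K0 / cw * eps powr (a/3)" using K0 cw by simp
    show "0 <= (\<integral>x. s.e x \<partial>leb Om)" using s.e_nonneg by (intro integral_nonneg_AE AE_I2) auto
   qed
   also have "\<dots> = (CT + 64 * K0 * E / cw) * eps powr (a/3)" by (simp add: algebra_simps)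
   also have "\<dots> <= C5 * eps powr (a/3)" by (intro mult_right_mono) (auto simp: C5_def)
   also have "\<dots> = (h eps)\<^sup>2"
   proof -
    have "eps powr (a/6) * eps powr (a/6) = eps powr (a/3)" by (simp flip: powr_add)
    then show ?thesis using C5 by (simp add: h_def power_mult_distrib power2_eq_square [of "_ powr _"])
   qed
   finally show ?thesis .
  qed
  define P where "P = {x \<in> Om. \<bar>u x\<bar> < 1 - 1 / (4 * real k1)}"
  have Pop: "open P"
  proof -
   have "open (Om \<inter> (\<lambda>x. \<bar>u x\<bar>) -` {..<1 - 1 / (4 * real k1)})"
    using closure_cont [OF s.u_cont] open_Om by (intro continuous_open_preimage continuous_intros) auto
   moreover have "Om \<inter> (\<lambda>x. \<bar>u x\<bar>) -` {..<1 - 1 / (4 * real k1)} = P" by (auto simp: P_def)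
   ultimately show ?thesis by simp
  qed
  have cp: "continuous_on (closure Om) (\<lambda>x. max 0 (s.xi x))" and cm: "continuous_on (closure Om) (\<lambda>x. max 0 (- s.xi x))"
   by (intro continuous_intros s.e_cont)+
  note me = measure_dens [OF s.e_cont(1) s.e_nonneg] and mp = measure_dens [OF cp max.cobounded1]
   and mm = measure_dens [OF cm max.cobounded1] and ma = measure_dens [OF s.al_cont s.al_nonneg [OF c0]]
  have P3: "measure (dens (\<lambda>x. max 0 (- s.xi x))) P <= \<kappa> / 3"
  proof (rule is_thresholdD [OF \<delta>(2) amon s.eps e1(2), where h = "h eps"])
   show "0 < h eps" using C5 s.eps by (simp add: h_def)
   show "h eps < \<delta>" "h eps * ln (1/eps) <= \<delta>" using sm by auto
   show "measure (dens s.e) UNIV <= E" using me [of UNIV] eE by simp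
   show "measure (dens (s.al c)) UNIV <= A'" using ma [of UNIV] s.al_total [OF c0 eE fA] by (simp add: A'_def)
   show "measure (dens (\<lambda>x. max 0 (s.xi x))) UNIV <= (h eps)\<^sup>2" using mp [of UNIV] xip by simp
   show "P \<subseteq> Om" "P \<in> sets borel" using Pop by (auto simp: P_def)
   show "cs * eps ^ (DIM('a) - 1) <= measure (dens s.e) (ball x eps)" if x: "x \<in> P" for x
    unfolding cs_def
   proof (rule s.lower_start [OF cone(4,2,3) cw u1 L DL b(1) \<theta> \<theta>L])
    show "\<theta> * eps <= \<rho>" 
    proof -
     have "\<theta> * eps <= 1 * eps" using \<theta> s.eps by (intro mult_right_mono) auto
     then show ?thesis using e1 by simp
    qed
    show "x \<in> Om" "\<bar>u x\<bar> <= 1 - 2 * b" using x b(2) by (auto simp: P_def)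
   qed
   show "measure (dens (\<lambda>x. max 0 (- s.xi x))) B <= measure (dens s.e) B" if B: "B \<in> sets borel" for B
   proof -
    have "(\<integral>x. indicator B x * max 0 (- s.xi x) \<partial>leb Om) <= (\<integral>x. indicator B x * s.e x \<partial>leb Om)"
    proof (rule integral_mono)
     show "integrable (leb Om) (\<lambda>x. indicator B x * max 0 (- s.xi x))"
      using B by (intro emeasure_dens(2) cm) auto
     show "integrable (leb Om) (\<lambda>x. indicator B x * s.e x)"
      using B by (intro emeasure_dens(2) s.e_cont s.e_nonneg) auto
     show "indicator B x * max 0 (- s.xi x) <= indicator B x * s.e x" for x
      using s.xi_le_e [of x] s.e_nonneg [of x] by (intro mult_left_mono) auto
    qed
    then show ?thesis using me [of B] mm [of B] B by simp
   qed
  qed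
  have i3: "integrable (leb Om) (\<lambda>x. indicator P x * max 0 (- s.xi x))"
   using Pop by (intro emeasure_dens(2) cm) auto
  have "(\<integral>x. \<bar>s.xi x\<bar> \<partial>leb Om) <= (\<integral>x. max 0 (s.xi x) + (?N k1 x + indicator P x * max 0 (- s.xi x)) \<partial>leb Om)"
  proof (rule integral_mono)
   have "integrable (leb Om) (\<lambda>x. max 0 (s.xi x) + max 0 (- s.xi x))"
    by (intro Bochner_Integration.integrable_add s.integrable_e(2,3))
   moreover have "(\<lambda>x. max 0 (s.xi x) + max 0 (- s.xi x)) = (\<lambda>x. \<bar>s.xi x\<bar>)" by (auto simp: fun_eq_iff max_def abs_if)
   ultimately show "integrable (leb Om) (\<lambda>x. \<bar>s.xi x\<bar>)" by simp
   from i3 show "integrable (leb Om) (\<lambda>x. max 0 (s.xi x) + (?N k1 x + indicator P x * max 0 (- s.xi x)))"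
    by (intro Bochner_Integration.integrable_add s.integrable_e(2,3) near(2) k1')
   fix x assume "x \<in> space (leb Om)"
   then show "\<bar>s.xi x\<bar> <= max 0 (s.xi x) + (?N k1 x + indicator P x * max 0 (- s.xi x))"
    using s.xi_le_e [of x] s.e_nonneg [of x] by (auto simp: indicator_def P_def)
  qed
  also have "\<dots> = (\<integral>x. max 0 (s.xi x) \<partial>leb Om) + ((\<integral>x. ?N k1 x \<partial>leb Om) + (\<integral>x. indicator P x * max 0 (- s.xi x) \<partial>leb Om))"
   using i3 near(2) [OF k1'(2,1)] s.integrable_e(2)
   by (simp add: Bochner_Integration.integral_add Bochner_Integration.integrable_add)
  also have "\<dots> <= \<kappa> / 3 + (\<kappa> / 3 + \<kappa> / 3)"
  proof (intro add_mono)
   show "(\<integral>x. max 0 (s.xi x) \<partial>leb Om) <= \<kappa> / 3" using xip sm by linarith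
   show "(\<integral>x. ?N k1 x \<partial>leb Om) <= \<kappa> / 3"
    using near(1) [OF k1'(2,1)] k1T by linarith
   show "(\<integral>x. indicator P x * max 0 (- s.xi x) \<partial>leb Om) <= \<kappa> / 3" using P3 mm [of P] Pop by simp
  qed
  finally show ?thesis by simp
 qed
 then show ?case using e0 that by blast
 qed
 qed
qed

section \<open>Maximum principles for the flow\<close>

text \<open>The set where \<open>v\<close> is nonnegative is compact; a point of it with the least time is a first touching point.\<close>

lemma parabolic_touch:
 fixes v :: "real => 'a::euclidean_space => real"
 assumes K: "compact K" and c: "continuous_on ({0..T} \<times> K) (\<lambda>(t, x). v t x)"
  and init: "\<And>x. x \<in> K ==> v 0 x < 0"
  and touch: "\<And>t x. 0 < t ==> t <= T ==> x \<in> K ==> v t x = 0 ==>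
   (\<And>s y. 0 <= s ==> s <= t ==> y \<in> K ==> v s y <= 0) ==> False"
  and t: "0 <= t" "t <= T" and x: "x \<in> K"
 shows "v t x < 0"
proof (rule ccontr)
 assume "\<not> v t x < 0"
 define A where "A = {p \<in> {0..T} \<times> K. 0 <= (case p of (t, x) => v t x)}"
 have cK: "compact ({0..T} \<times> K)" by (intro compact_Times K compact_Icc)
 have "closedin (top_of_set ({0..T} \<times> K)) ({0..T} \<times> K \<inter> (\<lambda>(t, x). v t x) -` {0..})"
  by (intro continuous_closedin_preimage c) auto
 then have "compact ({0..T} \<times> K \<inter> (\<lambda>(t, x). v t x) -` {0..})" using cK closedin_compact by blast
 moreover have "{0..T} \<times> K \<inter> (\<lambda>(t, x). v t x) -` {0..} = A" by (auto simp: A_def)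
 ultimately have A: "compact A" by simp
 have ne: "A \<noteq> {}" using \<open>\<not> v t x < 0\<close> t x by (auto simp: A_def not_less)
 obtain p where p: "p \<in> A" "\<And>q. q \<in> A ==> fst p <= fst q"
  using continuous_attains_inf [OF A ne continuous_on_fst [OF continuous_on_id]] by auto
 obtain t0 x0 where px: "p = (t0, x0)" by force
 have 0: "0 <= t0" "t0 <= T" "x0 \<in> K" "0 <= v t0 x0" using p(1) px by (auto simp: A_def)
 have before: "v s y < 0" if "0 <= s" "s < t0" "y \<in> K" for s y
  using p(2) [of "(s, y)"] that 0 px by (auto simp: A_def not_le [symmetric])
 have t0: "0 < t0" using init [of x0] 0 by (cases "t0 = 0") auto
 have le: "v s y <= 0" if "0 <= s" "s <= t0" "y \<in> K" for s y
 proof (cases "s = t0")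
  case False
  then show ?thesis using before that by (simp add: less_imp_le)
 next
  case True
  have "continuous_on {0..T} (\<lambda>s. v s y)"
  proof -
   have 1: "continuous_on {0..T} (\<lambda>s. (s, y))" by (intro continuous_intros)
   have 2: "(\<lambda>s. (s, y)) ` {0..T} \<subseteq> {0..T} \<times> K" using that by auto
   show ?thesis using continuous_on_compose2 [OF c 1 2] by simp
  qed
  then have "((\<lambda>s. v s y) \<longlongrightarrow> v t0 y) (at t0 within {0..T})" using 0 by (simp add: continuous_on)
  then have lim: "((\<lambda>s. v s y) \<longlongrightarrow> v t0 y) (at t0 within {0<..<t0})"
   using 0 by (elim tendsto_within_subset) auto
  have nt: "at t0 within {0<..<t0} \<noteq> bot" using t0 by (simp add: at_within_eq_bot_iff)
  have "eventually (\<lambda>s. v s y <= 0) (at t0 within {0<..<t0})"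
   unfolding eventually_at_filter using before [of _ y] that by (auto intro!: always_eventually less_imp_le)
  from tendsto_upperbound [OF lim this nt] show ?thesis using True by simp
 qed
 have "v t0 x0 = 0" using le [of t0 x0] 0 by simp
 from touch [OF t0 0(2,3) this le] show False .
qed

lemma left_max_derivative:
 assumes "(f has_real_derivative D) (at t)" "0 < t" "\<And>s. 0 <= s ==> s <= t ==> f s <= f t"
 shows "0 <= D"
proof (rule ccontr)
 assume "\<not> 0 <= D"
 then obtain d where d: "0 < d" "\<And>h. 0 < h ==> h < d ==> f t < f (t - h)"
  using DERIV_neg_dec_left [OF assms(1)] by auto
 define h where "h = min (d/2) t"
 have "0 < h" "h < d" "h <= t" using d assms(2) by (auto simp: h_def)
 then show False using d(2) [of h] assms(3) [of "t - h"] by auto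
qed

lemma second_derivative_max:
 fixes q q' :: "real => real"
 assumes d: "0 < d" and q: "\<And>s. \<bar>s\<bar> < d ==> (q has_real_derivative q' s) (at s)"
  and q'': "(q' has_real_derivative k) (at 0)" and max: "\<And>s. \<bar>s\<bar> < d ==> q s <= q 0"
 shows "q' 0 = 0" "k <= 0"
proof -
 have "q' 0 = 0" using DERIV_local_max [OF q [of 0], of d] d max by auto
 then show "q' 0 = 0" .
 show "k <= 0"
 proof (rule ccontr)
  assume "\<not> k <= 0"
  then obtain r where r: "0 < r" "\<And>h. 0 < h ==> h < r ==> q' 0 < q' (0 + h)"
   using DERIV_pos_inc_right [OF q''] by auto
  define h where "h = min (d/2) (r/2)"
  have h: "0 < h" "h < d" "h < r" using d r by (auto simp: h_def)
  obtain c where c: "0 < c" "c < h" "q h - q 0 = (h - 0) * q' c"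
   using MVT2 [of 0 h q q'] h q by auto
  have "0 < q' c" using r(2) [of c] c h \<open>q' 0 = 0\<close> by auto
  then have "0 < (h - 0) * q' c" using h by (intro mult_pos_pos) auto
  then have "q 0 < q h" using c(3) by linarith
  then show False using max [of h] h by auto
 qed
qed

context C2_domain
begin

lemma interior_max:
 assumes x: "x \<in> Om" and v: "\<And>y. y \<in> Om ==> (v has_derivative (\<lambda>h. G y \<bullet> h)) (at y)"
  and K: "\<And>b. b \<in> Basis ==> ((\<lambda>s. G (x + s *\<^sub>R b) \<bullet> b) has_real_derivative K b) (at 0)"
  and max: "\<And>y. y \<in> Om ==> v y <= v x"
 shows "G x = 0" "(\<Sum>b\<in>Basis. K b) <= 0"
proof -
 obtain d where d: "0 < d" "ball x d \<subseteq> Om" using open_Om x open_contains_ball by blast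
 have line: "x + s *\<^sub>R b \<in> Om" if "\<bar>s\<bar> < d" "b \<in> Basis" for s and b :: 'a
  using d(2) that by (auto simp: dist_norm)
 have "G x \<bullet> b = 0 \<and> K b <= 0" if b: "b \<in> Basis" for b
 proof -
  have "((\<lambda>s. v (x + s *\<^sub>R b)) has_real_derivative G (x + s *\<^sub>R b) \<bullet> b) (at s)" if "\<bar>s\<bar> < d" for s
   using has_derivative_line [OF v [OF line [OF that b]]] by (simp add: has_real_derivative_iff_has_vector_derivative)
  from second_derivative_max [OF d(1) this K [OF b]] show ?thesis using max line [OF _ b] by auto
 qed
 then show "G x = 0" "(\<Sum>b\<in>Basis. K b) <= 0" by (auto intro: euclidean_eqI sum_nonpos)
qed

lemma frontier_max:
 fixes v' :: "'a => real"
 assumes p: "p \<in> frontier Om" and v: "(v has_derivative v') (at p within closure Om)"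
  and max: "\<And>y. y \<in> closure Om ==> v y <= v p"
 shows "0 <= v' (Z p)"
proof (rule ccontr)
 assume neg: "\<not> 0 <= v' (Z p)"
 have Z0: "0 < norm (Z p)" using Z_frontier [OF p] by simp
 have lin: "linear v'" using has_derivative_linear [OF v] .
 define e where "e = - v' (Z p) / (2 * norm (Z p))"
 have e: "0 < e" using neg Z0 by (simp add: e_def field_simps)
 obtain d where d: "0 < d" "\<And>y. y \<in> closure Om ==> norm (y - p) < d ==> norm (v y - v p - v' (y - p)) <= e * norm (y - p)"
  using v e unfolding has_derivative_within_alt by blast
 have "eventually (\<lambda>s. z (p + s *\<^sub>R (- Z p)) < z p + s * (Z p \<bullet> (- Z p)) / 2) (at_right 0)"
  using Z0 by (intro derivative_neg_eventually z_deriv) simp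
 then obtain r where r: "0 < r" "\<And>s. 0 < s ==> s < r ==> z (p + s *\<^sub>R (- Z p)) < z p + s * (Z p \<bullet> (- Z p)) / 2"
  by (auto simp: eventually_at_right_field)
 define s where "s = min (r/2) (d / (2 * norm (Z p)))"
 have s: "0 < s" "s < r" using r d Z0 by (auto simp: s_def)
 have "s * norm (Z p) <= d / (2 * norm (Z p)) * norm (Z p)" using Z0 by (intro mult_right_mono) (auto simp: s_def)
 then have sd: "s * norm (Z p) < d" using Z0 d by simp
 let ?y = "p + s *\<^sub>R (- Z p)"
 have "0 < s * (Z p \<bullet> Z p)" using s Z0 by simp
 then have "z ?y < 0" using r(2) [OF s] z_frontier [OF p] by simp
 then have "?y \<in> Om" by (simp add: Om_eq)
 then have y: "?y \<in> closure Om" using closure_subset by blast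
 have "norm (v ?y - v p - v' (?y - p)) <= e * norm (?y - p)"
  using d(2) [OF y] sd s by simp
 moreover have "v' (?y - p) = - (s * v' (Z p))" using lin by (simp add: linear_neg linear_cmul)
 moreover have "norm (?y - p) = s * norm (Z p)" using s by simp
 ultimately have "norm (v ?y - v p - (- (s * v' (Z p)))) <= e * (s * norm (Z p))" by metis
 then have "\<bar>v ?y - v p + s * v' (Z p)\<bar> <= e * (s * norm (Z p))" by simp
 moreover have "e * (s * norm (Z p)) = - s * v' (Z p) / 2" using Z0 by (simp add: e_def)
 ultimately have "- s * v' (Z p) <= - s * v' (Z p) / 2" using max [OF y] by linarith
 then have "0 <= s * v' (Z p)" by linarith
 then show False using neg s by (simp add: zero_le_mult_iff)
qed

text \<open>The domain lies on one side of the directions \<open>\<tau> - \<eta> *\<^sub>R Z p\<close> and its complement on that of \<open>\<tau> + \<eta> *\<^sub>R Z p\<close>, so a segment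
  between them meets the frontier, where \<open>h\<close> vanishes.\<close>

lemma tangential_derivative_zero:
 fixes h' :: "'a => real"
 assumes p: "p \<in> frontier Om" and h: "(h has_derivative h') (at p within closure Om)"
  and zero: "\<And>y. y \<in> frontier Om ==> h y = 0" and t: "Z p \<bullet> \<tau> = 0"
 shows "h' \<tau> = 0"
proof -
 have Z0: "0 < Z p \<bullet> Z p" using Z_frontier [OF p] by simp
 have lin: "linear h'" using has_derivative_linear [OF h] .
 have "\<bar>h' \<tau>\<bar> <= \<eta> * (\<bar>h' (Z p)\<bar> + norm \<tau> + norm (Z p))" if \<eta>: "0 < \<eta>" "\<eta> <= 1" for \<eta>
 proof -
  obtain d where d: "0 < d" "\<And>y. y \<in> closure Om ==> norm (y - p) < d ==> norm (h y - h p - h' (y - p)) <= \<eta> * norm (y - p)"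
   using h \<eta>(1) unfolding has_derivative_within_alt by blast
  have 1: "eventually (\<lambda>s. z (p + s *\<^sub>R (\<tau> - \<eta> *\<^sub>R Z p)) < z p + s * (Z p \<bullet> (\<tau> - \<eta> *\<^sub>R Z p)) / 2) (at_right 0)"
   using t \<eta> Z0 by (intro derivative_neg_eventually z_deriv) (simp add: inner_diff_right)
  have 2: "eventually (\<lambda>s. - z (p + s *\<^sub>R (\<tau> + \<eta> *\<^sub>R Z p)) < - z p + s * ((- Z p) \<bullet> (\<tau> + \<eta> *\<^sub>R Z p)) / 2) (at_right 0)"
  proof (rule derivative_neg_eventually)
   show "((\<lambda>x. - z x) has_derivative (\<lambda>h. (- Z p) \<bullet> h)) (at p)" using has_derivative_minus [OF z_deriv [of p]] by simp
   show "(- Z p) \<bullet> (\<tau> + \<eta> *\<^sub>R Z p) < 0" using t \<eta> Z0 by (simp add: inner_add_right)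
  qed
  have n0: "0 < norm \<tau> + norm (Z p)" using Z_frontier [OF p] by (simp add: add_nonneg_pos)
  define s1 where "s1 = d / (norm \<tau> + norm (Z p))"
  have "0 < s1" using d n0 by (simp add: s1_def)
  then have 3: "eventually (\<lambda>s. s < s1) (at_right 0)" by (auto simp: eventually_at_right_field)
  obtain s where s: "0 < s" "s < s1" "z (p + s *\<^sub>R (\<tau> - \<eta> *\<^sub>R Z p)) < z p + s * (Z p \<bullet> (\<tau> - \<eta> *\<^sub>R Z p)) / 2"
   "- z (p + s *\<^sub>R (\<tau> + \<eta> *\<^sub>R Z p)) < - z p + s * ((- Z p) \<bullet> (\<tau> + \<eta> *\<^sub>R Z p)) / 2"
  proof -
   have "eventually (\<lambda>s. 0 < s \<and> s < s1 \<and> z (p + s *\<^sub>R (\<tau> - \<eta> *\<^sub>R Z p)) < z p + s * (Z p \<bullet> (\<tau> - \<eta> *\<^sub>R Z p)) / 2 \<and>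
     - z (p + s *\<^sub>R (\<tau> + \<eta> *\<^sub>R Z p)) < - z p + s * ((- Z p) \<bullet> (\<tau> + \<eta> *\<^sub>R Z p)) / 2) (at_right 0)"
    using 1 2 3 eventually_at_right_less [of 0] by eventually_elim simp
   then show thesis using eventually_happens' [OF trivial_limit_at_right_real] that by blast
  qed
  have pos: "0 < s * (\<eta> * (Z p \<bullet> Z p))" using s \<eta> Z0 by simp
  have a: "p + s *\<^sub>R (\<tau> - \<eta> *\<^sub>R Z p) \<in> Om"
   using s(3) pos t z_frontier [OF p] by (simp add: Om_eq inner_diff_right)
  have b: "p + s *\<^sub>R (\<tau> + \<eta> *\<^sub>R Z p) \<notin> Om"
   using s(4) pos t z_frontier [OF p] by (simp add: Om_eq inner_add_right)
  let ?S = "closed_segment (p + s *\<^sub>R (\<tau> - \<eta> *\<^sub>R Z p)) (p + s *\<^sub>R (\<tau> + \<eta> *\<^sub>R Z p))"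
  have "?S \<inter> frontier Om \<noteq> {}"
   using a b by (intro connected_Int_frontier) auto
  then obtain y where y: "y \<in> ?S" "y \<in> frontier Om" by blast
  obtain l where l: "0 <= l" "l <= 1" "y = (1 - l) *\<^sub>R (p + s *\<^sub>R (\<tau> - \<eta> *\<^sub>R Z p)) + l *\<^sub>R (p + s *\<^sub>R (\<tau> + \<eta> *\<^sub>R Z p))"
   using y(1) unfolding in_segment by blast
  define k where "k = (2 * l - 1) * \<eta>"
  have k: "\<bar>k\<bar> <= \<eta>" using l \<eta> by (auto simp: k_def abs_mult mult_le_cancel_right1)
  have yk: "y - p = s *\<^sub>R (\<tau> + k *\<^sub>R Z p)" unfolding l(3) k_def by (simp add: algebra_simps flip: scaleR_add_left)
  have "norm (k *\<^sub>R Z p) <= 1 * norm (Z p)" unfolding norm_scaleR using k \<eta> by (intro mult_right_mono) auto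
  then have nt: "norm (\<tau> + k *\<^sub>R Z p) <= norm \<tau> + norm (Z p)" using norm_triangle_ineq [of \<tau> "k *\<^sub>R Z p"] by linarith
  then have ny: "norm (y - p) <= s * (norm \<tau> + norm (Z p))" unfolding yk using s by (simp add: mult_left_mono)
  also have "\<dots> < d" using s(2) n0 by (simp add: s1_def pos_less_divide_eq)
  finally have "norm (h y - h p - h' (y - p)) <= \<eta> * norm (y - p)" using d(2) frontier_closure [OF y(2)] by blast
  then have "\<bar>h' (y - p)\<bar> <= \<eta> * norm (y - p)" using zero [OF y(2)] zero [OF p] by simp
  also have "\<dots> <= \<eta> * (s * (norm \<tau> + norm (Z p)))" using ny \<eta> by (intro mult_left_mono) auto
  also have "h' (y - p) = s * (h' \<tau> + k * h' (Z p))" unfolding yk using lin by (simp add: linear_add linear_cmul)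
  finally have "s * \<bar>h' \<tau> + k * h' (Z p)\<bar> <= s * (\<eta> * (norm \<tau> + norm (Z p)))" using s by (simp add: abs_mult mult_ac)
  then have "\<bar>h' \<tau> + k * h' (Z p)\<bar> <= \<eta> * (norm \<tau> + norm (Z p))" using s by simp
  moreover have "\<bar>k * h' (Z p)\<bar> <= \<eta> * \<bar>h' (Z p)\<bar>" unfolding abs_mult using k by (intro mult_right_mono) auto
  ultimately have "\<bar>h' \<tau>\<bar> <= \<eta> * (norm \<tau> + norm (Z p)) + \<eta> * \<bar>h' (Z p)\<bar>" by linarith
  then show ?thesis by (simp add: algebra_simps)
 qed
 note bound = this
 show ?thesis
 proof (rule ccontr)
  assume "h' \<tau> \<noteq> 0"
  define B where "B = \<bar>h' (Z p)\<bar> + norm \<tau> + norm (Z p)"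
  have B: "0 < B" using Z_frontier [OF p] by (simp add: B_def add_nonneg_pos)
  define \<eta> where "\<eta> = min 1 (\<bar>h' \<tau>\<bar> / (2 * B))"
  have \<eta>: "0 < \<eta>" "\<eta> <= 1" using B \<open>h' \<tau> \<noteq> 0\<close> by (auto simp: \<eta>_def)
  have "\<bar>h' \<tau>\<bar> <= \<eta> * B" using bound [OF \<eta>] by (simp add: B_def)
  also have "\<dots> <= \<bar>h' \<tau>\<bar> / (2 * B) * B" using B by (intro mult_right_mono) (auto simp: \<eta>_def)
  also have "\<dots> = \<bar>h' \<tau>\<bar> / 2" using B by simp
  finally show False using \<open>h' \<tau> \<noteq> 0\<close> by simp
 qed
qed

end

text \<open>A solution together with all derivatives that the maximum principle needs: \<open>Du\<close> is the spatial gradient, \<open>H\<close> the Hessian, \<open>T t x b\<close> the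
  derivative of \<open>H t x b\<close> in the direction \<open>b\<close>, \<open>ft\<close> the time derivative, and \<open>P\<close> the gradient of \<open>ft\<close>, which is also the time
  derivative of \<open>Du\<close>. Up to time 0 only \<open>u\<close> and \<open>Du\<close> are continuous.\<close>

locale ac_flow = C2_domain Om z Z Z' + w: well W W' W'' \<alpha> \<beta> \<gamma>
 for Om :: "'a::euclidean_space set" and z Z Z' W W' W'' \<alpha> \<beta> \<gamma> +
 fixes eps :: real and u :: "real => 'a => real" and Du :: "real => 'a => 'a" and H :: "real => 'a => 'a => 'a"
  and T :: "real => 'a => 'a => 'a" and ft :: "real => 'a => real" and P :: "real => 'a => 'a"
 assumes u_cont0: "continuous_on ({0..} \<times> closure Om) (\<lambda>(t, x). u t x)"
  and Du_cont0: "continuous_on ({0..} \<times> closure Om) (\<lambda>(t, x). Du t x)"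
  and slice: "\<And>t. 0 < t ==> slice Om z Z Z' W W' eps (u t) (Du t) (H t)"
  and u_frontier: "\<And>t p. 0 < t ==> p \<in> frontier Om ==> (u t has_derivative (\<lambda>h. Du t p \<bullet> h)) (at p within closure Om)"
  and Du_frontier: "\<And>t p. 0 < t ==> p \<in> frontier Om ==> (Du t has_derivative H t p) (at p within closure Om)"
  and H_frontier_sym: "\<And>t p h k. 0 < t ==> p \<in> frontier Om ==> H t p h \<bullet> k = h \<bullet> H t p k"
  and third: "\<And>t x b. 0 < t ==> x \<in> Om ==> b \<in> Basis ==> ((\<lambda>s. H t (x + s *\<^sub>R b) b) has_vector_derivative T t x b) (at 0)"
  and ft_eq: "\<And>t x. 0 < t ==> x \<in> Om ==> ft t x = div_of (H t x) - W' (u t x) / eps\<^sup>2"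
  and u_time: "\<And>t x. 0 < t ==> x \<in> Om ==> ((\<lambda>s. u s x) has_real_derivative ft t x) (at t)"
  and Du_time: "\<And>t x. 0 < t ==> x \<in> Om ==> ((\<lambda>s. Du s x) has_vector_derivative P t x) (at t)"
  and P_eq: "\<And>t x. 0 < t ==> x \<in> Om ==> P t x = (\<Sum>b\<in>Basis. T t x b) - (W'' (u t x) / eps\<^sup>2) *\<^sub>R Du t x"
  and ft_deriv: "\<And>t x. 0 < t ==> x \<in> Om ==> (ft t has_derivative (\<lambda>h. P t x \<bullet> h)) (at x)"
  and ft_cont: "continuous_on ({0<..} \<times> closure Om) (\<lambda>(t, x). ft t x)"
  and P_cont: "continuous_on ({0<..} \<times> closure Om) (\<lambda>(t, x). P t x)"
begin

lemma eps_pos: "0 < eps" using slice [of 1] by (simp add: slice_def slice_axioms_def)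

lemma eq_slice: "0 < t ==> x \<in> Om ==> ft t x = slice.f W' eps (u t) (H t) x"
 using slice.f_def [OF slice] ft_eq by simp

lemma cont0: "continuous_on ({0..T0} \<times> closure Om) (\<lambda>(t, x). u t x)" "continuous_on ({0..T0} \<times> closure Om) (\<lambda>(t, x). Du t x)"
 by (rule continuous_on_subset [OF u_cont0], auto) (rule continuous_on_subset [OF Du_cont0], auto)

text \<open>The barrier \<open>\<delta> * exp (\<Lambda> * t) * (M + z x)\<close> has positive normal derivative, which excludes touching on the boundary, and it grows
  fast enough to absorb \<open>W'\<close>, which is Lipschitz on the range of \<open>u\<close>.\<close>

lemma norm_u_le_1:
 assumes init: "\<And>x. x \<in> closure Om ==> \<bar>u 0 x\<bar> <= 1" and t: "0 <= t" and x: "x \<in> closure Om"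
 shows "\<bar>u t x\<bar> <= 1"
proof -
 obtain Bz where Bz: "0 < Bz" "\<And>x. x \<in> closure Om ==> norm (z x) <= Bz" using bounded_on_closure [OF z_cont] by blast
 have dc: "continuous_on (closure Om) (\<lambda>x. div_of (Z' x))"
  by (intro div_of_cont continuous_on_subset [OF Z'_cont]) auto
 obtain Cz where Cz: "0 < Cz" "\<And>x. x \<in> closure Om ==> norm (div_of (Z' x)) <= Cz" using bounded_on_closure [OF dc] by blast
 obtain L where L: "\<And>s. \<bar>s\<bar> <= 2 ==> \<bar>W'' s\<bar> <= L"
 proof -
  have "compact (W'' ` {-2..2})" by (intro compact_continuous_image continuous_on_subset [OF w.W''_cont]) auto
  then obtain L where "\<forall>y\<in>W'' ` {-2..2}. norm y <= L" using compact_imp_bounded bounded_iff by blast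
  then show thesis by (intro that [of L]) (auto simp: abs_le_iff)
 qed
 have L0: "0 <= L" using L [of 0] abs_ge_zero [of "W'' 0"] by linarith
 have lip: "\<bar>W' s\<bar> <= L * (\<bar>s\<bar> - 1)" if s: "1 <= \<bar>s\<bar>" "\<bar>s\<bar> <= 2" for s
 proof (cases "0 <= s")
  case True
  have "norm (W' s - W' 1) <= L * norm (s - 1)"
  proof (rule field_differentiable_bound [of "{1..2}" W' W''])
   show "(W' has_field_derivative W'' y) (at y within {1..2})" for y by (rule has_field_derivative_at_within [OF w.W'_deriv])
  qed (use s True L in auto)
  then show ?thesis using s True w.W'_zero by simp
 next
  case False
  have "norm (W' s - W' (- 1)) <= L * norm (s - (- 1))"
  proof (rule field_differentiable_bound [of "{-2..-1}" W' W''])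
   show "(W' has_field_derivative W'' y) (at y within {-2..-1})" for y by (rule has_field_derivative_at_within [OF w.W'_deriv])
  qed (use s False L in auto)
  then show ?thesis using s False w.W'_zero by simp
 qed
 define M where "M = Bz + 1"
 have Mz: "1 <= M + z y" "M + z y <= M" if "y \<in> closure Om" for y
  using Bz(2) [OF that] z_closure [OF that] by (auto simp: M_def)
 define \<Lambda> where "\<Lambda> = Cz + 4 * L / eps\<^sup>2 + 1"
 have \<Lambda>: "0 < \<Lambda>" using Cz L0 by (simp add: \<Lambda>_def add_pos_nonneg)
 have main: "(u t x)\<^sup>2 < 1 + \<delta> * exp (\<Lambda> * t) * (M + z x)" if \<delta>: "0 < \<delta>" "\<delta> * exp (\<Lambda> * t) * M <= 3" for \<delta>
 proof -
  define v where "v s y = (u s y)\<^sup>2 - 1 - \<delta> * exp (\<Lambda> * s) * (M + z y)" for s y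
  have "v t x < 0"
  proof (rule parabolic_touch [OF compact_closure, where T = t and v = v])
   have "continuous_on ({0..t} \<times> closure Om) (\<lambda>p. (case p of (t, x) => u t x)\<^sup>2 - 1 - \<delta> * exp (\<Lambda> * fst p) * (M + z (snd p)))"
    by (intro continuous_intros cont0 continuous_on_compose2 [OF z_cont [of UNIV]]) auto
   then show "continuous_on ({0..t} \<times> closure Om) (\<lambda>(s, y). v s y)" by (simp add: v_def case_prod_beta)
   show "v 0 y < 0" if y: "y \<in> closure Om" for y
   proof -
    have "(u 0 y)\<^sup>2 <= 1" using init [OF y] by (simp add: abs_square_le_1)
    moreover have "0 < \<delta> * (M + z y)" using \<delta> Mz [OF y] by simp
    ultimately show ?thesis by (simp add: v_def)
   qed
   fix s y assume s: "0 < s" "s <= t" and y: "y \<in> closure Om" and v0: "v s y = 0"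
    and max: "\<And>r q. 0 <= r ==> r <= s ==> q \<in> closure Om ==> v r q <= 0"
   interpret s: slice Om z Z Z' W W' eps "u s" "Du s" "H s" by (rule slice [OF s(1)])
   define d where "d = \<delta> * exp (\<Lambda> * s)"
   have d: "0 < d" using \<delta> by (simp add: d_def)
   define w where "w = d * (M + z y)"
   have w: "d <= w" "(u s y)\<^sup>2 = 1 + w" "w <= 3"
   proof -
    show "d <= w" using mult_left_mono [OF Mz(1) [OF y], of d] d by (simp add: w_def)
    show "(u s y)\<^sup>2 = 1 + w" using v0 by (simp add: v_def w_def d_def)
    have "w <= d * M" using Mz(2) [OF y] d by (simp add: w_def)
    also have "\<dots> <= \<delta> * exp (\<Lambda> * t) * M"
     unfolding d_def using s \<delta> \<Lambda> Bz by (intro mult_right_mono mult_left_mono) (auto simp: M_def)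
    finally show "w <= 3" using \<delta>(2) by simp
   qed
   show False
   proof (cases "y \<in> Om")
    case True
    define G where "G q = (2 * u s q) *\<^sub>R Du s q - d *\<^sub>R Z q" for q
    have G: "(v s has_derivative (\<lambda>h. G q \<bullet> h)) (at q)" if "q \<in> Om" for q
    proof -
     have "((\<lambda>y. u s y * u s y - 1 - d * (M + z y)) has_derivative (\<lambda>h. u s q * (Du s q \<bullet> h) + (Du s q \<bullet> h) * u s q - 0 - d * (0 + Z q \<bullet> h))) (at q)"
      by (intro has_derivative_diff has_derivative_mult has_derivative_mult_right has_derivative_add has_derivative_const s.u_deriv that z_deriv)
     then show ?thesis by (simp add: G_def v_def [abs_def] power2_eq_square d_def inner_diff_left algebra_simps)
    qed
    define K where "K b = 2 * (Du s y \<bullet> b)\<^sup>2 + 2 * u s y * (H s y b \<bullet> b) - d * (Z' y b \<bullet> b)" for b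
    have K: "((\<lambda>r. G (y + r *\<^sub>R b) \<bullet> b) has_real_derivative K b) (at 0)" for b
    proof -
     have "(G has_derivative (\<lambda>h. ((2 * u s y) *\<^sub>R H s y h + (2 * (Du s y \<bullet> h)) *\<^sub>R Du s y) - d *\<^sub>R Z' y h)) (at y)"
      unfolding G_def
      by (intro has_derivative_diff has_derivative_scaleR has_derivative_mult_right s.u_deriv s.Du_deriv True has_derivative_scaleR_right Z_deriv)
     from has_derivative_inner_left [OF this, of b]
     have "((\<lambda>q. G q \<bullet> b) has_derivative (\<lambda>h. (((2 * u s y) *\<^sub>R H s y h + (2 * (Du s y \<bullet> h)) *\<^sub>R Du s y) - d *\<^sub>R Z' y h) \<bullet> b)) (at (y + 0 *\<^sub>R b))"
      by simp
     from has_derivative_line [OF this] show ?thesis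
      by (simp add: has_real_derivative_iff_has_vector_derivative K_def inner_diff_left inner_add_left power2_eq_square algebra_simps)
    qed
    have mx: "v s q <= v s y" if "q \<in> Om" for q using max [of s q] v0 s that closure_subset by auto
    have sumK: "(\<Sum>b\<in>Basis. K b) <= 0" using interior_max(2) [OF True G K mx] .
    have "(\<Sum>b\<in>Basis. K b) = (\<Sum>b\<in>Basis. 2 * (Du s y \<bullet> b)\<^sup>2) + 2 * u s y * div_of (H s y) - d * div_of (Z' y)"
     unfolding K_def div_of_def by (simp add: sum.distrib sum_subtractf sum_distrib_left)
    moreover have "0 <= (\<Sum>b\<in>Basis. 2 * (Du s y \<bullet> b)\<^sup>2)" by (intro sum_nonneg) auto
    moreover have "d * div_of (Z' y) <= d * Cz"
     using Cz(2) [OF y] d by (intro mult_left_mono) auto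
    ultimately have lap: "2 * u s y * div_of (H s y) <= d * Cz" using sumK by linarith
    have "((\<lambda>r. v r y) has_real_derivative 2 * u s y * ft s y - \<Lambda> * w) (at s)"
     unfolding v_def w_def d_def
     by (rule derivative_eq_intros u_time s True refl)+ (simp add: algebra_simps)
    then have "0 <= 2 * u s y * ft s y - \<Lambda> * w"
     using s v0 max [OF _ _ y] by (intro left_max_derivative [of "\<lambda>r. v r y" _ s]) auto
    moreover have "2 * u s y * ft s y = 2 * u s y * div_of (H s y) - 2 * (u s y * W' (u s y)) / eps\<^sup>2"
     unfolding ft_eq [OF s(1) True] by (simp add: algebra_simps)
    moreover have "- (2 * (u s y * W' (u s y)) / eps\<^sup>2) <= 4 * L / eps\<^sup>2 * w"
    proof -
     have "1 <= (u s y)\<^sup>2" "(u s y)\<^sup>2 <= 2\<^sup>2" using w d by auto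
     then have u12: "1 <= \<bar>u s y\<bar>" "\<bar>u s y\<bar> <= 2"
      using abs_le_square_iff [of 1 "u s y"] abs_le_square_iff [of "u s y" 2] by auto
     have "\<bar>u s y\<bar> * 1 <= \<bar>u s y\<bar> * \<bar>u s y\<bar>" using u12 by (intro mult_left_mono) auto
     then have "\<bar>u s y\<bar> - 1 <= w" using w(2) by (simp add: power2_eq_square)
     have "\<bar>u s y * W' (u s y)\<bar> <= 2 * (L * (\<bar>u s y\<bar> - 1))" unfolding abs_mult using u12 lip [OF u12] by (intro mult_mono) auto
     also have "\<dots> <= 2 * (L * w)" using \<open>\<bar>u s y\<bar> - 1 <= w\<close> L0 by (intro mult_left_mono) auto
     finally have "- (2 * (u s y * W' (u s y))) <= 4 * L * w" by linarith
     then have "- (2 * (u s y * W' (u s y))) / eps\<^sup>2 <= 4 * L * w / eps\<^sup>2" by (intro divide_right_mono) auto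
     then show ?thesis by simp
    qed
    moreover have "d * Cz <= w * Cz" using w Cz by (intro mult_right_mono) auto
    ultimately have "0 <= w * Cz + 4 * L / eps\<^sup>2 * w - \<Lambda> * w" using lap by linarith
    then have "0 <= - w" by (simp add: \<Lambda>_def algebra_simps)
    then show False using w d by linarith
   next
    case False
    then have yf: "y \<in> frontier Om" using closure_cases [OF y] by blast
    have "((\<lambda>y. u s y * u s y - 1 - d * (M + z y)) has_derivative (\<lambda>h. u s y * (Du s y \<bullet> h) + (Du s y \<bullet> h) * u s y - 0 - d * (0 + Z y \<bullet> h))) (at y within closure Om)"
     by (intro has_derivative_diff has_derivative_mult has_derivative_mult_right has_derivative_add has_derivative_const u_frontier s yf has_derivative_at_withinI [OF z_deriv])
    then have "(v s has_derivative (\<lambda>h. u s y * (Du s y \<bullet> h) + (Du s y \<bullet> h) * u s y - d * (Z y \<bullet> h))) (at y within closure Om)"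
     by (simp add: v_def [abs_def] power2_eq_square d_def)
    from frontier_max [OF yf this] max [of s] v0 s
    have "0 <= u s y * (Du s y \<bullet> Z y) + (Du s y \<bullet> Z y) * u s y - d * (Z y \<bullet> Z y)" by auto
    then have "d * (Z y \<bullet> Z y) <= 0" using s.neumann [OF yf] by simp
    moreover have "0 < Z y \<bullet> Z y" using Z_frontier [OF yf] by simp
    ultimately show False using d by (simp add: mult_le_0_iff)
   qed
  qed (use t x in auto)
  then show ?thesis by (simp add: v_def)
 qed
 have close: "(u t x)\<^sup>2 <= 1 + e" if e: "0 < e" "e <= 3" for e
 proof -
  define \<delta> where "\<delta> = e / (exp (\<Lambda> * t) * M)"
  have M0: "0 < M" using Bz by (simp add: M_def)
  have \<delta>: "0 < \<delta>" "\<delta> * exp (\<Lambda> * t) * M = e" using e M0 by (auto simp: \<delta>_def)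
  have "(u t x)\<^sup>2 < 1 + \<delta> * exp (\<Lambda> * t) * (M + z x)" using main [OF \<delta>(1)] \<delta>(2) e by simp
  also have "\<dots> <= 1 + \<delta> * exp (\<Lambda> * t) * M" using \<delta>(1) Mz(2) [OF x] by simp
  finally show ?thesis using \<delta>(2) by simp
 qed
 have "(u t x)\<^sup>2 <= 1"
 proof (rule field_le_epsilon)
  fix e :: real assume e: "0 < e"
  have "(u t x)\<^sup>2 <= 1 + min e 3" using close [of "min e 3"] e by simp
  then show "(u t x)\<^sup>2 <= 1 + e" by linarith
 qed
 then show ?thesis by (simp add: abs_square_le_1)
qed

end

section \<open>The upper bound for the discrepancy\<close>

text \<open>At an interior touching point the gradient of the comparison function vanishes, which bounds the Hessian from below by
  \<open>Fp\<^sup>2 / eps ^ 4\<close> up to the boundary correction; this absorbs the reaction term.\<close>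

lemma touching_inequality:
 fixes D Zv HD :: "'a::euclidean_space"
 assumes eps: "0 < eps" and grad: "eps\<^sup>2 *\<^sub>R HD = Fp *\<^sub>R D + p *\<^sub>R Zv"
  and HB: "(norm HD)\<^sup>2 <= B * (norm D)\<^sup>2" and N: "0 < norm D" and p: "0 <= p"
  and par: "0 <= - (eps\<^sup>2 * B) - 2 * s * (norm D)\<^sup>2 + Fp * w / eps\<^sup>2 + R"
  and FF: "Fp * w <= Fp\<^sup>2"
 shows "2 * s * eps\<^sup>2 * (norm D)\<^sup>2 <= 2 * \<bar>Fp\<bar> * p * norm Zv / norm D + eps\<^sup>2 * R"
proof -
 define n where "n = norm D"
 have n: "0 < n" using N by (simp add: n_def)
 have "Fp\<^sup>2 * n\<^sup>2 - 2 * \<bar>Fp\<bar> * p * n * norm Zv <= (norm (Fp *\<^sub>R D + p *\<^sub>R Zv))\<^sup>2"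
 proof -
  have "\<bar>Fp * p * (D \<bullet> Zv)\<bar> <= \<bar>Fp\<bar> * p * (n * norm Zv)"
   unfolding abs_mult n_def using p by (intro mult_mono Cauchy_Schwarz_ineq2) auto
  moreover have "(norm (Fp *\<^sub>R D + p *\<^sub>R Zv))\<^sup>2 = Fp\<^sup>2 * n\<^sup>2 + 2 * (Fp * p * (D \<bullet> Zv)) + p\<^sup>2 * (norm Zv)\<^sup>2"
   unfolding n_def power2_norm_eq_inner by (simp add: inner_add_left inner_add_right inner_commute power2_eq_square algebra_simps)
  moreover have "0 <= p\<^sup>2 * (norm Zv)\<^sup>2" by simp
  moreover have "2 * \<bar>Fp\<bar> * p * n * norm Zv = 2 * (\<bar>Fp\<bar> * p * (n * norm Zv))" by simp
  ultimately show ?thesis by linarith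
 qed
 also have "\<dots> = eps\<^sup>2 * eps\<^sup>2 * (norm HD)\<^sup>2" unfolding grad [symmetric] by (simp add: power2_eq_square)
 also have "\<dots> <= eps\<^sup>2 * eps\<^sup>2 * (B * n\<^sup>2)" using HB by (intro mult_left_mono) (auto simp: n_def)
 finally have 1: "n * (Fp\<^sup>2 * n - 2 * \<bar>Fp\<bar> * p * norm Zv) <= n * (eps\<^sup>2 * eps\<^sup>2 * B * n)"
  by (simp add: power2_eq_square algebra_simps)
 have 2: "Fp\<^sup>2 * n - 2 * \<bar>Fp\<bar> * p * norm Zv <= eps\<^sup>2 * eps\<^sup>2 * B * n"
  using mult_left_le_imp_le [OF 1 n] .
 have "0 <= (eps\<^sup>2 * n) * (- (eps\<^sup>2 * B) - 2 * s * n\<^sup>2 + Fp * w / eps\<^sup>2 + R)"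
  using par n by (intro mult_nonneg_nonneg) (auto simp: n_def)
 also have "\<dots> = - (eps\<^sup>2 * eps\<^sup>2 * B * n) - 2 * s * eps\<^sup>2 * n\<^sup>2 * n + Fp * w * n + eps\<^sup>2 * R * n"
  using eps by (simp add: field_simps)
 finally have 3: "2 * s * eps\<^sup>2 * n\<^sup>2 * n <= 2 * \<bar>Fp\<bar> * p * norm Zv + (Fp * w - Fp\<^sup>2) * n + eps\<^sup>2 * R * n"
  using 2 by (simp add: algebra_simps)
 have "(Fp * w - Fp\<^sup>2) * n <= 0" using FF n by (simp add: mult_le_0_iff)
 then have "2 * s * eps\<^sup>2 * n\<^sup>2 * n <= (2 * \<bar>Fp\<bar> * p * norm Zv / n + eps\<^sup>2 * R) * n"
  using 3 n by (simp add: distrib_right)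
 from mult_right_le_imp_le [OF this n] show ?thesis by (simp add: n_def)
qed

context ac_flow
begin

lemma third_norm_bound:
 assumes t: "0 < t" and x: "x \<in> Om"
 shows "(norm (H t x h))\<^sup>2 <= (\<Sum>b\<in>Basis. (norm (H t x b))\<^sup>2) * (norm h)\<^sup>2"
proof -
 interpret s: slice Om z Z Z' W W' eps "u t" "Du t" "H t" by (rule slice [OF t])
 have lin: "linear (H t x)" using has_derivative_linear [OF s.Du_deriv [OF x]] .
 have "H t x h \<bullet> b = h \<bullet> H t x b" for b by (rule s.H_sym [OF x])
 have "(norm (H t x h))\<^sup>2 = (\<Sum>b\<in>Basis. (H t x h \<bullet> b)\<^sup>2)"
  by (subst power2_norm_eq_inner, subst euclidean_inner) (simp add: power2_eq_square)
 also have "\<dots> <= (\<Sum>b\<in>Basis. (norm h)\<^sup>2 * (norm (H t x b))\<^sup>2)"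
 proof (rule sum_mono)
  fix b :: 'a
  have "\<bar>H t x h \<bullet> b\<bar> <= norm h * norm (H t x b)" unfolding s.H_sym [OF x] by (rule Cauchy_Schwarz_ineq2)
  then have "\<bar>H t x h \<bullet> b\<bar>\<^sup>2 <= (norm h * norm (H t x b))\<^sup>2" by (intro power_mono) auto
  then show "(H t x h \<bullet> b)\<^sup>2 <= (norm h)\<^sup>2 * (norm (H t x b))\<^sup>2" by (simp add: power_mult_distrib)
 qed
 also have "\<dots> = (\<Sum>b\<in>Basis. (norm (H t x b))\<^sup>2) * (norm h)\<^sup>2"
  by (simp add: sum_distrib_left [symmetric] mult.commute)
 finally show ?thesis .
qed

text \<open>The discrepancy, multiplied by \<open>eps\<close>, minus a small correction of size \<open>s\<close>. The concave term \<open>- s * (u - \<gamma>)\<^sup>2\<close> produces the good term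
  \<open>- 2 * s * (norm Du)\<^sup>2\<close> in the interior. The exponential is a boundary layer of width \<open>s\<close>, small although its normal derivative is \<open>K\<close>.\<close>

definition Q :: "real => real => real => 'a => real" where
 "Q K s t x = eps\<^sup>2 / 2 * (Du t x \<bullet> Du t x) - (W (u t x) + s * (4 - (u t x - \<gamma>)\<^sup>2) + (K + 1) * s) - K * s * (exp (z x / s) - 1)"

definition F' :: "real => real => real" where "F' s v = W' v - 2 * s * (v - \<gamma>)"

lemma F_deriv: "((\<lambda>v. W v + s * (4 - (v - \<gamma>)\<^sup>2) + (K + 1) * s) has_real_derivative F' s v) (at v)"
 unfolding F'_def by (auto intro!: derivative_eq_intros w.W_deriv simp: algebra_simps)

lemma exp_deriv: "0 < s ==> ((\<lambda>v. K * s * (exp (v / s) - 1)) has_real_derivative K * exp (v / s)) (at v)"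
 by (auto intro!: derivative_eq_intros)

lemma Du_sq_time:
 assumes t: "0 < t" and x: "x \<in> Om"
 shows "((\<lambda>r. Du r x \<bullet> Du r x) has_real_derivative 2 * (Du t x \<bullet> P t x)) (at t)"
proof -
 have "((\<lambda>r. Du r x \<bullet> Du r x) has_derivative (\<lambda>h. Du t x \<bullet> (h *\<^sub>R P t x) + (h *\<^sub>R P t x) \<bullet> Du t x)) (at t)"
  by (intro has_derivative_inner Du_time [OF t x, unfolded has_vector_derivative_def])
 moreover have "(\<lambda>h. Du t x \<bullet> (h *\<^sub>R P t x) + (h *\<^sub>R P t x) \<bullet> Du t x) = (*) (2 * (Du t x \<bullet> P t x))"
  by (auto simp: algebra_simps inner_commute)
 ultimately show ?thesis by (simp add: has_field_derivative_def)
qed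

lemma Q_touch_interior:
 assumes s: "0 < s" and K: "0 < K" and t: "0 < t" and x: "x \<in> Om" and u1: "\<bar>u t x\<bar> <= 1"
  and Z: "norm (Z x) <= CZ" "\<bar>div_of (Z' x)\<bar> <= CD" and W: "\<bar>W' (u t x)\<bar> <= CF"
  and zero: "Q K s t x = 0"
  and max: "\<And>r q. 0 <= r ==> r <= t ==> q \<in> closure Om ==> Q K s r q <= 0"
 shows "4 * s\<^sup>2 <= 2 * (CF + 4 * s) * K * CZ * eps / sqrt (2 * s) + eps\<^sup>2 * (K * CZ\<^sup>2 / s + K * CD)"
proof -
 interpret s: slice Om z Z Z' W W' eps "u t" "Du t" "H t" by (rule slice [OF t])
 have u2: "(u t x - \<gamma>)\<^sup>2 <= 4"
 proof -
  have "\<bar>u t x - \<gamma>\<bar> <= 2" using u1 w.\<gamma>(1,2) by linarith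
  then show ?thesis using abs_le_square_iff [of "u t x - \<gamma>" 2] by simp
 qed
 define p where "p y = K * exp (z y / s)" for y
 define G where "G y = eps\<^sup>2 *\<^sub>R H t y (Du t y) - F' s (u t y) *\<^sub>R Du t y - p y *\<^sub>R Z y" for y
 have e2_deriv: "((\<lambda>v. K * exp (v / s)) has_real_derivative K / s * exp (v / s)) (at v)" for v
  using s by (auto intro!: derivative_eq_intros)
 have F'_deriv: "(F' s has_real_derivative W'' v - 2 * s) (at v)" for v
  unfolding F'_def by (auto intro!: derivative_eq_intros w.W'_deriv)
 have G: "(Q K s t has_derivative (\<lambda>h. G y \<bullet> h)) (at y)" if y: "y \<in> Om" for y
 proof -
  have 1: "((\<lambda>y. W (u t y) + s * (4 - (u t y - \<gamma>)\<^sup>2) + (K + 1) * s) has_derivative (\<lambda>h. F' s (u t y) * (Du t y \<bullet> h))) (at y)"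
   by (rule has_derivative_compose [OF s.u_deriv [OF y], where g = "\<lambda>v. W v + s * (4 - (v - \<gamma>)\<^sup>2) + (K + 1) * s", OF F_deriv [unfolded has_field_derivative_def]])
  have 2: "((\<lambda>y. K * s * (exp (z y / s) - 1)) has_derivative (\<lambda>h. p y * (Z y \<bullet> h))) (at y)"
   unfolding p_def
   by (rule has_derivative_compose [OF z_deriv, where g = "\<lambda>v. K * s * (exp (v / s) - 1)", OF exp_deriv [OF s, unfolded has_field_derivative_def]])
  have 3: "((\<lambda>y. eps\<^sup>2 / 2 * (Du t y \<bullet> Du t y)) has_derivative (\<lambda>h. eps\<^sup>2 / 2 * (Du t y \<bullet> H t y h + H t y h \<bullet> Du t y))) (at y)"
   by (intro has_derivative_mult_right has_derivative_inner s.Du_deriv y)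
  have "(Q K s t has_derivative (\<lambda>h. eps\<^sup>2 / 2 * (Du t y \<bullet> H t y h + H t y h \<bullet> Du t y) - F' s (u t y) * (Du t y \<bullet> h) - p y * (Z y \<bullet> h))) (at y)"
   unfolding Q_def [abs_def] by (intro has_derivative_diff 1 2 3)
  moreover have "eps\<^sup>2 / 2 * (Du t y \<bullet> H t y h + H t y h \<bullet> Du t y) - F' s (u t y) * (Du t y \<bullet> h) - p y * (Z y \<bullet> h) = G y \<bullet> h" for h
   using s.H_sym [OF y, of h "Du t y"] s.H_sym [OF y, of "Du t y" h]
   by (simp add: G_def inner_diff_left inner_diff_right inner_commute)
  ultimately show ?thesis by simp
 qed
 define B where "B = (\<Sum>b\<in>Basis. (norm (H t x b))\<^sup>2)"
 define k where "k b = eps\<^sup>2 * ((norm (H t x b))\<^sup>2 + Du t x \<bullet> T t x b) - (W'' (u t x) - 2 * s) * (Du t x \<bullet> b)\<^sup>2 - F' s (u t x) * (H t x b \<bullet> b)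
   - K / s * exp (z x / s) * (Z x \<bullet> b)\<^sup>2 - p x * (Z' x b \<bullet> b)" for b
 have k: "((\<lambda>r. G (x + r *\<^sub>R b) \<bullet> b) has_real_derivative k b) (at 0)" if b: "b \<in> Basis" for b
 proof -
  obtain d where d: "0 < d" "ball x d \<subseteq> Om" using open_Om x open_contains_ball by blast
  have line: "x + r *\<^sub>R b \<in> Om" if "\<bar>r\<bar> < d" for r
   using d(2) that b by (auto simp: dist_norm)
  have x0: "x = x + 0 *\<^sub>R b" by simp
  have D1: "((\<lambda>r. Du t (x + r *\<^sub>R b)) has_vector_derivative H t x b) (at 0)"
   using has_derivative_line [of "Du t" "H t x" x 0 b] s.Du_deriv [OF x] by simp
  have D2: "((\<lambda>r. u t (x + r *\<^sub>R b)) has_real_derivative Du t x \<bullet> b) (at 0)"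
   using has_derivative_line [of "u t" "\<lambda>h. Du t x \<bullet> h" x 0 b] s.u_deriv [OF x] by (simp add: has_real_derivative_iff_has_vector_derivative)
  have D3: "((\<lambda>r. z (x + r *\<^sub>R b)) has_real_derivative Z x \<bullet> b) (at 0)"
   using has_derivative_line [of z "\<lambda>h. Z x \<bullet> h" x 0 b] z_deriv [of x] by (simp add: has_real_derivative_iff_has_vector_derivative)
  have D4: "((\<lambda>r. Z (x + r *\<^sub>R b)) has_vector_derivative Z' x b) (at 0)"
   using has_derivative_line [of Z "Z' x" x 0 b] Z_deriv [of x] by simp
  have in1: "((\<lambda>r. A r \<bullet> C r) has_real_derivative A 0 \<bullet> C' + A' \<bullet> C 0) (at 0)"
   if "(A has_vector_derivative A') (at 0)" "(C has_vector_derivative C') (at 0)" for A C :: "real => 'a" and A' C'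
  proof -
   have "((\<lambda>r. A r \<bullet> C r) has_derivative (\<lambda>h. A 0 \<bullet> (h *\<^sub>R C') + (h *\<^sub>R A') \<bullet> C 0)) (at 0)"
    using that unfolding has_vector_derivative_def by (rule has_derivative_inner)
   moreover have "(\<lambda>h. A 0 \<bullet> (h *\<^sub>R C') + (h *\<^sub>R A') \<bullet> C 0) = (*) (A 0 \<bullet> C' + A' \<bullet> C 0)"
    by (auto simp: algebra_simps)
   ultimately show ?thesis by (simp add: has_field_derivative_def)
  qed
  have cb: "((\<lambda>r::real. b) has_vector_derivative 0) (at 0)" by simp
  have E1: "((\<lambda>r. Du t (x + r *\<^sub>R b) \<bullet> H t (x + r *\<^sub>R b) b) has_real_derivative Du t x \<bullet> T t x b + H t x b \<bullet> H t x b) (at 0)"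
   using in1 [OF D1 third [OF t x b]] by simp
  have E2: "((\<lambda>r. Du t (x + r *\<^sub>R b) \<bullet> b) has_real_derivative H t x b \<bullet> b) (at 0)" using in1 [OF D1 cb] by simp
  have E4: "((\<lambda>r. Z (x + r *\<^sub>R b) \<bullet> b) has_real_derivative Z' x b \<bullet> b) (at 0)" using in1 [OF D4 cb] by simp
  have E5: "((\<lambda>r. F' s (u t (x + r *\<^sub>R b))) has_real_derivative (W'' (u t x) - 2 * s) * (Du t x \<bullet> b)) (at 0)"
   using DERIV_chain2 [where f = "F' s" and g = "\<lambda>r. u t (x + r *\<^sub>R b)" and x = 0, OF _ D2] F'_deriv [of "u t x"] by simp
  have E6: "((\<lambda>r. p (x + r *\<^sub>R b)) has_real_derivative K / s * exp (z x / s) * (Z x \<bullet> b)) (at 0)"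
   unfolding p_def using DERIV_chain2 [where f = "\<lambda>v. K * exp (v / s)" and g = "\<lambda>r. z (x + r *\<^sub>R b)" and x = 0 and Da = "K / s * exp (z x / s)", OF _ D3] e2_deriv [of "z x"] by simp
  have "((\<lambda>r. eps\<^sup>2 * (Du t (x + r *\<^sub>R b) \<bullet> H t (x + r *\<^sub>R b) b) - F' s (u t (x + r *\<^sub>R b)) * (Du t (x + r *\<^sub>R b) \<bullet> b) - p (x + r *\<^sub>R b) * (Z (x + r *\<^sub>R b) \<bullet> b)) has_real_derivative
    (eps\<^sup>2 * (Du t x \<bullet> T t x b + H t x b \<bullet> H t x b) - ((W'' (u t x) - 2 * s) * (Du t x \<bullet> b) * (Du t x \<bullet> b) + (H t x b \<bullet> b) * F' s (u t x)) - (K / s * exp (z x / s) * (Z x \<bullet> b) * (Z x \<bullet> b) + (Z' x b \<bullet> b) * p x))) (at 0)"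
   using DERIV_diff [OF DERIV_diff [OF DERIV_cmult [OF E1, of "eps\<^sup>2"] DERIV_mult [OF E5 E2]] DERIV_mult [OF E6 E4]] by simp
  then have 1: "((\<lambda>r. eps\<^sup>2 * (Du t (x + r *\<^sub>R b) \<bullet> H t (x + r *\<^sub>R b) b) - F' s (u t (x + r *\<^sub>R b)) * (Du t (x + r *\<^sub>R b) \<bullet> b) - p (x + r *\<^sub>R b) * (Z (x + r *\<^sub>R b) \<bullet> b)) has_real_derivative k b) (at 0)"
   unfolding k_def power2_norm_eq_inner by (simp add: power2_eq_square algebra_simps)
  show ?thesis
  proof (rule DERIV_cong_ev [THEN iffD1, OF refl _ refl 1])
   have "eventually (\<lambda>r. \<bar>r\<bar> < d) (nhds 0)" using d(1) by (auto simp: eventually_nhds_metric)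
   then show "eventually (\<lambda>r. eps\<^sup>2 * (Du t (x + r *\<^sub>R b) \<bullet> H t (x + r *\<^sub>R b) b) - F' s (u t (x + r *\<^sub>R b)) * (Du t (x + r *\<^sub>R b) \<bullet> b) - p (x + r *\<^sub>R b) * (Z (x + r *\<^sub>R b) \<bullet> b) = G (x + r *\<^sub>R b) \<bullet> b) (nhds 0)"
   proof eventually_elim
    case (elim r)
    show ?case unfolding G_def inner_diff_left inner_scaleR_left s.H_sym [OF line [OF elim]] by simp
   qed
  qed
 qed
 have mx: "Q K s t y <= Q K s t x" if "y \<in> Om" for y using max [of t y] zero t that closure_subset by auto
 have G0: "G x = 0" and sumk: "(\<Sum>b\<in>Basis. k b) <= 0" using interior_max [OF x G k mx] by auto
 have sums: "(\<Sum>b\<in>Basis. (v \<bullet> b)\<^sup>2) = (norm v)\<^sup>2" for v :: 'a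
  by (subst power2_norm_eq_inner, subst euclidean_inner) (simp add: power2_eq_square)
 have sk: "(\<Sum>b\<in>Basis. k b) = eps\<^sup>2 * (B + Du t x \<bullet> (\<Sum>b\<in>Basis. T t x b)) - (W'' (u t x) - 2 * s) * (norm (Du t x))\<^sup>2
   - F' s (u t x) * div_of (H t x) - K / s * exp (z x / s) * (norm (Z x))\<^sup>2 - p x * div_of (Z' x)"
  unfolding k_def sum_subtractf sum_distrib_left [symmetric] sum.distrib sums B_def div_of_def inner_sum_right ..
 have "((\<lambda>r. Q K s r x) has_real_derivative eps\<^sup>2 * (Du t x \<bullet> P t x) - F' s (u t x) * ft t x) (at t)"
 proof -
  have 2: "((\<lambda>r. W (u r x) + s * (4 - (u r x - \<gamma>)\<^sup>2) + (K + 1) * s) has_real_derivative F' s (u t x) * ft t x) (at t)"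
   by (rule DERIV_chain2 [where f = "\<lambda>v. W v + s * (4 - (v - \<gamma>)\<^sup>2) + (K + 1) * s", OF F_deriv u_time [OF t x]])
  show ?thesis unfolding Q_def using DERIV_diff [OF DERIV_diff [OF DERIV_cmult [OF Du_sq_time [OF t x], of "eps\<^sup>2 / 2"] 2] DERIV_const] by simp
 qed
 then have time: "0 <= eps\<^sup>2 * (Du t x \<bullet> P t x) - F' s (u t x) * ft t x"
  by (rule left_max_derivative [of "\<lambda>r. Q K s r x"]) (use t zero max x closure_subset in auto)
 have P: "eps\<^sup>2 * (Du t x \<bullet> P t x) = eps\<^sup>2 * (Du t x \<bullet> (\<Sum>b\<in>Basis. T t x b)) - W'' (u t x) * (norm (Du t x))\<^sup>2"
  unfolding P_eq [OF t x] using eps_pos by (simp add: inner_diff_right power2_norm_eq_inner algebra_simps)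
 define R where "R = K / s * exp (z x / s) * (norm (Z x))\<^sup>2 + p x * div_of (Z' x)"
 have par: "0 <= - (eps\<^sup>2 * B) - 2 * s * (norm (Du t x))\<^sup>2 + F' s (u t x) * W' (u t x) / eps\<^sup>2 + R"
  using time sumk unfolding sk P ft_eq [OF t x] R_def by (simp add: algebra_simps)
 have xc: "x \<in> closure Om" using x closure_subset by blast
 have z0: "z x <= 0" using z_closure [OF xc] .
 have ez: "exp (z x / s) <= 1" using z0 s by (simp add: divide_nonpos_pos)
 have p: "0 <= p x" "p x <= K" using K ez by (auto simp: p_def)
 have N2: "2 * s <= eps\<^sup>2 * (norm (Du t x))\<^sup>2"
 proof -
  have "eps\<^sup>2 / 2 * (norm (Du t x))\<^sup>2 = W (u t x) + s * (4 - (u t x - \<gamma>)\<^sup>2) + s + K * s * exp (z x / s)"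
   using zero unfolding Q_def power2_norm_eq_inner by (simp add: algebra_simps)
  moreover have "0 <= s * (4 - (u t x - \<gamma>)\<^sup>2)" "0 <= K * s * exp (z x / s)" using u2 s K by auto
  ultimately show ?thesis using w.W_nonneg [of "u t x"] by linarith
 qed
 then have N: "0 < norm (Du t x)" using s by (cases "Du t x = 0") auto
 have sq: "sqrt (2 * s) <= eps * norm (Du t x)"
  using N2 eps_pos by (intro real_le_lsqrt) (auto simp: power_mult_distrib)
 have "eps\<^sup>2 *\<^sub>R H t x (Du t x) = F' s (u t x) *\<^sub>R Du t x + p x *\<^sub>R Z x" using G0 by (simp add: G_def algebra_simps)
 then have main: "2 * s * eps\<^sup>2 * (norm (Du t x))\<^sup>2 <= 2 * \<bar>F' s (u t x)\<bar> * p x * norm (Z x) / norm (Du t x) + eps\<^sup>2 * R"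
 proof (rule touching_inequality [OF eps_pos _ _ N p(1) par])
  show "(norm (H t x (Du t x)))\<^sup>2 <= B * (norm (Du t x))\<^sup>2" unfolding B_def by (rule third_norm_bound [OF t x])
  have "F' s (u t x) * W' (u t x) - (F' s (u t x))\<^sup>2 = 2 * s * (W' (u t x) * (u t x - \<gamma>)) - 4 * s\<^sup>2 * (u t x - \<gamma>)\<^sup>2"
   by (simp add: F'_def power2_eq_square algebra_simps)
  moreover have "2 * s * (W' (u t x) * (u t x - \<gamma>)) <= 0" using w.\<gamma>(3) [OF u1] s by (simp add: mult_le_0_iff)
  moreover have "0 <= 4 * s\<^sup>2 * (u t x - \<gamma>)\<^sup>2" by simp
  ultimately show "F' s (u t x) * W' (u t x) <= (F' s (u t x))\<^sup>2" by linarith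
 qed
 have "4 * s\<^sup>2 <= 2 * s * eps\<^sup>2 * (norm (Du t x))\<^sup>2"
  using mult_left_mono [OF N2, of "2 * s"] s by (simp add: power2_eq_square)
 moreover have "2 * \<bar>F' s (u t x)\<bar> * p x * norm (Z x) / norm (Du t x) <= 2 * (CF + 4 * s) * K * CZ * (eps / sqrt (2 * s))"
 proof -
  have "\<bar>u t x - \<gamma>\<bar> <= 2" using u1 w.\<gamma>(1,2) by linarith
  then have "s * \<bar>u t x - \<gamma>\<bar> <= s * 2" using s by (intro mult_left_mono) auto
  then have "\<bar>2 * s * (u t x - \<gamma>)\<bar> <= 4 * s" using s by (simp add: abs_mult)
  then have F: "\<bar>F' s (u t x)\<bar> <= CF + 4 * s" using W unfolding F'_def by linarith
  have i: "1 / norm (Du t x) <= eps / sqrt (2 * s)" using sq N s by (simp add: field_simps)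
  have "(2 * \<bar>F' s (u t x)\<bar> * p x * norm (Z x)) * (1 / norm (Du t x)) <= (2 * (CF + 4 * s) * K * CZ) * (eps / sqrt (2 * s))"
  proof (rule mult_mono [OF _ i])
   have "0 <= CF" using W abs_ge_zero [of "W' (u t x)"] by linarith
   moreover have "0 <= CZ" using Z(1) norm_ge_zero [of "Z x"] by linarith
   ultimately show "0 <= 2 * (CF + 4 * s) * K * CZ" using K s by (intro mult_nonneg_nonneg) auto
   show "2 * \<bar>F' s (u t x)\<bar> * p x * norm (Z x) <= 2 * (CF + 4 * s) * K * CZ"
    using F p Z K s \<open>0 <= CF\<close> by (intro mult_mono) auto
  qed (use N in auto)
  then show ?thesis by simp
 qed
 moreover have "eps\<^sup>2 * R <= eps\<^sup>2 * (K * CZ\<^sup>2 / s + K * CD)"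
 proof (intro mult_left_mono)
  have "K / s * exp (z x / s) * (norm (Z x))\<^sup>2 <= K / s * 1 * CZ\<^sup>2" using ez K s Z by (intro mult_mono power_mono) auto
  moreover have "p x * div_of (Z' x) <= K * CD"
  proof -
   have "p x * div_of (Z' x) <= p x * \<bar>div_of (Z' x)\<bar>" using p by (intro mult_left_mono) auto
   also have "\<dots> <= K * CD" using p Z K by (intro mult_mono) auto
   finally show ?thesis .
  qed
  ultimately show "R <= K * CZ\<^sup>2 / s + K * CD" unfolding R_def by simp
 qed simp
 ultimately show ?thesis using main by simp
qed

text \<open>Since the domain need not be convex, the normal derivative of \<open>(norm Du)\<^sup>2\<close> may be positive. Differentiating the Neumann condition
  along the tangential vector \<open>Du\<close> expresses it through the second derivative of \<open>z\<close>; at a touching point it is bounded, and a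
  large \<open>K\<close> outweighs it.\<close>

lemma Q_touch_frontier:
 assumes s: "0 < s" and K: "0 < K" and t: "0 < t" and p: "p \<in> frontier Om" and u1: "\<bar>u t p\<bar> <= 1"
  and Z': "\<And>h. norm (Z' p h) <= C' * norm h" and W: "W (u t p) <= MW" and m: "m <= Z p \<bullet> Z p"
  and big: "2 * C' * (MW + (K + 5) * s) < K * m"
  and zero: "Q K s t p = 0" and max: "\<And>q. q \<in> closure Om ==> Q K s t q <= 0"
 shows False
proof -
 interpret s: slice Om z Z Z' W W' eps "u t" "Du t" "H t" by (rule slice [OF t])
 have 1: "((\<lambda>y. W (u t y) + s * (4 - (u t y - \<gamma>)\<^sup>2) + (K + 1) * s) has_derivative (\<lambda>h. F' s (u t p) * (Du t p \<bullet> h))) (at p within closure Om)"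
  by (rule has_derivative_compose [OF u_frontier [OF t p], where g = "\<lambda>v. W v + s * (4 - (v - \<gamma>)\<^sup>2) + (K + 1) * s", OF F_deriv [unfolded has_field_derivative_def]])
 have 2: "((\<lambda>y. K * s * (exp (z y / s) - 1)) has_derivative (\<lambda>h. K * exp (z p / s) * (Z p \<bullet> h))) (at p within closure Om)"
  by (rule has_derivative_compose [OF has_derivative_at_withinI [OF z_deriv], where g = "\<lambda>v. K * s * (exp (v / s) - 1)", OF exp_deriv [OF s, unfolded has_field_derivative_def]])
 have 3: "((\<lambda>y. eps\<^sup>2 / 2 * (Du t y \<bullet> Du t y)) has_derivative (\<lambda>h. eps\<^sup>2 / 2 * (Du t p \<bullet> H t p h + H t p h \<bullet> Du t p))) (at p within closure Om)"
  by (intro has_derivative_mult_right has_derivative_inner Du_frontier t p)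
 have "(Q K s t has_derivative (\<lambda>h. eps\<^sup>2 / 2 * (Du t p \<bullet> H t p h + H t p h \<bullet> Du t p) - F' s (u t p) * (Du t p \<bullet> h) - K * exp (z p / s) * (Z p \<bullet> h))) (at p within closure Om)"
  unfolding Q_def [abs_def] by (intro has_derivative_diff 1 2 3)
 from frontier_max [OF p this] max zero
 have ge: "0 <= eps\<^sup>2 * (Du t p \<bullet> H t p (Z p)) - K * (Z p \<bullet> Z p)"
  using s.neumann [OF p] z_frontier [OF p] by (simp add: inner_commute)
 have "((\<lambda>y. Du t y \<bullet> Z y) has_derivative (\<lambda>h. Du t p \<bullet> Z' p h + H t p h \<bullet> Z p)) (at p within closure Om)"
  by (intro has_derivative_inner Du_frontier t p has_derivative_at_withinI [OF Z_deriv])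
 from tangential_derivative_zero [OF p this s.neumann, of "Du t p"]
 have "Du t p \<bullet> Z' p (Du t p) + H t p (Du t p) \<bullet> Z p = 0" using s.neumann [OF p] by (simp add: inner_commute)
 then have "Du t p \<bullet> H t p (Z p) = - (Du t p \<bullet> Z' p (Du t p))" using H_frontier_sym [OF t p, of "Du t p" "Z p"] by simp
 also have "\<dots> <= norm (Du t p) * (C' * norm (Du t p))"
 proof -
  have "\<bar>Du t p \<bullet> Z' p (Du t p)\<bar> <= norm (Du t p) * norm (Z' p (Du t p))" by (rule Cauchy_Schwarz_ineq2)
  also have "\<dots> <= norm (Du t p) * (C' * norm (Du t p))" by (intro mult_left_mono Z') simp
  finally show ?thesis by linarith
 qed
 finally have "eps\<^sup>2 * (Du t p \<bullet> H t p (Z p)) <= eps\<^sup>2 * (norm (Du t p) * (C' * norm (Du t p)))" by (intro mult_left_mono) auto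
 also have "\<dots> = C' * (eps\<^sup>2 * (norm (Du t p))\<^sup>2)" by (simp add: power2_eq_square)
 finally have le: "K * (Z p \<bullet> Z p) <= C' * (eps\<^sup>2 * (norm (Du t p))\<^sup>2)" using ge by linarith
 have C': "0 <= C'"
 proof -
  have "0 <= C' * norm (Z p)" using Z' [of "Z p"] norm_ge_zero [of "Z' p (Z p)"] by linarith
  then show ?thesis using Z_frontier [OF p] by (simp add: zero_le_mult_iff)
 qed
 have "eps\<^sup>2 / 2 * (norm (Du t p))\<^sup>2 = W (u t p) + s * (4 - (u t p - \<gamma>)\<^sup>2) + (K + 1) * s"
  using zero z_frontier [OF p] unfolding Q_def power2_norm_eq_inner by simp
 also have "\<dots> <= MW + s * 4 + (K + 1) * s" using W s K by (intro add_mono mult_left_mono) auto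
 finally have "eps\<^sup>2 * (norm (Du t p))\<^sup>2 <= 2 * (MW + (K + 5) * s)" by (simp add: algebra_simps)
 then have "C' * (eps\<^sup>2 * (norm (Du t p))\<^sup>2) <= C' * (2 * (MW + (K + 5) * s))" using C' by (intro mult_left_mono)
 moreover have "K * m <= K * (Z p \<bullet> Z p)" using m K by (intro mult_left_mono) auto
 ultimately show False using le big by (simp add: mult.assoc mult.left_commute)
qed

lemma Q_negative:
 assumes s: "0 < s" and K: "0 < K" and u0: "\<And>x. x \<in> closure Om ==> \<bar>u 0 x\<bar> <= 1"
  and CZ: "\<And>x. x \<in> closure Om ==> norm (Z x) <= CZ" and CD: "\<And>x. x \<in> closure Om ==> \<bar>div_of (Z' x)\<bar> <= CD"
  and C': "\<And>x h. x \<in> closure Om ==> norm (Z' x h) <= C' * norm h"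
  and m: "\<And>p. p \<in> frontier Om ==> m <= Z p \<bullet> Z p"
  and CF: "\<And>v. \<bar>v\<bar> <= 1 ==> \<bar>W' v\<bar> <= CF" and MW: "\<And>v. \<bar>v\<bar> <= 1 ==> W v <= MW"
  and big: "2 * C' * (MW + (K + 5) * s) < K * m"
  and small: "2 * (CF + 4 * s) * K * CZ * eps / sqrt (2 * s) + eps\<^sup>2 * (K * CZ\<^sup>2 / s + K * CD) < 4 * s\<^sup>2"
  and init: "\<And>x. x \<in> closure Om ==> eps\<^sup>2 / 2 * (norm (Du 0 x))\<^sup>2 - W (u 0 x) < s"
  and t: "0 <= t" and x: "x \<in> closure Om"
 shows "Q K s t x < 0"
proof (rule parabolic_touch [OF compact_closure, where T = t and v = "Q K s"])
 have "continuous_on ({0..t} \<times> closure Om) (\<lambda>p. eps\<^sup>2 / 2 * ((case p of (t, x) => Du t x) \<bullet> (case p of (t, x) => Du t x))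
   - (W (case p of (t, x) => u t x) + s * (4 - ((case p of (t, x) => u t x) - \<gamma>)\<^sup>2) + (K + 1) * s) - K * s * (exp (z (snd p) / s) - 1))"
  using s by (intro continuous_intros cont0 continuous_on_compose2 [OF z_cont [of UNIV]] continuous_on_compose2 [OF w.W_cont [of UNIV]]) auto
 then show "continuous_on ({0..t} \<times> closure Om) (\<lambda>(s', y). Q K s s' y)" by (simp add: Q_def case_prod_beta)
 show "Q K s 0 y < 0" if y: "y \<in> closure Om" for y
 proof -
  have "\<bar>u 0 y - \<gamma>\<bar> <= 2" using u0 [OF y] w.\<gamma>(1,2) by linarith
  then have "(u 0 y - \<gamma>)\<^sup>2 <= 4" using abs_le_square_iff [of "u 0 y - \<gamma>" 2] by simp
  then have "0 <= s * (4 - (u 0 y - \<gamma>)\<^sup>2)" using s by simp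
  moreover have "0 <= K * s * exp (z y / s)" using s K by simp
  ultimately show ?thesis using init [OF y] unfolding Q_def power2_norm_eq_inner by (simp add: algebra_simps)
 qed
 fix r y assume r: "0 < r" "r <= t" and y: "y \<in> closure Om" and zero: "Q K s r y = 0"
  and max: "\<And>r' q. 0 <= r' ==> r' <= r ==> q \<in> closure Om ==> Q K s r' q <= 0"
 have u1: "\<bar>u r y\<bar> <= 1" using norm_u_le_1 [OF u0 _ y] r by simp
 show False
 proof (cases "y \<in> Om")
  case True
  from Q_touch_interior [OF s K r(1) True u1 CZ [OF y] CD [OF y] CF [OF u1] zero max] small show False by simp
 next
  case False
  then have yf: "y \<in> frontier Om" using closure_cases [OF y] by blast
  show False
   by (rule Q_touch_frontier [OF s K r(1) yf u1 C' [OF y] MW [OF u1] m [OF yf] big zero]) (use max r in auto)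
 qed
qed (use t x in auto)

end

text \<open>The choice \<open>s = eps powr a\<close> is large compared with the initial discrepancy, as \<open>a < 1 - \<theta>\<close>, and satisfies \<open>eps \<le> s ^ 3\<close>, which
  makes touching impossible for small \<open>eps\<close>.\<close>

theorem discrepancy_upper_bound:
 fixes Om :: "'a::euclidean_space set" and \<theta> c :: real
 assumes dom: "C2_domain Om z Z Z'" and well: "well W W' W'' \<alpha> \<beta> \<gamma>" and \<theta>: "\<theta> < 1"
 obtains a K0 L eps0 where "0 < a" "0 <= K0" "0 <= L" "0 < eps0"
  "\<And>eps u Du H T ft P x (t::real). ac_flow Om z Z Z' W W' W'' \<alpha> \<beta> \<gamma> eps u Du H T ft P ==> eps < eps0 ==>
   (\<And>x. x \<in> closure Om ==> \<bar>u 0 x\<bar> <= 1) ==>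
   (\<And>x. x \<in> closure Om ==> eps * (norm (Du 0 x))\<^sup>2 / 2 - W (u 0 x) / eps <= c * eps powr (- \<theta>)) ==>
   0 <= t ==> x \<in> closure Om ==>
   eps * norm (Du t x) <= L \<and> eps * (norm (Du t x))\<^sup>2 / 2 - W (u t x) / eps <= K0 * eps powr a / eps"
proof -
 interpret C2_domain Om z Z Z' by (rule dom)
 interpret w: well W W' W'' \<alpha> \<beta> \<gamma> by (rule well)
 obtain CZ where CZ: "0 < CZ" "\<And>x. x \<in> closure Om ==> norm (Z x) <= CZ" using bounded_on_closure [OF Z_cont] by blast
 have dc: "continuous_on (closure Om) (\<lambda>x. div_of (Z' x))"
  by (intro div_of_cont continuous_on_subset [OF Z'_cont]) auto
 obtain CD where CD: "0 < CD" "\<And>x. x \<in> closure Om ==> norm (div_of (Z' x)) <= CD" using bounded_on_closure [OF dc] by blast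
 obtain C' where C': "0 < C'" "\<And>x h. x \<in> closure Om ==> norm (Z' x h) <= C' * norm h"
  using linear_uniform_bound [OF compact_closure Z'_linear continuous_on_subset [OF Z'_cont]] by blast
 obtain m where m: "0 < m" "\<And>p. p \<in> frontier Om ==> m <= Z p \<bullet> Z p"
 proof (cases "frontier Om = {}")
  case False
  have "compact (frontier Om)" using bounded_Om by (rule compact_frontier_bounded)
  from continuous_attains_inf [OF this False, of "\<lambda>p. Z p \<bullet> Z p"]
  obtain q where q: "q \<in> frontier Om" "\<And>p. p \<in> frontier Om ==> Z q \<bullet> Z q <= Z p \<bullet> Z p"
   using continuous_on_inner [OF Z_cont Z_cont] by blast
  show thesis using that [of "Z q \<bullet> Z q"] q Z_frontier [OF q(1)] by simp
 qed (use that [of 1] in auto)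
 have bd: "\<exists>B>0. \<forall>v. \<bar>v\<bar> <= 1 --> \<bar>g v\<bar> <= B" if "continuous_on UNIV g" for g :: "real => real"
 proof -
  have "compact (g ` {-1..1})" by (intro compact_continuous_image continuous_on_subset [OF that]) auto
  then obtain B where B: "0 < B" "\<forall>y\<in>g ` {-1..1}. norm y <= B" using compact_imp_bounded bounded_pos by metis
  show ?thesis
  proof (intro exI conjI allI impI)
   show "0 < B" by (rule B(1))
   fix v :: real assume "\<bar>v\<bar> <= 1"
   then have "g v \<in> g ` {-1..1}" by (intro imageI) (simp add: abs_le_iff)
   then show "\<bar>g v\<bar> <= B" using B(2) by auto
  qed
 qed
 obtain CF where CF: "0 < CF" "\<And>v. \<bar>v\<bar> <= 1 ==> \<bar>W' v\<bar> <= CF" using bd [OF w.W'_cont] by blast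
 obtain MW where MW: "0 < MW" "\<And>v. \<bar>v\<bar> <= 1 ==> \<bar>W v\<bar> <= MW" using bd [OF w.W_cont] by blast
 have MW': "W v <= MW" if "\<bar>v\<bar> <= 1" for v using MW(2) [OF that] by linarith
 define K where "K = (2 * C' * (MW + 1) + 1) / m"
 have K: "0 < K" "2 * C' * (MW + 1) < K * m" using C' MW m by (auto simp: K_def add_pos_pos)
 define C where "C = 2 * (CF + 4) * K * CZ + (K * CZ\<^sup>2 + K * CD)"
 have C: "0 < C" using CF K CZ CD by (auto simp: C_def intro!: add_pos_pos)
 define a where "a = min (1 / 3) ((1 - \<theta>) / 2)"
 have "0 < a" using \<theta> by (simp add: a_def)
 moreover have "a <= 1 / 3" "a <= (1 - \<theta>) / 2" unfolding a_def by (rule min.cobounded1, rule min.cobounded2)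
 ultimately have a: "0 < a" "a <= 1 / 3" "a * 2 <= 1 - \<theta>" by auto
 define \<delta> where "\<delta> = min (min (1 / 2) (1 / (K + 5))) (min (1 / (\<bar>c\<bar> + 1)) (1 / C\<^sup>2))"
 have "\<delta> <= 1 / 2" "\<delta> <= 1 / (K + 5)" "\<delta> <= 1 / (\<bar>c\<bar> + 1)" "\<delta> <= 1 / C\<^sup>2"
  unfolding \<delta>_def by (rule min.coboundedI1 [OF min.cobounded1] min.coboundedI1 [OF min.cobounded2] min.coboundedI2 [OF min.cobounded1] min.coboundedI2 [OF min.cobounded2])+
 moreover have "0 < \<delta>" using K C by (simp add: \<delta>_def)
 ultimately have \<delta>: "0 < \<delta>" "\<delta> < 1" "\<delta> <= 1 / (K + 5)" "\<delta> <= 1 / (\<bar>c\<bar> + 1)" "\<delta> <= 1 / C\<^sup>2" by auto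
 define eps0 where "eps0 = \<delta> powr (1 / a)"
 have e0: "0 < eps0" using \<delta> by (simp add: eps0_def)
 show thesis
 proof (rule that [of a "K + 5" "sqrt (2 * (MW + 1))" eps0])
  show "0 < a" "0 <= K + 5" "0 <= sqrt (2 * (MW + 1))" "0 < eps0" using a K MW e0 by auto
  fix eps u Du H T ft P x and t :: real
  assume "ac_flow Om z Z Z' W W' W'' \<alpha> \<beta> \<gamma> eps u Du H T ft P" and eps: "eps < eps0"
   and u0: "\<And>x. x \<in> closure Om ==> \<bar>u 0 x\<bar> <= 1"
   and xi0: "\<And>x. x \<in> closure Om ==> eps * (norm (Du 0 x))\<^sup>2 / 2 - W (u 0 x) / eps <= c * eps powr (- \<theta>)"
   and t: "0 <= t" and x: "x \<in> closure Om"
  interpret f: ac_flow Om z Z Z' W W' W'' \<alpha> \<beta> \<gamma> eps u Du H T ft P by fact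
  have e: "0 < eps" by (rule f.eps_pos)
  define s where "s = eps powr a"
  have s: "0 < s" using e by (simp add: s_def)
  have "s <= eps0 powr a" unfolding s_def using e eps a by (intro powr_mono2) auto
  also have "\<dots> = \<delta>" unfolding eps0_def using a \<delta> by (simp add: powr_powr)
  finally have s\<delta>: "s <= \<delta>" .
  have s1: "s <= 1" "(K + 5) * s <= 1" "c * s < 1" "s * C\<^sup>2 <= 1"
  proof -
   show "s <= 1" using s\<delta> \<delta> by simp
   have "s <= 1 / (K + 5)" using s\<delta> \<delta> by linarith
   then show "(K + 5) * s <= 1" using K by (simp add: pos_le_divide_eq mult.commute)
   have "s <= 1 / (\<bar>c\<bar> + 1)" using s\<delta> \<delta> by linarith
   then have "s * (\<bar>c\<bar> + 1) <= 1" by (simp add: pos_le_divide_eq)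
   moreover have "c * s <= \<bar>c\<bar> * s" using s by (intro mult_right_mono) auto
   moreover have "s * (\<bar>c\<bar> + 1) = \<bar>c\<bar> * s + s" by (simp add: algebra_simps)
   ultimately show "c * s < 1" using s by linarith
   have "s <= 1 / C\<^sup>2" using s\<delta> \<delta> by linarith
   then show "s * C\<^sup>2 <= 1" using C by (simp add: pos_le_divide_eq)
  qed
  have eps1: "eps <= 1"
  proof -
   have "\<delta> powr (1 / a) <= 1 powr (1 / a)" using \<delta> a by (intro powr_mono2) auto
   then show ?thesis using eps by (simp add: eps0_def)
  qed
  have es: "eps <= s ^ 3"
  proof -
   have "eps powr 1 <= eps powr (a * 3)" using e eps1 a by (intro powr_mono') auto
   also have "\<dots> = s powr 3" by (simp add: s_def powr_powr)
   finally show ?thesis using e s by (simp add: powr_numeral)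
  qed
  have et: "eps powr (1 - \<theta>) <= s\<^sup>2"
  proof -
   have "eps powr (1 - \<theta>) <= eps powr (a * 2)" using e eps1 a by (intro powr_mono') auto
   also have "\<dots> = s powr 2" by (simp add: s_def powr_powr)
   finally show ?thesis using e s by (simp add: powr_numeral)
  qed
  have init: "eps\<^sup>2 / 2 * (norm (Du 0 y))\<^sup>2 - W (u 0 y) < s" if y: "y \<in> closure Om" for y
  proof -
   have "eps\<^sup>2 / 2 * (norm (Du 0 y))\<^sup>2 - W (u 0 y) = eps * (eps * (norm (Du 0 y))\<^sup>2 / 2 - W (u 0 y) / eps)"
    using e by (simp add: field_simps power2_eq_square)
   also have "\<dots> <= eps * (c * eps powr (- \<theta>))" using xi0 [OF y] e by (intro mult_left_mono) auto
   also have "\<dots> = c * (eps powr 1 * eps powr (- \<theta>))" using e by simp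
   also have "\<dots> = c * eps powr (1 - \<theta>)" unfolding powr_add [symmetric] by simp
   also have "\<dots> <= \<bar>c\<bar> * s\<^sup>2" using et by (intro mult_mono) auto
   also have "\<dots> = s * (\<bar>c\<bar> * s)" by (simp add: power2_eq_square)
   also have "\<dots> < s * 1"
   proof (rule mult_strict_left_mono [OF _ s])
    have "s <= 1 / (\<bar>c\<bar> + 1)" using s\<delta> \<delta> by linarith
    then have "s * (\<bar>c\<bar> + 1) <= 1" by (simp add: pos_le_divide_eq)
    then show "\<bar>c\<bar> * s < 1" using s by (simp add: algebra_simps)
   qed
   finally show ?thesis by simp
  qed
  have big: "2 * C' * (MW + (K + 5) * s) < K * m"
  proof -
   have "2 * C' * (MW + (K + 5) * s) <= 2 * C' * (MW + 1)" using s1 C' by (intro mult_left_mono) auto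
   then show ?thesis using K by linarith
  qed
  have small: "2 * (CF + 4 * s) * K * CZ * eps / sqrt (2 * s) + eps\<^sup>2 * (K * CZ\<^sup>2 / s + K * CD) < 4 * s\<^sup>2"
  proof -
   define q where "q = sqrt s"
   have q: "0 < q" "q\<^sup>2 = s" "q <= 1" using s s1 by (auto simp: q_def)
   have "q <= sqrt (2 * s)" using s by (simp add: q_def)
   then have "eps / sqrt (2 * s) <= s ^ 3 / q" using es e q s by (intro frac_le) auto
   also have "\<dots> = s\<^sup>2 * q" using q(1) unfolding q(2) [symmetric] by (simp add: power2_eq_square power3_eq_cube)
   finally have "(2 * (CF + 4 * s) * K * CZ) * (eps / sqrt (2 * s)) <= (2 * (CF + 4) * K * CZ) * (s\<^sup>2 * q)"
    using s1 s CF K CZ e by (intro mult_mono) auto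
   moreover have "eps\<^sup>2 * (K * CZ\<^sup>2 / s + K * CD) <= (s\<^sup>2 * q) * (K * CZ\<^sup>2 + K * CD)"
   proof -
    have "eps\<^sup>2 * (K * CZ\<^sup>2 / s + K * CD) <= eps\<^sup>2 * ((K * CZ\<^sup>2 + K * CD) / s)"
    proof (rule mult_left_mono)
     have "K * CD * s <= K * CD * 1" using s1 K CD by (intro mult_left_mono) auto
     then have "K * CD <= K * CD / s" using s by (simp add: pos_le_divide_eq)
     then show "K * CZ\<^sup>2 / s + K * CD <= (K * CZ\<^sup>2 + K * CD) / s" by (simp only: add_divide_distrib add_left_mono)
    qed simp
    also have "\<dots> = (eps\<^sup>2 / s) * (K * CZ\<^sup>2 + K * CD)" by simp
    also have "\<dots> <= (s\<^sup>2 * q) * (K * CZ\<^sup>2 + K * CD)"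
    proof (rule mult_right_mono)
     have "eps\<^sup>2 <= (s ^ 3)\<^sup>2" using es e by (intro power_mono) auto
     also have "(s ^ 3)\<^sup>2 = (s\<^sup>2 * q * s) * (s\<^sup>2 * q)" using q(1) unfolding q(2) [symmetric]
      by (simp add: power2_eq_square power3_eq_cube)
     also have "\<dots> <= (s\<^sup>2 * q * s) * 1"
     proof (rule mult_left_mono)
      show "s\<^sup>2 * q <= 1" using s s1 q by (intro mult_le_one power_le_one) auto
     qed (use s q in auto)
     finally show "eps\<^sup>2 / s <= s\<^sup>2 * q" using s by (simp add: pos_divide_le_eq)
    qed (use K CZ CD in auto)
    finally show ?thesis .
   qed
   moreover have "s\<^sup>2 * (C * q) = (2 * (CF + 4) * K * CZ) * (s\<^sup>2 * q) + (s\<^sup>2 * q) * (K * CZ\<^sup>2 + K * CD)"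
    unfolding C_def by (simp add: algebra_simps)
   moreover have "2 * (CF + 4 * s) * K * CZ * eps / sqrt (2 * s) = (2 * (CF + 4 * s) * K * CZ) * (eps / sqrt (2 * s))" by simp
   ultimately have "2 * (CF + 4 * s) * K * CZ * eps / sqrt (2 * s) + eps\<^sup>2 * (K * CZ\<^sup>2 / s + K * CD) <= s\<^sup>2 * (C * q)"
    by linarith
   also have "\<dots> <= s\<^sup>2 * 1"
   proof (rule mult_left_mono)
    have "(C * q)\<^sup>2 <= 1\<^sup>2" using s1(4) by (simp add: power_mult_distrib q mult.commute)
    then show "C * q <= 1" by (rule power2_le_imp_le) simp
   qed simp
   also have "\<dots> < 4 * s\<^sup>2" using s by simp
   finally show ?thesis .
  qed
  have CD': "\<bar>div_of (Z' y)\<bar> <= CD" if "y \<in> closure Om" for y using CD(2) [OF that] by simp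
  have Q: "f.Q K s t x < 0"
   by (rule f.Q_negative [OF s K(1) u0 CZ(2) CD' C'(2) m(2) CF(2) MW' big small init t x])
  have u1: "\<bar>u t x\<bar> <= 1" by (rule f.norm_u_le_1 [OF u0 t x])
  have "s * (4 - (u t x - \<gamma>)\<^sup>2) <= s * 4" using s by (intro mult_left_mono) auto
  moreover have "K * s * (exp (z x / s) - 1) <= 0"
  proof -
   have "exp (z x / s) <= 1" using z_closure [OF x] s by (simp add: divide_nonpos_pos)
   then show ?thesis using K s by (simp add: mult_le_0_iff)
  qed
  moreover have "4 * s + (K + 1) * s = (K + 5) * s" by (simp add: algebra_simps)
  ultimately have main: "eps\<^sup>2 / 2 * (norm (Du t x))\<^sup>2 <= W (u t x) + (K + 5) * s"
   using Q unfolding f.Q_def power2_norm_eq_inner by linarith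
  show "eps * norm (Du t x) <= sqrt (2 * (MW + 1)) \<and> eps * (norm (Du t x))\<^sup>2 / 2 - W (u t x) / eps <= (K + 5) * eps powr a / eps"
  proof
   have "(eps * norm (Du t x))\<^sup>2 <= 2 * (MW + 1)" using main MW' [OF u1] s1(2) by (simp add: power_mult_distrib)
   then show "eps * norm (Du t x) <= sqrt (2 * (MW + 1))" by (rule real_le_rsqrt)
   have "eps * (norm (Du t x))\<^sup>2 / 2 - W (u t x) / eps = (eps\<^sup>2 / 2 * (norm (Du t x))\<^sup>2 - W (u t x)) / eps"
    using e by (simp add: field_simps power2_eq_square)
   also have "\<dots> <= (K + 5) * s / eps" using main e by (intro divide_right_mono) auto
   finally show "eps * (norm (Du t x))\<^sup>2 / 2 - W (u t x) / eps <= (K + 5) * eps powr a / eps" by (simp add: s_def)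
  qed
 qed
qed

section \<open>Smoothness of solutions up to the boundary\<close>

text \<open>Both mixed derivatives are attained, at intermediate points, by the same second difference quotient.\<close>

lemma clairaut:
 fixes f f1 f2 f12 f21 :: "real => real => real"
 assumes d: "0 < d"
  and f1: "\<And>a b. \<bar>a\<bar> < d ==> \<bar>b\<bar> < d ==> ((\<lambda>a. f a b) has_real_derivative f1 a b) (at a)"
  and f2: "\<And>a b. \<bar>a\<bar> < d ==> \<bar>b\<bar> < d ==> (f a has_real_derivative f2 a b) (at b)"
  and f12: "\<And>a b. \<bar>a\<bar> < d ==> \<bar>b\<bar> < d ==> (f1 a has_real_derivative f12 a b) (at b)"
  and f21: "\<And>a b. \<bar>a\<bar> < d ==> \<bar>b\<bar> < d ==> ((\<lambda>a. f2 a b) has_real_derivative f21 a b) (at a)"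
  and c12: "isCont (\<lambda>(a, b). f12 a b) (0, 0)" and c21: "isCont (\<lambda>(a, b). f21 a b) (0, 0)"
 shows "f12 0 0 = f21 0 0"
proof -
 define h where "h n = d / real (n + 2)" for n
 have h: "0 < h n" "h n < d" for n using d by (auto simp: h_def pos_divide_less_eq add_pos_nonneg)
 have ex: "\<exists>a b a' b'. 0 <= a \<and> a <= h n \<and> 0 <= b \<and> b <= h n \<and> 0 <= a' \<and> a' <= h n \<and> 0 <= b' \<and> b' <= h n \<and> f12 a b = f21 a' b'" for n
 proof -
  have A: "((\<lambda>a. f a (h n) - f a 0) has_real_derivative f1 a (h n) - f1 a 0) (at a)" if "0 <= a" "a <= h n" for a
   using that h [of n] by (intro DERIV_diff f1) auto
  have B: "((\<lambda>b. f (h n) b - f 0 b) has_real_derivative f2 (h n) b - f2 0 b) (at b)" if "0 <= b" "b <= h n" for b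
   using that h [of n] by (intro DERIV_diff f2) auto
  obtain a where a: "0 < a" "a < h n" "(f (h n) (h n) - f (h n) 0) - (f 0 (h n) - f 0 0) = (h n - 0) * (f1 a (h n) - f1 a 0)"
   using MVT2 [OF h(1) A] by blast
  obtain b where b: "0 < b" "b < h n" "f1 a (h n) - f1 a 0 = (h n - 0) * f12 a b"
   using MVT2 [of 0 "h n" "f1 a" "f12 a"] h [of n] a f12 by auto
  obtain b' where b': "0 < b'" "b' < h n" "(f (h n) (h n) - f 0 (h n)) - (f (h n) 0 - f 0 0) = (h n - 0) * (f2 (h n) b' - f2 0 b')"
   using MVT2 [OF h(1) B] by blast
  obtain a' where a': "0 < a'" "a' < h n" "f2 (h n) b' - f2 0 b' = (h n - 0) * f21 a' b'"
   using MVT2 [of 0 "h n" "\<lambda>a. f2 a b'" "\<lambda>a. f21 a b'"] h [of n] b' f21 by auto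
  have "h n * (h n * f12 a b) = h n * (h n * f21 a' b')" using a(3) b'(3) unfolding a'(3) b(3) diff_0_right by linarith
  then have "f12 a b = f21 a' b'" using h [of n] by simp
  then show ?thesis using a b a' b' less_imp_le by metis
 qed
 then obtain a b a' b' where ab: "\<And>n. 0 <= a n \<and> a n <= h n" "\<And>n. 0 <= b n \<and> b n <= h n" "\<And>n. 0 <= a' n \<and> a' n <= h n"
   "\<And>n. 0 <= b' n \<and> b' n <= h n" "\<And>n. f12 (a n) (b n) = f21 (a' n) (b' n)" by metis
 have "(\<lambda>n. d * inverse (real (Suc (Suc n)))) \<longlonglongrightarrow> d * 0"
  by (intro tendsto_mult tendsto_const LIMSEQ_Suc [OF LIMSEQ_inverse_real_of_nat])
 then have h0: "h \<longlonglongrightarrow> 0" by (simp add: h_def [abs_def] divide_inverse)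
 have l: "v \<longlonglongrightarrow> 0" if "\<And>n. 0 <= v n \<and> v n <= h n" for v
  using that by (intro real_tendsto_sandwich [OF _ _ tendsto_const h0]) auto
 have "(\<lambda>n. f12 (a n) (b n)) \<longlonglongrightarrow> f12 0 0"
  using isCont_tendsto_compose [OF c12 tendsto_Pair [OF l [of a] l [of b]]] ab by simp
 moreover have "(\<lambda>n. f21 (a' n) (b' n)) \<longlonglongrightarrow> f21 0 0"
  using isCont_tendsto_compose [OF c21 tendsto_Pair [OF l [of a'] l [of b']]] ab by simp
 ultimately show ?thesis unfolding ab(5) by (rule LIMSEQ_unique)
qed

lemma continuous_eq_closure:
 fixes f g :: "'a::metric_space => 'b::t2_space"
 assumes V: "V0 \<subseteq> V" "V \<subseteq> closure V0" and f: "continuous_on V f" and g: "continuous_on V g"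
  and eq: "\<And>x. x \<in> V0 ==> f x = g x" and p: "p \<in> V"
 shows "f p = g p"
proof -
 obtain X where X: "\<And>n. X n \<in> V0" "X \<longlonglongrightarrow> p" using V(2) p closure_sequential [of p V0] by blast
 have ev: "eventually (\<lambda>n. X n \<in> V) sequentially" using X(1) V(1) by (intro always_eventually allI) blast
 have "(\<lambda>n. f (X n)) \<longlonglongrightarrow> f p" by (rule continuous_on_tendsto_compose [OF f X(2) p ev])
 moreover have "(\<lambda>n. f (X n)) \<longlonglongrightarrow> g p" unfolding eq [OF X(1)] by (rule continuous_on_tendsto_compose [OF g X(2) p ev])
 ultimately show ?thesis by (rule LIMSEQ_unique)
qed

definition pd :: "'a::euclidean_space set => 'a => ('a => real) => 'a => real" where
 "pd V b g p = frechet_derivative g (at p within V) b"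

lemma smooth_on_pd: "smooth_on g V ==> b \<in> Basis ==> smooth_on (pd V b g) V"
 unfolding smooth_on_def pd_def [abs_def] using Ck_on_SucD(2) by blast

lemma smooth_on_cont: "smooth_on g V ==> continuous_on V g"
 unfolding smooth_on_def by (drule spec [of _ 0]) (simp only: Ck_on.simps)

lemma smooth_on_deriv:
 assumes "smooth_on g V" "p \<in> V"
 shows "(g has_derivative (\<lambda>h. \<Sum>b\<in>Basis. (h \<bullet> b) * pd V b g p)) (at p within V)"
proof -
 have "Ck_on (Suc 0) g V" using assms(1) unfolding smooth_on_def by blast
 from has_derivative_gradient_on [OF Ck_on_SucD(1) [OF this] assms(2)]
 show ?thesis by (simp add: gradient_on_def pd_def inner_sum_left inner_sum_right inner_commute mult.commute)
qed

text \<open>\<open>V0\<close> is the interior of the space-time cylinder \<open>V\<close>, which contains the lateral boundary. Identities between derivatives within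
  \<open>V\<close> are proved on \<open>V0\<close> and extended by continuity.\<close>

locale smooth_cylinder =
 fixes V0 V :: "'a::euclidean_space set"
 assumes V0: "open V0" "V0 \<subseteq> V" "V \<subseteq> closure V0"
begin

lemma at_V0: "p \<in> V0 ==> at p within V = at p"
 using V0 interior_maximal [OF V0(2,1)] by (intro at_within_interior) blast

lemma pd_line:
 assumes g: "smooth_on g V" and p: "p + s *\<^sub>R b \<in> V0" and b: "b \<in> Basis"
 shows "((\<lambda>s. g (p + s *\<^sub>R b)) has_real_derivative pd V b g (p + s *\<^sub>R b)) (at s)"
proof -
 have D: "(g has_derivative (\<lambda>h. \<Sum>i\<in>Basis. (h \<bullet> i) * pd V i g (p + s *\<^sub>R b))) (at (p + s *\<^sub>R b))"
  using smooth_on_deriv [OF g, of "p + s *\<^sub>R b"] p V0 at_V0 [OF p] by auto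
 have "(\<Sum>i\<in>Basis. (b \<bullet> i) * pd V i g (p + s *\<^sub>R b)) = (\<Sum>i\<in>Basis. if i = b then pd V b g (p + s *\<^sub>R b) else 0)"
  using b by (intro sum.cong) (auto simp: inner_Basis)
 also have "\<dots> = pd V b g (p + s *\<^sub>R b)" using b by simp
 finally show ?thesis using has_derivative_line [OF D] by (simp add: has_real_derivative_iff_has_vector_derivative)
qed

lemma pd_eq:
 assumes g: "smooth_on g V" and p: "p \<in> V0" and b: "b \<in> Basis"
  and D: "((\<lambda>s. g (p + s *\<^sub>R b)) has_real_derivative k) (at 0)"
 shows "pd V b g p = k"
 using DERIV_unique [OF pd_line [OF g _ b, of p 0] ] p D by simp

lemma eq_closure:
 assumes "smooth_on f V" "smooth_on g V" "\<And>x. x \<in> V0 ==> f x = g x" "p \<in> V"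
 shows "f p = (g p :: real)"
 by (rule continuous_eq_closure [OF V0(2,3) smooth_on_cont [OF assms(1)] smooth_on_cont [OF assms(2)] assms(3,4)])

lemma pd_cong:
 assumes f: "smooth_on f V" and g: "smooth_on g V" and eq: "\<And>x. x \<in> V0 ==> f x = g x" and p: "p \<in> V" and b: "b \<in> Basis"
 shows "pd V b f p = pd V b g p"
proof (rule eq_closure [OF smooth_on_pd [OF f b] smooth_on_pd [OF g b] _ p])
 fix x assume x: "x \<in> V0"
 obtain d where d: "0 < d" "ball x d \<subseteq> V0" using V0(1) x open_contains_ball by blast
 show "pd V b f x = pd V b g x"
 proof (rule pd_eq [OF f x b])
  have "eventually (\<lambda>s. \<bar>s\<bar> < d) (nhds (0::real))" using d(1) by (auto simp: eventually_nhds_metric)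
  then have "eventually (\<lambda>s. f (x + s *\<^sub>R b) = g (x + s *\<^sub>R b)) (nhds 0)"
  proof eventually_elim
   case (elim s)
   have "x + s *\<^sub>R b \<in> ball x d" using elim b by (simp add: dist_norm)
   then show ?case using d(2) eq by blast
  qed
  moreover have "((\<lambda>s. g (x + s *\<^sub>R b)) has_real_derivative pd V b g x) (at 0)" using pd_line [OF g _ b, of x 0] x by simp
  ultimately show "((\<lambda>s. f (x + s *\<^sub>R b)) has_real_derivative pd V b g x) (at 0)"
   by (rule DERIV_cong_ev [OF refl _ refl, THEN iffD2])
 qed
qed

lemma pd_commute:
 assumes g: "smooth_on g V" and p: "p \<in> V" and b: "b \<in> Basis" and c: "c \<in> Basis"
 shows "pd V c (pd V b g) p = pd V b (pd V c g) p"
proof (rule eq_closure [OF smooth_on_pd [OF smooth_on_pd [OF g b] c] smooth_on_pd [OF smooth_on_pd [OF g c] b] _ p])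
 fix x assume x: "x \<in> V0"
 obtain d where d: "0 < d" "ball x d \<subseteq> V0" using V0(1) x open_contains_ball by blast
 let ?X = "\<lambda>r s. x + r *\<^sub>R b + s *\<^sub>R c"
 have X: "?X r s \<in> V0" if "\<bar>r\<bar> < d/2" "\<bar>s\<bar> < d/2" for r s
 proof -
  have "norm (r *\<^sub>R b + s *\<^sub>R c) <= norm (r *\<^sub>R b) + norm (s *\<^sub>R c)" by (rule norm_triangle_ineq)
  also have "\<dots> < d" using that b c by simp
  finally have "norm (r *\<^sub>R b + s *\<^sub>R c) < d" .
  moreover have "dist x (?X r s) = norm (r *\<^sub>R b + s *\<^sub>R c)"
   unfolding dist_norm by (subst norm_minus_commute) (simp add: add.assoc)
  ultimately show ?thesis using d(2) by auto
 qed
 have X': "?X r s = (x + s *\<^sub>R c) + r *\<^sub>R b" for r s by simp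
 have cont: "isCont (\<lambda>(r, s). k (?X r s)) (0, 0)" if k: "smooth_on k V" for k
 proof -
  have 1: "isCont (\<lambda>q::real \<times> real. x + fst q *\<^sub>R b + snd q *\<^sub>R c) (0, 0)" by (intro continuous_intros)
  have "continuous_on V0 k" using smooth_on_cont [OF k] V0(2) by (rule continuous_on_subset)
  then have "isCont k x" using x V0(1) continuous_on_eq_continuous_at by blast
  then have "isCont k (x + fst (0::real, 0::real) *\<^sub>R b + snd (0::real, 0::real) *\<^sub>R c)" by simp
  from isCont_o2 [OF 1 this] show ?thesis by (simp add: case_prod_unfold)
 qed
 have "pd V c (pd V b g) (?X 0 0) = pd V b (pd V c g) (?X 0 0)"
 proof (rule clairaut [where d = "d/2" and f = "\<lambda>r s. g (?X r s)" and ?f1.0 = "\<lambda>r s. pd V b g (?X r s)" and ?f2.0 = "\<lambda>r s. pd V c g (?X r s)"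
   and ?f12.0 = "\<lambda>r s. pd V c (pd V b g) (?X r s)" and ?f21.0 = "\<lambda>r s. pd V b (pd V c g) (?X r s)"])
  show "0 < d/2" using d by simp
  show "isCont (\<lambda>(r, s). pd V c (pd V b g) (?X r s)) (0, 0)" "isCont (\<lambda>(r, s). pd V b (pd V c g) (?X r s)) (0, 0)"
   by (intro cont smooth_on_pd g b c)+
  fix r s assume rs: "\<bar>r\<bar> < d/2" "\<bar>s\<bar> < d/2"
  note Xm = X [OF rs] X [OF rs, unfolded X']
  show "((\<lambda>r. g (?X r s)) has_real_derivative pd V b g (?X r s)) (at r)"
   unfolding X' by (rule pd_line [OF g Xm(2) b])
  show "((\<lambda>s. g (?X r s)) has_real_derivative pd V c g (?X r s)) (at s)"
   by (rule pd_line [OF g Xm(1) c])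
  show "((\<lambda>s. pd V b g (?X r s)) has_real_derivative pd V c (pd V b g) (?X r s)) (at s)"
   by (rule pd_line [OF smooth_on_pd [OF g b] Xm(1) c])
  show "((\<lambda>r. pd V c g (?X r s)) has_real_derivative pd V b (pd V c g) (?X r s)) (at r)"
   unfolding X' by (rule pd_line [OF smooth_on_pd [OF g c] Xm(2) b])
 qed
 then show "pd V c (pd V b g) x = pd V b (pd V c g) x" by simp
qed

end

lemma double_well_well:
 assumes "double_well W"
 obtains \<alpha> \<beta> \<gamma> where "well W (deriv W) (deriv (deriv W)) \<alpha> \<beta> \<gamma>"
proof -
 have C: "Ck_on (Suc (Suc (Suc 0))) W UNIV" using assms unfolding double_well_def by (simp only: numeral_3_eq_3)
 have fd: "frechet_derivative g (at x) 1 = deriv g x" "(g has_real_derivative deriv g x) (at x)"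
  if g: "g differentiable_on UNIV" for g :: "real => real" and x
 proof -
  have "g differentiable (at x)" using g by (simp add: differentiable_on_def)
  then obtain g' where g': "(g has_real_derivative g') (at x)" using real_differentiable_def by blast
  then show "(g has_real_derivative deriv g x) (at x)" using DERIV_imp_deriv by blast
  then have "(g has_derivative (\<lambda>h. deriv g x * h)) (at x)" by (simp add: has_field_derivative_def)
  then show "frechet_derivative g (at x) 1 = deriv g x" using fun_cong [OF frechet_derivative_at, of g "(*) (deriv g x)" x 1] by simp
 qed
 note D0 = Ck_on_SucD(1) [OF C]
 have C1: "Ck_on (Suc (Suc 0)) (deriv W) UNIV"
  using Ck_on_SucD(2) [OF C, of 1] unfolding fd(1) [OF D0] by simp
 note D1 = Ck_on_SucD(1) [OF C1]
 have C2: "Ck_on (Suc 0) (deriv (deriv W)) UNIV"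
  using Ck_on_SucD(2) [OF C1, of 1] unfolding fd(1) [OF D1] by simp
 note D2 = Ck_on_SucD(1) [OF C2]
 have W0: "W 1 = 0" "W (-1) = 0" "\<And>s. s \<noteq> 1 ==> s \<noteq> -1 ==> 0 < W s" using assms unfolding double_well_def by blast+
 obtain \<gamma> where g: "-1 < \<gamma>" "\<gamma> < 1" "\<And>s. s \<in> {\<gamma><..<1} ==> deriv W s < 0" "\<And>s. s \<in> {-1<..<\<gamma>} ==> 0 < deriv W s"
  using assms unfolding double_well_def by blast
 obtain \<alpha> \<beta> where ab: "0 < \<alpha>" "\<alpha> < 1" "0 < \<beta>" "\<And>s. \<alpha> <= \<bar>s\<bar> ==> \<bar>s\<bar> <= 1 ==> \<beta> <= deriv (deriv W) s"
  using assms unfolding double_well_def by blast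
 have nn: "0 <= W s" for s using W0 by (cases "s = 1 \<or> s = - 1") (auto intro: less_imp_le)
 have crit: "deriv W s = 0" if "W s = 0" for s
  using DERIV_local_min [OF fd(2) [OF D0, of s], of 1] nn that by auto
 have "well W (deriv W) (deriv (deriv W)) \<alpha> \<beta> \<gamma>"
 proof (rule well.intro)
  show "(W has_real_derivative deriv W s) (at s)" "(deriv W has_real_derivative deriv (deriv W) s) (at s)" for s
   using fd(2) [OF D0] fd(2) [OF D1] by auto
  show "continuous_on UNIV (deriv (deriv W))" by (rule differentiable_imp_continuous_on [OF D2])
  fix s :: real assume s: "\<bar>s\<bar> <= 1"
  consider "s = 1 \<or> s = -1 \<or> s = \<gamma>" | "s \<in> {\<gamma><..<1}" | "s \<in> {-1<..<\<gamma>}" using s by force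
  then show "deriv W s * (s - \<gamma>) <= 0"
  proof cases
   case 1 then show ?thesis using crit W0 by auto
  next
   case 2 then show ?thesis using g(3) [OF 2] by (simp add: mult_le_0_iff)
  next
   case 3 then show ?thesis using g(4) [OF 3] by (simp add: mult_le_0_iff)
  qed
 qed (use W0 g ab in auto)
 then show thesis by (rule that)
qed

lemma uniform_limit_continuous_on:
 fixes f :: "real => 'a::metric_space => 'b::metric_space"
 assumes u: "\<And>t::real. 0 <= t ==> uniform_limit X f (f t) (at t within {0..})" and c: "\<And>t. 0 <= t ==> continuous_on X (f t)"
 shows "continuous_on ({0..} \<times> X) (\<lambda>(t, x). f t x)"
 unfolding continuous_on_iff
proof (intro ballI allI impI)
 fix p :: "real \<times> 'a" and e :: real assume p: "p \<in> {0..} \<times> X" and e: "0 < e"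
 obtain t :: real and x where px: "p = (t, x)" "0 <= t" "x \<in> X" using p by auto
 have "eventually (\<lambda>s. \<forall>y\<in>X. dist (f s y) (f t y) < e/2) (at t within {0..})"
  using uniform_limitD [OF u [OF px(2)], of "e/2"] e by simp
 then obtain d1 where d1: "0 < d1" "\<And>s. 0 <= s ==> s \<noteq> t ==> dist s t < d1 ==> \<forall>y\<in>X. dist (f s y) (f t y) < e/2"
  unfolding eventually_at by auto
 obtain d2 where d2: "0 < d2" "\<And>y. y \<in> X ==> dist y x < d2 ==> dist (f t y) (f t x) < e/2"
  using c [OF px(2)] px(3) e unfolding continuous_on_iff by (meson half_gt_zero)
 show "\<exists>d>0. \<forall>q\<in>{0..} \<times> X. dist q p < d --> dist (case q of (t, x) => f t x) (case p of (t, x) => f t x) < e"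
 proof (intro exI conjI ballI impI)
  show "0 < min d1 d2" using d1 d2 by simp
  fix q :: "real \<times> 'a" assume q: "q \<in> {0..} \<times> X" and qd: "dist q p < min d1 d2"
  obtain s y where qx: "q = (s, y)" "0 <= s" "y \<in> X" using q by auto
  have "dist s t < d1" using dist_fst_le [of q p] qd qx px by simp
  moreover have "dist y x < d2" using dist_snd_le [of q p] qd qx px by simp
  ultimately have "dist (f s y) (f t y) < e/2" "dist (f t y) (f t x) < e/2"
   using d1(2) [of s] d2(2) qx e by (cases "s = t"; auto)+
  then have "dist (f s y) (f t x) < e" using dist_triangle [of "f s y" "f t x" "f t y"] by linarith
  then show "dist (case q of (t, x) => f t x) (case p of (t, x) => f t x) < e" by (simp add: qx px)
 qed
qed

lemma sum_Basis_times_real: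
 fixes f :: "'a::euclidean_space \<times> real => real"
 shows "sum f Basis = (\<Sum>b\<in>Basis. f (b, 0)) + f (0, 1)"
proof -
 have "inj_on (\<lambda>b. (b::'a, 0::real)) Basis" by (auto intro!: inj_onI)
 then show ?thesis unfolding Basis_prod_def
  by (subst sum.union_disjoint) (auto simp: sum.reindex)
qed

text \<open>All data are partial derivatives, within the cylinder, of \<open>u t x\<close> as a function of \<open>(x, t)\<close>. The equation for \<open>P\<close> is the
  spatial derivative of the equation; it needs the symmetry of the third derivatives.\<close>

theorem allen_cahn_solution_ac_flow:
 fixes Om :: "'a::euclidean_space set"
 assumes dom: "C2_domain Om z Z Z'" and well: "well W (deriv W) (deriv (deriv W)) \<alpha> \<beta> \<gamma>" and e: "0 < \<epsilon>"
  and sol: "allen_cahn_solution W Om \<epsilon> u0 u"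
  and normal: "\<And>f p. neumann_condition Om f ==> p \<in> frontier Om ==> gradient_on (closure Om) f p \<bullet> Z p = 0"
 obtains H T ft P where "ac_flow Om z Z Z' W (deriv W) (deriv (deriv W)) \<alpha> \<beta> \<gamma> \<epsilon> u (\<lambda>t. gradient_on (closure Om) (u t)) H T ft P"
proof -
 interpret d: C2_domain Om z Z Z' by (rule dom)
 interpret w: well W "deriv W" "deriv (deriv W)" \<alpha> \<beta> \<gamma> by (rule well)
 let ?S = "closure Om"
 define V where "V = ?S \<times> {(0::real)<..}"
 define V0 where "V0 = Om \<times> {(0::real)<..}"
 interpret c: smooth_cylinder V0 V
 proof
  show "open V0" unfolding V0_def by (intro open_Times d.open_Om) auto
  show "V0 \<subseteq> V" unfolding V0_def V_def using closure_subset by blast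
  show "V \<subseteq> closure V0" unfolding V0_def V_def closure_Times using closure_subset [of "{(0::real)<..}"] by blast
 qed
 have C1: "\<And>t. 0 <= t ==> Ck_on 1 (u t) ?S" and ul: "\<And>t. 0 <= t ==> uniform_limit ?S u (u t) (at t within {0..})"
  and gl: "\<And>t. 0 <= t ==> uniform_limit ?S (\<lambda>s. gradient_on ?S (u s)) (gradient_on ?S (u t)) (at t within {0..})"
  and sm: "smooth_on (\<lambda>(x, t). u t x) V"
  and pde: "\<And>t x. 0 < t ==> x \<in> Om ==> ((\<lambda>s. u s x) has_real_derivative laplacian (u t) x - deriv W (u t x) / \<epsilon>\<^sup>2) (at t)"
  and neu: "\<And>t. 0 < t ==> neumann_condition Om (u t)"
  using sol unfolding allen_cahn_solution_def V_def by blast+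
 have C1': "u t differentiable_on ?S" "continuous_on ?S (gradient_on ?S (u t))" if "0 <= t" for t
 proof -
  have C: "Ck_on (Suc 0) (u t) ?S" using C1 [OF that] by (simp only: One_nat_def)
  show "u t differentiable_on ?S" by (rule Ck_on_SucD(1) [OF C])
  have "continuous_on ?S (\<lambda>x. frechet_derivative (u t) (at x within ?S) b)" if "b \<in> Basis" for b
   using Ck_on_SucD(2) [OF C that] by (simp only: Ck_on.simps)
  then show "continuous_on ?S (gradient_on ?S (u t))" unfolding gradient_on_def [abs_def]
   by (intro continuous_on_sum continuous_on_scaleR continuous_on_const)
 qed
 define U where "U = (\<lambda>(x, t). u t x)"
 have U: "smooth_on U V" using sm by (simp add: U_def)
 \<comment> \<open>the space and time derivatives on the cylinder\<close>
 define X where "X b g = pd V (b, 0) g" for b :: 'a and g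
 define \<tau> where "\<tau> g = pd V (0, 1) g" for g
 have Bs: "(b, 0::real) \<in> Basis" if "b \<in> Basis" for b :: 'a using that by (simp add: Basis_prod_def)
 have Bt: "(0::'a, 1::real) \<in> Basis" by (simp add: Basis_prod_def)
 have X: "smooth_on (X b g) V" if "smooth_on g V" "b \<in> Basis" for b g unfolding X_def by (rule smooth_on_pd [OF that(1) Bs [OF that(2)]])
 have \<tau>: "smooth_on (\<tau> g) V" if "smooth_on g V" for g unfolding \<tau>_def by (rule smooth_on_pd [OF that Bt])
 have cont: "continuous_on V g" if "smooth_on g V" for g by (rule smooth_on_cont [OF that])
 have XX: "X c (X b g) p = X b (X c g) p" if "smooth_on g V" "p \<in> V" "b \<in> Basis" "c \<in> Basis" for b c g p
  unfolding X_def by (rule c.pd_commute [OF that(1,2) Bs [OF that(3)] Bs [OF that(4)]])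
 have \<tau>X: "\<tau> (X b g) p = X b (\<tau> g) p" if "smooth_on g V" "p \<in> V" "b \<in> Basis" for b g p
  unfolding X_def \<tau>_def by (rule c.pd_commute [OF that(1,2) Bs [OF that(3)] Bt])
 have Xcong: "X b f p = X b g p" if "smooth_on f V" "smooth_on g V" "\<And>x. x \<in> V0 ==> f x = g x" "p \<in> V" "b \<in> Basis" for b f g p
  unfolding X_def by (rule c.pd_cong [OF that(1-4) Bs [OF that(5)]])
 have VI: "(x, t) \<in> V" if "x \<in> ?S" "0 < t" for x t using that by (simp add: V_def)
 have V0I: "(x, t) \<in> V0" if "x \<in> Om" "0 < t" for x t using that by (simp add: V0_def)
 have cl: "x \<in> ?S" if "x \<in> Om" for x using that closure_subset by blast
 have Sx: "((\<lambda>y. g (y, t)) has_derivative (\<lambda>h. \<Sum>b\<in>Basis. (h \<bullet> b) * X b g (x, t))) (at x within ?S)"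
  if g: "smooth_on g V" and x: "x \<in> ?S" and t: "0 < t" for g x t
 proof -
  have 1: "((\<lambda>y. (y, t)) has_derivative (\<lambda>h. (h, 0))) (at x within ?S)" by (intro has_derivative_Pair has_derivative_ident has_derivative_const)
  have "(g has_derivative (\<lambda>h. \<Sum>b\<in>Basis. (h \<bullet> b) * pd V b g (x, t))) (at (x, t) within (\<lambda>y. (y, t)) ` ?S)"
   by (rule has_derivative_subset [OF smooth_on_deriv [OF g VI [OF x t]]]) (use t in \<open>auto simp: V_def\<close>)
  from has_derivative_in_compose [OF 1 this]
  show ?thesis by (simp add: sum_Basis_times_real X_def)
 qed
 have at_Om: "at x within ?S = at x" if "x \<in> Om" for x
  using that d.open_Om interior_maximal [OF closure_subset d.open_Om] by (intro at_within_interior) blast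
 have St: "((\<lambda>s. g (x, s)) has_real_derivative \<tau> g (x, t)) (at t)" if g: "smooth_on g V" and x: "x \<in> Om" and t: "0 < t" for g x t
 proof -
  have "((\<lambda>s. g ((x, 0) + s *\<^sub>R (0, 1))) has_real_derivative pd V (0, 1) g ((x, 0) + t *\<^sub>R (0, 1))) (at t)"
   by (rule c.pd_line [OF g _ Bt]) (simp add: V0I [OF x t])
  then show ?thesis by (simp add: \<tau>_def)
 qed
 define G where "G t x = (\<Sum>b\<in>Basis. X b U (x, t) *\<^sub>R b)" for t x
 define H where "H t x h = (\<Sum>b\<in>Basis. (\<Sum>c\<in>Basis. (h \<bullet> c) * X c (X b U) (x, t)) *\<^sub>R b)" for t x h
 define T where "T t x b = (\<Sum>c\<in>Basis. X b (X b (X c U)) (x, t) *\<^sub>R c)" for t x b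
 define ft where "ft t x = \<tau> U (x, t)" for t x
 define P where "P t x = (\<Sum>b\<in>Basis. \<tau> (X b U) (x, t) *\<^sub>R b)" for t x
 have contx: "continuous_on ?S (\<lambda>x. g (x, t))" if "smooth_on g V" "0 < t" for g t
  by (rule continuous_on_compose2 [OF cont [OF that(1)]]) (use that(2) in \<open>auto simp: V_def intro!: continuous_intros\<close>)
 have conttx: "continuous_on ({0<..} \<times> ?S) (\<lambda>(t, x). g (x, t))" if "smooth_on g V" for g
  unfolding case_prod_beta by (rule continuous_on_compose2 [OF cont [OF that]]) (auto simp: V_def intro!: continuous_intros)
 have u_G: "(u t has_derivative (\<lambda>h. G t x \<bullet> h)) (at x within ?S)" if "0 < t" "x \<in> ?S" for t x
  using Sx [OF U that(2,1)] by (simp add: U_def G_def inner_sum_left inner_sum_right inner_commute mult.commute)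
 have G_cont: "continuous_on ?S (G t)" if "0 < t" for t
  unfolding G_def [abs_def] by (intro continuous_on_sum continuous_on_scaleR continuous_on_const contx X U that)
 have G_eq: "gradient_on ?S (u t) x = G t x" if t: "0 < t" and x: "x \<in> ?S" for t x
 proof (rule continuous_eq_closure [OF closure_subset order_refl C1'(2) G_cont [OF t] _ x])
  fix y assume y: "y \<in> Om"
  have "(u t has_derivative (\<lambda>h. gradient_on ?S (u t) y \<bullet> h)) (at y)"
   using has_derivative_gradient_on [OF C1'(1) cl [OF y], of t] t at_Om [OF y] by simp
  moreover have "(u t has_derivative (\<lambda>h. G t y \<bullet> h)) (at y)" using u_G [OF t cl [OF y]] at_Om [OF y] by simp
  ultimately have eq: "(\<lambda>h. gradient_on ?S (u t) y \<bullet> h) = (\<lambda>h. G t y \<bullet> h)" by (rule has_derivative_unique)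
  have "gradient_on ?S (u t) y \<bullet> h = G t y \<bullet> h" for h using fun_cong [OF eq, of h] .
  then show "gradient_on ?S (u t) y = G t y" by (rule euclidean_eqI)
 qed (use t in simp)
 have G_H: "(G t has_derivative H t x) (at x within ?S)" if "0 < t" "x \<in> ?S" for t x
  unfolding G_def [abs_def] H_def [abs_def]
  by (intro has_derivative_sum has_derivative_scaleR_left Sx X U that)
 have D_H: "(gradient_on ?S (u t) has_derivative H t x) (at x within ?S)" if t: "0 < t" and x: "x \<in> ?S" for t x
  by (rule has_derivative_transform [OF x _ G_H [OF t x]]) (use G_eq t in auto)
 have H_sym: "H t x h \<bullet> k = h \<bullet> H t x k" if "0 < t" "x \<in> ?S" for t x h k
 proof -
  have "H t x h \<bullet> k = (\<Sum>b\<in>Basis. \<Sum>c\<in>Basis. (h \<bullet> c) * X c (X b U) (x, t) * (b \<bullet> k))"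
   unfolding H_def inner_sum_left by (simp add: sum_distrib_right)
  also have "\<dots> = (\<Sum>b\<in>Basis. \<Sum>c\<in>Basis. (h \<bullet> c) * X b (X c U) (x, t) * (b \<bullet> k))"
   by (intro sum.cong refl) (simp add: XX [OF U VI [OF that(2,1)]])
  also have "\<dots> = (\<Sum>c\<in>Basis. \<Sum>b\<in>Basis. (h \<bullet> c) * X b (X c U) (x, t) * (b \<bullet> k))" by (rule sum.swap)
  also have "\<dots> = h \<bullet> H t x k"
   unfolding H_def inner_sum_right by (simp add: sum_distrib_right sum_distrib_left inner_commute mult_ac)
  finally show ?thesis .
 qed
 have H_b: "H t x b = (\<Sum>c\<in>Basis. X b (X c U) (x, t) *\<^sub>R c)" if "b \<in> Basis" for t x b
 proof -
  have "(\<Sum>c\<in>Basis. (b \<bullet> c) * X c (X i U) (x, t)) = (\<Sum>c\<in>Basis. if c = b then X b (X i U) (x, t) else 0)" for i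
   using that by (intro sum.cong) (auto simp: inner_Basis)
  then show ?thesis using that by (simp add: H_def)
 qed
 have div: "div_of (H t x) = (\<Sum>b\<in>Basis. X b (X b U) (x, t))" for t x
  unfolding div_of_def
 proof (rule sum.cong [OF refl])
  fix b :: 'a assume b: "b \<in> Basis"
  have "H t x b \<bullet> b = (\<Sum>c\<in>Basis. if c = b then X b (X b U) (x, t) else 0)"
   unfolding H_b [OF b] inner_sum_left using b by (intro sum.cong) (auto simp: inner_Basis)
  then show "H t x b \<bullet> b = X b (X b U) (x, t)" using b by simp
 qed
 have fr: "frechet_derivative (\<lambda>y. g (y, t)) (at x) b = X b g (x, t)" if "smooth_on g V" "x \<in> Om" "0 < t" "b \<in> Basis" for g x t b
 proof -
  have eq: "(\<lambda>h. \<Sum>b\<in>Basis. (h \<bullet> b) * X b g (x, t)) = frechet_derivative (\<lambda>y. g (y, t)) (at x)"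
   using Sx [OF that(1) cl [OF that(2)] that(3)] at_Om [OF that(2)] by (intro frechet_derivative_at) simp
  have "frechet_derivative (\<lambda>y. g (y, t)) (at x) b = (\<Sum>i\<in>Basis. (b \<bullet> i) * X i g (x, t))"
   using fun_cong [OF eq [symmetric], of b] .
  also have "\<dots> = (\<Sum>i\<in>Basis. if i = b then X b g (x, t) else 0)" using that(4) by (intro sum.cong) (auto simp: inner_Basis)
  finally show ?thesis using that(4) by simp
 qed
 have lap: "laplacian (u t) x = div_of (H t x)" if x: "x \<in> Om" and t: "0 < t" for t x
  unfolding laplacian_def div
 proof (rule sum.cong [OF refl])
  fix b :: 'a assume b: "b \<in> Basis"
  have u: "u t = (\<lambda>y. U (y, t))" by (simp add: U_def)
  have D: "((\<lambda>y. X b U (y, t)) has_derivative (\<lambda>h. \<Sum>i\<in>Basis. (h \<bullet> i) * X i (X b U) (x, t))) (at x)"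
   using Sx [OF X [OF U b] cl [OF x] t] at_Om [OF x] by simp
  have "((\<lambda>y. frechet_derivative (u t) (at y) b) has_derivative (\<lambda>h. \<Sum>i\<in>Basis. (h \<bullet> i) * X i (X b U) (x, t))) (at x)"
   by (rule has_derivative_transform_within_open [OF D d.open_Om x]) (simp add: u fr [OF U _ t b])
  then have "frechet_derivative (\<lambda>y. frechet_derivative (u t) (at y) b) (at x) = frechet_derivative (\<lambda>y. X b U (y, t)) (at x)"
   using frechet_derivative_at [OF D] by (simp only: frechet_derivative_at [symmetric])
  then show "frechet_derivative (\<lambda>y. frechet_derivative (u t) (at y) b) (at x) b = X b (X b U) (x, t)"
   using fr [OF X [OF U b] x t b] by simp
 qed
 have u_time: "((\<lambda>s. u s x) has_real_derivative ft t x) (at t)" if "0 < t" "x \<in> Om" for t x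
  using St [OF U that(2,1)] by (simp add: U_def ft_def)
 have ft_eq: "ft t x = div_of (H t x) - deriv W (u t x) / \<epsilon>\<^sup>2" if "0 < t" "x \<in> Om" for t x
  using DERIV_unique [OF u_time [OF that] pde [OF that]] lap [OF that(2,1)] by simp
 have sumsc: "(\<Sum>b\<in>Basis. g b *\<^sub>R b) = (h :: 'a)" if "\<And>b. b \<in> Basis ==> g b = h \<bullet> b" for g h
  using that by (simp add: euclidean_representation cong: sum.cong)
 have P_eq: "P t x = (\<Sum>b\<in>Basis. T t x b) - (deriv (deriv W) (u t x) / \<epsilon>\<^sup>2) *\<^sub>R G t x" if t: "0 < t" and x: "x \<in> Om" for t x
 proof (rule euclidean_eqI)
  fix c :: 'a assume c: "c \<in> Basis"
  have comp: "(\<Sum>b\<in>Basis. g b *\<^sub>R b) \<bullet> c = g c" for g :: "'a => real"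
   using c by (simp add: inner_sum_left_Basis)
  have "((\<lambda>y. \<tau> U (y, t)) has_derivative (\<lambda>h. \<Sum>b\<in>Basis. (h \<bullet> b) * X b (\<tau> U) (x, t))) (at x)"
   using Sx [OF \<tau> [OF U] cl [OF x] t] at_Om [OF x] by simp
  moreover have "((\<lambda>y. \<tau> U (y, t)) has_derivative (\<lambda>h. (\<Sum>b\<in>Basis. \<Sum>i\<in>Basis. (h \<bullet> i) * X i (X b (X b U)) (x, t)) - deriv (deriv W) (u t x) * (G t x \<bullet> h) / \<epsilon>\<^sup>2)) (at x)"
  proof -
   have "((\<lambda>y. X b (X b U) (y, t)) has_derivative (\<lambda>h. \<Sum>i\<in>Basis. (h \<bullet> i) * X i (X b (X b U)) (x, t))) (at x)" if "b \<in> Basis" for b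
    using Sx [OF X [OF X [OF U that] that] cl [OF x] t] at_Om [OF x] by simp
   then have 1: "((\<lambda>y. \<Sum>b\<in>Basis. X b (X b U) (y, t)) has_derivative (\<lambda>h. \<Sum>b\<in>Basis. \<Sum>i\<in>Basis. (h \<bullet> i) * X i (X b (X b U)) (x, t))) (at x)"
    by (rule has_derivative_sum)
   have ux: "(u t has_derivative (\<lambda>h. G t x \<bullet> h)) (at x)" using u_G [OF t cl [OF x]] at_Om [OF x] by simp
   have 2: "((\<lambda>y. deriv W (u t y)) has_derivative (\<lambda>h. deriv (deriv W) (u t x) * (G t x \<bullet> h))) (at x)"
    by (rule has_derivative_compose [OF ux, where g = "deriv W", OF w.W'_deriv [unfolded has_field_derivative_def]])
   have 3: "((\<lambda>y. (\<Sum>b\<in>Basis. X b (X b U) (y, t)) - deriv W (u t y) / \<epsilon>\<^sup>2) has_derivative (\<lambda>h. (\<Sum>b\<in>Basis. \<Sum>i\<in>Basis. (h \<bullet> i) * X i (X b (X b U)) (x, t)) - deriv (deriv W) (u t x) * (G t x \<bullet> h) / \<epsilon>\<^sup>2)) (at x)"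
    using has_derivative_diff [OF 1 has_derivative_mult_right [OF 2, of "inverse (\<epsilon>\<^sup>2)"]] by (simp add: divide_inverse mult_ac)
   show ?thesis
    by (rule has_derivative_transform_within_open [OF 3 d.open_Om x]) (use ft_eq [OF t] in \<open>simp add: ft_def div\<close>)
  qed
  ultimately have eq: "(\<lambda>h. \<Sum>b\<in>Basis. (h \<bullet> b) * X b (\<tau> U) (x, t)) = (\<lambda>h. (\<Sum>b\<in>Basis. \<Sum>i\<in>Basis. (h \<bullet> i) * X i (X b (X b U)) (x, t)) - deriv (deriv W) (u t x) * (G t x \<bullet> h) / \<epsilon>\<^sup>2)"
   by (rule has_derivative_unique)
  have pick: "(\<Sum>i\<in>Basis. (c \<bullet> i) * g i) = (g c :: real)" for g
  proof -
   have "(\<Sum>i\<in>Basis. (c \<bullet> i) * g i) = (\<Sum>i\<in>Basis. if i = c then g c else 0)" using c by (intro sum.cong) (auto simp: inner_Basis)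
   then show ?thesis using c by simp
  qed
  have "X c (\<tau> U) (x, t) = (\<Sum>b\<in>Basis. X c (X b (X b U)) (x, t)) - deriv (deriv W) (u t x) * (G t x \<bullet> c) / \<epsilon>\<^sup>2"
   using fun_cong [OF eq, of c] unfolding pick .
  moreover have "X c (X b (X b U)) (x, t) = X b (X b (X c U)) (x, t)" if b: "b \<in> Basis" for b
  proof -
   have "X c (X b (X b U)) (x, t) = X b (X c (X b U)) (x, t)" by (rule XX [OF X [OF U b] VI [OF cl [OF x] t] b c])
   also have "\<dots> = X b (X b (X c U)) (x, t)"
    by (rule Xcong [OF X [OF X [OF U b] c] X [OF X [OF U c] b] XX [OF U _ b c] VI [OF cl [OF x] t] b]) (use c.V0 in blast)
   finally show ?thesis .
  qed
  moreover have "T t x b \<bullet> c = X b (X b (X c U)) (x, t)" for b unfolding T_def by (rule comp)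
  then have "(\<Sum>b\<in>Basis. T t x b) \<bullet> c = (\<Sum>b\<in>Basis. X b (X b (X c U)) (x, t))" by (simp add: inner_sum_left)
  ultimately show "P t x \<bullet> c = ((\<Sum>b\<in>Basis. T t x b) - (deriv (deriv W) (u t x) / \<epsilon>\<^sup>2) *\<^sub>R G t x) \<bullet> c"
   unfolding P_def comp \<tau>X [OF U VI [OF cl [OF x] t] c] inner_diff_left by simp
 qed
 have "ac_flow Om z Z Z' W (deriv W) (deriv (deriv W)) \<alpha> \<beta> \<gamma> \<epsilon> u (\<lambda>t. gradient_on ?S (u t)) H T ft P"
 proof (rule ac_flow.intro [OF dom well], rule ac_flow_axioms.intro)
  show "continuous_on ({0..} \<times> ?S) (\<lambda>(t, x). u t x)"
   by (rule uniform_limit_continuous_on [OF ul]) (use differentiable_imp_continuous_on [OF C1'(1)] in auto)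
  show "continuous_on ({0..} \<times> ?S) (\<lambda>(t, x). gradient_on ?S (u t) x)"
   by (rule uniform_limit_continuous_on [OF gl C1'(2)]) auto
  show "continuous_on ({0<..} \<times> ?S) (\<lambda>(t, x). ft t x)" unfolding ft_def by (rule conttx [OF \<tau> [OF U]])
  show "continuous_on ({0<..} \<times> ?S) (\<lambda>(t, x). P t x)"
   unfolding P_def case_prod_beta
   by (intro continuous_on_sum continuous_on_scaleR continuous_on_const conttx [unfolded case_prod_beta] \<tau> X U)
  fix t :: real assume t: "0 < t"
  have Hc: "continuous_on ?S (\<lambda>x. H t x h)" for h
   unfolding H_def by (intro continuous_on_sum continuous_on_scaleR continuous_on_mult continuous_on_const contx X U t)
  show "slice Om z Z Z' W (deriv W) \<epsilon> (u t) (gradient_on ?S (u t)) (H t)"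
  proof (rule slice.intro [OF dom], rule slice_axioms.intro)
   show "continuous_on ?S (u t)" "continuous_on ?S (gradient_on ?S (u t))"
    using differentiable_imp_continuous_on [OF C1'(1)] C1'(2) t by auto
   show "continuous_on ?S (\<lambda>x. H t x h)" for h by (rule Hc)
   show "gradient_on ?S (u t) x \<bullet> Z x = 0" if "x \<in> frontier Om" for x by (rule normal [OF neu [OF t] that])
   fix x assume x: "x \<in> Om"
   show "(u t has_derivative (\<lambda>h. gradient_on ?S (u t) x \<bullet> h)) (at x)"
    using has_derivative_gradient_on [OF C1'(1) cl [OF x], of t] t at_Om [OF x] by simp
   show "(gradient_on ?S (u t) has_derivative H t x) (at x)" using D_H [OF t cl [OF x]] at_Om [OF x] by simp
   show "H t x h \<bullet> k = h \<bullet> H t x k" for h k by (rule H_sym [OF t cl [OF x]])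
  qed (use e w.W_deriv w.W'_cont w.W_nonneg in auto)
  { fix p assume p: "p \<in> frontier Om"
   have pc: "p \<in> ?S" by (rule d.frontier_closure [OF p])
   show "(u t has_derivative (\<lambda>h. gradient_on ?S (u t) p \<bullet> h)) (at p within ?S)"
    by (rule has_derivative_gradient_on [OF C1'(1) pc]) (use t in simp)
   show "(gradient_on ?S (u t) has_derivative H t p) (at p within ?S)" by (rule D_H [OF t pc])
   show "H t p h \<bullet> k = h \<bullet> H t p k" for h k by (rule H_sym [OF t pc]) }
  fix x assume x: "x \<in> Om"
  show "ft t x = div_of (H t x) - deriv W (u t x) / \<epsilon>\<^sup>2" by (rule ft_eq [OF t x])
  show "((\<lambda>s. u s x) has_real_derivative ft t x) (at t)" by (rule u_time [OF t x])
  show "P t x = (\<Sum>b\<in>Basis. T t x b) - (deriv (deriv W) (u t x) / \<epsilon>\<^sup>2) *\<^sub>R gradient_on ?S (u t) x"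
   unfolding G_eq [OF t cl [OF x]] by (rule P_eq [OF t x])
  show "(ft t has_derivative (\<lambda>h. P t x \<bullet> h)) (at x)"
   using Sx [OF \<tau> [OF U] cl [OF x] t] at_Om [OF x]
   by (simp add: ft_def [abs_def] P_def inner_sum_left inner_sum_right inner_commute mult.commute \<tau>X [OF U VI [OF cl [OF x] t]])
  have "((\<lambda>s. G s x) has_vector_derivative P t x) (at t)"
   unfolding G_def P_def
  proof (rule has_vector_derivative_sum)
   fix b :: 'a assume b: "b \<in> Basis"
   show "((\<lambda>s. X b U (x, s) *\<^sub>R b) has_vector_derivative \<tau> (X b U) (x, t) *\<^sub>R b) (at t)"
    using has_vector_derivative_scaleR [OF St [OF X [OF U b] x t] has_vector_derivative_const] by simp
  qed
  then show "((\<lambda>s. gradient_on ?S (u s) x) has_vector_derivative P t x) (at t)"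
   by (rule has_vector_derivative_transform_within_open [where S = "{0<..}"]) (use t G_eq cl [OF x] in auto)
  fix b :: 'a assume b: "b \<in> Basis"
  have "((\<lambda>s. X b (X c U) (x + s *\<^sub>R b, t)) has_real_derivative X b (X b (X c U)) (x, t)) (at 0)" if "c \<in> Basis" for c
  proof -
   have "((\<lambda>s. X b (X c U) ((x, t) + s *\<^sub>R (b, 0))) has_real_derivative pd V (b, 0) (X b (X c U)) ((x, t) + 0 *\<^sub>R (b, 0))) (at 0)"
    by (rule c.pd_line [OF X [OF X [OF U that] b] _ Bs [OF b]]) (simp add: V0I [OF x t])
   then show ?thesis by (simp add: X_def)
  qed
  then have "((\<lambda>s. \<Sum>c\<in>Basis. X b (X c U) (x + s *\<^sub>R b, t) *\<^sub>R c) has_vector_derivative T t x b) (at 0)"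
   unfolding T_def
   by (intro has_vector_derivative_sum) (use has_vector_derivative_scaleR [OF _ has_vector_derivative_const] in fastforce)
  then show "((\<lambda>s. H t (x + s *\<^sub>R b) b) has_vector_derivative T t x b) (at 0)" by (simp add: H_b [OF b])
 qed
 then show thesis by (rule that)
qed

section \<open>Dissipation of energy\<close>

lemma continuous_on_integral:
 fixes g :: "'a::t2_space => 'b::euclidean_space => real"
 assumes K: "compact K" "bounded S" "S \<in> sets borel" "S \<subseteq> K" and T: "compact T"
  and g: "continuous_on (T \<times> K) (\<lambda>(t, x). g t x)"
 shows "continuous_on T (\<lambda>t. integral\<^sup>L (leb S) (g t))"
proof -
 interpret finite_measure "leb S" using finite_measure_leb K(2,3) by blast
 have gt: "continuous_on S (g t)" if "t \<in> T" for t
 proof -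
  have "continuous_on S (\<lambda>x. (t, x))" by (intro continuous_intros)
  from continuous_on_compose2 [OF g this] show ?thesis using that K(4) by auto
 qed
 have "compact ((\<lambda>(t, x). g t x) ` (T \<times> K))" by (intro compact_continuous_image g compact_Times T K(1))
 from compact_imp_bounded [OF this]
 obtain B where B: "\<And>y. y \<in> (\<lambda>(t, x). g t x) ` (T \<times> K) ==> norm y <= B" unfolding bounded_iff by blast
 have gB: "\<bar>g t x\<bar> <= B" if "t \<in> T" "x \<in> S" for t x
 proof -
  have "g t x \<in> (\<lambda>(t, x). g t x) ` (T \<times> K)" using that K(4) by force
  then show ?thesis using B by simp
 qed
 show ?thesis unfolding continuous_on_def
 proof
  fix t assume t: "t \<in> T"
  have "((\<lambda>s. integral\<^sup>L (leb S) (g s) - integral\<^sup>L (leb S) (g t)) \<longlongrightarrow> 0) (at t within T)"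
  proof (rule tendstoI)
   fix e :: real assume e: "0 < e"
   define M where "M = measure (leb S) (space (leb S))"
   have M: "0 <= M" by (simp add: M_def)
   have ev: "eventually (\<lambda>s. \<forall>x\<in>K. dist (g s x) (g t x) <= e / (2 * (M + 1))) (at t within T)"
   proof -
    have "0 < e / (2 * (M + 1))" using e M by simp
    obtain X0 where X0: "t \<in> X0" "open X0" "\<forall>s\<in>X0 \<inter> T. \<forall>x\<in>K. dist (g s x) (g t x) <= e / (2 * (M + 1))"
     by (rule continuous_on_prod_compactE [OF g K(1) t \<open>0 < e / (2 * (M + 1))\<close>]) (simp only: prod.case that)
    show ?thesis unfolding eventually_at_topological
     by (intro exI [of _ X0] conjI X0(1,2) ballI impI) (use X0(3) in auto)
   qed
   moreover have "eventually (\<lambda>s. s \<in> T) (at t within T)" by (simp add: eventually_at_filter)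
   ultimately show "eventually (\<lambda>s. dist (integral\<^sup>L (leb S) (g s) - integral\<^sup>L (leb S) (g t)) 0 < e) (at t within T)"
   proof eventually_elim
    case (elim s)
    have i: "integrable (leb S) (g r)" if "r \<in> T" for r
     by (rule integrable_leb_bounded [OF K(2,3) continuous_on_borel_measurable_leb [OF gt [OF that]] gB [OF that]])
    have "\<bar>integral\<^sup>L (leb S) (g s) - integral\<^sup>L (leb S) (g t)\<bar> = \<bar>\<integral>x. g s x - g t x \<partial>leb S\<bar>"
     by (simp add: i elim t)
    also have "\<dots> <= (\<integral>x. \<bar>g s x - g t x\<bar> \<partial>leb S)" by (rule integral_abs_bound)
    also have "\<dots> <= (\<integral>x. e / (2 * (M + 1)) \<partial>leb S)"
     using elim K(4) by (intro integral_mono integrable_abs Bochner_Integration.integrable_diff i t integrable_const) (auto simp: dist_real_def)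
    also have "\<dots> = e / 2 * (M / (M + 1))" by (simp add: M_def)
    also have "\<dots> <= e / 2 * 1" using e M by (intro mult_left_mono) auto
    also have "\<dots> < e" using e by simp
    finally show ?case by simp
   qed
  qed
  then show "((\<lambda>t. integral\<^sup>L (leb S) (g t)) \<longlongrightarrow> integral\<^sup>L (leb S) (g t)) (at t within T)" by (simp add: LIM_zero_iff)
 qed
qed

context ac_flow
begin

definition energy :: "real => real" where "energy t = integral\<^sup>L (leb Om) (slice.e W eps (u t) (Du t))"
definition dissipation :: "real => real" where "dissipation t = (\<integral>x. eps * (ft t x)\<^sup>2 \<partial>leb Om)"

lemma e_eq: "slice.e W eps (u t) (Du t) x = eps * (norm (Du t x))\<^sup>2 / 2 + W (u t x) / eps"
 and xi_eq: "slice.xi W eps (u t) (Du t) x = eps * (norm (Du t x))\<^sup>2 / 2 - W (u t x) / eps" if "0 < t"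
 by (simp_all add: slice.e_def [OF slice [OF that]] slice.xi_def [OF slice [OF that]])

lemma e_fun: "0 < t ==> slice.e W eps (u t) (Du t) = (\<lambda>x. eps * (norm (Du t x))\<^sup>2 / 2 + W (u t x) / eps)"
 by (rule ext) (rule e_eq)

text \<open>The field \<open>ft *\<^sub>R Du\<close> has no flux.\<close>

lemma energy_deriv:
 assumes t: "0 < t"
 shows "(energy has_real_derivative - dissipation t) (at t)"
proof -
 interpret s: slice Om z Z Z' W W' eps "u t" "Du t" "H t" by (rule slice [OF t])
 define e' where "e' r x = eps * (Du r x \<bullet> P r x) + W' (u r x) * ft r x / eps" for r x
 let ?K = "{t/2..2 * t} \<times> closure Om"
 have sub: "?K \<subseteq> {0<..} \<times> closure Om" "?K \<subseteq> {0..} \<times> closure Om" using t by auto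
 have "continuous_on ?K (\<lambda>p. eps * ((case p of (t, x) => Du t x) \<bullet> (case p of (t, x) => P t x)) + W' (case p of (t, x) => u t x) * (case p of (t, x) => ft t x) / eps)"
  using eps_pos by (intro continuous_intros continuous_on_compose2 [OF w.W'_cont [of UNIV]]
   continuous_on_subset [OF u_cont0 sub(2)] continuous_on_subset [OF Du_cont0 sub(2)] continuous_on_subset [OF ft_cont sub(1)] continuous_on_subset [OF P_cont sub(1)]) auto
 then have ce: "continuous_on ?K (\<lambda>(r, x). e' r x)" by (simp add: e'_def case_prod_beta)
 have cl: "x \<in> closure Om" if "x \<in> Om" for x using that closure_subset by blast
 have D: "((\<lambda>r. integral\<^sup>L (leb Om) (\<lambda>x. eps * (norm (Du r x))\<^sup>2 / 2 + W (u r x) / eps)) has_real_derivative integral\<^sup>L (leb Om) (e' t)) (at t)"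
 proof (rule integral_has_real_derivative [OF _ _ _ _ ce])
  show "t/2 < t" "t < 2 * t" using t by simp_all
  fix r assume "t/2 < r"
  then have r: "0 < r" using t by simp
  show "continuous_on (closure Om) (\<lambda>x. eps * (norm (Du r x))\<^sup>2 / 2 + W (u r x) / eps)"
   using slice.e_cont(1) [OF slice [OF r]] unfolding e_fun [OF r] .
  fix x assume x: "x \<in> Om"
  have 2: "((\<lambda>r. W (u r x)) has_real_derivative W' (u r x) * ft r x) (at r)"
   by (rule DERIV_chain2 [where f = W, OF w.W_deriv u_time [OF r x]])
  have 3: "((\<lambda>r. eps / 2 * (Du r x \<bullet> Du r x) + W (u r x) / eps) has_real_derivative eps / 2 * (2 * (Du r x \<bullet> P r x)) + W' (u r x) * ft r x / eps) (at r)"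
   by (rule DERIV_add [OF DERIV_cmult [OF Du_sq_time [OF r x]] DERIV_cdivide [OF 2]])
  have 4: "(\<lambda>r. eps / 2 * (Du r x \<bullet> Du r x) + W (u r x) / eps) = (\<lambda>r. eps * (norm (Du r x))\<^sup>2 / 2 + W (u r x) / eps)"
   by (rule ext) (simp add: dot_square_norm)
  have 5: "eps / 2 * (2 * (Du r x \<bullet> P r x)) + W' (u r x) * ft r x / eps = e' r x"
   unfolding e'_def by simp
  show "((\<lambda>r. eps * (norm (Du r x))\<^sup>2 / 2 + W (u r x) / eps) has_real_derivative e' r x) (at r)"
   using 3 unfolding 4 5 .
 qed
 have cx: "continuous_on S (\<lambda>x. (t, x))" for S :: "'a set" by (intro continuous_intros)
 have cft: "continuous_on (closure Om) (ft t)" and cP: "continuous_on (closure Om) (P t)"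
  using continuous_on_compose2 [OF ft_cont cx [of "closure Om"]] continuous_on_compose2 [OF P_cont cx [of "closure Om"]] t by auto
 define V' where "V' x h = (P t x \<bullet> h) *\<^sub>R Du t x + ft t x *\<^sub>R H t x h" for x h
 have V'c: "continuous_on (closure Om) (\<lambda>x. V' x h)" for h unfolding V'_def
  by (intro continuous_intros cft cP s.Du_cont s.H_cont)
 have divV: "div_of (V' x) = P t x \<bullet> Du t x + ft t x * div_of (H t x)" for x
  unfolding V'_def div_of_add div_of_scaleR div_of_rank1 [OF bounded_linear.linear [OF bounded_linear_inner_right]] ..
 have fi: "integrable (leb Om) (\<lambda>x. eps * (ft t x)\<^sup>2)" by (intro integrable_cont continuous_intros cft)
 have tK: "(\<lambda>x. (t, x)) ` closure Om \<subseteq> ?K" using t by auto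
 have ei: "integrable (leb Om) (e' t)"
  using continuous_on_compose2 [OF ce cx tK] by (intro integrable_cont) simp
 have e'_split: "e' t x + eps * (ft t x)\<^sup>2 = eps * div_of (V' x)" if x: "x \<in> Om" for x
 proof -
  have dH: "div_of (H t x) = ft t x + W' (u t x) / eps\<^sup>2" using ft_eq [OF t x] by simp
  show ?thesis unfolding divV e'_def dH using eps_pos by (simp add: field_simps power2_eq_square inner_commute)
 qed
 have "integral\<^sup>L (leb Om) (\<lambda>x. div_of (V' x)) = 0"
 proof (rule no_flux [where V = "\<lambda>x. ft t x *\<^sub>R Du t x", OF _ V'c])
  fix x assume x: "x \<in> Om"
  have "((\<lambda>x. ft t x *\<^sub>R Du t x) has_derivative (\<lambda>h. ft t x *\<^sub>R H t x h + (P t x \<bullet> h) *\<^sub>R Du t x)) (at x)"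
   by (intro has_derivative_scaleR ft_deriv s.Du_deriv t x)
  then show "((\<lambda>x. ft t x *\<^sub>R Du t x) has_derivative V' x) (at x)"
   by (simp add: V'_def [abs_def] add.commute)
 next
  show "continuous_on (closure Om) (\<lambda>x. ft t x *\<^sub>R Du t x)" by (intro continuous_intros cft s.Du_cont)
  show "(ft t x *\<^sub>R Du t x) \<bullet> Z x = 0" if "x \<in> frontier Om" for x using s.neumann [OF that] by simp
 qed
 then have "0 = (\<integral>x. eps * div_of (V' x) \<partial>leb Om)" by simp
 also have "\<dots> = (\<integral>x. e' t x + eps * (ft t x)\<^sup>2 \<partial>leb Om)"
  by (rule Bochner_Integration.integral_cong) (auto simp: e'_split)
 also have "\<dots> = integral\<^sup>L (leb Om) (e' t) + dissipation t" unfolding dissipation_def by (rule Bochner_Integration.integral_add [OF ei fi])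
 finally have "integral\<^sup>L (leb Om) (e' t) = - dissipation t" by simp
 with D have D: "((\<lambda>r. integral\<^sup>L (leb Om) (\<lambda>x. eps * (norm (Du r x))\<^sup>2 / 2 + W (u r x) / eps)) has_real_derivative - dissipation t) (at t)" by simp
 have "eventually (\<lambda>r. r \<in> {0<..}) (nhds t)" using t by (intro eventually_nhds_in_open) auto
 then have ev: "eventually (\<lambda>r. energy r = integral\<^sup>L (leb Om) (\<lambda>x. eps * (norm (Du r x))\<^sup>2 / 2 + W (u r x) / eps)) (nhds t)"
  by eventually_elim (simp add: energy_def e_fun)
 show ?thesis by (rule DERIV_cong_ev [OF refl ev refl, THEN iffD2, OF D])
qed

lemma energy_le_initial:
 assumes init: "(\<integral>x. eps * (norm (Du 0 x))\<^sup>2 / 2 + W (u 0 x) / eps \<partial>leb Om) <= E" and t: "0 < t"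
 shows "energy t <= E"
proof -
 define F where "F t = (\<integral>x. eps * (norm (Du t x))\<^sup>2 / 2 + W (u t x) / eps \<partial>leb Om)" for t
 have FE: "F r = energy r" if "0 < r" for r using that by (simp add: F_def energy_def e_fun)
 have "continuous_on ({0..t} \<times> closure Om) (\<lambda>p. eps * (norm (case p of (t, x) => Du t x))\<^sup>2 / 2 + W (case p of (t, x) => u t x) / eps)"
  using eps_pos by (intro continuous_intros cont0 continuous_on_compose2 [OF w.W_cont [of UNIV]]) auto
 then have "continuous_on ({0..t} \<times> closure Om) (\<lambda>(t, x). eps * (norm (Du t x))\<^sup>2 / 2 + W (u t x) / eps)" by (simp add: case_prod_beta)
 from continuous_on_integral [OF compact_closure bounded_Om sets_Om closure_subset compact_Icc this]
 have c: "continuous_on {0..t} F" by (simp add: F_def [abs_def])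
 have F: "(F has_real_derivative - dissipation x) (at x)" if x: "0 < x" for x
 proof -
  have "eventually (\<lambda>r. r \<in> {0<..}) (nhds x)" using x by (intro eventually_nhds_in_open) auto
  then have ev: "eventually (\<lambda>r. F r = energy r) (nhds x)" by eventually_elim (simp add: FE)
  show ?thesis by (rule DERIV_cong_ev [OF refl ev refl, THEN iffD2, OF energy_deriv [OF x]])
 qed
 have "F differentiable (at x)" if "0 < x" "x < t" for x using F [OF that(1)] real_differentiable_def by blast
 from MVT [OF t c this] obtain l r where r: "0 < r" "r < t" "(F has_real_derivative l) (at r)" "F t - F 0 = (t - 0) * l" by blast
 have "l = - dissipation r" by (rule DERIV_unique [OF r(3) F [OF r(1)]])
 moreover have "0 <= dissipation r" unfolding dissipation_def using eps_pos by (intro integral_nonneg_AE) auto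
 ultimately have "(t - 0) * l <= 0" using t by (intro mult_nonneg_nonpos) auto
 then have "F t <= F 0" using r(4) by linarith
 then show ?thesis using init FE [OF t] by (simp add: F_def)
qed

end

section \<open>The discrepancy integrated over time\<close>

context ac_flow
begin

lemma xi_cont: "continuous_on ({0..} \<times> closure Om) (\<lambda>(t, x). \<bar>eps * (norm (Du t x))\<^sup>2 / 2 - W (u t x) / eps\<bar>)"
proof -
 have "continuous_on ({0..} \<times> closure Om) (\<lambda>p. \<bar>eps * (norm (case p of (t, x) => Du t x))\<^sup>2 / 2 - W (case p of (t, x) => u t x) / eps\<bar>)"
  using eps_pos by (intro continuous_intros u_cont0 Du_cont0 continuous_on_compose2 [OF w.W_cont [of UNIV]]) auto
 then show ?thesis by (simp add: case_prod_beta)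
qed

lemma discrepancy_integral_cont:
 assumes "0 <= t1" shows "continuous_on {t1..t2} (\<lambda>t. \<integral>x. \<bar>eps * (norm (Du t x))\<^sup>2 / 2 - W (u t x) / eps\<bar> \<partial>leb Om)"
 by (rule continuous_on_integral [OF compact_closure bounded_Om sets_Om closure_subset compact_Icc continuous_on_subset [OF xi_cont]])
  (use assms in auto)

end

text \<open>At a time of dissipation at most \<open>A\<close> the discrepancy is small. At any other time it is at most the energy, hence at most \<open>E / A\<close>
  times the dissipation, whose integral over time is at most \<open>E\<close>; so \<open>A\<close> has to be large compared with \<open>E\<^sup>2 / \<kappa>\<close>.\<close>

theorem discrepancy_time_integral:
 fixes Om :: "'a::euclidean_space set" and \<theta> c E \<kappa> t1 t2 :: real
 assumes dom: "C2_domain Om z Z Z'" and well: "well W W' W'' \<alpha> \<beta> \<gamma>" and \<theta>: "\<theta> < 1" and E: "0 <= E" and \<kappa>: "0 < \<kappa>" and t: "0 < t1" "t1 <= t2"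
 obtains eps0 where "0 < eps0"
  "\<And>eps u Du H T ft P. ac_flow Om z Z Z' W W' W'' \<alpha> \<beta> \<gamma> eps u Du H T ft P ==> eps < eps0 ==>
   (\<And>x. x \<in> closure Om ==> \<bar>u 0 x\<bar> <= 1) ==>
   (\<And>x. x \<in> closure Om ==> eps * (norm (Du 0 x))\<^sup>2 / 2 - W (u 0 x) / eps <= c * eps powr (- \<theta>)) ==>
   (\<integral>x. eps * (norm (Du 0 x))\<^sup>2 / 2 + W (u 0 x) / eps \<partial>leb Om) <= E ==>
   integral {t1..t2} (\<lambda>t. \<integral>x. \<bar>eps * (norm (Du t x))\<^sup>2 / 2 - W (u t x) / eps\<bar> \<partial>leb Om) <= \<kappa>"
proof -
 interpret C2_domain Om z Z Z' by (rule dom)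
 interpret w: well W W' W'' \<alpha> \<beta> \<gamma> by (rule well)
 show thesis
 proof (rule discrepancy_upper_bound [OF dom well \<theta>, of c], goal_cases)
 case (1 a K0 L e1)
 note a = 1(1-4) and upper = 1(5)
 define A where "A = 2 * E\<^sup>2 / \<kappa> + 1"
 define \<kappa>' where "\<kappa>' = \<kappa> / (2 * (t2 - t1 + 1))"
 have A: "0 < A" "E / A * E <= \<kappa> / 2"
 proof -
  show A: "0 < A" using \<kappa> by (simp add: A_def add_nonneg_pos)
  have "E\<^sup>2 <= \<kappa> / 2 * A" using \<kappa> by (simp add: A_def field_simps)
  then show "E / A * E <= \<kappa> / 2" using A by (simp add: power2_eq_square pos_divide_le_eq)
 qed
 have \<kappa>': "0 < \<kappa>'" "\<kappa>' * (t2 - t1) <= \<kappa> / 2"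
  using \<kappa> t by (auto simp: \<kappa>'_def field_simps)
 show ?case
 proof (rule slice_equipartition [OF dom well E less_imp_le [OF A(1)] a(2,1,3) \<kappa>'(1)], goal_cases)
 case (1 e2)
 note e2 = 1(1) and equi = 1(2)
 show ?case
 proof (rule that [of "min e1 e2"])
  show "0 < min e1 e2" using a e2 by simp
  fix eps u Du H T ft P
  assume flow: "ac_flow Om z Z Z' W W' W'' \<alpha> \<beta> \<gamma> eps u Du H T ft P" and eps: "eps < min e1 e2"
   and u0: "\<And>x. x \<in> closure Om ==> \<bar>u 0 x\<bar> <= 1"
   and xi0: "\<And>x. x \<in> closure Om ==> eps * (norm (Du 0 x))\<^sup>2 / 2 - W (u 0 x) / eps <= c * eps powr (- \<theta>)"
   and en0: "(\<integral>x. eps * (norm (Du 0 x))\<^sup>2 / 2 + W (u 0 x) / eps \<partial>leb Om) <= E"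
  interpret f: ac_flow Om z Z Z' W W' W'' \<alpha> \<beta> \<gamma> eps u Du H T ft P by (rule flow)
  define G where "G t = (\<integral>x. \<bar>eps * (norm (Du t x))\<^sup>2 / 2 - W (u t x) / eps\<bar> \<partial>leb Om)" for t
  have eps12: "eps < e1" "eps < e2" using eps by auto
  have cl: "x \<in> closure Om" if "x \<in> Om" for x using that closure_subset by blast
  have G_le: "G t <= \<kappa>' + E / A * f.dissipation t" if t0: "0 < t" for t
  proof -
   interpret s: slice Om z Z Z' W W' eps "u t" "Du t" "H t" by (rule f.slice [OF t0])
   have Gx: "G t = (\<integral>x. \<bar>s.xi x\<bar> \<partial>leb Om)" by (simp add: G_def s.xi_def)
   have D: "f.dissipation t = (\<integral>x. eps * (s.f x)\<^sup>2 \<partial>leb Om)"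
    unfolding f.dissipation_def by (rule Bochner_Integration.integral_cong) (auto simp: f.eq_slice [OF t0])
   have D0: "0 <= f.dissipation t" unfolding f.dissipation_def using f.eps_pos by (intro integral_nonneg_AE) auto
   have en: "(\<integral>x. s.e x \<partial>leb Om) <= E" using f.energy_le_initial [OF en0 t0] by (simp add: f.energy_def)
   show ?thesis
   proof (cases "f.dissipation t <= A")
    case True
    have "(\<integral>x. \<bar>s.xi x\<bar> \<partial>leb Om) <= \<kappa>'"
    proof (rule equi [OF f.slice [OF t0] eps12(2) _ _ _ en])
     show "(\<integral>x. eps * (s.f x)\<^sup>2 \<partial>leb Om) <= A" using True D by simp
     fix x assume x: "x \<in> Om"
     show "\<bar>u t x\<bar> <= 1" by (rule f.norm_u_le_1 [OF u0 less_imp_le [OF t0] cl [OF x]])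
     show "eps * norm (Du t x) <= L" "s.xi x <= K0 * eps powr a / eps"
      using upper [OF flow eps12(1) u0 xi0 less_imp_le [OF t0] cl [OF x]] by (simp_all add: s.xi_def)
    qed
    moreover have "0 <= E / A * f.dissipation t" using E A D0 by simp
    ultimately show ?thesis using Gx by linarith
   next
    case False
    have "G t <= (\<integral>x. s.e x \<partial>leb Om)"
     unfolding Gx
    proof (rule integral_mono)
     show "integrable (leb Om) s.e" "integrable (leb Om) (\<lambda>x. \<bar>s.xi x\<bar>)"
      by (intro integrable_cont continuous_intros s.e_cont)+
    qed (rule s.xi_le_e)
    also have "\<dots> <= E / A * A" using en A by simp
    also have "\<dots> <= E / A * f.dissipation t" using False E A by (intro mult_left_mono) auto
    finally show ?thesis using \<kappa>' by simp
   qed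
  qed
  have F: "((\<lambda>t. \<kappa>' - E / A * (- f.dissipation t)) has_integral
    (\<kappa>' * t2 - E / A * f.energy t2) - (\<kappa>' * t1 - E / A * f.energy t1)) {t1..t2}"
  proof (rule fundamental_theorem_of_calculus [OF t(2)])
   fix x assume "x \<in> {t1..t2}"
   then have x: "0 < x" using t by simp
   have "((\<lambda>t. \<kappa>' * t - E / A * f.energy t) has_real_derivative \<kappa>' * 1 - E / A * (- f.dissipation x)) (at x)"
    by (intro DERIV_diff DERIV_cmult DERIV_ident f.energy_deriv x)
   then show "((\<lambda>t. \<kappa>' * t - E / A * f.energy t) has_vector_derivative \<kappa>' - E / A * (- f.dissipation x)) (at x within {t1..t2})"
    by (simp only: mult_1_right has_real_derivative_iff_has_vector_derivative [symmetric] has_field_derivative_at_within)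
  qed
  have "(G has_integral integral {t1..t2} G) {t1..t2}"
   using f.discrepancy_integral_cont [of t1 t2] t unfolding G_def [abs_def]
   by (intro integrable_integral integrable_continuous_interval) simp
  from has_integral_le [OF this F]
  have "integral {t1..t2} G <= (\<kappa>' * t2 - E / A * f.energy t2) - (\<kappa>' * t1 - E / A * f.energy t1)"
   using G_le t by simp
  also have "\<dots> <= \<kappa>' * (t2 - t1) + E / A * E"
  proof -
   have "0 <= f.energy t2" unfolding f.energy_def using slice.e_nonneg [OF f.slice [of t2]] t by (intro integral_nonneg_AE) auto
   then have "0 <= E / A * f.energy t2" using E A by simp
   moreover have "E / A * f.energy t1 <= E / A * E" using f.energy_le_initial [OF en0 t(1)] E A by (intro mult_left_mono) auto
   moreover have "\<kappa>' * (t2 - t1) = \<kappa>' * t2 - \<kappa>' * t1" by (rule right_diff_distrib)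
   ultimately show ?thesis by linarith
  qed
  also have "\<dots> <= \<kappa>" using A \<kappa>' by linarith
  finally show "integral {t1..t2} (\<lambda>t. \<integral>x. \<bar>eps * (norm (Du t x))\<^sup>2 / 2 - W (u t x) / eps\<bar> \<partial>leb Om) <= \<kappa>"
   by (simp add: G_def [abs_def])
 qed
 qed
 qed
qed

section \<open>Passage to the limit\<close>

lemma discrepancy_measure_test:
 fixes \<Omega> :: "'a::euclidean_space set" and \<phi> :: "'a \<times> real => real"
 assumes Om: "bounded \<Omega>" "open \<Omega>"
  and c: "continuous_on ({0..} \<times> closure \<Omega>) (\<lambda>(t, x). \<bar>discrepancy W \<Omega> \<epsilon> (u t) x\<bar>)"
  and \<phi>: "continuous_on UNIV \<phi>" "\<And>p. 0 <= \<phi> p" "\<And>p. \<phi> p <= 1" "\<And>p. \<phi> p \<noteq> 0 ==> snd p \<in> {t1..t2}" and t: "0 <= t1"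
 shows "integral\<^sup>L (discrepancy_measure W \<Omega> \<epsilon> u) \<phi> <= integral {t1..t2} (\<lambda>t. \<integral>x. \<bar>discrepancy W \<Omega> \<epsilon> (u t) x\<bar> \<partial>leb \<Omega>)"
proof -
 let ?R = "restrict_space lborel (UNIV \<times> {0..}) :: ('a \<times> real) measure"
 define d where "d p = \<bar>discrepancy W \<Omega> \<epsilon> (u (snd p)) (fst p)\<bar>" for p :: "'a \<times> real"
 define G where "G t = (\<integral>x. \<bar>discrepancy W \<Omega> \<epsilon> (u t) x\<bar> \<partial>leb \<Omega>)" for t
 define D where "D p = indicator (\<Omega> \<times> {t1..t2}) p *\<^sub>R d p" for p
 have \<Omega>b: "\<Omega> \<in> sets borel" using Om by simp
 have sets: "\<Omega> \<times> {0::real..} \<in> sets borel" "\<Omega> \<times> {t1..t2} \<in> sets borel" "(UNIV :: 'a set) \<times> {0::real..} \<in> sets borel"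
  using \<Omega>b by (auto intro!: borel_Times)
 have dc: "continuous_on (\<Omega> \<times> {0..}) d"
 proof -
  have 1: "continuous_on (\<Omega> \<times> {0..}) (\<lambda>p. (snd p, fst p))" by (intro continuous_intros)
  have 2: "(\<lambda>p. (snd p, fst p)) ` (\<Omega> \<times> {0::real..}) \<subseteq> {0..} \<times> closure \<Omega>" using closure_subset [of \<Omega>] by auto
  show ?thesis using continuous_on_compose2 [OF c 1 2] by (simp add: d_def [abs_def])
 qed
 have Dm: "D \<in> borel_measurable borel"
  unfolding D_def [abs_def] by (rule borel_measurable_continuous_on_indicator [OF sets(2) continuous_on_subset [OF dc]]) (use t in auto)
 have \<phi>m: "\<phi> \<in> borel_measurable borel" by (rule borel_measurable_continuous_onI [OF \<phi>(1)])
 have dm: "(\<lambda>(x, t). ennreal \<bar>discrepancy W \<Omega> \<epsilon> (u t) x\<bar> * indicator \<Omega> x) \<in> borel_measurable ?R"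
 proof -
  have "(\<lambda>p. indicator (\<Omega> \<times> {0..}) p *\<^sub>R d p) \<in> borel_measurable borel"
   by (rule borel_measurable_continuous_on_indicator [OF sets(1) dc])
  then have "(\<lambda>p. ennreal (indicator (\<Omega> \<times> {0..}) p *\<^sub>R d p)) \<in> borel_measurable ?R"
   by (intro measurable_restrict_space1) simp
  then show ?thesis
   by (rule measurable_cong [THEN iffD1, rotated]) (auto simp: space_restrict_space d_def indicator_def)
 qed
 have "(\<integral>\<^sup>+ p. ennreal (\<phi> p) \<partial>discrepancy_measure W \<Omega> \<epsilon> u) = (\<integral>\<^sup>+ p. (case p of (x, t) => ennreal \<bar>discrepancy W \<Omega> \<epsilon> (u t) x\<bar> * indicator \<Omega> x) * ennreal (\<phi> p) \<partial>?R)"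
  unfolding discrepancy_measure_def
  by (rule nn_integral_density [OF dm]) (use \<phi>m in \<open>intro measurable_restrict_space1, simp\<close>)
 also have "\<dots> = (\<integral>\<^sup>+ p. (case p of (x, t) => ennreal \<bar>discrepancy W \<Omega> \<epsilon> (u t) x\<bar> * indicator \<Omega> x) * ennreal (\<phi> p) * indicator (UNIV \<times> {0..}) p \<partial>lborel)"
  by (rule nn_integral_restrict_space) (use sets(3) in simp)
 also have "\<dots> <= (\<integral>\<^sup>+ p. ennreal (D p) \<partial>lborel)"
 proof (rule nn_integral_mono)
  fix p :: "'a \<times> real"
  obtain x s where p: "p = (x, s)" by force
  show "(case p of (x, t) => ennreal \<bar>discrepancy W \<Omega> \<epsilon> (u t) x\<bar> * indicator \<Omega> x) * ennreal (\<phi> p) * indicator (UNIV \<times> {0..}) p <= ennreal (D p)"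
  proof (cases "x \<in> \<Omega> \<and> \<phi> p \<noteq> 0")
   case True
   then have "s \<in> {t1..t2}" using \<phi>(4) [of p] p by simp
   then have D: "D p = d p" using True p by (simp add: D_def)
   have "ennreal (d p) * ennreal (\<phi> p) <= ennreal (d p)"
    unfolding ennreal_mult [OF _ \<phi>(2), of "d p", symmetric, simplified d_def abs_ge_zero, folded d_def]
    using \<phi>(2,3) [of p] by (intro ennreal_leI mult_left_le) (auto simp: d_def)
   then show ?thesis unfolding D using True p \<open>s \<in> {t1..t2}\<close> t by (simp add: d_def)
  qed (auto simp: p)
 qed
 also have "\<dots> = (\<integral>\<^sup>+ s. (\<integral>\<^sup>+ x. ennreal (D (x, s)) \<partial>lborel) \<partial>lborel)"
  unfolding lborel_prod [symmetric]
  by (rule lborel_pair.nn_integral_snd [symmetric]) (simp add: lborel_prod measurable_compose [OF Dm measurable_ennreal])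
 also have "\<dots> = (\<integral>\<^sup>+ s. ennreal (indicator {t1..t2} s *\<^sub>R G s) \<partial>lborel)"
 proof (rule nn_integral_cong)
  fix s :: real
  show "(\<integral>\<^sup>+ x. ennreal (D (x, s)) \<partial>lborel) = ennreal (indicator {t1..t2} s *\<^sub>R G s)"
  proof (cases "s \<in> {t1..t2}")
   case True
   then have s0: "0 <= s" using t by simp
   have 1: "continuous_on (closure \<Omega>) (\<lambda>x. (s, x))" by (intro continuous_intros)
   have 2: "(\<lambda>x. (s, x)) ` closure \<Omega> \<subseteq> {0..} \<times> closure \<Omega>" using s0 by auto
   have cs: "continuous_on (closure \<Omega>) (\<lambda>x. \<bar>discrepancy W \<Omega> \<epsilon> (u s) x\<bar>)" using continuous_on_compose2 [OF c 1 2] by simp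
   have "compact (closure \<Omega>)" using Om by simp
   from compact_imp_bounded [OF compact_continuous_image [OF cs this]]
   obtain B where B: "\<And>y. y \<in> (\<lambda>x. \<bar>discrepancy W \<Omega> \<epsilon> (u s) x\<bar>) ` closure \<Omega> ==> norm y <= B" unfolding bounded_iff by blast
   have i: "integrable (leb \<Omega>) (\<lambda>x. \<bar>discrepancy W \<Omega> \<epsilon> (u s) x\<bar>)"
   proof (rule integrable_leb_bounded [OF Om(1) \<Omega>b continuous_on_borel_measurable_leb [OF continuous_on_subset [OF cs closure_subset]]])
    fix x assume "x \<in> \<Omega>"
    then have "x \<in> closure \<Omega>" using closure_subset by blast
    then show "\<bar>\<bar>discrepancy W \<Omega> \<epsilon> (u s) x\<bar>\<bar> <= B" using B [OF imageI] by simp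
   qed
   have "(\<integral>\<^sup>+ x. ennreal (D (x, s)) \<partial>lborel) = (\<integral>\<^sup>+ x. ennreal \<bar>discrepancy W \<Omega> \<epsilon> (u s) x\<bar> * indicator \<Omega> x \<partial>lborel)"
    using True by (intro nn_integral_cong) (auto simp: D_def d_def indicator_def)
   also have "\<dots> = (\<integral>\<^sup>+ x. ennreal \<bar>discrepancy W \<Omega> \<epsilon> (u s) x\<bar> \<partial>leb \<Omega>)"
    unfolding leb_def by (rule nn_integral_restrict_space [symmetric]) (use \<Omega>b in simp)
   also have "\<dots> = ennreal (G s)" unfolding G_def by (rule nn_integral_eq_integral [OF i]) simp
   finally show ?thesis using True by simp
  qed (auto simp: D_def)
 qed
 also have "\<dots> = ennreal (integral {t1..t2} G)"
 proof -
  have Gc: "continuous_on {t1..t2} G"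
   unfolding G_def [abs_def]
   by (rule continuous_on_integral [OF _ Om(1) \<Omega>b closure_subset compact_Icc continuous_on_subset [OF c]]) (use Om t in auto)
  have G0: "0 <= G s" for s unfolding G_def by (intro integral_nonneg_AE) auto
  have "(G has_integral integral {t1..t2} G) {t1..t2}" by (intro integrable_integral integrable_continuous_interval Gc)
  moreover have "(\<lambda>s. indicator {t1..t2} s *\<^sub>R G s) = (\<lambda>s. if s \<in> {t1..t2} then G s else 0)" by (rule ext) simp
  ultimately have h: "((\<lambda>s. indicator {t1..t2} s *\<^sub>R G s) has_integral integral {t1..t2} G) UNIV"
   by (simp only: has_integral_restrict_UNIV)
  show ?thesis
   by (rule nn_integral_has_integral_lborel [OF borel_measurable_continuous_on_indicator [OF _ Gc] _ h]) (use G0 in auto)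
 qed
 finally have le: "(\<integral>\<^sup>+ p. ennreal (\<phi> p) \<partial>discrepancy_measure W \<Omega> \<epsilon> u) <= ennreal (integral {t1..t2} G)" .
 have I0: "0 <= integral {t1..t2} G"
  by (cases "G integrable_on {t1..t2}") (auto simp: G_def not_integrable_integral intro!: integral_nonneg integral_nonneg_AE)
 have "\<phi> \<in> borel_measurable (discrepancy_measure W \<Omega> \<epsilon> u)"
 proof -
  have "\<phi> \<in> borel_measurable ?R" using \<phi>m by (intro measurable_restrict_space1) simp
  then show ?thesis unfolding discrepancy_measure_def by (simp cong: measurable_cong_sets)
 qed
 then have "integral\<^sup>L (discrepancy_measure W \<Omega> \<epsilon> u) \<phi> = enn2real (\<integral>\<^sup>+ p. ennreal (\<phi> p) \<partial>discrepancy_measure W \<Omega> \<epsilon> u)"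
  by (rule integral_eq_nn_integral) (use \<phi>(2) in simp)
 also have "\<dots> <= enn2real (ennreal (integral {t1..t2} G))" by (rule enn2real_mono [OF le]) simp
 also have "\<dots> = integral {t1..t2} G" using I0 by simp
 finally show ?thesis by (simp add: G_def [abs_def])
qed

text \<open>A cutoff that is 1 for \<open>norm x \<le> n\<close>, \<open>1 / n \<le> t \<le> n\<close>, and is supported in positive times.\<close>

definition bump :: "nat => 'a::euclidean_space \<times> real => real" where
 "bump n p = max 0 (min 1 (real n + 1 - norm (fst p))) * max 0 (min 1 (min (2 * real n * snd p - 1) (real n + 1 - snd p)))"

lemma bump_props:
 "continuous_on S (bump n)" "0 <= bump n p" "bump n p <= 1"
 "bump n p \<noteq> 0 ==> 1 <= n ==> norm (fst p) <= real n + 1 \<and> snd p \<in> {1 / (2 * real n)..real n + 1}"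
 "norm (fst p) <= real n ==> 1 <= n ==> snd p \<in> {1 / real n..real n} ==> bump n p = 1"
proof -
 show "continuous_on S (bump n)" unfolding bump_def [abs_def] by (intro continuous_intros)
 show "0 <= bump n p" "bump n p <= 1" by (auto simp: bump_def intro!: mult_nonneg_nonneg mult_le_one)
 { assume b: "bump n p \<noteq> 0" and n: "1 <= n"
  have "0 < real n + 1 - norm (fst p)" "0 < 2 * real n * snd p - 1" "0 < real n + 1 - snd p"
   using b unfolding bump_def by (auto simp: max_def min_def split: if_splits)
  then show "norm (fst p) <= real n + 1 \<and> snd p \<in> {1 / (2 * real n)..real n + 1}" using n by (simp add: field_simps) }
 { assume "norm (fst p) <= real n" "1 <= n" "snd p \<in> {1 / real n..real n}"
  moreover from this have "2 <= 2 * real n * snd p" by (simp add: field_simps)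
  ultimately show "bump n p = 1" unfolding bump_def by simp }
qed

lemma radon_measure_zero_open_half:
 fixes \<xi> :: "('a::euclidean_space \<times> real) measure"
 assumes r: "radon_measure_on (UNIV \<times> {0..}) \<xi>" and z: "\<And>n. 1 <= n ==> integral\<^sup>L \<xi> (bump n) <= 0"
 shows "emeasure \<xi> (UNIV \<times> {0<..}) = 0"
proof -
 have s: "sets \<xi> = sets (restrict_space borel (UNIV \<times> {0..}))" and fin: "\<And>K. compact K ==> K \<subseteq> UNIV \<times> {0..} ==> emeasure \<xi> K < \<infinity>"
  using r by (auto simp: radon_measure_on_def)
 have Kset: "K \<in> sets \<xi>" if "closed K" "K \<subseteq> UNIV \<times> {0..}" for K
  unfolding s sets_restrict_space_iff [of "UNIV \<times> {0..}" borel, simplified] using that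
  by (auto simp: sets_restrict_space_iff borel_closed closed_Times)
 define K where "K n = (cball 0 (real n) :: 'a set) \<times> {1 / real n..real n}" for n
 have "emeasure \<xi> (K n) = 0" if n: "1 <= n" for n
 proof -
  define L where "L = (cball 0 (real n + 1) :: 'a set) \<times> {1 / (2 * real n)..real n + 1}"
  have L: "compact L" "L \<subseteq> UNIV \<times> {0..}" unfolding L_def using n by (auto intro!: compact_Times intro: order_trans [of 0 "1 / (2 * real n)"])
  have K: "compact (K n)" "K n \<subseteq> UNIV \<times> {0..}" unfolding K_def using n by (auto intro!: compact_Times intro: order_trans [of 0 "1 / real n"])
  have Ls: "L \<in> sets \<xi>" by (rule Kset [OF compact_imp_closed [OF L(1)] L(2)])
  have Ks: "K n \<in> sets \<xi>" by (rule Kset [OF compact_imp_closed [OF K(1)] K(2)])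
  have m: "bump n \<in> borel_measurable \<xi>"
   using borel_measurable_continuous_on_restrict [OF bump_props(1)] s by (simp cong: measurable_cong_sets)
  have i: "integrable \<xi> (bump n)"
  proof (rule Bochner_Integration.integrable_bound [OF _ m])
   show "integrable \<xi> (indicator L :: _ => real)" using Ls fin [OF L] by simp
   have "norm (bump n p) <= norm (indicator L p :: real)" for p
    using bump_props(2,3) [of n p] bump_props(4) [of n p] n by (cases "bump n p = 0") (auto simp: L_def indicator_def mem_Times_iff)
   then show "AE p in \<xi>. norm (bump n p) <= norm (indicator L p :: real)" by simp
  qed
  have "emeasure \<xi> (K n) = (\<integral>\<^sup>+ p. indicator (K n) p \<partial>\<xi>)" using Ks by simp
  also have "\<dots> <= (\<integral>\<^sup>+ p. ennreal (bump n p) \<partial>\<xi>)"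
  proof (rule nn_integral_mono)
   fix p show "indicator (K n) p <= ennreal (bump n p)"
    using bump_props(5) [of p n] n by (auto simp: K_def indicator_def)
  qed
  also have "\<dots> = ennreal (integral\<^sup>L \<xi> (bump n))" by (rule nn_integral_eq_integral [OF i]) (simp add: bump_props)
  also have "\<dots> = 0" using z [OF n] by (simp add: ennreal_neg)
  finally show ?thesis by simp
 qed
 moreover have "UNIV \<times> {0<..} = (\<Union>n. K (Suc n))"
 proof (intro equalityI subsetI)
  fix p :: "'a \<times> real" assume p: "p \<in> UNIV \<times> {0<..}"
  obtain N where N: "max (max (norm (fst p)) (snd p)) (1 / snd p) <= real N" using real_arch_simple by blast
  have "1 / real (Suc N) <= snd p"
  proof -
   have "1 / snd p <= real (Suc N)" using N by simp
   then show ?thesis using p by (auto simp: field_simps)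
  qed
  then have "p \<in> K (Suc N)" using N by (simp add: K_def mem_Times_iff)
  then show "p \<in> (\<Union>n. K (Suc n))" by blast
 next
  fix p assume "p \<in> (\<Union>n. K (Suc n))"
  then obtain n where "1 / real (Suc n) <= snd p" by (auto simp: K_def)
  moreover have "0 < 1 / real (Suc n)" by simp
  ultimately have "0 < snd p" by linarith
  then show "p \<in> UNIV \<times> {0<..}" by (simp add: mem_Times_iff)
 qed
 moreover have "K (Suc n) \<in> sets \<xi>" for n
  by (rule Kset) (auto simp: K_def intro!: closed_Times intro: order_trans [of 0 "1 / real (Suc n)"])
 ultimately show ?thesis using emeasure_UN_eq_0 [of \<xi> "\<lambda>n. K (Suc n)"] by auto
qed

lemma gradient_on_cong:
 assumes eq: "\<And>y. y \<in> S ==> f y = g y" and x: "x \<in> S"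
 shows "gradient_on S f x = gradient_on S g x"
proof -
 have "(f has_derivative f') (at x within S) \<longleftrightarrow> (g has_derivative f') (at x within S)" for f'
  using has_derivative_transform [OF x, of f g f'] has_derivative_transform [OF x, of g f f'] eq by auto
 then show ?thesis by (simp add: gradient_on_def frechet_derivative_def)
qed

lemma AE_le_closure:
 fixes f :: "'a::euclidean_space => real"
 assumes Om: "open Om" and c: "continuous_on (closure Om) f" and ae: "AE x in lborel. x \<in> Om --> f x <= B" and x: "x \<in> closure Om"
 shows "f x <= B"
proof -
 define N where "N = Om \<inter> f -` {B<..}"
 have "open N" unfolding N_def by (rule continuous_open_preimage [OF continuous_on_subset [OF c closure_subset] Om open_greaterThan])
 have "N \<in> null_sets lborel"
 proof (rule AE_iff_null_sets [THEN iffD2])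
  show "N \<in> sets lborel" using \<open>open N\<close> by simp
  show "AE x in lborel. x \<notin> N" using ae by eventually_elim (auto simp: N_def)
 qed
 then have "negligible N" using \<open>open N\<close> by (simp add: negligible_iff_null_sets null_sets_completionI)
 then have "N = {}" using open_not_negligible [OF \<open>open N\<close>] by blast
 then have "f y <= B" if "y \<in> Om" for y using that by (force simp: N_def not_less [symmetric])
 then show ?thesis by (rule continuous_le_on_closure [OF c x])
qed

theorem proposition7p2:
  fixes \<Omega> :: "(real ^ 'n) set"
    and W :: "real \<Rightarrow> real"
    and \<epsilon> :: "nat \<Rightarrow> real"
    and u\<^sub>0 :: "nat \<Rightarrow> real ^ 'n \<Rightarrow> real"
    and u :: "nat \<Rightarrow> real \<Rightarrow> real ^ 'n \<Rightarrow> real"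
    and D\<^sub>0 c\<^sub>1 c\<^sub>2 \<theta> :: real
    and \<mu> :: "real \<Rightarrow> (real ^ 'n) measure"
    and \<sigma> :: "nat \<Rightarrow> nat"
    and \<xi> :: "((real ^ 'n) \<times> real) measure"
  assumes domain: "smooth_bounded_domain \<Omega>"
    and potential: "double_well W"
    and eps_pos: "\<And>i. \<epsilon> i > 0"
    and eps_lim: "\<epsilon> \<longlonglongrightarrow> 0"
    and theta: "3 / 5 \<le> \<theta>" "\<theta> < 1"
    and init_C1: "\<And>i. Ck_on 1 (u\<^sub>0 i) (closure \<Omega>)"
    and init_bound: "\<And>i. AE x in lborel. x \<in> \<Omega> \<longrightarrow> \<bar>u\<^sub>0 i x\<bar> \<le> 1"
    and init_density: "\<And>i x r. x \<in> \<Omega> \<Longrightarrow> r > 0 \<Longrightarrow>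
          (LINT y : ball x r \<inter> \<Omega> | lborel. energy_density W \<Omega> (\<epsilon> i) (u\<^sub>0 i) y)
            / (unit_ball_vol (real (CARD('n) - 1)) * r ^ (CARD('n) - 1)) \<le> D\<^sub>0"
    and init_gradient: "\<And>i x. x \<in> closure \<Omega> \<Longrightarrow>
          \<epsilon> i * norm (gradient_on (closure \<Omega>) (u\<^sub>0 i) x) \<le> c\<^sub>1"
    and init_discrepancy: "\<And>i x. x \<in> closure \<Omega> \<Longrightarrow>
          discrepancy W \<Omega> (\<epsilon> i) (u\<^sub>0 i) x \<le> c\<^sub>2 * \<epsilon> i powr (- \<theta>)"
    and init_neumann: "\<And>i. neumann_condition \<Omega> (u\<^sub>0 i)"
    and solution: "\<And>i. allen_cahn_solution W \<Omega> (\<epsilon> i) (u\<^sub>0 i) (u i)"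
    and mu_radon: "\<And>t. t \<ge> 0 \<Longrightarrow> radon_measure_on UNIV (\<mu> t)"
    and mu_lim: "\<And>t. t \<ge> 0 \<Longrightarrow>
          radon_converges_on UNIV (\<lambda>i. energy_measure W \<Omega> (\<epsilon> i) (u i t)) (\<mu> t)"
    and subseq: "strict_mono \<sigma>"
    and xi_radon: "radon_measure_on (UNIV \<times> {0..}) \<xi>"
    and xi_lim: "radon_converges_on (UNIV \<times> {0..})
          (\<lambda>j. discrepancy_measure W \<Omega> (\<epsilon> (\<sigma> j)) (u (\<sigma> j))) \<xi>"
  shows "emeasure \<xi> (UNIV \<times> {0<..}) = 0"
proof -
 obtain z Z Z' where dom: "C2_domain \<Omega> z Z Z'" and
  normal: "\<And>f p. neumann_condition \<Omega> f ==> p \<in> frontier \<Omega> ==> gradient_on (closure \<Omega>) f p \<bullet> Z p = 0"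
  using smooth_bounded_domain_C2_domain [OF domain] by blast
 interpret C2_domain \<Omega> z Z Z' by (rule dom)
 obtain \<alpha> \<beta> \<gamma> where well: "well W (deriv W) (deriv (deriv W)) \<alpha> \<beta> \<gamma>" by (rule double_well_well [OF potential])
 let ?Du = "\<lambda>i t. gradient_on (closure \<Omega>) (u i t)"
 have flow: "\<exists>H T ft P. ac_flow \<Omega> z Z Z' W (deriv W) (deriv (deriv W)) \<alpha> \<beta> \<gamma> (\<epsilon> i) (u i) (?Du i) H T ft P" for i
  by (rule allen_cahn_solution_ac_flow [OF dom well eps_pos solution normal]) blast+
 have C1: "f differentiable_on closure \<Omega>" if "Ck_on 1 f (closure \<Omega>)" for f
  using Ck_on_SucD(1) [of 0] that by (simp only: One_nat_def)
 have C0: "continuous_on (closure \<Omega>) f" if "Ck_on 1 f (closure \<Omega>)" for f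
  by (rule differentiable_imp_continuous_on [OF C1 [OF that]])
 have uC1: "Ck_on 1 (u i 0) (closure \<Omega>)" and uOm: "\<And>x. x \<in> \<Omega> ==> u i 0 x = u\<^sub>0 i x" for i
  using solution [of i] unfolding allen_cahn_solution_def by blast+
 have u_eq: "u i 0 x = u\<^sub>0 i x" if "x \<in> closure \<Omega>" for i x
  by (rule continuous_eq_closure [OF closure_subset order_refl C0 [OF uC1] C0 [OF init_C1] uOm that])
 have Du_eq: "?Du i 0 x = gradient_on (closure \<Omega>) (u\<^sub>0 i) x" if "x \<in> closure \<Omega>" for i x
  by (rule gradient_on_cong [OF u_eq that])
 have u0: "\<bar>u i 0 x\<bar> <= 1" if "x \<in> closure \<Omega>" for i x
  unfolding u_eq [OF that]
  by (rule AE_le_closure [OF open_Om continuous_on_rabs [OF C0 [OF init_C1]] init_bound that])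
 have xi0: "\<epsilon> i * (norm (?Du i 0 x))\<^sup>2 / 2 - W (u i 0 x) / \<epsilon> i <= c\<^sub>2 * \<epsilon> i powr (- \<theta>)" if "x \<in> closure \<Omega>" for i x
  using init_discrepancy [OF that, of i] unfolding discrepancy_def u_eq [OF that] Du_eq [OF that] .
 obtain x0 where x0: "x0 \<in> \<Omega>" using domain unfolding smooth_bounded_domain_def by blast
 obtain r where r: "0 < r" "\<Omega> \<subseteq> ball x0 r"
  using bounded_subset_ballD [OF bounded_Om, of x0] by blast
 define V where "V = unit_ball_vol (real (CARD('n) - 1)) * r ^ (CARD('n) - 1)"
 have V: "0 < V" using r by (simp add: V_def unit_ball_vol_pos)
 define E where "E = max 0 (D\<^sub>0 * V)"
 have en0: "(\<integral>x. \<epsilon> i * (norm (?Du i 0 x))\<^sup>2 / 2 + W (u i 0 x) / \<epsilon> i \<partial>leb \<Omega>) <= E" for i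
 proof -
  have "(\<integral>x. \<epsilon> i * (norm (?Du i 0 x))\<^sup>2 / 2 + W (u i 0 x) / \<epsilon> i \<partial>leb \<Omega>) = (\<integral>x. energy_density W \<Omega> (\<epsilon> i) (u\<^sub>0 i) x \<partial>leb \<Omega>)"
  proof (rule Bochner_Integration.integral_cong [OF refl])
   fix x assume "x \<in> space (leb \<Omega>)"
   then have x: "x \<in> closure \<Omega>" using closure_subset [of \<Omega>] by auto
   show "\<epsilon> i * (norm (?Du i 0 x))\<^sup>2 / 2 + W (u i 0 x) / \<epsilon> i = energy_density W \<Omega> (\<epsilon> i) (u\<^sub>0 i) x"
    unfolding energy_density_def u_eq [OF x] Du_eq [OF x] ..
  qed
  also have "\<dots> = (LINT y : ball x0 r \<inter> \<Omega> | lborel. energy_density W \<Omega> (\<epsilon> i) (u\<^sub>0 i) y)"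
   unfolding integral_leb [OF sets_Om] set_lebesgue_integral_def
   by (rule Bochner_Integration.integral_cong [OF refl]) (use r in \<open>auto simp: indicator_def\<close>)
  also have "\<dots> <= D\<^sub>0 * V" using init_density [OF x0 r(1), of i] V by (simp add: V_def pos_divide_le_eq)
  finally show ?thesis by (simp add: E_def)
 qed
 show ?thesis
 proof (rule radon_measure_zero_open_half [OF xi_radon])
  fix n :: nat assume n: "1 <= n"
  let ?K = "(cball 0 (real n + 1) :: (real ^ 'n) set) \<times> {1 / (2 * real n)..real n + 1}"
  have "1 / (2 * real n) <= 1" using n by (simp add: divide_le_eq_1)
  also have "1 <= real n + 1" by simp
  finally have t: "0 < 1 / (2 * real n)" "1 / (2 * real n) <= real n + 1" using n by auto
  have "compact ?K" by (intro compact_Times compact_cball compact_Icc)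
  moreover have "?K \<subseteq> UNIV \<times> {0..}" by (intro Sigma_mono) (use order_trans [OF less_imp_le [OF t(1)]] in auto)
  moreover have "bump n p = 0" if "p \<notin> ?K" for p :: "(real ^ 'n) \<times> real"
   using bump_props(4) [of n p] n that by (auto simp: mem_Times_iff)
  ultimately have "\<exists>K. compact K \<and> K \<subseteq> UNIV \<times> {0..} \<and> (\<forall>x\<in>UNIV \<times> {0..} - K. bump n (x :: (real ^ 'n) \<times> real) = 0)"
   by (intro exI [of _ ?K]) auto
  then have lim: "(\<lambda>j. integral\<^sup>L (discrepancy_measure W \<Omega> (\<epsilon> (\<sigma> j)) (u (\<sigma> j))) (bump n)) \<longlonglongrightarrow> integral\<^sup>L \<xi> (bump n)"
   using xi_lim bump_props(1) unfolding radon_converges_on_def by blast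
  have "integral\<^sup>L \<xi> (bump n) <= 0 + \<kappa>" if \<kappa>: "0 < \<kappa>" for \<kappa>
  proof (rule discrepancy_time_integral [OF dom well theta(2) _ \<kappa> t, of E c\<^sub>2], goal_cases)
   case 1
   show ?case by (simp add: E_def)
  next
   case (2 eps0)
   have "(\<lambda>j. \<epsilon> (\<sigma> j)) \<longlonglongrightarrow> 0" using LIMSEQ_subseq_LIMSEQ [OF eps_lim subseq] by (simp add: comp_def)
   then have "eventually (\<lambda>j. \<epsilon> (\<sigma> j) < eps0) sequentially" using 2(1) by (rule order_tendstoD(2))
   then have "eventually (\<lambda>j. integral\<^sup>L (discrepancy_measure W \<Omega> (\<epsilon> (\<sigma> j)) (u (\<sigma> j))) (bump n) <= \<kappa>) sequentially"
   proof eventually_elim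
    case (elim j)
    let ?i = "\<sigma> j"
    obtain H T ft P where ac: "ac_flow \<Omega> z Z Z' W (deriv W) (deriv (deriv W)) \<alpha> \<beta> \<gamma> (\<epsilon> ?i) (u ?i) (?Du ?i) H T ft P"
     using flow [of ?i] by blast
    have "integral\<^sup>L (discrepancy_measure W \<Omega> (\<epsilon> ?i) (u ?i)) (bump n)
      <= integral {1 / (2 * real n)..real n + 1} (\<lambda>t. \<integral>x. \<bar>discrepancy W \<Omega> (\<epsilon> ?i) (u ?i t) x\<bar> \<partial>leb \<Omega>)"
    proof (rule discrepancy_measure_test [OF bounded_Om open_Om])
     show "continuous_on ({0..} \<times> closure \<Omega>) (\<lambda>(t, x). \<bar>discrepancy W \<Omega> (\<epsilon> ?i) (u ?i t) x\<bar>)"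
      unfolding discrepancy_def by (rule ac_flow.xi_cont [OF ac])
     show "snd p \<in> {1 / (2 * real n)..real n + 1}" if "bump n p \<noteq> 0" for p :: "(real ^ 'n) \<times> real"
      using bump_props(4) [OF that n] by blast
    qed (use bump_props t in auto)
    also have "\<dots> <= \<kappa>" unfolding discrepancy_def
     by (rule 2(2) [OF ac elim u0 xi0 en0])
    finally show ?case .
   qed
   then show ?thesis using tendsto_upperbound [OF lim _ sequentially_bot] by simp
  qed
  then show "integral\<^sup>L \<xi> (bump n) <= 0" by (rule field_le_epsilon)
 qed
qed

end
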